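(* Let $P\in\mathsf{RSP}_n$ be a regular Schur labeled skew shape poset and let $\lambda/\mu=\mathrm{sh}(\tau_P)$. Then: (1) $\left(\mathbf P_{\boldsymbol\alpha_{\mathrm{proj}}(\lambda/\mu)},\eta_P\right)$ is a projective cover of $\mathsf M_P$. (2) $\left(\mathbf P_{\boldsymbol\alpha_{\mathrm{inj}}(\lambda/\mu)},\iota_P\right)$ is an injective hull of $\mathsf M_P$.
   Context: **Permutations.** $\mathfrak S_n$ is the symmetric group on $[n]=\{1,\dots,n\}$ with length $\ell$, simple transpositions $s_i=(i,i+1)$, longest element $w_0$; $\mathrm{Des}_L(\sigma)=\{i\mid\ell(s_i\sigma)<\ell(\sigma)\}$. The left weak order $\preceq_L$ has covers $\sigma\prec s_i\sigma$ when $\ell(s_i\sigma)>\ell(\sigma)$; $[\sigma,\rho]_L$ denotes its closed intervals. For $I\subseteq[n-1]$, $w_0(I)$ is the longest element of the subgroup generated by $s_i$, $i\in I$. For a composition $\alpha$ of $n$, $\mathrm{set}(\alpha)=\{\alpha_1,\alpha_1+\alpha_2,\dots,\alpha_1+\cdots+\alpha_{k-1}\}$, $w_0(\alpha)=w_0(\mathrm{set}(\alpha))$; $\alpha^{\mathrm c}$ is the composition with $\mathrm{set}(\alpha^{\mathrm c})=[n-1]\setminus\mathrm{set}(\alpha)$; $\alpha^{\mathrm r}$ is $\alpha$ reversed. **Modules.** $H_n(0)$ is the unital associative $\mathbb C$-algebra generated by $\pi_1,\dots,\pi_{n-1}$ with $\pi_i^2=\pi_i$, $\pi_i\pi_{i+1}\pi_i=\pi_{i+1}\pi_i\pi_{i+1}$,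 $\pi_i\pi_j=\pi_j\pi_i$ for $|i-j|\ge2$. For a subset $S\subseteq\mathfrak S_n$ that is either an interval $[\sigma,\rho]_L$ or of the form $\Sigma_L(P)$ below, the space $\mathbb CS$ is an $H_n(0)$-module by $\pi_i\cdot\gamma=\gamma$ if $i\in\mathrm{Des}_L(\gamma)$; $0$ if $i\notin\mathrm{Des}_L(\gamma)$ and $s_i\gamma\notin S$; $s_i\gamma$ if $i\notin\mathrm{Des}_L(\gamma)$ and $s_i\gamma\in S$. Denote it $\mathsf B(\sigma,\rho)$ if $S=[\sigma,\rho]_L$ and $\mathsf M_P$ if $S=\Sigma_L(P)$. A projective cover of a finitely generated module $M$ is a pair $(\boldsymbol P,f)$ with $\boldsymbol P$ projective and $f:\boldsymbol P\to M$ an epimorphism with $\ker f\subseteq\mathrm{rad}(\boldsymbol P)$ (intersection of maximal submodules). An injective hull of $M$ is a pair $(\boldsymbol I,\iota)$ with $\boldsymbol I$ injective and $\iota:M\to\boldsymbol I$ a monomorphism with $\iota(M)\supseteq\mathrm{soc}(\boldsymbol I)$ (sum of irreducible submodules). **Twist.** Let $\theta$ be the automorphism of $H_n(0)$ with $\theta(\pi_i)=1-\pi_i$, $\chi$ the anti-automorphism with $\chi(\pi_i)=\pi_i$, and $\hat\theta=\theta\circ\chi$. $\mathbf T^-_{\hat\theta}$ is the contravariant functor sending $M$ to its dual space $M^*$ with action $(h\cdot\delta)(v)=\delta(\hat\theta(h)\cdot v)$, and a homomorphism to its transpose. **Skew shapes and posets.** A skew partition $\lambda/\mu$ is a pair of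 partitions with $\mu_i\le\lambda_i$ for all $i$ (missing parts $0$); its Young diagram is the set of boxes $(i,j)$ (row $i$ from the top, column $j$ from the left) with $\mu_i<j\le\lambda_i$; size $|\lambda|-|\mu|$. All skew partitions are assumed basic (no empty rows or columns in the diagram). It is connected if each pair of consecutive rows contains two boxes, one in each row, sharing an edge; in general the diagram splits into connected components ordered from the top, and we write $\lambda/\mu=\lambda^{(1)}/\mu^{(1)}\star\cdots\star\lambda^{(k)}/\mu^{(k)}$ with $\lambda^{(i)}/\mu^{(i)}$ the (connected) $i$th component from the top, each component lying strictly below and strictly to the left of the preceding one. $\lambda^{\mathrm t}$ is the transpose of $\lambda$. A bijective tableau of shape $\lambda/\mu$ (size $n$) is a filling of the diagram using each element of $[n]$ once; it is standard (in $\mathrm{SYT}(\lambda/\mu)$) if rows increase left to right and columns increase top to bottom, and a Schur labeling if rows decrease left to right and columns increase top to bottom. $\mathsf{poset}(\tau)$ is the poset on $[n]$ with $i\preceq_\tau j$ iff the box of $i$ in $\tau$ is weakly above and weakly left of that of $j$. $\mathsf{SP}_n$ is the set of all $\mathsf{poset}(\tau)$, $\tau$ a Schur labeling of a skew shape of size $n$. A poset $P$ on $[n]$ is regular if $x\preceq_Pz$ and ($x<y<z$ or $z<y<x$) imply $x\preceq_Py$ or $y\preceq_Pz$. $\mathsf{RSP}_n$ is the set of regular posets in $\mathsf{SP}_n$. For $P\in\mathsf{SP}_n$, $\tau_P$ is the unique Schur labeling $\tau$ of basic shape with $\mathsf{poset}(\tau)=P$ whose connected components, from top to bottom, have increasing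 minimum entries. $\Sigma_L(P)=\{\sigma\in\mathfrak S_n\mid\sigma(i)\le\sigma(j)\text{ for all }i\preceq_Pj\}$. For bijective tableaux $\tau,T$ of the same shape, $\mathsf{read}_\tau(T)(k)=T_{\tau^{-1}(k)}$, the entry of $T$ in the box where $\tau$ has $k$. One has $\Sigma_L(P)=\mathsf{read}_{\tau_P}(\mathrm{SYT}(\mathrm{sh}(\tau_P)))$. $\tau_0=\tau_0^{\lambda/\mu}$ (resp. $\tau_1=\tau_1^{\lambda/\mu}$) is the filling of the diagram by $1,\dots,n$ from right to left in each row starting with the top row (resp. from top to bottom in each column starting with the rightmost column). $T_{\lambda/\mu}$ (resp. $T'_{\lambda/\mu}$) is the filling from left to right in each row starting with the top row (resp. from top to bottom in each column starting with the leftmost column). **Generalized compositions.** A generalized composition of $n$ is a formal expression $\boldsymbol\alpha=\alpha^{(1)}\star\cdots\star\alpha^{(k)}$ with $\alpha^{(i)}$ compositions of total size $n$. $\boldsymbol\alpha_\bullet$ is the concatenation of the $\alpha^{(i)}$; $\boldsymbol\alpha_\odot$ is the near-concatenation $\alpha^{(1)}\odot\cdots\odot\alpha^{(k)}$, where $\alpha\odot\beta=(\alpha_1,\dots,\alpha_{\ell(\alpha)}+\beta_1,\beta_2,\dots)$. $\boldsymbol\alpha_\bullet^{\mathrm c}=(\boldsymbol\alpha_\bullet)^{\mathrm c}$, $\boldsymbol\alpha_\odot^{\mathrm c}=(\boldsymbol\alpha_\odot)^{\mathrm c}$. $\boldsymbol\alpha^{\mathrm c\cdot\mathrm r}=((\alpha^{(k)})^{\mathrm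 c})^{\mathrm r}\star\cdots\star((\alpha^{(1)})^{\mathrm c})^{\mathrm r}$. $\mathbf P_{\boldsymbol\alpha}=\mathsf B(w_0(\boldsymbol\alpha_\bullet^{\mathrm c}),w_0w_0(\boldsymbol\alpha_\odot))$. For connected $\lambda/\mu$, $\boldsymbol\alpha_{\mathrm{proj}}(\lambda/\mu)=(\lambda_1-\mu_1,\dots,\lambda_{\ell(\lambda)}-\mu_{\ell(\lambda)})$; in general $\boldsymbol\alpha_{\mathrm{proj}}(\lambda/\mu)=\boldsymbol\alpha_{\mathrm{proj}}(\lambda^{(1)}/\mu^{(1)})\star\cdots\star\boldsymbol\alpha_{\mathrm{proj}}(\lambda^{(k)}/\mu^{(k)})$. $\boldsymbol\alpha_{\mathrm{inj}}(\lambda/\mu)=\boldsymbol\alpha_{\mathrm{proj}}(\lambda^{\mathrm t}/\mu^{\mathrm t})^{\mathrm c\cdot\mathrm r}$. **Maps.** For $\rho\in[w_0(\boldsymbol\alpha_\odot^{\mathrm c}),w_0w_0(\boldsymbol\alpha_\odot)]_L$, $\Upsilon_{\boldsymbol\alpha;\rho}:\mathbf P_{\boldsymbol\alpha}\to\mathsf B(w_0(\boldsymbol\alpha_\bullet^{\mathrm c}),\rho)$ is the linear map sending a basis element $\gamma$ to $\gamma$ if $\gamma\in[w_0(\boldsymbol\alpha_\bullet^{\mathrm c}),\rho]_L$ and to $0$ otherwise. For $Q\in\mathsf{RSP}_n$ with $\mathrm{sh}(\tau_Q)=\nu/\kappa$, $f_Q:\mathsf M_{\mathsf{poset}(\tau_0^{\nu/\kappa})}\to\mathsf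 M_Q$ is the linear map $\mathsf{read}_{\tau_0}(T)\mapsto\mathsf{read}_{\tau_Q}(T)$ ($T\in\mathrm{SYT}(\nu/\kappa)$), and $\eta_Q=f_Q\circ\Upsilon_{\boldsymbol\alpha_{\mathrm{proj}}(\nu/\kappa);\,\mathsf{read}_{\tau_0}(T'_{\nu/\kappa})}$ (here $\mathsf M_{\mathsf{poset}(\tau_0^{\nu/\kappa})}=\mathsf B(\mathsf{read}_{\tau_0}(T_{\nu/\kappa}),\mathsf{read}_{\tau_0}(T'_{\nu/\kappa}))$ and $\mathsf{read}_{\tau_0}(T_{\nu/\kappa})=w_0(\boldsymbol\alpha_{\mathrm{proj}}(\nu/\kappa)_\bullet^{\mathrm c})$). With $\lambda/\mu=\mathrm{sh}(\tau_P)$ and $R=\mathsf{poset}(\tau_1^{\lambda^{\mathrm t}/\mu^{\mathrm t}})$ (for which $\tau_R=\tau_1^{\lambda^{\mathrm t}/\mu^{\mathrm t}}$), let $g_1:\mathbf T^-_{\hat\theta}(\mathsf M_R)\to\mathsf M_{\mathsf{poset}(\tau_0^{\lambda/\mu})}$ be the linear isomorphism $\gamma^*\mapsto(-1)^{\ell(\gamma\,\mathsf{read}_{\tau_1}(T'_{\lambda^{\mathrm t}/\mu^{\mathrm t}})^{-1})}\gamma w_0$ and $g_2:\mathbf T^-_{\hat\theta}(\mathbf P_{\boldsymbol\alpha_{\mathrm{proj}}(\lambda^{\mathrm t}/\mu^{\mathrm t})})\to\mathbf P_{\boldsymbol\alpha_{\mathrm{inj}}(\lambda/\mu)}$ the linear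 isomorphism $\gamma^*\mapsto(-1)^{\ell(\gamma(w_0w_0(\boldsymbol\alpha_{\mathrm{inj}}(\lambda/\mu)_\odot))^{-1})}\gamma w_0$, where $\gamma^*$ are dual basis elements to the permutation bases; both are $H_n(0)$-isomorphisms. Finally $\iota_P=g_2\circ\mathbf T^-_{\hat\theta}(\eta_R)\circ g_1^{-1}\circ f_P^{-1}$. *)

theory Defs
  imports Complex_Main "HOL-Algebra.Sym_Groups" "HOL-Algebra.QuotRing" "HOL-Algebra.Module"
begin

section \<open>Left modules over a not necessarily commutative ring\<close>

text \<open>The locale \<^locale>\<open>module\<close> of the library demands a commutative ring of scalars.  We reuse its
  record type (the fields \<^const>\<open>mult\<close> and \<^const>\<open>one\<close> of a module are irrelevant), and the
  locale \<^locale>\<open>submodule\<close>, which has no such restriction.\<close>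

locale left_module = R: ring R + M: abelian_group M
  for R :: "('r, 'k) ring_scheme" and M :: "('r, 'a) module" +
  assumes lsmult_closed:
      "\<lbrakk>a \<in> carrier R; x \<in> carrier M\<rbrakk> \<Longrightarrow> a \<odot>\<^bsub>M\<^esub> x \<in> carrier M"
    and lsmult_l_distr:
      "\<lbrakk>a \<in> carrier R; b \<in> carrier R; x \<in> carrier M\<rbrakk> \<Longrightarrow>
        (a \<oplus>\<^bsub>R\<^esub> b) \<odot>\<^bsub>M\<^esub> x = a \<odot>\<^bsub>M\<^esub> x \<oplus>\<^bsub>M\<^esub> b \<odot>\<^bsub>M\<^esub> x"
    and lsmult_r_distr:
      "\<lbrakk>a \<in> carrier R; x \<in> carrier M; y \<in> carrier M\<rbrakk> \<Longrightarrow>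
        a \<odot>\<^bsub>M\<^esub> (x \<oplus>\<^bsub>M\<^esub> y) = a \<odot>\<^bsub>M\<^esub> x \<oplus>\<^bsub>M\<^esub> a \<odot>\<^bsub>M\<^esub> y"
    and lsmult_assoc:
      "\<lbrakk>a \<in> carrier R; b \<in> carrier R; x \<in> carrier M\<rbrakk> \<Longrightarrow>
        (a \<otimes>\<^bsub>R\<^esub> b) \<odot>\<^bsub>M\<^esub> x = a \<odot>\<^bsub>M\<^esub> (b \<odot>\<^bsub>M\<^esub> x)"
    and lsmult_one: "x \<in> carrier M \<Longrightarrow> \<one>\<^bsub>R\<^esub> \<odot>\<^bsub>M\<^esub> x = x"

definition module_hom ::
  "('r, 'k) ring_scheme \<Rightarrow> ('r, 'a) module \<Rightarrow> ('r, 'b) module \<Rightarrow> ('a \<Rightarrow> 'b) set" where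
  "module_hom R M N = {f. f \<in> carrier M \<rightarrow> carrier N \<and>
     (\<forall>x\<in>carrier M. \<forall>y\<in>carrier M. f (x \<oplus>\<^bsub>M\<^esub> y) = f x \<oplus>\<^bsub>N\<^esub> f y) \<and>
     (\<forall>r\<in>carrier R. \<forall>x\<in>carrier M. f (r \<odot>\<^bsub>M\<^esub> x) = r \<odot>\<^bsub>N\<^esub> f x)}"

definition module_epi ::
  "('r, 'k) ring_scheme \<Rightarrow> ('r, 'a) module \<Rightarrow> ('r, 'b) module \<Rightarrow> ('a \<Rightarrow> 'b) set" where
  "module_epi R M N = {f \<in> module_hom R M N. f ` carrier M = carrier N}"

definition module_mono ::
  "('r, 'k) ring_scheme \<Rightarrow> ('r, 'a) module \<Rightarrow> ('r, 'b) module \<Rightarrow> ('a \<Rightarrow> 'b) set" where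
  "module_mono R M N = {f \<in> module_hom R M N. inj_on f (carrier M)}"

text \<open>HOL cannot quantify over all modules of all types inside a definition.  The element types
  of the test modules are therefore parameters of projectivity and injectivity; a theorem in
  which these are type variables asserts the lifting (extension) property for test modules over
  arbitrary types.\<close>

definition projective_module ::
  "'x itself \<Rightarrow> 'y itself \<Rightarrow> ('r, 'k) ring_scheme \<Rightarrow> ('r, 'p) module \<Rightarrow> bool" where
  "projective_module TX TY R P \<longleftrightarrow> left_module R P \<and>
     (\<forall>(M :: ('r, 'x) module) (N :: ('r, 'y) module) g f.
        left_module R M \<longrightarrow> left_module R N \<longrightarrow> g \<in> module_epi R M N \<longrightarrow> f \<in> module_hom R P N \<longrightarrow>
        (\<exists>h\<in>module_hom R P M. \<forall>x\<in>carrier P. g (h x) = f x))"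

definition injective_module ::
  "'x itself \<Rightarrow> 'y itself \<Rightarrow> ('r, 'k) ring_scheme \<Rightarrow> ('r, 'i) module \<Rightarrow> bool" where
  "injective_module TX TY R I \<longleftrightarrow> left_module R I \<and>
     (\<forall>(M :: ('r, 'x) module) (N :: ('r, 'y) module) g f.
        left_module R M \<longrightarrow> left_module R N \<longrightarrow> g \<in> module_mono R M N \<longrightarrow> f \<in> module_hom R M I \<longrightarrow>
        (\<exists>h\<in>module_hom R N I. \<forall>x\<in>carrier M. h (g x) = f x))"

definition finitely_generated_module ::
  "('r, 'k) ring_scheme \<Rightarrow> ('r, 'a) module \<Rightarrow> bool" where
  "finitely_generated_module R M \<longleftrightarrow> left_module R M \<and>
     (\<exists>A. finite A \<and> A \<subseteq> carrier M \<and> (\<forall>K. submodule K R M \<longrightarrow> A \<subseteq> K \<longrightarrow> K = carrier M))"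

definition maximal_submodule ::
  "'a set \<Rightarrow> ('r, 'k) ring_scheme \<Rightarrow> ('r, 'a) module \<Rightarrow> bool" where
  "maximal_submodule K R M \<longleftrightarrow> submodule K R M \<and> K \<noteq> carrier M \<and>
     (\<forall>L. submodule L R M \<longrightarrow> K \<subseteq> L \<longrightarrow> L = K \<or> L = carrier M)"

definition irreducible_submodule ::
  "'a set \<Rightarrow> ('r, 'k) ring_scheme \<Rightarrow> ('r, 'a) module \<Rightarrow> bool" where
  "irreducible_submodule K R M \<longleftrightarrow> submodule K R M \<and> K \<noteq> {\<zero>\<^bsub>M\<^esub>} \<and>
     (\<forall>L. submodule L R M \<longrightarrow> L \<subseteq> K \<longrightarrow> L = {\<zero>\<^bsub>M\<^esub>} \<or> L = K)"

text \<open>The intersection of the empty family is the whole module.\<close>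

definition module_rad :: "('r, 'k) ring_scheme \<Rightarrow> ('r, 'a) module \<Rightarrow> 'a set" where
  "module_rad R M = {x \<in> carrier M. \<forall>K. maximal_submodule K R M \<longrightarrow> x \<in> K}"

definition module_soc :: "('r, 'k) ring_scheme \<Rightarrow> ('r, 'a) module \<Rightarrow> 'a set" where
  "module_soc R M = {finsum M x F | F x. finite F \<and>
     (\<forall>K\<in>F. irreducible_submodule K R M \<and> x K \<in> K)}"

definition projective_cover ::
  "'x itself \<Rightarrow> 'y itself \<Rightarrow> ('r, 'k) ring_scheme \<Rightarrow> ('r, 'p) module \<Rightarrow> ('p \<Rightarrow> 'a) \<Rightarrow>
    ('r, 'a) module \<Rightarrow> bool" where
  "projective_cover TX TY R P f M \<longleftrightarrow> finitely_generated_module R M \<and>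
     projective_module TX TY R P \<and> f \<in> module_epi R P M \<and> a_kernel P M f \<subseteq> module_rad R P"

definition injective_hull ::
  "'x itself \<Rightarrow> 'y itself \<Rightarrow> ('r, 'k) ring_scheme \<Rightarrow> ('r, 'i) module \<Rightarrow> ('a \<Rightarrow> 'i) \<Rightarrow>
    ('r, 'a) module \<Rightarrow> bool" where
  "injective_hull TX TY R I \<iota> M \<longleftrightarrow> finitely_generated_module R M \<and>
     injective_module TX TY R I \<and> \<iota> \<in> module_mono R M I \<and> module_soc R I \<subseteq> \<iota> ` carrier M"


section \<open>The symmetric group\<close>

text \<open>The group is \<^term>\<open>sym_group n\<close>: permutations of \<open>{1..n}\<close>, extended by the identity to all
  natural numbers, with \<open>\<sigma> \<rho> = \<sigma> \<circ> \<rho>\<close>.  The index set \<open>[n-1]\<close> is \<open>{1..<n}\<close>.\<close>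

definition simple_transp :: "nat \<Rightarrow> nat \<Rightarrow> nat" where
  "simple_transp i = transpose i (Suc i)"

definition perm_length :: "nat \<Rightarrow> (nat \<Rightarrow> nat) \<Rightarrow> nat" where
  "perm_length n \<sigma> = (LEAST k. \<exists>ws. length ws = k \<and> set ws \<subseteq> {1..<n} \<and>
     \<sigma> = foldr (\<circ>) (map simple_transp ws) id)"

definition Des_L :: "nat \<Rightarrow> (nat \<Rightarrow> nat) \<Rightarrow> nat set" where
  "Des_L n \<sigma> = {i \<in> {1..<n}. perm_length n (simple_transp i \<circ> \<sigma>) < perm_length n \<sigma>}"

definition weak_cover :: "nat \<Rightarrow> (nat \<Rightarrow> nat) \<Rightarrow> (nat \<Rightarrow> nat) \<Rightarrow> bool" where
  "weak_cover n \<sigma> \<rho> \<longleftrightarrow> \<sigma> \<in> carrier (sym_group n) \<and>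
     (\<exists>i\<in>{1..<n}. \<rho> = simple_transp i \<circ> \<sigma> \<and> perm_length n \<rho> > perm_length n \<sigma>)"

definition weak_interval :: "nat \<Rightarrow> (nat \<Rightarrow> nat) \<Rightarrow> (nat \<Rightarrow> nat) \<Rightarrow> (nat \<Rightarrow> nat) set" where
  "weak_interval n \<sigma> \<rho> =
     {\<gamma> \<in> carrier (sym_group n). (weak_cover n)\<^sup>*\<^sup>* \<sigma> \<gamma> \<and> (weak_cover n)\<^sup>*\<^sup>* \<gamma> \<rho>}"

definition longest_parabolic :: "nat \<Rightarrow> nat set \<Rightarrow> nat \<Rightarrow> nat" where
  "longest_parabolic n I =
     (ARG_MAX (perm_length n) \<sigma>. \<sigma> \<in> generate (sym_group n) (simple_transp ` I))"

definition longest_perm :: "nat \<Rightarrow> nat \<Rightarrow> nat" where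
  "longest_perm n = (ARG_MAX (perm_length n) \<sigma>. \<sigma> \<in> carrier (sym_group n))"


section \<open>Compositions and generalized compositions\<close>

definition composition :: "nat \<Rightarrow> nat list \<Rightarrow> bool" where
  "composition n \<alpha> \<longleftrightarrow> 0 \<notin> set \<alpha> \<and> sum_list \<alpha> = n"

definition comp_set :: "nat list \<Rightarrow> nat set" where
  "comp_set \<alpha> = {sum_list (take k \<alpha>) | k. 1 \<le> k \<and> k < length \<alpha>}"

definition comp_compl :: "nat list \<Rightarrow> nat list" where
  "comp_compl \<alpha> = (THE \<beta>. composition (sum_list \<alpha>) \<beta> \<and>
     comp_set \<beta> = {1..<sum_list \<alpha>} - comp_set \<alpha>)"

definition w0_comp :: "nat \<Rightarrow> nat list \<Rightarrow> nat \<Rightarrow> nat" where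
  "w0_comp n \<alpha> = longest_parabolic n (comp_set \<alpha>)"

text \<open>A generalized composition \<open>\<alpha>\<^sub>1 \<star> \<dots> \<star> \<alpha>\<^sub>k\<close> is the list of the compositions \<open>\<alpha>\<^sub>i\<close>.\<close>

type_synonym gcomp = "nat list list"

definition near_concat2 :: "nat list \<Rightarrow> nat list \<Rightarrow> nat list" where
  "near_concat2 \<alpha> \<beta> = (if \<alpha> = [] then \<beta> else if \<beta> = [] then \<alpha>
     else butlast \<alpha> @ (last \<alpha> + hd \<beta>) # tl \<beta>)"

definition near_concat :: "gcomp \<Rightarrow> nat list" where
  "near_concat \<alpha> = foldr near_concat2 \<alpha> []"

definition gcomp_cr :: "gcomp \<Rightarrow> gcomp" where
  "gcomp_cr \<alpha> = rev (map (\<lambda>\<beta>. rev (comp_compl \<beta>)) \<alpha>)"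

text \<open>The end points of the interval defining \<open>\<^bold>P\<^sub>\<alpha>\<close>.\<close>

definition proj_lower :: "nat \<Rightarrow> gcomp \<Rightarrow> nat \<Rightarrow> nat" where
  "proj_lower n \<alpha> = w0_comp n (comp_compl (concat \<alpha>))"

definition proj_upper :: "nat \<Rightarrow> gcomp \<Rightarrow> nat \<Rightarrow> nat" where
  "proj_upper n \<alpha> = longest_perm n \<circ> w0_comp n (near_concat \<alpha>)"


section \<open>The 0-Hecke algebra\<close>

text \<open>The free algebra on generators indexed by \<open>[n-1]\<close>: finitely supported
  complex-valued functions on words over \<open>[n-1]\<close>.\<close>

definition mono_word :: "nat list \<Rightarrow> nat list \<Rightarrow> complex" where
  "mono_word u = (\<lambda>w. if w = u then 1 else 0)"

definition free_alg :: "nat \<Rightarrow> (nat list \<Rightarrow> complex) ring" where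
  "free_alg n =
     \<lparr> carrier = {f. finite {w. f w \<noteq> 0} \<and> (\<forall>w. f w \<noteq> 0 \<longrightarrow> set w \<subseteq> {1..<n})},
       mult = (\<lambda>f g w. \<Sum>k\<le>length w. f (take k w) * g (drop k w)),
       one = mono_word [],
       zero = (\<lambda>w. 0),
       add = (\<lambda>f g w. f w + g w) \<rparr>"

definition hecke_relations :: "nat \<Rightarrow> (nat list \<Rightarrow> complex) set" where
  "hecke_relations n =
     {(\<lambda>w. mono_word [i, i] w - mono_word [i] w) | i. i \<in> {1..<n}} \<union>
     {(\<lambda>w. mono_word [i, Suc i, i] w - mono_word [Suc i, i, Suc i] w) | i.
        i \<in> {1..<n} \<and> Suc i \<in> {1..<n}} \<union>
     {(\<lambda>w. mono_word [i, j] w - mono_word [j, i] w) | i j.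
        i \<in> {1..<n} \<and> j \<in> {1..<n} \<and> (i + 2 \<le> j \<or> j + 2 \<le> i)}"

type_synonym hecke = "(nat list \<Rightarrow> complex) set"

definition hecke_ideal :: "nat \<Rightarrow> hecke" where
  "hecke_ideal n = genideal (free_alg n) (hecke_relations n)"

definition hecke_alg :: "nat \<Rightarrow> hecke ring" where
  "hecke_alg n = free_alg n Quot hecke_ideal n"

definition hecke_gen :: "nat \<Rightarrow> nat \<Rightarrow> hecke" where
  "hecke_gen n i = hecke_ideal n +>\<^bsub>free_alg n\<^esub> mono_word [i]"

definition hecke_scalar :: "nat \<Rightarrow> complex \<Rightarrow> hecke" where
  "hecke_scalar n c = hecke_ideal n +>\<^bsub>free_alg n\<^esub> (\<lambda>w. c * mono_word [] w)"

definition hecke_linear :: "nat \<Rightarrow> (hecke \<Rightarrow> hecke) \<Rightarrow> bool" where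
  "hecke_linear n f \<longleftrightarrow> (\<forall>c. \<forall>x\<in>carrier (hecke_alg n).
     f (hecke_scalar n c \<otimes>\<^bsub>hecke_alg n\<^esub> x) = hecke_scalar n c \<otimes>\<^bsub>hecke_alg n\<^esub> f x)"

definition opposite_ring :: "'a ring \<Rightarrow> 'a ring" where
  "opposite_ring R = R\<lparr> mult := (\<lambda>x y. y \<otimes>\<^bsub>R\<^esub> x) \<rparr>"

definition hecke_theta :: "nat \<Rightarrow> hecke \<Rightarrow> hecke" where
  "hecke_theta n = (THE f. f \<in> extensional (carrier (hecke_alg n)) \<and>
     f \<in> ring_iso (hecke_alg n) (hecke_alg n) \<and> hecke_linear n f \<and>
     (\<forall>i\<in>{1..<n}. f (hecke_gen n i) = \<one>\<^bsub>hecke_alg n\<^esub> \<ominus>\<^bsub>hecke_alg n\<^esub> hecke_gen n i))"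

definition hecke_chi :: "nat \<Rightarrow> hecke \<Rightarrow> hecke" where
  "hecke_chi n = (THE f. f \<in> extensional (carrier (hecke_alg n)) \<and>
     f \<in> ring_iso (hecke_alg n) (opposite_ring (hecke_alg n)) \<and> hecke_linear n f \<and>
     (\<forall>i\<in>{1..<n}. f (hecke_gen n i) = hecke_gen n i))"

definition hecke_theta_hat :: "nat \<Rightarrow> hecke \<Rightarrow> hecke" where
  "hecke_theta_hat n = hecke_theta n \<circ> hecke_chi n"

text \<open>The contravariant functor \<open>\<^bold>T\<^sup>-\<close> attached to \<open>\<theta> \<circ> \<chi>\<close>, on objects and on morphisms
  with source \<open>M\<close>.  The dual space is the set of complex-linear functionals on the carrier; the
  complex structure of a module is the one induced by the scalars of the algebra.\<close>

definition twist_module :: "nat \<Rightarrow> (hecke, 'v) module \<Rightarrow> (hecke, 'v \<Rightarrow> complex) module" where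
  "twist_module n M =
     \<lparr> carrier = {\<delta> \<in> extensional (carrier M).
         (\<forall>x\<in>carrier M. \<forall>y\<in>carrier M. \<delta> (x \<oplus>\<^bsub>M\<^esub> y) = \<delta> x + \<delta> y) \<and>
         (\<forall>c. \<forall>x\<in>carrier M. \<delta> (hecke_scalar n c \<odot>\<^bsub>M\<^esub> x) = c * \<delta> x)},
       mult = undefined,
       one = undefined,
       zero = (\<lambda>x\<in>carrier M. 0),
       add = (\<lambda>\<delta> \<epsilon>. \<lambda>x\<in>carrier M. \<delta> x + \<epsilon> x),
       smult = (\<lambda>h \<delta>. \<lambda>x\<in>carrier M. \<delta> (hecke_theta_hat n h \<odot>\<^bsub>M\<^esub> x)) \<rparr>"

definition twist_hom :: "(hecke, 'v) module \<Rightarrow> ('v \<Rightarrow> 'u) \<Rightarrow> ('u \<Rightarrow> complex) \<Rightarrow> 'v \<Rightarrow> complex" where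
  "twist_hom M f \<delta> = (\<lambda>x\<in>carrier M. \<delta> (f x))"


section \<open>Modules with a basis of permutations\<close>

text \<open>Vectors of \<open>\<complex>S\<close> are functions on permutations that vanish outside \<open>S\<close>.\<close>

type_synonym pvec = "(nat \<Rightarrow> nat) \<Rightarrow> complex"

definition basis_vec :: "(nat \<Rightarrow> nat) \<Rightarrow> pvec" where
  "basis_vec \<gamma> = (\<lambda>\<sigma>. if \<sigma> = \<gamma> then 1 else 0)"

definition gen_act_basis :: "nat \<Rightarrow> (nat \<Rightarrow> nat) set \<Rightarrow> nat \<Rightarrow> (nat \<Rightarrow> nat) \<Rightarrow> pvec" where
  "gen_act_basis n S i \<gamma> =
     (if i \<in> Des_L n \<gamma> then basis_vec \<gamma>
      else if simple_transp i \<circ> \<gamma> \<notin> S then (\<lambda>\<sigma>. 0)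
      else basis_vec (simple_transp i \<circ> \<gamma>))"

definition gen_act :: "nat \<Rightarrow> (nat \<Rightarrow> nat) set \<Rightarrow> nat \<Rightarrow> pvec \<Rightarrow> pvec" where
  "gen_act n S i v = (\<lambda>\<sigma>. \<Sum>\<gamma>\<in>S. v \<gamma> * gen_act_basis n S i \<gamma> \<sigma>)"

definition free_act :: "nat \<Rightarrow> (nat \<Rightarrow> nat) set \<Rightarrow> (nat list \<Rightarrow> complex) \<Rightarrow> pvec \<Rightarrow> pvec" where
  "free_act n S f v = (\<lambda>\<sigma>. \<Sum>w | f w \<noteq> 0. f w * foldr (gen_act n S) w v \<sigma>)"

text \<open>A residue class acts through any of its representatives; the action is well defined
  whenever the operators \<^term>\<open>gen_act n S i\<close> satisfy the defining relations.\<close>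

definition perm_module :: "nat \<Rightarrow> (nat \<Rightarrow> nat) set \<Rightarrow> (hecke, pvec) module" where
  "perm_module n S =
     \<lparr> carrier = {v. \<forall>\<sigma>. \<sigma> \<notin> S \<longrightarrow> v \<sigma> = 0},
       mult = undefined,
       one = undefined,
       zero = (\<lambda>\<sigma>. 0),
       add = (\<lambda>u v \<sigma>. u \<sigma> + v \<sigma>),
       smult = (\<lambda>h v. the_elem ((\<lambda>f. free_act n S f v) ` h)) \<rparr>"

definition B_module :: "nat \<Rightarrow> (nat \<Rightarrow> nat) \<Rightarrow> (nat \<Rightarrow> nat) \<Rightarrow> (hecke, pvec) module" where
  "B_module n \<sigma> \<rho> = perm_module n (weak_interval n \<sigma> \<rho>)"

definition P_module :: "nat \<Rightarrow> gcomp \<Rightarrow> (hecke, pvec) module" where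
  "P_module n \<alpha> = B_module n (proj_lower n \<alpha>) (proj_upper n \<alpha>)"

definition Sigma_L :: "nat \<Rightarrow> (nat \<times> nat) set \<Rightarrow> (nat \<Rightarrow> nat) set" where
  "Sigma_L n P = {\<sigma> \<in> carrier (sym_group n). \<forall>(i, j)\<in>P. \<sigma> i \<le> \<sigma> j}"

definition M_module :: "nat \<Rightarrow> (nat \<times> nat) set \<Rightarrow> (hecke, pvec) module" where
  "M_module n P = perm_module n (Sigma_L n P)"


section \<open>Skew partitions and tableaux\<close>

type_synonym skew = "nat list \<times> nat list"

definition is_partition :: "nat list \<Rightarrow> bool" where
  "is_partition p \<longleftrightarrow> sorted_wrt (\<ge>) p \<and> 0 \<notin> set p"

definition part :: "nat list \<Rightarrow> nat \<Rightarrow> nat" where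
  "part p i = (if 1 \<le> i \<and> i \<le> length p then p ! (i - 1) else 0)"

definition diagram :: "skew \<Rightarrow> (nat \<times> nat) set" where
  "diagram sk = {(i, j). part (snd sk) i < j \<and> j \<le> part (fst sk) i}"

definition skew_partition :: "skew \<Rightarrow> bool" where
  "skew_partition sk \<longleftrightarrow> is_partition (fst sk) \<and> is_partition (snd sk) \<and>
     (\<forall>i. part (snd sk) i \<le> part (fst sk) i)"

definition basic :: "skew \<Rightarrow> bool" where
  "basic sk \<longleftrightarrow> (\<forall>i\<in>{1..length (fst sk)}. \<exists>j. (i, j) \<in> diagram sk) \<and>
     (\<forall>j\<in>{1..part (fst sk) 1}. \<exists>i. (i, j) \<in> diagram sk)"

definition skew_size :: "skew \<Rightarrow> nat" where
  "skew_size sk = sum_list (fst sk) - sum_list (snd sk)"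

definition transpose_partition :: "nat list \<Rightarrow> nat list" where
  "transpose_partition p = map (\<lambda>j. length (filter (\<lambda>x. j \<le> x) p)) [1..<Suc (part p 1)]"

definition transpose_skew :: "skew \<Rightarrow> skew" where
  "transpose_skew sk = (transpose_partition (fst sk), transpose_partition (snd sk))"

text \<open>The connected components from the top, each given by the list of its rows: the maximal runs
  of rows in which any two consecutive ones contain boxes sharing an edge.\<close>

fun maximal_runs :: "('a \<Rightarrow> 'a \<Rightarrow> bool) \<Rightarrow> 'a list \<Rightarrow> 'a list list" where
  "maximal_runs L [] = []"
| "maximal_runs L [x] = [[x]]"
| "maximal_runs L (x # y # xs) =
     (let bs = maximal_runs L (y # xs)
      in if L x y then (x # hd bs) # tl bs else [x] # bs)"

definition components :: "skew \<Rightarrow> nat list list" where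
  "components sk = maximal_runs (\<lambda>i i'. \<exists>j. (i, j) \<in> diagram sk \<and> (i', j) \<in> diagram sk)
     [1..<Suc (length (fst sk))]"

definition alpha_proj :: "skew \<Rightarrow> gcomp" where
  "alpha_proj sk = map (map (\<lambda>i. part (fst sk) i - part (snd sk) i)) (components sk)"

definition alpha_inj :: "skew \<Rightarrow> gcomp" where
  "alpha_inj sk = gcomp_cr (alpha_proj (transpose_skew sk))"

text \<open>A tableau consists of its shape and its filling, a function that is \<^const>\<open>undefined\<close>
  outside the diagram.\<close>

type_synonym tableau = "skew \<times> (nat \<times> nat \<Rightarrow> nat)"

definition shape :: "tableau \<Rightarrow> skew" where
  "shape T = fst T"

definition entry :: "tableau \<Rightarrow> nat \<times> nat \<Rightarrow> nat" where
  "entry T = snd T"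

definition bijective_tableau :: "nat \<Rightarrow> tableau \<Rightarrow> bool" where
  "bijective_tableau n T \<longleftrightarrow> skew_partition (shape T) \<and> basic (shape T) \<and> skew_size (shape T) = n \<and>
     entry T \<in> extensional (diagram (shape T)) \<and> bij_betw (entry T) (diagram (shape T)) {1..n}"

definition columns_increase :: "tableau \<Rightarrow> bool" where
  "columns_increase T \<longleftrightarrow> (\<forall>i i' j. (i, j) \<in> diagram (shape T) \<longrightarrow> (i', j) \<in> diagram (shape T) \<longrightarrow>
     i < i' \<longrightarrow> entry T (i, j) < entry T (i', j))"

definition rows_increase :: "tableau \<Rightarrow> bool" where
  "rows_increase T \<longleftrightarrow> (\<forall>i j j'. (i, j) \<in> diagram (shape T) \<longrightarrow> (i, j') \<in> diagram (shape T) \<longrightarrow>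
     j < j' \<longrightarrow> entry T (i, j) < entry T (i, j'))"

definition rows_decrease :: "tableau \<Rightarrow> bool" where
  "rows_decrease T \<longleftrightarrow> (\<forall>i j j'. (i, j) \<in> diagram (shape T) \<longrightarrow> (i, j') \<in> diagram (shape T) \<longrightarrow>
     j < j' \<longrightarrow> entry T (i, j) > entry T (i, j'))"

definition SYT :: "skew \<Rightarrow> tableau set" where
  "SYT sk = {T. shape T = sk \<and> bijective_tableau (skew_size sk) T \<and>
     rows_increase T \<and> columns_increase T}"

definition schur_labeling :: "nat \<Rightarrow> tableau \<Rightarrow> bool" where
  "schur_labeling n T \<longleftrightarrow> bijective_tableau n T \<and> rows_decrease T \<and> columns_increase T"

text \<open>Posets are given by their (reflexive) order relation.\<close>

definition tab_poset :: "tableau \<Rightarrow> (nat \<times> nat) set" where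
  "tab_poset T = {(entry T a, entry T b) | a b. a \<in> diagram (shape T) \<and> b \<in> diagram (shape T) \<and>
     fst a \<le> fst b \<and> snd a \<le> snd b}"

definition SP :: "nat \<Rightarrow> (nat \<times> nat) set set" where
  "SP n = {tab_poset T | T. schur_labeling n T}"

definition regular_poset :: "nat \<Rightarrow> (nat \<times> nat) set \<Rightarrow> bool" where
  "regular_poset n P \<longleftrightarrow> partial_order_on {1..n} P \<and>
     (\<forall>x y z. (x, z) \<in> P \<longrightarrow> x < y \<and> y < z \<or> z < y \<and> y < x \<longrightarrow> (x, y) \<in> P \<or> (y, z) \<in> P)"

definition RSP :: "nat \<Rightarrow> (nat \<times> nat) set set" where
  "RSP n = {P \<in> SP n. regular_poset n P}"

definition component_mins :: "tableau \<Rightarrow> nat list" where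
  "component_mins T =
     map (\<lambda>rs. Min (entry T ` {b \<in> diagram (shape T). fst b \<in> set rs})) (components (shape T))"

definition tau :: "nat \<Rightarrow> (nat \<times> nat) set \<Rightarrow> tableau" where
  "tau n P = (THE T. schur_labeling n T \<and> tab_poset T = P \<and> sorted_wrt (<) (component_mins T))"

text \<open>The filling by \<open>1, 2, \<dots>\<close> that visits the boxes in the (reflexive) total order \<open>before\<close>.\<close>

definition filling :: "(nat \<times> nat \<Rightarrow> nat \<times> nat \<Rightarrow> bool) \<Rightarrow> skew \<Rightarrow> tableau" where
  "filling before sk = (sk, \<lambda>b\<in>diagram sk. card {a \<in> diagram sk. before a b})"

definition tau0 :: "skew \<Rightarrow> tableau" where
  "tau0 = filling (\<lambda>(i, j) (i', j'). i < i' \<or> i = i' \<and> j \<ge> j')"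

definition tau1 :: "skew \<Rightarrow> tableau" where
  "tau1 = filling (\<lambda>(i, j) (i', j'). j > j' \<or> j = j' \<and> i \<le> i')"

text \<open>The tableau \<open>T'\<^sub>\<lambda>\<^sub>/\<^sub>\<mu>\<close>: columns from the left, each from top to bottom.\<close>

definition T_col :: "skew \<Rightarrow> tableau" where
  "T_col = filling (\<lambda>(i, j) (i', j'). j < j' \<or> j = j' \<and> i \<le> i')"

definition read_tab :: "tableau \<Rightarrow> tableau \<Rightarrow> nat \<Rightarrow> nat" where
  "read_tab t T k = (if k \<in> entry t ` diagram (shape t)
     then entry T (inv_into (diagram (shape t)) (entry t) k) else k)"


section \<open>The maps\<close>

definition Upsilon :: "nat \<Rightarrow> gcomp \<Rightarrow> (nat \<Rightarrow> nat) \<Rightarrow> pvec \<Rightarrow> pvec" where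
  "Upsilon n \<alpha> \<rho> v = (\<lambda>\<sigma>. if \<sigma> \<in> weak_interval n (proj_lower n \<alpha>) \<rho> then v \<sigma> else 0)"

definition f_map :: "nat \<Rightarrow> (nat \<times> nat) set \<Rightarrow> pvec \<Rightarrow> pvec" where
  "f_map n Q v = (let sk = shape (tau n Q) in
     (\<lambda>\<sigma>. \<Sum>T\<in>SYT sk. v (read_tab (tau0 sk) T) * basis_vec (read_tab (tau n Q) T) \<sigma>))"

definition eta_map :: "nat \<Rightarrow> (nat \<times> nat) set \<Rightarrow> pvec \<Rightarrow> pvec" where
  "eta_map n Q = (let sk = shape (tau n Q) in
     f_map n Q \<circ> Upsilon n (alpha_proj sk) (read_tab (tau0 sk) (T_col sk)))"

text \<open>The linear map sending the dual basis element of \<open>\<gamma> \<in> S\<close> to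
  \<open>(-1) ^ perm_length (\<gamma> \<rho>\<inverse>)\<close> times \<open>\<gamma> w\<^sub>0\<close>.  A functional \<open>\<delta>\<close> is the sum of the dual
  basis elements with coefficients \<^term>\<open>\<delta> (basis_vec \<gamma>)\<close>.\<close>

definition dual_to_perm ::
  "nat \<Rightarrow> (nat \<Rightarrow> nat) set \<Rightarrow> (nat \<Rightarrow> nat) \<Rightarrow> (pvec \<Rightarrow> complex) \<Rightarrow> pvec" where
  "dual_to_perm n S \<rho> \<delta> = (\<lambda>\<sigma>. \<Sum>\<gamma>\<in>S. \<delta> (basis_vec \<gamma>) *
     ((-1) ^ perm_length n (\<gamma> \<circ> inv' \<rho>) * basis_vec (\<gamma> \<circ> longest_perm n) \<sigma>))"

definition R_poset :: "skew \<Rightarrow> (nat \<times> nat) set" where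
  "R_poset sk = tab_poset (tau1 (transpose_skew sk))"

definition g1_map :: "nat \<Rightarrow> skew \<Rightarrow> (pvec \<Rightarrow> complex) \<Rightarrow> pvec" where
  "g1_map n sk = dual_to_perm n (Sigma_L n (R_poset sk))
     (read_tab (tau1 (transpose_skew sk)) (T_col (transpose_skew sk)))"

definition g2_map :: "nat \<Rightarrow> skew \<Rightarrow> (pvec \<Rightarrow> complex) \<Rightarrow> pvec" where
  "g2_map n sk = (let \<alpha> = alpha_proj (transpose_skew sk) in
     dual_to_perm n (weak_interval n (proj_lower n \<alpha>) (proj_upper n \<alpha>))
       (longest_perm n \<circ> w0_comp n (near_concat (alpha_inj sk))))"

definition iota_map :: "nat \<Rightarrow> (nat \<times> nat) set \<Rightarrow> pvec \<Rightarrow> pvec" where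
  "iota_map n P = (let sk = shape (tau n P); R = R_poset sk in
     g2_map n sk
     \<circ> twist_hom (P_module n (alpha_proj (transpose_skew sk))) (eta_map n R)
     \<circ> inv_into (carrier (twist_module n (M_module n R))) (g1_map n sk)
     \<circ> inv_into (carrier (M_module n (tab_poset (tau0 sk)))) (f_map n P))"

end

theory Submission
 imports Defs
begin

text \<open>The proof rests on one property of the labeling \<open>\<tau>\<^sub>P\<close> of a regular poset: its labels increase
 from north-east to south-west (\<open>regular_distinguished\<close>).  Of two consecutive entries of a standard
 filling, neither lies strictly to the south-east of the other, so the left descents of a reading word
 do not depend on which labeling with this property is used to read.  Hence \<open>f_map\<close> is an isomorphism
 (\<open>f_map_iso\<close>), and the module of \<open>P\<close> may be replaced by that of the row labeling \<open>\<tau>\<^sub>0\<close>.  That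
 \<open>\<tau>\<^sub>P\<close> is well defined is a separate matter: the covers of \<open>P\<close> determine the relative position of
 boxes inside a component, and the minima of the components determine the order of the components.

 The module \<open>\<^bold>P\<^sub>\<alpha>\<close> has as basis the permutations with descents at all positions of a set \<open>J\<close> and
 ascents at all positions of a set \<open>K\<close>.  It is generated by the shortest of them.  If \<open>q\<close> is the
 product of the elements \<open>1 - \<pi>\<^sub>k\<close> along the longest element of the subgroup of \<open>K\<close>, then
 \<open>\<gamma> \<mapsto> \<pi>\<^sub>\<gamma> q\<close> is a homomorphism to the regular module which, followed by multiplication with the
 generator, is unitriangular for the length.  So \<open>\<^bold>P\<^sub>\<alpha>\<close> is a retract of the regular module
 (\<open>regular_retract_M\<close>), hence projective.

 For \<open>\<alpha>\<close> the row lengths, the map \<open>\<Upsilon>\<close> forgets all permutations that are not reading words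
 of standard fillings.  On a simple quotient of \<open>\<^bold>P\<^sub>\<alpha>\<close> every generator acts as \<open>0\<close> or \<open>1\<close>, and a basis
 vector can survive only if no element of \<open>K\<close> separates the two positions of an inversion
 (\<open>eigenfunctional_support\<close>).  Such a permutation is a reading word of a standard filling, because
 positions in different rows of one component are separated by an element of \<open>K\<close>.  So the kernel
 of \<open>\<eta>\<^sub>P\<close> lies in the radical.

 The second part is dual to the first.  A homomorphism into the twisted dual of a retract of the
 regular module is determined by a linear functional, and functionals extend, so such a dual is injective
 (\<open>twist_regular_retract_injective\<close>).  Reversing all positions exchanges the roles of descents and
 ascents, which identifies the duals of the modules of the transposed shape with the modules in the
 statement.  A simple submodule of the hull is spanned by a functional on the projective module
 of the transposed shape that is an eigenvector of all generators; by the radical computation above it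
 vanishes on the kernel of \<open>\<eta>\<^sub>R\<close>, so it factors through \<open>\<eta>\<^sub>R\<close> and lies in the image of \<open>\<iota>\<^sub>P\<close>.\<close>

section \<open>Inversions and the weak order\<close>

abbreviation "tr \<equiv> simple_transp"
abbreviation "len \<equiv> perm_length"

abbreviation perms :: "nat => (nat => nat) set" where
 "perms n \<equiv> {w. w permutes {1..n}}"

definition inversions :: "nat => (nat => nat) => (nat \<times> nat) set" where
 "inversions n w = {(a, b). a \<in> {1..n} \<and> b \<in> {1..n} \<and> a < b \<and> w b < w a}"

lemma finite_inversions [simp]: "finite (inversions n w)"
 by (rule finite_subset[of _ "{1..n} \<times> {1..n}"]) (auto simp: inversions_def)

lemma simple_transp_permutes:
 "i \<in> {1..<n} ==> tr i permutes {1..n}"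
 unfolding simple_transp_def by (rule permutes_swap_id) auto

lemma simple_transp_invol [simp]:
 "tr i (tr i x) = x" "tr i o (tr i o f) = f"
 by (auto simp: simple_transp_def fun_eq_iff)

lemma simple_transp_simps [simp]:
 "tr i i = Suc i" "tr i (Suc i) = i"
 by (auto simp: simple_transp_def)

lemma simple_transp_other: "x \<noteq> i ==> x \<noteq> Suc i ==> tr i x = x"
 by (auto simp: simple_transp_def)

lemma tr_comp_permutes:
 "i \<in> {1..<n} ==> w permutes {1..n} ==> (tr i o w) permutes {1..n}"
 using simple_transp_permutes permutes_compose by blast

lemma inv_simple_transp [simp]: "inv' (tr i) = tr i"
 by (simp add: simple_transp_def)

lemma inv_simple_transp_comp:
 assumes "w permutes {1..n}"
 shows "inv' (tr i o w) = inv' w o tr i"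
proof -
 have "bij (tr i)" by (simp add: simple_transp_def)
 thus ?thesis using permutes_bij[OF assms] by (simp add: o_inv_distrib)
qed

lemma simple_transp_less_iff:
 "u \<noteq> v ==> \<not> (u = i \<and> v = Suc i) ==> \<not> (u = Suc i \<and> v = i) ==>
  tr i u < tr i v \<longleftrightarrow> u < v"
 by (auto simp: simple_transp_def Transposition.transpose_def)

lemma increasing_permutation_eq_id:
 assumes "t permutes {1..n}" and "\<And>i. i \<in> {1..<n} ==> t i < t (Suc i)"
 shows "t = id"
proof (rule permutes_natset_ge[OF assms(1)], rule ballI)
 fix i assume "i \<in> {1..n}"
 hence "1 \<le> i" "i \<le> n" by auto
 thus "i \<le> t i"
 proof (induction i rule: dec_induct)
  case base
  thus ?case using permutes_in_image[OF assms(1), of 1] by auto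
 next
  case (step k)
  thus ?case using assms(2)[of k] by auto
 qed
qed

text \<open>Multiplying by a simple transposition on the left exchanges two neighbouring values, so it
 changes the inversion status of exactly one pair of positions.\<close>

lemma inversions_simple_transp_up:
 assumes w: "w permutes {1..n}" and i: "i \<in> {1..<n}" and lt: "inv' w i < inv' w (Suc i)"
 shows "inversions n (tr i o w) = insert (inv' w i, inv' w (Suc i)) (inversions n w)"
  and "(inv' w i, inv' w (Suc i)) \<notin> inversions n w"
proof -
 define p q where "p = inv' w i" and "q = inv' w (Suc i)"
 have sp: "w p = i" and sq: "w q = Suc i"
  using permutes_inverses[OF w] by (auto simp: p_def q_def)
 have pq: "p \<in> {1..n}" "q \<in> {1..n}" "p < q"
  using sp sq i permutes_in_image[OF w, of p] permutes_in_image[OF w, of q] lt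
  by (auto simp: p_def q_def)
 have inj: "w x = w y \<longleftrightarrow> x = y" for x y using permutes_inj[OF w] by (auto dest: injD)
 have "(a, b) \<in> inversions n (tr i o w) \<longleftrightarrow> (a, b) = (p, q) \<or> (a, b) \<in> inversions n w"
  for a b
 proof (cases "a < b")
  case True
  hence ne: "w a \<noteq> w b" using inj by auto
  consider "w a = i" "w b = Suc i" | "w a = Suc i" "w b = i" |
   "\<not> (w b = i \<and> w a = Suc i)" "\<not> (w b = Suc i \<and> w a = i)" by blast
  thus ?thesis
  proof cases
   case 1
   hence "a = p" "b = q" using sp sq inj by metis+
   thus ?thesis using 1 pq by (auto simp: inversions_def)
  next
   case 2
   hence "b = p" "a = q" using sp sq inj by metis+
   thus ?thesis using True pq by auto
  next
   case 3
   hence "(a, b) \<noteq> (p, q)" using sp sq by auto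
   thus ?thesis using simple_transp_less_iff[OF ne[symmetric], of i] 3
    by (auto simp: inversions_def)
  qed
 next
  case False
  thus ?thesis using pq by (auto simp: inversions_def)
 qed
 thus "inversions n (tr i o w) =
   insert (inv' w i, inv' w (Suc i)) (inversions n w)"
  unfolding p_def q_def by fast
 show "(inv' w i, inv' w (Suc i)) \<notin> inversions n w"
  using sp sq unfolding p_def q_def by (auto simp: inversions_def)
qed

lemma inversions_simple_transp_down:
 assumes w: "w permutes {1..n}" and i: "i \<in> {1..<n}" and lt: "inv' w (Suc i) < inv' w i"
 shows "inversions n w = insert (inv' w (Suc i), inv' w i) (inversions n (tr i o w))"
  and "(inv' w (Suc i), inv' w i) \<notin> inversions n (tr i o w)"
proof -
 let ?t = "tr i o w"
 have 1: "?t permutes {1..n}" using tr_comp_permutes[OF i w] .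
 have 2: "inv' ?t i = inv' w (Suc i)" "inv' ?t (Suc i) = inv' w i"
  by (simp_all add: inv_simple_transp_comp[OF w])
 show "inversions n w = insert (inv' w (Suc i), inv' w i) (inversions n ?t)"
  "(inv' w (Suc i), inv' w i) \<notin> inversions n ?t"
  using inversions_simple_transp_up[OF 1 i] lt 2 by simp_all
qed

lemma inv_values_neq:
 assumes "w permutes {1..n}" shows "inv' w i \<noteq> inv' w (Suc i)"
 using permutes_inj[OF permutes_inv[OF assms]] by (metis injD n_not_Suc_n)

lemma card_inversions_word_le:
 assumes "set ws \<subseteq> {1..<n}"
 shows "foldr (o) (map tr ws) id permutes {1..n} \<and>
  card (inversions n (foldr (o) (map tr ws) id)) \<le> length ws"
 using assms
proof (induction ws)
 case Nil
 have "inversions n id = {}" by (auto simp: inversions_def)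
 moreover have "foldr (o) (map tr []) id = id"
  unfolding list.map foldr.simps(1) id_apply ..
 ultimately show ?case using permutes_id[of "{1..n}"] by (metis card.empty le0)
next
 case (Cons i ws)
 let ?w = "foldr (o) (map tr ws) id"
 have i: "i \<in> {1..<n}" and ws: "set ws \<subseteq> {1..<n}" using Cons(2) by auto
 have IH: "?w permutes {1..n}" "card (inversions n ?w) \<le> length ws"
  using Cons(1)[OF ws] by blast+
 have "card (inversions n (tr i o ?w)) \<le> Suc (card (inversions n ?w))"
 proof (cases "inv' ?w i < inv' ?w (Suc i)")
  case True
  show ?thesis using inversions_simple_transp_up[OF IH(1) i True] by simp
 next
  case False
  hence "inv' ?w (Suc i) < inv' ?w i" using inv_values_neq[OF IH(1), of i] by linarith
  from inversions_simple_transp_down[OF IH(1) i this] show ?thesis by simp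
 qed
 moreover have "foldr (o) (map tr (i # ws)) id = tr i o ?w"
  unfolding list.map foldr.simps(2) comp_apply ..
 ultimately show ?case using IH tr_comp_permutes[OF i IH(1)] by (metis Suc_le_mono le_trans length_Cons)
qed

text \<open>A permutation other than the identity has a descent, and composing with the corresponding
 transposition removes one inversion.\<close>

lemma exists_word_of_length_inversions:
 "w permutes {1..n} ==> card (inversions n w) = k ==>
  \<exists>ws. length ws = k \<and> set ws \<subseteq> {1..<n} \<and> w = foldr (o) (map tr ws) id"
proof (induction k arbitrary: w)
 case 0
 have "inv' w = id"
 proof (rule increasing_permutation_eq_id[OF permutes_inv[OF 0(1)]])
  fix i assume i: "i \<in> {1..<n}"
  have "inversions n w = {}" using 0(2) by simp
  hence "\<not> inv' w (Suc i) < inv' w i"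
   using inversions_simple_transp_down(1)[OF 0(1) i] by blast
  thus "inv' w i < inv' w (Suc i)"
   using inv_values_neq[OF 0(1), of i] by linarith
 qed
 hence "w = id" using permutes_inv_inv[OF 0(1)] inv_id by metis
 thus ?case by auto
next
 case (Suc k)
 have "\<exists>i\<in>{1..<n}. inv' w (Suc i) < inv' w i"
 proof (rule ccontr)
  assume a: "\<not> ?thesis"
  have "inv' w = id"
  proof (rule increasing_permutation_eq_id[OF permutes_inv[OF Suc(2)]])
   fix i assume i: "i \<in> {1..<n}"
   show "inv' w i < inv' w (Suc i)" using a i inv_values_neq[OF Suc(2), of i]
    by (meson linorder_neqE_nat)
  qed
  hence "w = id" using permutes_inv_inv[OF Suc(2)] inv_id by metis
  hence "inversions n w = {}" by (auto simp: inversions_def)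
  thus False using Suc(3) by simp
 qed
 then obtain i where i: "i \<in> {1..<n}" and d: "inv' w (Suc i) < inv' w i" by blast
 let ?t = "tr i o w"
 have "card (inversions n ?t) = k"
  using inversions_simple_transp_down[OF Suc(2) i d] Suc(3) by simp
 from Suc.IH[OF tr_comp_permutes[OF i Suc(2)] this] obtain ws where
  ws: "length ws = k" "set ws \<subseteq> {1..<n}" "?t = foldr (o) (map tr ws) id" by blast
 have "w = foldr (o) (map tr (i # ws)) id"
  unfolding list.map foldr.simps(2) comp_apply ws(3)[symmetric] by simp
 moreover have "length (i # ws) = Suc k" "set (i # ws) \<subseteq> {1..<n}" using ws i by auto
 ultimately show ?case by blast
qed

lemma perm_length_eq:
 assumes "w permutes {1..n}"
 shows "len n w = card (inversions n w)"
 unfolding perm_length_def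
proof (rule Least_equality)
 show "\<exists>ws. length ws = card (inversions n w) \<and> set ws \<subseteq> {1..<n} \<and>
   w = foldr (o) (map tr ws) id"
  using exists_word_of_length_inversions[OF assms refl] .
next
 fix k assume "\<exists>ws. length ws = k \<and> set ws \<subseteq> {1..<n} \<and> w = foldr (o) (map tr ws) id"
 thus "card (inversions n w) \<le> k" using card_inversions_word_le by blast
qed

lemma Des_L_iff:
 assumes w: "w permutes {1..n}"
 shows "i \<in> Des_L n w \<longleftrightarrow> i \<in> {1..<n} \<and> inv' w (Suc i) < inv' w i"
proof (cases "i \<in> {1..<n}")
 case i: True
 have s: "tr i o w permutes {1..n}" using tr_comp_permutes[OF i w] .
 show ?thesis
 proof (cases "inv' w i < inv' w (Suc i)")
  case True
  thus ?thesis using inversions_simple_transp_up[OF w i True]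
   by (simp add: Des_L_def perm_length_eq[OF w] perm_length_eq[OF s])
 next
  case False
  hence d: "inv' w (Suc i) < inv' w i" using inv_values_neq[OF w, of i] by linarith
  show ?thesis using inversions_simple_transp_down[OF w i d] i d
   by (simp add: Des_L_def perm_length_eq[OF w] perm_length_eq[OF s])
 qed
qed (auto simp: Des_L_def)

lemma not_Des_L_iff:
 assumes "w permutes {1..n}" "i \<in> {1..<n}"
 shows "i \<notin> Des_L n w \<longleftrightarrow> inv' w i < inv' w (Suc i)"
 using Des_L_iff[OF assms(1), of i] assms(2) inv_values_neq[OF assms(1), of i] by auto

lemma Des_L_subset: "i \<in> Des_L n w ==> i \<in> {1..<n}"
 by (simp add: Des_L_def)

lemma Des_L_simple_transp_same:
 assumes "w permutes {1..n}" "i \<in> {1..<n}"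
 shows "i \<in> Des_L n (tr i o w) \<longleftrightarrow> i \<notin> Des_L n w"
 using not_Des_L_iff[OF assms] Des_L_iff[OF tr_comp_permutes[OF assms(2,1)]] assms(2)
 by (simp add: inv_simple_transp_comp[OF assms(1)])

lemma inversions_up:
 assumes "w permutes {1..n}" "i \<in> {1..<n}" "i \<notin> Des_L n w"
 shows "inversions n (tr i o w) = insert (inv' w i, inv' w (Suc i)) (inversions n w)"
  and "len n (tr i o w) = Suc (len n w)"
 using inversions_simple_transp_up[OF assms(1,2)] not_Des_L_iff[OF assms(1,2)] assms
  perm_length_eq[OF assms(1)] perm_length_eq[OF tr_comp_permutes[OF assms(2,1)]]
 by auto

lemma inversions_down:
 assumes "w permutes {1..n}" "i \<in> Des_L n w"
 shows "inversions n w = insert (inv' w (Suc i), inv' w i) (inversions n (tr i o w))"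
  and "len n w = Suc (len n (tr i o w))"
proof -
 have i: "i \<in> {1..<n}" "inv' w (Suc i) < inv' w i" using assms Des_L_iff by auto
 show "inversions n w = insert (inv' w (Suc i), inv' w i) (inversions n (tr i o w))"
  "len n w = Suc (len n (tr i o w))"
  using inversions_simple_transp_down[OF assms(1) i] perm_length_eq[OF assms(1)]
   perm_length_eq[OF tr_comp_permutes[OF i(1) assms(1)]] by auto
qed

lemma weak_cover_iff:
 "weak_cover n w r \<longleftrightarrow> w permutes {1..n} \<and>
   (\<exists>i\<in>{1..<n}. r = tr i o w \<and> i \<notin> Des_L n w)"
proof (cases "w permutes {1..n}")
 case True
 have "len n w < len n (tr i o w) \<longleftrightarrow> i \<notin> Des_L n w"
  if "i \<in> {1..<n}" for i
  using inversions_up(2)[OF True that] by (cases "i \<in> Des_L n w") (auto simp: Des_L_def)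
 thus ?thesis using True by (auto simp: weak_cover_def sym_group_carrier)
qed (simp add: weak_cover_def sym_group_carrier)

text \<open>If no admissible step existed, the permutation comparing the two elements would be
 increasing.\<close>

lemma weak_step_up:
 assumes w: "w permutes {1..n}" and r: "r permutes {1..n}"
  and sub: "inversions n w \<subseteq> inversions n r" and ne: "w \<noteq> r"
 shows "\<exists>i\<in>{1..<n}. i \<notin> Des_L n w \<and> inversions n (tr i o w) \<subseteq> inversions n r"
proof (rule ccontr)
 assume a: "\<not> ?thesis"
 have "r o inv' w = id"
 proof (rule increasing_permutation_eq_id)
  show "r o inv' w permutes {1..n}" by (rule permutes_compose[OF permutes_inv[OF w] r])
  fix i assume i: "i \<in> {1..<n}"
  let ?p = "inv' w i" and ?q = "inv' w (Suc i)"
  have pq: "?p \<in> {1..n}" "?q \<in> {1..n}"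
   using i permutes_in_image[OF permutes_inv[OF w]] by auto
  have ne': "r ?p \<noteq> r ?q"
   using inv_values_neq[OF w, of i] permutes_inj[OF r] by (auto dest: injD)
  show "(r o inv' w) i < (r o inv' w) (Suc i)"
  proof (cases "i \<in> Des_L n w")
   case True
   hence "(?q, ?p) \<in> inversions n w" using inversions_down(1)[OF w] by blast
   thus ?thesis using sub by (auto simp: inversions_def)
  next
   case False
   hence "(?p, ?q) \<notin> inversions n r"
    using a i inversions_up(1)[OF w i False] sub False by (metis insert_subset)
   moreover have "?p < ?q" using False not_Des_L_iff[OF w i] by blast
   ultimately show ?thesis using pq ne' by (auto simp: inversions_def)
  qed
 qed
 hence "r o inv' w o w = w" by simp
 thus False using ne permutes_inv_o(2)[OF w] by (simp add: comp_assoc)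
qed

lemma weak_step_down:
 assumes w: "w permutes {1..n}" and r: "r permutes {1..n}"
  and sub: "inversions n w \<subseteq> inversions n r" and ne: "w \<noteq> r"
 shows "\<exists>i\<in>Des_L n r. inversions n w \<subseteq> inversions n (tr i o r)"
proof (rule ccontr)
 assume a: "\<not> ?thesis"
 have "w o inv' r = id"
 proof (rule increasing_permutation_eq_id)
  show "w o inv' r permutes {1..n}" by (rule permutes_compose[OF permutes_inv[OF r] w])
  fix i assume i: "i \<in> {1..<n}"
  let ?p = "inv' r i" and ?q = "inv' r (Suc i)"
  have pq: "?p \<in> {1..n}" "?q \<in> {1..n}"
   using i permutes_in_image[OF permutes_inv[OF r]] by auto
  have ne': "w ?p \<noteq> w ?q"
   using inv_values_neq[OF r, of i] permutes_inj[OF w] by (auto dest: injD)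
  show "(w o inv' r) i < (w o inv' r) (Suc i)"
  proof (cases "i \<in> Des_L n r")
   case True
   hence "(?q, ?p) \<in> inversions n w" using inversions_down(1)[OF r True] a sub by auto
   thus ?thesis by (auto simp: inversions_def)
  next
   case False
   hence lt: "?p < ?q" using not_Des_L_iff[OF r i] by blast
   have "r ?p < r ?q" using permutes_inverses(1)[OF r] by simp
   hence "(?p, ?q) \<notin> inversions n r" by (auto simp: inversions_def)
   hence "(?p, ?q) \<notin> inversions n w" using sub by blast
   thus ?thesis using pq ne' lt by (auto simp: inversions_def)
  qed
 qed
 hence "w o inv' r o r = r" by simp
 thus False using ne permutes_inv_o(2)[OF r] by (simp add: comp_assoc)
qed

text \<open>Adding inversions one at a time, by the preceding lemmas, stays inside any larger inversion set.\<close>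

theorem weak_order_iff_inversions:
 assumes w: "w permutes {1..n}" and r: "r permutes {1..n}"
 shows "(weak_cover n)\<^sup>*\<^sup>* w r \<longleftrightarrow> inversions n w \<subseteq> inversions n r"
proof
 assume "(weak_cover n)\<^sup>*\<^sup>* w r"
 thus "inversions n w \<subseteq> inversions n r"
 proof (induction rule: rtranclp_induct)
  case (step t r')
  hence "inversions n t \<subseteq> inversions n r'"
   using inversions_up(1) by (force simp: weak_cover_iff)
  thus ?case using step by blast
 qed simp
next
 assume "inversions n w \<subseteq> inversions n r"
 with w show "(weak_cover n)\<^sup>*\<^sup>* w r"
 proof (induction "card (inversions n r) - card (inversions n w)" arbitrary: w rule: less_induct)
  case less
  show ?case
  proof (cases "w = r")
   case False
   from weak_step_up[OF less(2) r less(3) False] obtain i where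
    i: "i \<in> {1..<n}" "i \<notin> Des_L n w" "inversions n (tr i o w) \<subseteq> inversions n r" by blast
   let ?t = "tr i o w"
   have p: "?t permutes {1..n}" using tr_comp_permutes[OF i(1) less(2)] .
   have "card (inversions n ?t) = Suc (card (inversions n w))"
    using inversions_up(2)[OF less(2) i(1,2)] perm_length_eq[OF p] perm_length_eq[OF less(2)] by simp
   moreover have "card (inversions n ?t) \<le> card (inversions n r)"
    by (rule card_mono[OF finite_inversions i(3)])
   ultimately have "(weak_cover n)\<^sup>*\<^sup>* ?t r" using less(1)[OF _ p i(3)] by linarith
   moreover have "weak_cover n w ?t" using i less(2) by (auto simp: weak_cover_iff)
   ultimately show ?thesis by (meson converse_rtranclp_into_rtranclp)
  qed simp
 qed
qed

lemma weak_interval_eq: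
 assumes "w permutes {1..n}" "r permutes {1..n}"
 shows "weak_interval n w r = {u \<in> perms n. inversions n w \<subseteq> inversions n u \<and>
  inversions n u \<subseteq> inversions n r}"
 using weak_order_iff_inversions assms
 unfolding weak_interval_def sym_group_carrier by blast

section \<open>Blocks of consecutive positions and longest elements\<close>

text \<open>The classes are the orbits of the parabolic subgroup of \<open>I\<close>.\<close>

definition same_block :: "nat set => nat => nat => bool" where
 "same_block I a b \<longleftrightarrow> {min a b..<max a b} \<subseteq> I"

lemma same_block_refl [simp]: "same_block I a a"
 by (simp add: same_block_def)

lemma same_block_sym: "same_block I a b ==> same_block I b a"
 by (simp add: same_block_def min.commute max.commute)

lemma same_block_less: "a \<le> b ==> same_block I a b \<longleftrightarrow> {a..<b} \<subseteq> I"
 by (simp add: same_block_def min_def max_def)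

lemma same_block_trans: "same_block I a b ==> same_block I b c ==> same_block I a c"
 unfolding same_block_def
proof
 fix x assume 1: "{min a b..<max a b} \<subseteq> I" "{min b c..<max b c} \<subseteq> I" "x \<in> {min a c..<max a c}"
 hence "x \<in> {min a b..<max a b} \<or> x \<in> {min b c..<max b c}" by auto
 thus "x \<in> I" using 1 by blast
qed

lemma same_block_mono: "I \<subseteq> I' ==> same_block I a b ==> same_block I' a b"
 by (auto simp: same_block_def)

lemma same_block_Suc: "same_block I a (Suc a) \<longleftrightarrow> a \<in> I"
 by (auto simp: same_block_def)

text \<open>The two predicates below describe membership in the parabolic subgroup of \<open>I\<close> without
 reference to generators.\<close>

definition block_preserving :: "nat set => (nat => nat) => bool" where
 "block_preserving I w \<longleftrightarrow> (\<forall>a. same_block I a (w a))"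

lemma block_preserving_id [simp]: "block_preserving I id"
 by (simp add: block_preserving_def)

lemma block_preserving_simple_transp: "i \<in> I ==> block_preserving I (tr i)"
 unfolding block_preserving_def
proof
 fix a assume "i \<in> I"
 thus "same_block I a (tr i a)"
  by (cases "a = i"; cases "a = Suc i")
   (auto simp: simple_transp_other same_block_Suc same_block_sym)
qed

lemma block_preserving_comp:
 "block_preserving I w ==> block_preserving I t ==> block_preserving I (w o t)"
 unfolding block_preserving_def using same_block_trans by fastforce

lemma block_preserving_mono: "I \<subseteq> I' ==> block_preserving I w ==> block_preserving I' w"
 unfolding block_preserving_def using same_block_mono by blast

lemma generate_block_preserving:
 assumes "I \<subseteq> {1..<n}" "w \<in> generate (sym_group n) (tr ` I)"
 shows "w permutes {1..n} \<and> block_preserving I w"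
 using assms(2)
proof (induction rule: generate.induct)
 case one
 thus ?case using permutes_id block_preserving_id by (metis sym_group_one)
next
 case (incl h)
 thus ?case using assms(1) simple_transp_permutes block_preserving_simple_transp by blast
next
 case (inv h)
 hence "h \<in> carrier (sym_group n)"
  using assms(1) simple_transp_permutes by (auto simp: sym_group_carrier)
 hence "inv\<^bsub>sym_group n\<^esub> h = h" using inv sym_group_inv_equality by fastforce
 thus ?case using inv assms(1) simple_transp_permutes block_preserving_simple_transp by (metis image_iff subsetD)
next
 case (eng h1 h2)
 thus ?case unfolding sym_group_mult using block_preserving_comp permutes_compose by blast
qed

lemma less_chain_down:
 assumes "\<And>i. i \<in> {u..<v} ==> f (Suc i) < (f i :: nat)" "u < v"
 shows "f v < f u"
proof -
 have "u \<le> w ==> w < v ==> f (Suc w) < f u" for w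
 proof (induction w rule: dec_induct)
  case (step w)
  thus ?case using assms(1)[of "Suc w"] by force
 qed (use assms in auto)
 from this[of "v - 1"] show ?thesis using assms(2) by auto
qed

lemma less_chain_up:
 assumes "\<And>i. i \<in> {u..<v} ==> (f i :: nat) < f (Suc i)" "u < v"
 shows "f u < f v"
proof -
 have "u \<le> w ==> w < v ==> f u < f (Suc w)" for w
 proof (induction w rule: dec_induct)
  case (step w)
  thus ?case using assms(1)[of "Suc w"] by force
 qed (use assms in auto)
 from this[of "v - 1"] show ?thesis using assms(2) by auto
qed

lemma block_preserving_inversions:
 assumes "w permutes {1..n}" "block_preserving I w" "(a, b) \<in> inversions n w"
 shows "same_block I a b"
proof (rule ccontr)
 assume a: "\<not> same_block I a b"
 have ab: "a < b" "w b < w a" using assms(3) by (auto simp: inversions_def)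
 hence "\<not> {a..<b} \<subseteq> I" using a same_block_less[of a b I] by simp
 then obtain k where k: "k \<in> {a..<b}" "k \<notin> I" by blast
 have "w a \<le> k"
 proof (rule ccontr)
  assume "\<not> w a \<le> k"
  hence "k \<in> {min a (w a)..<max a (w a)}" using k by (auto simp: min_def max_def)
  thus False using assms(2) k(2) unfolding block_preserving_def same_block_def by blast
 qed
 moreover have "k < w b"
 proof (rule ccontr)
  assume "\<not> k < w b"
  hence "k \<in> {min b (w b)..<max b (w b)}" using k by (auto simp: min_def max_def)
  thus False using assms(2) k(2) unfolding block_preserving_def same_block_def by blast
 qed
 ultimately show False using ab by simp
qed

text \<open>If two positions of a block were in increasing order, their values would span a piece of the block
 on which the descents force the opposite order.\<close>

lemma block_preserving_decreasing:
 assumes w: "w permutes {1..n}" and bp: "block_preserving I w" and I: "I \<subseteq> Des_L n w"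
  and ab: "a < b" "same_block I a b"
 shows "w b < w a"
proof (rule ccontr)
 assume "\<not> w b < w a"
 moreover have "w a \<noteq> w b" using permutes_inj[OF w] ab by (auto dest: injD)
 ultimately have lt: "w a < w b" by simp
 have "same_block I (w a) (w b)"
  using bp ab(2) same_block_trans same_block_sym unfolding block_preserving_def by meson
 hence sub: "{w a..<w b} \<subseteq> I" using lt by (simp add: same_block_less)
 have "inv' w (w b) < inv' w (w a)"
  by (rule less_chain_down[OF _ lt]) (use sub I Des_L_iff[OF w] in blast)
 thus False using ab by (simp add: permutes_inverses[OF w])
qed

definition block_pairs :: "nat => nat set => (nat \<times> nat) set" where
 "block_pairs n I = {(a, b). a \<in> {1..n} \<and> b \<in> {1..n} \<and> a < b \<and> same_block I a b}"

lemma perm_length_less: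
 assumes "w permutes {1..n}"
 shows "len n w < Suc (card ({1..n} \<times> {1..n}))"
 unfolding perm_length_eq[OF assms] less_Suc_eq_le
 by (rule card_mono) (auto simp: inversions_def)

text \<open>An element of maximal length in the subgroup has every generator as a left descent, so it
 reverses every block.\<close>

lemma longest_parabolic:
 assumes I: "I \<subseteq> {1..<n}"
 shows "longest_parabolic n I permutes {1..n}"
  and "block_preserving I (longest_parabolic n I)"
  and "I \<subseteq> Des_L n (longest_parabolic n I)"
  and "inversions n (longest_parabolic n I) = block_pairs n I"
proof -
 let ?G = "generate (sym_group n) (tr ` I)"
 let ?w = "longest_parabolic n I"
 have one: "id \<in> ?G" using generate.one[of "sym_group n"] by (simp add: sym_group_one)
 have bd: "\<forall>y. y \<in> ?G --> len n y < Suc (card ({1..n} \<times> {1..n}))"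
  using generate_block_preserving[OF I] perm_length_less by blast
 have wG: "?w \<in> ?G" unfolding longest_parabolic_def using arg_max_natI[of "\<lambda>x. x \<in> ?G", OF one bd] .
 have max: "len n y \<le> len n ?w" if "y \<in> ?G" for y
  unfolding longest_parabolic_def using arg_max_nat_le[of "\<lambda>x. x \<in> ?G", OF that bd] .
 show w: "?w permutes {1..n}" and bp: "block_preserving I ?w"
  using generate_block_preserving[OF I wG] by auto
 show D: "I \<subseteq> Des_L n ?w"
 proof
  fix i assume i: "i \<in> I"
  have "tr i o ?w \<in> ?G"
   using generate.eng[OF generate.incl wG, of "tr i"] i by (simp add: sym_group_mult)
  from max[OF this] show "i \<in> Des_L n ?w" using inversions_up(2)[OF w, of i] i I by fastforce
 qed
 show "inversions n ?w = block_pairs n I"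
  using block_preserving_inversions[OF w bp] block_preserving_decreasing[OF w bp D]
  by (auto simp: block_pairs_def inversions_def)
qed

text \<open>Every index is a left descent of a longest element, so its inverse composed with the reversal is
 increasing, hence the identity.\<close>

lemma longest_perm:
 shows "longest_perm n permutes {1..n}" and "a \<in> {1..n} ==> longest_perm n a = Suc n - a"
proof -
 let ?G = "carrier (sym_group n)"
 let ?w = "longest_perm n"
 have one: "id \<in> ?G" by (simp add: sym_group_carrier permutes_id)
 have bd: "\<forall>y. y \<in> ?G --> len n y < Suc (card ({1..n} \<times> {1..n}))"
  using perm_length_less by (auto simp: sym_group_carrier)
 have wG: "?w \<in> ?G" unfolding longest_perm_def using arg_max_natI[of "\<lambda>x. x \<in> ?G", OF one bd] .
 have max: "len n y \<le> len n ?w" if "y \<in> ?G" for y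
  unfolding longest_perm_def using arg_max_nat_le[of "\<lambda>x. x \<in> ?G", OF that bd] .
 show w: "?w permutes {1..n}" using wG by (simp add: sym_group_carrier)
 have D: "i \<in> Des_L n ?w" if i: "i \<in> {1..<n}" for i
  using max[of "tr i o ?w"] tr_comp_permutes[OF i w]
   inversions_up(2)[OF w i] by (fastforce simp: sym_group_carrier)
 let ?r = "\<lambda>a. if a \<in> {1..n} then Suc n - a else a"
 have r: "?r permutes {1..n}"
 proof (rule bij_imp_permutes)
  show "bij_betw ?r {1..n} {1..n}"
   by (rule bij_betw_byWitness[of _ ?r]) auto
 qed auto
 have "inv' ?w o ?r = id"
 proof (rule increasing_permutation_eq_id[OF permutes_compose[OF r permutes_inv[OF w]]])
  fix i assume i: "i \<in> {1..<n}"
  hence "n - i \<in> {1..<n}" by auto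
  from D[OF this] have "inv' ?w (Suc (n - i)) < inv' ?w (n - i)" using Des_L_iff[OF w] by blast
  thus "(inv' ?w o ?r) i < (inv' ?w o ?r) (Suc i)" using i by (auto simp: Suc_diff_le)
 qed
 hence "?w o (inv' ?w o ?r) = ?w" by simp
 hence "?w = ?r" using permutes_inv_o(1)[OF w] by (simp add: comp_assoc[symmetric])
 thus "a \<in> {1..n} ==> longest_perm n a = Suc n - a" by metis
qed

lemma same_block_imp_descent:
 assumes "(a, b) \<in> inversions n w" "same_block I a b" "w permutes {1..n}"
 shows "\<exists>k\<in>I. k \<in> {1..<n} \<and> w (Suc k) < w k"
proof (rule ccontr)
 assume a: "\<not> ?thesis"
 have ab: "a < b" "a \<in> {1..n}" "b \<in> {1..n}" "w b < w a" using assms(1) by (auto simp: inversions_def)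
 have "w a < w b"
 proof (rule less_chain_up[OF _ ab(1)])
  fix i assume i: "i \<in> {a..<b}"
  hence "i \<in> I" using assms(2) same_block_less[of a b I] ab(1) by auto
  moreover have "i \<in> {1..<n}" using i ab by auto
  ultimately have "\<not> w (Suc i) < w i" using a by blast
  moreover have "w i \<noteq> w (Suc i)" using permutes_inj[OF assms(3)] by (metis injD n_not_Suc_n)
  ultimately    show "w i < w (Suc i)" by linarith
 qed
 thus False using ab by simp
qed

lemma block_pairs_subset_inversions:
 assumes "w permutes {1..n}" "I \<subseteq> {1..<n}" "\<And>k. k \<in> I ==> w (Suc k) < w k"
 shows "block_pairs n I \<subseteq> inversions n w"
proof
 fix p assume "p \<in> block_pairs n I"
 then obtain a b where p: "p = (a, b)" "a \<in> {1..n}" "b \<in> {1..n}" "a < b" "{a..<b} \<subseteq> I"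
  by (auto simp: block_pairs_def same_block_less)
 have "w b < w a" by (rule less_chain_down[OF _ p(4)]) (use p(5) assms(3) in blast)
 thus "p \<in> inversions n w" using p by (simp add: inversions_def)
qed

section \<open>Elements attached to permutations by braid relations\<close>

lemma perm_length_id [simp]: "len n id = 0"
proof -
 have "inversions n id = {}" by (auto simp: inversions_def)
 thus ?thesis by (metis card.empty perm_length_eq permutes_id)
qed

lemma Des_L_empty_imp_id:
 assumes w: "w permutes {1..n}" and "Des_L n w = {}"
 shows "w = id"
proof -
 have "inv' w = id"
  by (rule increasing_permutation_eq_id[OF permutes_inv[OF w]])
   (use not_Des_L_iff[OF w] assms(2) in blast)
 thus ?thesis using permutes_inv_inv[OF w] inv_id by metis
qed

lemma finite_Des_L [simp]: "finite (Des_L n w)"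
 by (rule finite_subset[of _ "{1..<n}"]) (auto simp: Des_L_def)

lemma Des_L_comp_iff:
 assumes "w permutes {1..n}" "i \<in> {1..<n}"
 shows "j \<in> Des_L n (tr i o w) \<longleftrightarrow>
  j \<in> {1..<n} \<and> inv' w (tr i (Suc j)) < inv' w (tr i j)"
 using Des_L_iff[OF tr_comp_permutes[OF assms(2,1)]]
 by (simp add: inv_simple_transp_comp[OF assms(1)])

lemma simple_transp_commute:
 assumes "i + 2 \<le> j"
 shows "tr i o (tr j o w) = tr j o (tr i o w)"
 using assms by (auto simp: fun_eq_iff simple_transp_def Transposition.transpose_def)

lemma simple_transp_braid:
 "tr i o (tr (Suc i) o (tr i o w)) =
  tr (Suc i) o (tr i o (tr (Suc i) o w))"
 by (auto simp: fun_eq_iff simple_transp_def Transposition.transpose_def)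

lemma Des_L_commute:
 assumes "w permutes {1..n}" "i \<in> {1..<n}" "i + 2 \<le> j \<or> j + 2 \<le> i"
 shows "j \<in> Des_L n (tr i o w) \<longleftrightarrow> j \<in> Des_L n w"
 using assms(3) unfolding Des_L_comp_iff[OF assms(1,2)] Des_L_iff[OF assms(1)]
 by (auto simp: simple_transp_other)

text \<open>If both \<open>i\<close> and \<open>i + 1\<close> are descents, three consecutive values occur in reverse order.\<close>

lemma Des_L_braid:
 assumes w: "w permutes {1..n}" and D: "i \<in> Des_L n w" "Suc i \<in> Des_L n w"
 shows "Suc i \<in> Des_L n (tr i o w)"
  and "i \<in> Des_L n (tr (Suc i) o (tr i o w))"
  and "i \<in> Des_L n (tr (Suc i) o w)"
  and "Suc i \<in> Des_L n (tr i o (tr (Suc i) o w))"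
proof -
 have i: "i \<in> {1..<n}" "Suc i \<in> {1..<n}" using D Des_L_subset by blast+
 have lt: "inv' w (Suc i) < inv' w i" "inv' w (Suc (Suc i)) < inv' w (Suc i)"
  using D Des_L_iff[OF w] by auto
 have 1: "tr i (Suc (Suc i)) = Suc (Suc i)" "tr (Suc i) i = i"
  by (auto simp: simple_transp_other)
 note p = tr_comp_permutes[OF i(1) w] tr_comp_permutes[OF i(2) w]
 show "Suc i \<in> Des_L n (tr i o w)" "i \<in> Des_L n (tr (Suc i) o w)"
  using i lt 1 by (simp_all add: Des_L_comp_iff[OF w])
 show "i \<in> Des_L n (tr (Suc i) o (tr i o w))"
  "Suc i \<in> Des_L n (tr i o (tr (Suc i) o w))"
  using i lt 1 by (simp_all add: Des_L_comp_iff[OF p(1)] Des_L_comp_iff[OF p(2)]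
    inv_simple_transp_comp[OF w])
qed

locale braid_monoid = monoid G for G (structure) +
 fixes n :: nat and a :: "nat => 'a"
 assumes gen_closed: "i \<in> {1..<n} ==> a i \<in> carrier G"
  and gen_braid: "i \<in> {1..<n} ==> Suc i \<in> {1..<n} ==>
   a i \<otimes> (a (Suc i) \<otimes> a i) = a (Suc i) \<otimes> (a i \<otimes> a (Suc i))"
  and gen_commute: "i \<in> {1..<n} ==> j \<in> {1..<n} ==> i + 2 \<le> j ==> a i \<otimes> a j = a j \<otimes> a i"
begin

primrec elt_aux :: "nat => (nat => nat) => 'a" where
 "elt_aux 0 w = \<one>"
| "elt_aux (Suc k) w = a (Min (Des_L n w)) \<otimes> elt_aux k (tr (Min (Des_L n w)) o w)"

text \<open>The product of the generators along one particular reduced word of the permutation.\<close>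

definition elt :: "(nat => nat) => 'a" where
 "elt w = elt_aux (len n w) w"

lemma elt_id [simp]: "elt id = \<one>"
 by (simp add: elt_def)

lemma elt_Min:
 assumes "w permutes {1..n}" "Des_L n w \<noteq> {}"
 shows "elt w = a (Min (Des_L n w)) \<otimes> elt (tr (Min (Des_L n w)) o w)"
proof -
 have "Min (Des_L n w) \<in> Des_L n w" using assms(2) by simp
 from inversions_down(2)[OF assms(1) this] show ?thesis unfolding elt_def by simp
qed

lemma elt_closed: "w permutes {1..n} ==> elt w \<in> carrier G"
proof (induction "len n w" arbitrary: w rule: less_induct)
 case less
 show ?case
 proof (cases "Des_L n w = {}")
  case True
  thus ?thesis using Des_L_empty_imp_id[OF less(2)] elt_id one_closed by metis
 next
  case False
  hence m: "Min (Des_L n w) \<in> Des_L n w" by simp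
  show ?thesis
   using less(1)[OF _ tr_comp_permutes[OF Des_L_subset[OF m] less(2)]]
    inversions_down(2)[OF less(2) m] gen_closed[OF Des_L_subset[OF m]]
   unfolding elt_Min[OF less(2) False] by simp
 qed
qed

text \<open>Matsumoto's theorem: the recursion may start with any left descent.  Two different left
 descents \<open>m < i\<close> are exchanged by one commutation or one braid relation.\<close>

theorem elt_rec: "w permutes {1..n} ==> i \<in> Des_L n w ==> elt w = a i \<otimes> elt (tr i o w)"
proof (induction "len n w" arbitrary: w i rule: less_induct)
 case less
 note w = less(2)
 define m where "m = Min (Des_L n w)"
 have m: "m \<in> Des_L n w" unfolding m_def using Min_in[OF finite_Des_L, of n w] less(3) by blast
 have mi: "m \<le> i" unfolding m_def using Min_le[OF finite_Des_L less(3)] .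
 have elt: "elt w = a m \<otimes> elt (tr m o w)" using elt_Min[OF w] less(3) unfolding m_def by auto
 have im: "i \<in> {1..<n}" "m \<in> {1..<n}" using less(3) m Des_L_subset by blast+
 note pm = tr_comp_permutes[OF im(2) w]
 note pi = tr_comp_permutes[OF im(1) w]
 have lm: "len n (tr m o w) < len n w"
  and li: "len n (tr i o w) < len n w"
  using inversions_down(2)[OF w m] inversions_down(2)[OF w less(3)] by linarith+
 consider "m = i" | "i = Suc m" | "m + 2 \<le> i" using mi by linarith
 thus ?case
 proof cases
  case 1
  thus ?thesis using elt by simp
 next
  case 3
  have 1: "i \<in> Des_L n (tr m o w)" "m \<in> Des_L n (tr i o w)"
   using Des_L_commute[OF w] 3 m less(3) im by blast+
  let ?r = "tr i o (tr m o w)"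
  have c: "elt ?r \<in> carrier G" using elt_closed[OF tr_comp_permutes[OF im(1) pm]] .
  have "elt (tr m o w) = a i \<otimes> elt ?r" using less(1)[OF lm pm 1(1)] .
  moreover have "elt (tr i o w) = a m \<otimes> elt ?r"
   using less(1)[OF li pi 1(2)] simple_transp_commute[OF 3, of w] by simp
  ultimately show ?thesis using elt gen_commute[OF im(2,1) 3] c gen_closed im
   by (simp add: m_assoc[symmetric])
 next
  case 2
  note D = Des_L_braid[OF w m, folded 2, OF less(3)]
  let ?r = "tr m o (tr i o (tr m o w))"
  note pim = tr_comp_permutes[OF im(1) pm]
  note pmi = tr_comp_permutes[OF im(2) pi]
  have c: "elt ?r \<in> carrier G" using elt_closed[OF tr_comp_permutes[OF im(2) pim]] .
  have l: "len n (tr i o (tr m o w)) < len n w"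
   "len n (tr m o (tr i o w)) < len n w"
   using inversions_down(2)[OF pm D(1)] inversions_down(2)[OF pi D(3)] lm li by linarith+
  have "elt (tr m o w) = a i \<otimes> (a m \<otimes> elt ?r)"
   using less(1)[OF lm pm D(1)] less(1)[OF l(1) pim D(2)] by simp
  moreover have "elt (tr i o w) = a m \<otimes> (a i \<otimes> elt ?r)"
   using less(1)[OF li pi D(3)] less(1)[OF l(2) pmi D(4)] simple_transp_braid[of m w, folded 2] by simp
  moreover have "a m \<otimes> (a i \<otimes> (a m \<otimes> elt ?r)) = a i \<otimes> (a m \<otimes> (a i \<otimes> elt ?r))"
   using gen_braid[of m, folded 2] im c gen_closed[OF im(1)] gen_closed[OF im(2)]
   by (metis m_assoc m_closed)
  ultimately show ?thesis using elt by simp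
 qed
qed

lemma elt_up:
 assumes "w permutes {1..n}" "i \<in> {1..<n}" "i \<notin> Des_L n w"
 shows "a i \<otimes> elt w = elt (tr i o w)"
proof -
 have "i \<in> Des_L n (tr i o w)" using Des_L_simple_transp_same[OF assms(1,2)] assms(3) by blast
 from elt_rec[OF tr_comp_permutes[OF assms(2,1)] this] show ?thesis by simp
qed

lemma elt_mult:
 assumes v: "v permutes {1..n}"
 shows "u permutes {1..n} ==> len n (u o v) \<le> len n u + len n v \<and>
  (len n (u o v) = len n u + len n v --> elt (u o v) = elt u \<otimes> elt v)"
proof (induction "len n u" arbitrary: u rule: less_induct)
 case less
 show ?case
 proof (cases "Des_L n u = {}")
  case True
  hence u: "u = id" using Des_L_empty_imp_id[OF less(2)] by blast
  have "elt v = \<one> \<otimes> elt v" using elt_closed[OF v] by simp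
  thus ?thesis unfolding u perm_length_id elt_id id_comp by simp
 next
  case False
  then obtain i where D: "i \<in> Des_L n u" by blast
  note i = Des_L_subset[OF D]
  let ?u = "tr i o u"
  have pu: "?u permutes {1..n}" by (rule tr_comp_permutes[OF i less(2)])
  have lu: "len n u = Suc (len n ?u)" using inversions_down(2)[OF less(2) D] .
  have IH: "len n (?u o v) \<le> len n ?u + len n v"
   "len n (?u o v) = len n ?u + len n v ==> elt (?u o v) = elt ?u \<otimes> elt v"
   using less(1)[OF _ pu] lu by auto
  have puv: "u o v permutes {1..n}" "?u o v permutes {1..n}"
   using permutes_compose[OF v] less(2) pu by blast+
  have eq: "?u o v = tr i o (u o v)" by (simp add: comp_assoc)
  show ?thesis
  proof (cases "i \<in> Des_L n (u o v)")
   case True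
   have l: "len n (u o v) = Suc (len n (?u o v))"
    using inversions_down(2)[OF puv(1) True] eq by simp
   have "elt (u o v) = a i \<otimes> elt (?u o v)" using elt_rec[OF puv(1) True] eq by simp
   moreover have "elt u = a i \<otimes> elt ?u" using elt_rec[OF less(2) D] .
   ultimately show ?thesis using IH l lu gen_closed[OF i] elt_closed[OF pu] elt_closed[OF v]
    by (auto simp: m_assoc)
  next
   case False
   thus ?thesis using inversions_up(2)[OF puv(1) i False] IH(1) lu unfolding eq by auto
  qed
 qed
qed

end

lemma inversions_inv:
 assumes w: "w permutes {1..n}"
 shows "len n (inv' w) = len n w"
proof -
 have in1: "w x \<in> {1..n} \<longleftrightarrow> x \<in> {1..n}" for x using permutes_in_image[OF w] .
 have in2: "inv' w x \<in> {1..n} \<longleftrightarrow> x \<in> {1..n}" for x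
  using permutes_in_image[OF permutes_inv[OF w]] .
 note inv = permutes_inverses[OF w]
 have "bij_betw (\<lambda>(p, q). (w q, w p)) (inversions n w) (inversions n (inv' w))"
 proof (rule bij_betw_byWitness[of _ "\<lambda>(u, v). (inv' w v, inv' w u)"])
  show "(\<lambda>(p, q). (w q, w p)) ` inversions n w \<subseteq> inversions n (inv' w)"
   unfolding inversions_def using in1 inv by fastforce
  show "(\<lambda>(u, v). (inv' w v, inv' w u)) ` inversions n (inv' w) \<subseteq> inversions n w"
   unfolding inversions_def using in2 inv by fastforce
 qed (auto simp: inv)
 thus ?thesis
  using perm_length_eq[OF w] perm_length_eq[OF permutes_inv[OF w]] bij_betw_same_card by metis
qed

lemma perm_length_right_descent:
 assumes w: "w permutes {1..n}" and k: "k \<in> {1..<n}" and d: "w (Suc k) < w k"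
 shows "len n w = Suc (len n (w o tr k))"
proof -
 note p = permutes_inv[OF w]
 have "k \<in> Des_L n (inv' w)" using Des_L_iff[OF p] k d permutes_inv_inv[OF w] by auto
 hence 1: "len n (inv' w) = Suc (len n (tr k o inv' w))"
  by (rule inversions_down(2)[OF p])
 have "inv' (w o tr k) = tr k o inv' w"
  using o_inv_distrib[OF permutes_bij[OF w], of "tr k"]
  by (simp add: simple_transp_def)
 moreover have "w o tr k permutes {1..n}"
  using permutes_compose[OF simple_transp_permutes[OF k] w] .
 ultimately show ?thesis using 1 inversions_inv w by metis
qed

locale zero_hecke_monoid = braid_monoid +
 assumes gen_idem: "i \<in> {1..<n} ==> a i \<otimes> a i = a i"
begin

lemma elt_absorb:
 assumes "w permutes {1..n}" "i \<in> Des_L n w"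
 shows "a i \<otimes> elt w = elt w"
 using elt_rec[OF assms] gen_idem[OF Des_L_subset[OF assms(2)]]
  elt_closed[OF tr_comp_permutes[OF Des_L_subset[OF assms(2)] assms(1)]]
  gen_closed[OF Des_L_subset[OF assms(2)]] by (simp add: m_assoc[symmetric])

lemma elt_right_descent:
 assumes w: "w permutes {1..n}" and k: "k \<in> {1..<n}" and d: "w (Suc k) < w k"
 shows "elt w \<otimes> a k = elt w" and "elt w = elt (w o tr k) \<otimes> a k"
proof -
 let ?s = "tr k"
 have p: "w o ?s permutes {1..n}" using permutes_compose[OF simple_transp_permutes[OF k] w] .
 have s: "?s permutes {1..n}" using simple_transp_permutes[OF k] .
 have c: "w o ?s o ?s = w" by (auto simp: fun_eq_iff)
 have nd: "k \<notin> Des_L n id" by (simp add: Des_L_iff[OF permutes_id])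
 have es: "elt ?s = a k" using elt_up[OF permutes_id k nd] gen_closed[OF k] unfolding comp_id elt_id by simp
 have ls: "len n ?s = 1"
  using inversions_up(2)[OF permutes_id k nd] unfolding comp_id perm_length_id by simp
 show 1: "elt w = elt (w o ?s) \<otimes> a k"
  using elt_mult[OF s p] perm_length_right_descent[OF assms] unfolding c ls es by simp
 show "elt w \<otimes> a k = elt w"
  using 1 gen_idem[OF k] gen_closed[OF k] elt_closed[OF p] by (simp add: m_assoc)
qed

lemma elt_right_ascent:
 assumes w: "w permutes {1..n}" and k: "k \<in> {1..<n}" and d: "w k < w (Suc k)"
 shows "elt w \<otimes> a k = elt (w o tr k)"
  and "len n (w o tr k) = Suc (len n w)"
proof -
 let ?s = "tr k"
 have p: "w o ?s permutes {1..n}" using permutes_compose[OF simple_transp_permutes[OF k] w] .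
 have c: "w o ?s o ?s = w" by (auto simp: fun_eq_iff)
 have "(w o ?s) (Suc k) < (w o ?s) k" using d by simp
 note e = elt_right_descent(2)[OF p k this] perm_length_right_descent[OF p k this]
 show "elt w \<otimes> a k = elt (w o ?s)" by (rule e(1)[unfolded c, symmetric])
 show "len n (w o ?s) = Suc (len n w)" by (rule e(2)[unfolded c])
qed

end

section \<open>The free algebra and the 0-Hecke algebra\<close>

lemma free_alg_simps:
 "carrier (free_alg n) = {f. finite {w. f w \<noteq> 0} \<and> (\<forall>w. f w \<noteq> 0 --> set w \<subseteq> {1..<n})}"
 "mult (free_alg n) f g = (\<lambda>w. \<Sum>k\<le>length w. f (take k w) * g (drop k w))"
 "one (free_alg n) = mono_word []" "zero (free_alg n) = (\<lambda>w. 0)"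
 "add (free_alg n) f g = (\<lambda>w. f w + g w)"
 by (simp_all add: free_alg_def)

definition term_of :: "complex => nat list => nat list => complex" where
 "term_of c u = (\<lambda>w. c * mono_word u w)"

lemma term_of_apply: "term_of c u w = (if w = u then c else 0)"
 by (simp add: term_of_def mono_word_def)

lemma term_of_closed: "set u \<subseteq> {1..<n} ==> term_of c u \<in> carrier (free_alg n)"
 by (auto simp: free_alg_simps term_of_apply)

lemma term_of_one: "term_of 1 u = mono_word u"
 by (simp add: term_of_def)

lemma free_alg_induct [consumes 1, case_names zero add_term]:
 assumes f: "f \<in> carrier (free_alg n)"
  and zero: "Q (\<lambda>w. 0)"
  and step: "\<And>f c u. f \<in> carrier (free_alg n) ==> Q f ==> set u \<subseteq> {1..<n} ==>
   Q (\<lambda>w. f w + term_of c u w)"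
 shows "Q f"
 using f
proof (induction "card {w. f w \<noteq> 0}" arbitrary: f rule: less_induct)
 case less
 have fin: "finite {w. f w \<noteq> 0}" using less(2) by (simp add: free_alg_simps)
 show ?case
 proof (cases "{w. f w \<noteq> 0} = {}")
  case True
  hence "f = (\<lambda>w. 0)" by auto
  thus ?thesis using zero by simp
 next
  case False
  then obtain u where u: "f u \<noteq> 0" by auto
  let ?g = "\<lambda>w. if w = u then 0 else f w"
  have supp: "{w. ?g w \<noteq> 0} = {w. f w \<noteq> 0} - {u}" by auto
  have g: "?g \<in> carrier (free_alg n)"
   unfolding free_alg_simps(1) mem_Collect_eq supp using fin less(2) by (simp add: free_alg_simps(1))
  note supp
  moreover have "card ({w. f w \<noteq> 0} - {u}) < card {w. f w \<noteq> 0}"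
   by (rule card_Diff1_less) (use fin u in auto)
  ultimately have "Q ?g" using less(1)[OF _ g] by simp
  moreover have "set u \<subseteq> {1..<n}" using less(2) u by (auto simp: free_alg_simps)
  ultimately have "Q (\<lambda>w. ?g w + term_of (f u) u w)" using step g by blast
  moreover have "(\<lambda>w. ?g w + term_of (f u) u w) = f" by (auto simp: term_of_apply)
  ultimately show ?thesis by simp
 qed
qed

lemma free_alg_add_closed:
 assumes "f \<in> carrier (free_alg n)" "g \<in> carrier (free_alg n)"
 shows "(\<lambda>w. f w + g w) \<in> carrier (free_alg n)"
proof -
 have "{w. f w + g w \<noteq> 0} \<subseteq> {w. f w \<noteq> 0} \<union> {w. g w \<noteq> 0}" by auto
 moreover have "finite ({w. f w \<noteq> 0} \<union> {w. g w \<noteq> 0})"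
  using assms by (simp add: free_alg_simps(1))
 ultimately have "finite {w. f w + g w \<noteq> 0}" by (rule finite_subset)
 moreover have "set w \<subseteq> {1..<n}" if "f w + g w \<noteq> 0" for w
 proof -
  have "f w \<noteq> 0 \<or> g w \<noteq> 0" using that by auto
  thus ?thesis using assms unfolding free_alg_simps(1) by blast
 qed
 ultimately show ?thesis unfolding free_alg_simps(1) by blast
qed

lemma free_alg_mult_closed:
 assumes f: "f \<in> carrier (free_alg n)" and g: "g \<in> carrier (free_alg n)"
 shows "mult (free_alg n) f g \<in> carrier (free_alg n)"
proof -
 have split: "\<exists>u v. w = u @ v \<and> f u \<noteq> 0 \<and> g v \<noteq> 0" if "mult (free_alg n) f g w \<noteq> 0" for w
 proof -
  from that obtain k where "f (take k w) * g (drop k w) \<noteq> 0"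
   unfolding free_alg_simps using sum.not_neutral_contains_not_neutral by blast
  thus ?thesis
   by (intro exI[of _ "take k w"] exI[of _ "drop k w"]) auto
 qed
 have "{w. mult (free_alg n) f g w \<noteq> 0} \<subseteq> (\<lambda>(u, v). u @ v) ` ({w. f w \<noteq> 0} \<times> {w. g w \<noteq> 0})"
 proof
  fix w assume "w \<in> {w. mult (free_alg n) f g w \<noteq> 0}"
  then obtain u v where "w = u @ v" "f u \<noteq> 0" "g v \<noteq> 0" using split by blast
  thus "w \<in> (\<lambda>(u, v). u @ v) ` ({w. f w \<noteq> 0} \<times> {w. g w \<noteq> 0})"
   by (intro image_eqI[of _ _ "(u, v)"]) auto
 qed
 moreover have "finite ((\<lambda>(u, v). u @ v) ` ({w. f w \<noteq> 0} \<times> {w. g w \<noteq> 0}))"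
  using f g by (simp add: free_alg_simps)
 ultimately have "finite {w. mult (free_alg n) f g w \<noteq> 0}" by (rule finite_subset)
 moreover have "set w \<subseteq> {1..<n}" if nz: "mult (free_alg n) f g w \<noteq> 0" for w
 proof -
  obtain u v where "w = u @ v" "f u \<noteq> 0" "g v \<noteq> 0" using split[OF nz] by blast
  moreover have "set u \<subseteq> {1..<n}" "set v \<subseteq> {1..<n}"
   using f g calculation unfolding free_alg_simps(1) by blast+
  ultimately show ?thesis by simp
 qed
 ultimately show ?thesis unfolding free_alg_simps(1) by blast
qed

lemma free_alg_mult_assoc:
 "mult (free_alg n) (mult (free_alg n) f g) h = mult (free_alg n) f (mult (free_alg n) g h)"
proof
 fix w
 let ?L = "\<lambda>k l. f (take l w) * g (take (k - l) (drop l w)) * h (drop k w)"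
 have "mult (free_alg n) (mult (free_alg n) f g) h w =
   (\<Sum>k\<le>length w. \<Sum>l\<le>k. ?L k l)"
  unfolding free_alg_simps sum_distrib_right
  by (intro sum.cong refl) (auto simp: min_def drop_take)
 also have "\<dots> = (\<Sum>(k, l)\<in>(SIGMA k:{..length w}. {..k}). ?L k l)"
  by (rule sum.Sigma) auto
 also have "\<dots> = (\<Sum>(l, j)\<in>(SIGMA l:{..length w}. {..length w - l}). ?L (l + j) l)"
  by (rule sum.reindex_bij_witness[of _ "\<lambda>(l, j). (l + j, l)" "\<lambda>(k, l). (l, k - l)"]) auto
 also have "\<dots> = (\<Sum>l\<le>length w. \<Sum>j\<le>length w - l. ?L (l + j) l)"
  by (rule sum.Sigma[symmetric]) auto
 also have "\<dots> = mult (free_alg n) f (mult (free_alg n) g h) w"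
  unfolding free_alg_simps sum_distrib_left
  by (intro sum.cong refl) (auto simp: mult.assoc add.commute)
 finally show "mult (free_alg n) (mult (free_alg n) f g) h w =
   mult (free_alg n) f (mult (free_alg n) g h) w" .
qed

lemma free_alg_one_mult:
 "mult (free_alg n) (mono_word []) f = f" "mult (free_alg n) f (mono_word []) = f"
proof -
 show "mult (free_alg n) (mono_word []) f = f"
 proof
  fix w
  have "(\<Sum>k\<le>length w. mono_word [] (take k w) * f (drop k w)) = (\<Sum>k\<in>{0}. f (drop k w))"
   by (rule sum.mono_neutral_cong_right) (auto simp: mono_word_def)
  thus "mult (free_alg n) (mono_word []) f w = f w" by (simp add: free_alg_simps)
 qed
 show "mult (free_alg n) f (mono_word []) = f"
 proof
  fix w
  have "(\<Sum>k\<le>length w. f (take k w) * mono_word [] (drop k w)) = (\<Sum>k\<in>{length w}. f (take k w))"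
   by (rule sum.mono_neutral_cong_right) (auto simp: mono_word_def)
  thus "mult (free_alg n) f (mono_word []) w = f w" by (simp add: free_alg_simps)
 qed
qed

lemma term_of_mult:
 "mult (free_alg n) (term_of c u) (term_of d v) = term_of (c * d) (u @ v)"
proof
 fix w
 show "mult (free_alg n) (term_of c u) (term_of d v) w = term_of (c * d) (u @ v) w"
 proof (cases "w = u @ v")
  case True
  have "(\<Sum>k\<le>length w. term_of c u (take k w) * term_of d v (drop k w)) =
    (\<Sum>k\<in>{length u}. term_of c u (take k w) * term_of d v (drop k w))"
  proof (rule sum.mono_neutral_right)
   show "\<forall>k\<in>{..length w} - {length u}. term_of c u (take k w) * term_of d v (drop k w) = 0"
   proof
    fix k assume k: "k \<in> {..length w} - {length u}"
    hence "length (take k w) = k" by auto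
    hence "take k w \<noteq> u" using k by auto
    thus "term_of c u (take k w) * term_of d v (drop k w) = 0" by (simp add: term_of_apply)
   qed
  qed (use True in auto)
  thus ?thesis using True by (simp add: free_alg_simps term_of_apply)
 next
  case False
  have "term_of c u (take k w) * term_of d v (drop k w) = 0" for k
   using False append_take_drop_id[of k w] by (auto simp: term_of_apply)
  hence "mult (free_alg n) (term_of c u) (term_of d v) w = 0"
   unfolding free_alg_simps(2) by (intro sum.neutral) blast
  thus ?thesis using False by (simp add: term_of_apply)
 qed
qed

lemma ring_free_alg: "ring (free_alg n)"
proof (rule ringI)
 show "abelian_group (free_alg n)"
 proof (rule abelian_groupI)
  fix f assume f: "f \<in> carrier (free_alg n)"
  hence "(\<lambda>w. - f w) \<in> carrier (free_alg n)" by (auto simp: free_alg_simps)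
  thus "\<exists>g\<in>carrier (free_alg n). g \<oplus>\<^bsub>free_alg n\<^esub> f = \<zero>\<^bsub>free_alg n\<^esub>"
   by (rule bexI[rotated]) (simp add: free_alg_simps)
 next
  fix f g assume "f \<in> carrier (free_alg n)" "g \<in> carrier (free_alg n)"
  thus "f \<oplus>\<^bsub>free_alg n\<^esub> g \<in> carrier (free_alg n)"
   unfolding free_alg_simps(5) by (rule free_alg_add_closed)
 next
  show "\<zero>\<^bsub>free_alg n\<^esub> \<in> carrier (free_alg n)" by (simp add: free_alg_simps(1,4))
 qed (simp_all add: free_alg_simps(4,5) ac_simps)
 show "Group.monoid (free_alg n)"
 proof (rule Group.monoidI)
  show "\<one>\<^bsub>free_alg n\<^esub> \<in> carrier (free_alg n)"
   using term_of_closed[of "[]" n 1] by (simp add: free_alg_simps(3) term_of_one)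
 qed (simp_all only: free_alg_mult_closed free_alg_one_mult free_alg_mult_assoc free_alg_simps(3))
qed (simp_all add: free_alg_simps(2,5) distrib_left distrib_right sum.distrib)

lemma hecke_relations_subset: "hecke_relations n \<subseteq> carrier (free_alg n)"
proof -
 interpret F: ring "free_alg n" by (rule ring_free_alg)
 have d: "(\<lambda>w. mono_word u w - mono_word v w) \<in> carrier (free_alg n)"
  if "set u \<subseteq> {1..<n}" "set v \<subseteq> {1..<n}" for u v
  using free_alg_add_closed[OF term_of_closed[OF that(1), of 1] term_of_closed[OF that(2), of "-1"]]
  by (simp add: term_of_def)
 show ?thesis unfolding hecke_relations_def by (auto intro!: d)
qed

lemma ideal_hecke_ideal: "ideal (hecke_ideal n) (free_alg n)"
 unfolding hecke_ideal_def by (rule ring.genideal_ideal[OF ring_free_alg hecke_relations_subset])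

abbreviation "HA \<equiv> hecke_alg"

lemma ring_hecke_alg: "ring (HA n)"
 unfolding hecke_alg_def by (rule ideal.quotient_is_ring[OF ideal_hecke_ideal])

definition hecke_class :: "nat => (nat list => complex) => hecke" where
 "hecke_class n f = hecke_ideal n +>\<^bsub>free_alg n\<^esub> f"

lemma hecke_class_hom: "hecke_class n \<in> ring_hom (free_alg n) (HA n)"
 using ideal.rcos_ring_hom[OF ideal_hecke_ideal] unfolding hecke_alg_def hecke_class_def[abs_def] .

lemma hecke_class_cases:
 assumes "h \<in> carrier (HA n)"
 obtains f where "f \<in> carrier (free_alg n)" "h = hecke_class n f"
 using assms by (auto simp: hecke_alg_def FactRing_def A_RCOSETS_def' hecke_class_def)

lemma hecke_class_add: "f \<in> carrier (free_alg n) ==> g \<in> carrier (free_alg n) ==>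
 hecke_class n (\<lambda>w. f w + g w) = hecke_class n f \<oplus>\<^bsub>HA n\<^esub> hecke_class n g"
 using ring_hom_add[OF hecke_class_hom] by (simp add: free_alg_simps)

lemma hecke_class_closed: "f \<in> carrier (free_alg n) ==> hecke_class n f \<in> carrier (HA n)"
 using ring_hom_closed[OF hecke_class_hom] .

lemma hecke_class_term_mult:
 assumes "set u \<subseteq> {1..<n}" "set v \<subseteq> {1..<n}"
 shows "hecke_class n (term_of c u) \<otimes>\<^bsub>HA n\<^esub> hecke_class n (term_of d v) =
  hecke_class n (term_of (c * d) (u @ v))"
 using ring_hom_mult[OF hecke_class_hom term_of_closed[OF assms(1)] term_of_closed[OF assms(2)]]
 by (simp add: term_of_mult)

lemma hecke_class_eq:
 assumes "f \<in> carrier (free_alg n)" "g \<in> carrier (free_alg n)"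
  and "(\<lambda>w. f w - g w) \<in> hecke_ideal n"
 shows "hecke_class n f = hecke_class n g"
proof -
 interpret I: ideal "hecke_ideal n" "free_alg n" by (rule ideal_hecke_ideal)
 have "f = (\<lambda>w. f w - g w) \<oplus>\<^bsub>free_alg n\<^esub> g" by (simp add: free_alg_simps)
 hence "f \<in> hecke_ideal n +>\<^bsub>free_alg n\<^esub> g"
  using assms(3) unfolding a_r_coset_def' by blast
 thus ?thesis unfolding hecke_class_def
  by (rule I.a_repr_independence[OF _ assms(2) I.a_subgroup, symmetric])
qed

lemma hecke_relation_eq:
 assumes "(\<lambda>w. mono_word u w - mono_word v w) \<in> hecke_relations n"
  and "set u \<subseteq> {1..<n}" "set v \<subseteq> {1..<n}"
 shows "hecke_class n (mono_word u) = hecke_class n (mono_word v)"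
 by (rule hecke_class_eq)
  (use term_of_closed[OF assms(2), of 1] term_of_closed[OF assms(3), of 1] assms(1)
   ring.genideal_self[OF ring_free_alg hecke_relations_subset] in
   \<open>auto simp: term_of_one hecke_ideal_def\<close>)

lemma hecke_gen_alt: "hecke_gen n i = hecke_class n (term_of 1 [i])"
 by (simp add: hecke_gen_def hecke_class_def term_of_def)

lemma hecke_scalar_alt: "hecke_scalar n c = hecke_class n (term_of c [])"
 by (simp add: hecke_scalar_def hecke_class_def term_of_def)

lemma hecke_gen_closed: "i \<in> {1..<n} ==> hecke_gen n i \<in> carrier (HA n)"
 unfolding hecke_gen_alt by (rule hecke_class_closed[OF term_of_closed]) simp

lemma scalar_closed: "hecke_scalar n c \<in> carrier (HA n)"
 unfolding hecke_scalar_alt by (rule hecke_class_closed[OF term_of_closed]) simp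

lemma zero_hecke_monoid_hecke_alg: "zero_hecke_monoid (HA n) n (hecke_gen n)"
proof -
 interpret ring "HA n" by (rule ring_hecke_alg)
 have m: "hecke_gen n i \<otimes>\<^bsub>HA n\<^esub> hecke_class n (mono_word u) = hecke_class n (mono_word (i # u))"
  if "set (i # u) \<subseteq> {1..<n}" for i u
  using hecke_class_term_mult[of "[i]" n u 1 1] that unfolding hecke_gen_alt by (simp add: term_of_one)
 have g: "hecke_gen n i = hecke_class n (mono_word [i])" for i
  by (simp add: hecke_gen_alt term_of_one)
 show ?thesis
 proof
  fix i j assume i: "i \<in> {1..<n}"
  show "hecke_gen n i \<in> carrier (HA n)" using hecke_gen_closed[OF i] .
  have "hecke_class n (mono_word [i, i]) = hecke_class n (mono_word [i])"
   by (rule hecke_relation_eq) (use i in \<open>auto simp: hecke_relations_def\<close>)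
  thus "hecke_gen n i \<otimes>\<^bsub>HA n\<^esub> hecke_gen n i = hecke_gen n i"
   using m[of i "[i]"] i g by simp
  show "hecke_gen n i \<otimes>\<^bsub>HA n\<^esub> (hecke_gen n (Suc i) \<otimes>\<^bsub>HA n\<^esub> hecke_gen n i) =
   hecke_gen n (Suc i) \<otimes>\<^bsub>HA n\<^esub> (hecke_gen n i \<otimes>\<^bsub>HA n\<^esub> hecke_gen n (Suc i))"
   if j: "Suc i \<in> {1..<n}"
  proof -
   have "hecke_class n (mono_word [i, Suc i, i]) = hecke_class n (mono_word [Suc i, i, Suc i])"
    by (rule hecke_relation_eq) (use i j in \<open>auto simp: hecke_relations_def\<close>)
   thus ?thesis
    using m[of i "[Suc i, i]"] m[of "Suc i" "[i]"] m[of "Suc i" "[i, Suc i]"] m[of i "[Suc i]"] i j g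
    by simp
  qed
  show "hecke_gen n i \<otimes>\<^bsub>HA n\<^esub> hecke_gen n j = hecke_gen n j \<otimes>\<^bsub>HA n\<^esub> hecke_gen n i"
   if j: "j \<in> {1..<n}" "i + 2 \<le> j"
  proof -
   have "hecke_class n (mono_word [i, j]) = hecke_class n (mono_word [j, i])"
    by (rule hecke_relation_eq) (use i j in \<open>unfold hecke_relations_def, blast\<close>, use i j in auto)
   thus ?thesis using m[of i "[j]"] m[of j "[i]"] i j g by simp
  qed
 qed
qed

text \<open>Every element is obtained from scalars by adding and by multiplying with generators on the
 left; properties of the action of the algebra reduce to its generators in this way.\<close>

lemma hecke_induct [consumes 1, case_names scalar gen add]:
 assumes h: "h \<in> carrier (HA n)"
  and scalar: "\<And>c. Q (hecke_scalar n c)"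
  and gen: "\<And>i h. i \<in> {1..<n} ==> h \<in> carrier (HA n) ==> Q h ==>
   Q (hecke_gen n i \<otimes>\<^bsub>HA n\<^esub> h)"
  and add: "\<And>h h'. h \<in> carrier (HA n) ==> h' \<in> carrier (HA n) ==> Q h ==> Q h' ==>
   Q (h \<oplus>\<^bsub>HA n\<^esub> h')"
 shows "Q h"
proof -
 obtain f where f: "f \<in> carrier (free_alg n)" "h = hecke_class n f" using h hecke_class_cases by blast
 have word: "Q (hecke_class n (term_of c u))" if "set u \<subseteq> {1..<n}" for c u
  using that
 proof (induction u)
  case Nil
  thus ?case using scalar by (simp add: hecke_scalar_alt)
 next
  case (Cons i u)
  hence "Q (hecke_gen n i \<otimes>\<^bsub>HA n\<^esub> hecke_class n (term_of c u))"
   by (intro gen hecke_class_closed term_of_closed) auto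
  thus ?case using hecke_class_term_mult[of "[i]" n u 1 c] Cons(2) unfolding hecke_gen_alt by simp
 qed
 have "Q (hecke_class n f)" using f(1)
 proof (induction rule: free_alg_induct)
  case zero
  have "term_of 0 [] = (\<lambda>w. 0)" by (simp add: term_of_def)
  thus ?case using word[of "[]" 0] by simp
 next
  case (add_term f c u)
  note t = term_of_closed[OF add_term.hyps(2)]
  show ?case unfolding hecke_class_add[OF add_term.hyps(1) t]
   by (rule add[OF hecke_class_closed[OF add_term.hyps(1)] hecke_class_closed[OF t]
      add_term.IH word[OF add_term.hyps(2)]])
 qed
 thus ?thesis using f by simp
qed

text \<open>A complex algebra is a ring with a central homomorphic image of the complex numbers.\<close>

locale complex_algebra = ring A for A (structure) +
 fixes sc :: "complex => 'a"
 assumes sc_closed: "sc c \<in> carrier A"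
  and sc_add: "sc (c + d) = sc c \<oplus> sc d"
  and sc_mult: "sc (c * d) = sc c \<otimes> sc d"
  and sc_one: "sc 1 = \<one>"
  and sc_central: "x \<in> carrier A ==> sc c \<otimes> x = x \<otimes> sc c"
begin

lemma sc_zero: "sc 0 = \<zero>"
 using sc_add[of 0 0] sc_closed by (metis add.l_cancel_one' add_0)

end

lemma complex_algebra_hecke_alg: "complex_algebra (HA n) (hecke_scalar n)"
proof -
 interpret ring "HA n" by (rule ring_hecke_alg)
 show ?thesis
 proof
  fix c d x
  show "hecke_scalar n c \<in> carrier (HA n)" by (rule scalar_closed)
  have "term_of (c + d) [] = (\<lambda>w. term_of c [] w + term_of d [] w)" by (auto simp: term_of_apply)
  thus "hecke_scalar n (c + d) = hecke_scalar n c \<oplus>\<^bsub>HA n\<^esub> hecke_scalar n d"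
   using hecke_class_add[OF term_of_closed term_of_closed] unfolding hecke_scalar_alt by simp
  show "hecke_scalar n (c * d) = hecke_scalar n c \<otimes>\<^bsub>HA n\<^esub> hecke_scalar n d"
   using hecke_class_term_mult[of "[]" n "[]" c d] unfolding hecke_scalar_alt by simp
  show "hecke_scalar n 1 = \<one>\<^bsub>HA n\<^esub>"
   using ring_hom_one[OF hecke_class_hom, of n]
   unfolding hecke_scalar_alt by (simp add: term_of_one free_alg_simps)
  assume "x \<in> carrier (HA n)"
  then obtain f where f: "f \<in> carrier (free_alg n)" "x = hecke_class n f" using hecke_class_cases by blast
  have t: "term_of c [] \<in> carrier (free_alg n)" by (rule term_of_closed) simp
  have "mult (free_alg n) (term_of c []) f = mult (free_alg n) f (term_of c [])"
  proof -
   have 1: "term_of c [] = (\<lambda>w. c * mono_word [] w)" by (simp add: term_of_def)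
   have "mult (free_alg n) (term_of c []) f = (\<lambda>w. c * mult (free_alg n) (mono_word []) f w)"
    unfolding 1 free_alg_simps by (simp add: sum_distrib_left mult.assoc)
   also have "\<dots> = (\<lambda>w. c * mult (free_alg n) f (mono_word []) w)" by (simp only: free_alg_one_mult)
   also have "\<dots> = mult (free_alg n) f (term_of c [])"
    unfolding 1 free_alg_simps by (simp add: sum_distrib_left mult.left_commute)
   finally show ?thesis .
  qed
  thus "hecke_scalar n c \<otimes>\<^bsub>HA n\<^esub> x = x \<otimes>\<^bsub>HA n\<^esub> hecke_scalar n c"
   using ring_hom_mult[OF hecke_class_hom t f(1)] ring_hom_mult[OF hecke_class_hom f(1) t]
   unfolding hecke_scalar_alt f(2) by simp
 qed
qed

section \<open>The universal property and the twist of the 0-Hecke algebra\<close>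

locale hecke_rep = complex_algebra A sc + zero_hecke_monoid A n a
 for A (structure) and sc :: "complex => 'a" and n a
begin

primrec word_elt :: "nat list => 'a" where
 "word_elt [] = \<one>"
| "word_elt (i # u) = a i \<otimes> word_elt u"

lemma word_elt_closed: "set u \<subseteq> {1..<n} ==> word_elt u \<in> carrier A"
 by (induction u) (use gen_closed in auto)

lemma word_elt_append: "set u \<subseteq> {1..<n} ==> set v \<subseteq> {1..<n} ==> word_elt (u @ v) = word_elt u \<otimes> word_elt v"
proof (induction u)
 case (Cons i u)
 hence "i \<in> {1..<n}" "set u \<subseteq> {1..<n}" by auto
 thus ?case using Cons gen_closed word_elt_closed by (simp add: m_assoc)
qed (use word_elt_closed in auto)

text \<open>An additive map on the free algebra with the expected values on scaled words is a ring
 homomorphism, and it factors through the 0-Hecke algebra since it respects the relations.\<close>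

context
 fixes E :: "(nat list => complex) => 'a"
 assumes E_add: "f \<in> carrier (free_alg n) ==> g \<in> carrier (free_alg n) ==>
   E (\<lambda>w. f w + g w) = E f \<oplus> E g"
  and E_term: "set u \<subseteq> {1..<n} ==> E (term_of c u) = sc c \<otimes> word_elt u"
begin

lemma E_zero: "E (\<lambda>w. 0) = \<zero>"
 using E_term[of "[]" 0] by (simp add: term_of_def sc_zero)

lemma E_closed: "f \<in> carrier (free_alg n) ==> E f \<in> carrier A"
 by (induction rule: free_alg_induct)
  (simp_all add: E_zero E_add term_of_closed E_term sc_closed word_elt_closed)

lemma E_mult_term:
 assumes u: "set u \<subseteq> {1..<n}" and "g \<in> carrier (free_alg n)"
 shows "E (mult (free_alg n) (term_of c u) g) = E (term_of c u) \<otimes> E g"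
 using assms(2)
proof (induction rule: free_alg_induct)
 case zero
 have "mult (free_alg n) (term_of c u) (\<lambda>w. 0) = (\<lambda>w. 0)" by (simp add: free_alg_simps(2))
 thus ?case using E_closed[OF term_of_closed[OF u]] by (simp add: E_zero)
next
 case (add_term g d v)
 interpret F: ring "free_alg n" by (rule ring_free_alg)
 note tu = term_of_closed[OF u, of c] and tv = term_of_closed[OF add_term.hyps(2), of d]
 have "mult (free_alg n) (term_of c u) (\<lambda>w. g w + term_of d v w) =
   (\<lambda>w. mult (free_alg n) (term_of c u) g w + mult (free_alg n) (term_of c u) (term_of d v) w)"
  by (simp add: free_alg_simps(2) distrib_left sum.distrib)
 hence "E (mult (free_alg n) (term_of c u) (\<lambda>w. g w + term_of d v w)) =
   E (term_of c u) \<otimes> E g \<oplus> E (term_of (c * d) (u @ v))"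
  using E_add[OF free_alg_mult_closed[OF tu add_term.hyps(1)] free_alg_mult_closed[OF tu tv]]
   add_term.IH by (simp add: term_of_mult)
 also have "E (term_of (c * d) (u @ v)) = sc (c * d) \<otimes> (word_elt u \<otimes> word_elt v)"
  using u add_term.hyps(2) by (simp add: E_term word_elt_append)
 also have "\<dots> = (sc c \<otimes> word_elt u) \<otimes> (sc d \<otimes> word_elt v)"
  using sc_closed word_elt_closed[OF u] word_elt_closed[OF add_term.hyps(2)]
   sc_central[OF word_elt_closed[OF u], of d]
  by (simp add: sc_mult m_assoc) (simp add: m_assoc[symmetric])
 also have "\<dots> = E (term_of c u) \<otimes> E (term_of d v)"
  using u add_term.hyps(2) by (simp add: E_term)
 also have "E (term_of c u) \<otimes> E g \<oplus> E (term_of c u) \<otimes> E (term_of d v) =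
   E (term_of c u) \<otimes> E (\<lambda>w. g w + term_of d v w)"
  using E_closed[OF tu] E_closed[OF tv] E_closed[OF add_term.hyps(1)] E_add[OF add_term.hyps(1) tv]
  by (simp add: r_distr)
 finally show ?case .
qed

lemma E_mult:
 assumes "f \<in> carrier (free_alg n)" and g: "g \<in> carrier (free_alg n)"
 shows "E (mult (free_alg n) f g) = E f \<otimes> E g"
 using assms(1)
proof (induction rule: free_alg_induct)
 case zero
 have "mult (free_alg n) (\<lambda>w. 0) g = (\<lambda>w. 0)" by (simp add: free_alg_simps(2))
 thus ?case using E_closed[OF g] by (simp add: E_zero)
next
 case (add_term f c u)
 note t = term_of_closed[OF add_term.hyps(2), of c]
 have "mult (free_alg n) (\<lambda>w. f w + term_of c u w) g =
   (\<lambda>w. mult (free_alg n) f g w + mult (free_alg n) (term_of c u) g w)"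
  by (simp add: free_alg_simps(2) distrib_right sum.distrib)
 thus ?case
  using E_add[OF free_alg_mult_closed[OF add_term.hyps(1) g] free_alg_mult_closed[OF t g]]
   add_term.IH E_mult_term[OF add_term.hyps(2) g] E_add[OF add_term.hyps(1) t]
   E_closed[OF add_term.hyps(1)] E_closed[OF t] E_closed[OF g] by (simp add: l_distr)
qed

lemma E_ring_hom: "ring_hom_ring (free_alg n) A E"
proof (rule ring_hom_ringI2[OF ring_free_alg ring_axioms])
 show "E \<in> ring_hom (free_alg n) A"
 proof (rule ring_hom_memI)
  show "E \<one>\<^bsub>free_alg n\<^esub> = \<one>"
   using E_term[of "[]" 1] by (simp add: free_alg_simps(3) term_of_one sc_one)
 qed (simp_all add: E_closed E_mult, simp add: free_alg_simps(5) E_add)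
qed

lemma E_relation:
 assumes "set u \<subseteq> {1..<n}" "set v \<subseteq> {1..<n}" "word_elt u = word_elt v"
 shows "(\<lambda>w. mono_word u w - mono_word v w) \<in> a_kernel (free_alg n) A E"
proof -
 have 1: "(\<lambda>w. mono_word u w - mono_word v w) = (\<lambda>w. term_of 1 u w + term_of (-1) v w)"
  by (simp add: term_of_def)
 note t = term_of_closed[OF assms(1), of 1] term_of_closed[OF assms(2), of "-1"]
 have "sc 1 \<oplus> sc (-1) = \<zero>" using sc_add[of 1 "-1"] sc_zero by simp
 hence "E (\<lambda>w. term_of 1 u w + term_of (-1) v w) = \<zero>"
  using E_add[OF t] assms sc_closed word_elt_closed[OF assms(2)]
  by (simp add: E_term l_distr[symmetric])
 thus ?thesis unfolding 1 using free_alg_add_closed[OF t]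
  by (simp add: a_kernel_def kernel_def)
qed

lemma E_kernel: "hecke_ideal n \<subseteq> a_kernel (free_alg n) A E"
proof -
 interpret E: ring_hom_ring "free_alg n" A E by (rule E_ring_hom)
 have "hecke_relations n \<subseteq> a_kernel (free_alg n) A E"
 proof
  fix r assume "r \<in> hecke_relations n"
  then consider i where "i \<in> {1..<n}" "r = (\<lambda>w. mono_word [i, i] w - mono_word [i] w)"
   | i where "i \<in> {1..<n}" "Suc i \<in> {1..<n}"
    "r = (\<lambda>w. mono_word [i, Suc i, i] w - mono_word [Suc i, i, Suc i] w)"
   | i j where "i \<in> {1..<n}" "j \<in> {1..<n}" "i + 2 \<le> j \<or> j + 2 \<le> i"
    "r = (\<lambda>w. mono_word [i, j] w - mono_word [j, i] w)"
   unfolding hecke_relations_def by blast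
  thus "r \<in> a_kernel (free_alg n) A E"
  proof cases
   case 1
   show ?thesis unfolding 1(2) by (rule E_relation) (use 1 gen_idem gen_closed in simp_all)
  next
   case 2
   show ?thesis unfolding 2(3) by (rule E_relation) (use 2 gen_braid gen_closed in simp_all)
  next
   case 3
   have "a i \<otimes> a j = a j \<otimes> a i" using 3 gen_commute[of i j] gen_commute[of j i] by metis
   thus ?thesis unfolding 3(4) by (intro E_relation) (use 3 gen_closed in simp_all)
  qed
 qed
 thus ?thesis unfolding hecke_ideal_def
  using ring.genideal_minimal[OF ring_free_alg E.kernel_is_ideal] by blast
qed

lemma E_hecke_class:
 assumes f: "f \<in> carrier (free_alg n)"
 shows "E ` hecke_class n f = {E f}"
proof -
 interpret I: ideal "hecke_ideal n" "free_alg n" by (rule ideal_hecke_ideal)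
 have "E (k \<oplus>\<^bsub>free_alg n\<^esub> f) = E f" if "k \<in> hecke_ideal n" for k
 proof -
  have "E k = \<zero>" using E_kernel that by (auto simp: a_kernel_def kernel_def)
  thus ?thesis using E_add[OF I.Icarr[OF that] f] E_closed[OF f] by (simp add: free_alg_simps(5))
 qed
 hence "E x = E f" if "x \<in> hecke_class n f" for x
  using that unfolding hecke_class_def a_r_coset_def' by blast
 moreover have "f \<in> hecke_class n f"
  unfolding hecke_class_def by (rule I.a_rcos_self[OF f])
 ultimately show ?thesis by blast
qed

definition lift where "lift h = the_elem (E ` h)"

lemma lift_hecke_class: "f \<in> carrier (free_alg n) ==> lift (hecke_class n f) = E f"
 by (simp add: lift_def E_hecke_class)

lemma lift_hom: "lift \<in> ring_hom (HA n) A"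
proof (rule ring_hom_memI)
 interpret F: ring "free_alg n" by (rule ring_free_alg)
 fix x y assume "x \<in> carrier (HA n)" "y \<in> carrier (HA n)"
 then obtain f g where f: "f \<in> carrier (free_alg n)" "x = hecke_class n f"
  and g: "g \<in> carrier (free_alg n)" "y = hecke_class n g" using hecke_class_cases by metis
 show "lift x \<in> carrier A" using f by (simp add: lift_hecke_class E_closed)
 show "lift (x \<otimes>\<^bsub>HA n\<^esub> y) = lift x \<otimes> lift y"
  unfolding f(2) g(2) ring_hom_mult[OF hecke_class_hom f(1) g(1), symmetric]
   lift_hecke_class[OF f(1)] lift_hecke_class[OF g(1)]
   lift_hecke_class[OF free_alg_mult_closed[OF f(1) g(1)]] by (rule E_mult[OF f(1) g(1)])
 show "lift (x \<oplus>\<^bsub>HA n\<^esub> y) = lift x \<oplus> lift y"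
  unfolding f(2) g(2) hecke_class_add[OF f(1) g(1), symmetric]
   lift_hecke_class[OF f(1)] lift_hecke_class[OF g(1)]
   lift_hecke_class[OF free_alg_add_closed[OF f(1) g(1)]] by (rule E_add[OF f(1) g(1)])
next
 have "\<one>\<^bsub>HA n\<^esub> = hecke_class n (term_of 1 [])"
  using ring_hom_one[OF hecke_class_hom, of n] by (simp add: free_alg_simps(3) term_of_one)
 thus "lift \<one>\<^bsub>HA n\<^esub> = \<one>"
  using lift_hecke_class[OF term_of_closed, of "[]" 1] E_term[of "[]" 1] by (simp add: sc_one)
qed

lemma lift_gen: "i \<in> {1..<n} ==> lift (hecke_gen n i) = a i"
 unfolding hecke_gen_alt using lift_hecke_class[OF term_of_closed, of "[i]" 1] gen_closed
 by (simp add: E_term sc_one)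

lemma lift_scalar: "lift (hecke_scalar n c) = sc c"
 unfolding hecke_scalar_alt using lift_hecke_class[OF term_of_closed, of "[]" c] sc_closed
 by (simp add: E_term)

end

text \<open>The evaluation of noncommutative polynomials at the generators of the target algebra.\<close>

definition eval_free where
 "eval_free f = (\<Oplus>w\<in>{w. f w \<noteq> 0}. sc (f w) \<otimes> word_elt w)"

lemma eval_free_superset:
 assumes "f \<in> carrier (free_alg n)" "finite W" "{w. f w \<noteq> 0} \<subseteq> W" "\<And>w. w \<in> W ==> set w \<subseteq> {1..<n}"
 shows "eval_free f = (\<Oplus>w\<in>W. sc (f w) \<otimes> word_elt w)"
 unfolding eval_free_def
 by (rule add.finprod_mono_neutral_cong_left)
  (use assms word_elt_closed sc_closed in \<open>auto simp: sc_zero\<close>)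

lemma eval_free_add:
 assumes f: "f \<in> carrier (free_alg n)" and g: "g \<in> carrier (free_alg n)"
 shows "eval_free (\<lambda>w. f w + g w) = eval_free f \<oplus> eval_free g"
proof -
 let ?W = "{w. f w \<noteq> 0} \<union> {w. g w \<noteq> 0}"
 have W: "finite ?W" "\<And>w. w \<in> ?W ==> set w \<subseteq> {1..<n}"
  using f g unfolding free_alg_simps(1) by blast+
 have c: "sc d \<otimes> word_elt w \<in> carrier A" if "w \<in> ?W" for d w
  using word_elt_closed[OF W(2)[OF that]] sc_closed by simp
 have "eval_free (\<lambda>w. f w + g w) = (\<Oplus>w\<in>?W. sc (f w + g w) \<otimes> word_elt w)"
  by (rule eval_free_superset[OF free_alg_add_closed[OF f g] W(1) _ W(2)]) auto
 also have "\<dots> = (\<Oplus>w\<in>?W. sc (f w) \<otimes> word_elt w \<oplus> sc (g w) \<otimes> word_elt w)"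
  by (rule finsum_cong') (use c W(2) word_elt_closed sc_closed in \<open>auto simp: sc_add l_distr\<close>)
 also have "\<dots> = (\<Oplus>w\<in>?W. sc (f w) \<otimes> word_elt w) \<oplus> (\<Oplus>w\<in>?W. sc (g w) \<otimes> word_elt w)"
  by (rule finsum_addf) (use c in auto)
 also have "\<dots> = eval_free f \<oplus> eval_free g"
  using eval_free_superset[OF f W(1) _ W(2)] eval_free_superset[OF g W(1) _ W(2)] by auto
 finally show ?thesis .
qed

lemma eval_free_term:
 assumes "set u \<subseteq> {1..<n}"
 shows "eval_free (term_of c u) = sc c \<otimes> word_elt u"
proof -
 have "eval_free (term_of c u) = (\<Oplus>w\<in>{u}. sc (term_of c u w) \<otimes> word_elt w)"
  by (rule eval_free_superset[OF term_of_closed[OF assms]]) (use assms in \<open>auto simp: term_of_apply\<close>)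
 thus ?thesis using word_elt_closed[OF assms] sc_closed by (simp add: term_of_apply)
qed

lemma universal_property:
 obtains L where "L \<in> ring_hom (HA n) A" "\<And>i. i \<in> {1..<n} ==> L (hecke_gen n i) = a i"
  "\<And>c. L (hecke_scalar n c) = sc c"
 using lift_hom[OF eval_free_add eval_free_term] lift_gen[OF eval_free_add eval_free_term]
  lift_scalar[OF eval_free_add eval_free_term] by blast

end

lemma hecke_hom_unique:
 assumes F: "F \<in> ring_hom (HA n) A" and G: "G \<in> ring_hom (HA n) A"
  and gen: "\<And>i. i \<in> {1..<n} ==> F (hecke_gen n i) = G (hecke_gen n i)"
  and scalar: "\<And>c. F (hecke_scalar n c) = G (hecke_scalar n c)"
  and h: "h \<in> carrier (HA n)"
 shows "F h = G h"
 using h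
proof (induction rule: hecke_induct)
 case (gen i h)
 thus ?case using assms(3) by (simp add: ring_hom_mult[OF F] ring_hom_mult[OF G] hecke_gen_closed)
next
 case (add h h')
 thus ?case by (simp add: ring_hom_add[OF F] ring_hom_add[OF G])
qed (rule scalar)

lemma hecke_linear_scalar:
 assumes F: "F \<in> ring_hom (HA n) A" and one: "\<one>\<^bsub>A\<^esub> = \<one>\<^bsub>HA n\<^esub>" and lin: "hecke_linear n F"
 shows "F (hecke_scalar n c) = hecke_scalar n c"
proof -
 interpret complex_algebra "HA n" "hecke_scalar n" by (rule complex_algebra_hecke_alg)
 have "F (hecke_scalar n c \<otimes>\<^bsub>HA n\<^esub> \<one>\<^bsub>HA n\<^esub>) = hecke_scalar n c \<otimes>\<^bsub>HA n\<^esub> F \<one>\<^bsub>HA n\<^esub>"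
  using lin unfolding hecke_linear_def by simp
 thus ?thesis using sc_closed ring_hom_one[OF F] one by simp
qed

lemma opposite_ring_simps:
 "carrier (opposite_ring R) = carrier R" "mult (opposite_ring R) = (\<lambda>x y. y \<otimes>\<^bsub>R\<^esub> x)"
 "add (opposite_ring R) = add R" "one (opposite_ring R) = one R" "zero (opposite_ring R) = zero R"
 by (simp_all add: opposite_ring_def)

lemma opposite_complex_algebra:
 assumes "complex_algebra A sc"
 shows "complex_algebra (opposite_ring A) sc"
proof -
 interpret complex_algebra A sc by fact
 have ag: "abelian_group (opposite_ring A)"
  by (rule abelian_groupI, unfold opposite_ring_simps)
   (blast intro: add.m_assoc add.m_comm add.l_inv_ex a_closed zero_closed l_zero)+
 have mon: "Group.monoid (opposite_ring A)"
  by (rule Group.monoidI) (simp_all add: opposite_ring_simps m_assoc)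
 have r: "ring (opposite_ring A)"
  by (rule ringI[OF ag mon]) (simp_all add: opposite_ring_simps l_distr r_distr)
 show ?thesis
 proof (intro complex_algebra.intro complex_algebra_axioms.intro r)
  fix c d
  show "sc (c * d) = sc c \<otimes>\<^bsub>opposite_ring A\<^esub> sc d"
   using sc_mult[of c d] sc_central[OF sc_closed, of c d] by (simp add: opposite_ring_simps)
 qed (simp_all add: opposite_ring_simps sc_closed sc_add sc_one sc_central)
qed

text \<open>The elements \<open>1 - p\<close> inherit the defining relations: expanding
 \<open>(1 - p) (1 - q) (1 - p)\<close> gives \<open>1 - p - q + pq + qp - pqp\<close>, which is symmetric once
 \<open>pqp = qpq\<close>.\<close>

lemma (in ring) one_minus_products:
 assumes p: "p \<in> carrier R" and q: "q \<in> carrier R"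
 shows "(\<one> \<ominus> p) \<otimes> (\<one> \<ominus> q) = \<one> \<ominus> p \<ominus> q \<oplus> p \<otimes> q"
  and "p \<otimes> p = p ==> (\<one> \<ominus> p) \<otimes> ((\<one> \<ominus> q) \<otimes> (\<one> \<ominus> p)) =
   \<one> \<ominus> p \<ominus> q \<oplus> p \<otimes> q \<oplus> q \<otimes> p \<ominus> p \<otimes> (q \<otimes> p)"
proof -
 have 1: "(\<one> \<ominus> x) \<otimes> y = y \<ominus> x \<otimes> y" if "x \<in> carrier R" "y \<in> carrier R" for x y
  using that by (simp add: minus_eq l_distr l_minus)
 have 2: "(\<one> \<ominus> p) \<otimes> (\<one> \<ominus> q) = \<one> \<ominus> p \<ominus> q \<oplus> p \<otimes> q" if "p \<in> carrier R" "q \<in> carrier R" for p q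
  using that by (simp add: 1 minus_eq r_distr r_minus l_distr l_minus minus_add a_ac)
 show "(\<one> \<ominus> p) \<otimes> (\<one> \<ominus> q) = \<one> \<ominus> p \<ominus> q \<oplus> p \<otimes> q" by (rule 2[OF assms])
 show "(\<one> \<ominus> p) \<otimes> ((\<one> \<ominus> q) \<otimes> (\<one> \<ominus> p)) =
   \<one> \<ominus> p \<ominus> q \<oplus> p \<otimes> q \<oplus> q \<otimes> p \<ominus> p \<otimes> (q \<otimes> p)" if pp: "p \<otimes> p = p"
 proof -
  have a: "p \<otimes> (\<one> \<ominus> q \<ominus> p \<oplus> q \<otimes> p) = p \<ominus> p \<otimes> q \<ominus> p \<oplus> p \<otimes> (q \<otimes> p)"
   using p q pp by (simp add: minus_eq r_distr r_minus)
  also have "\<dots> = \<ominus> (p \<otimes> q) \<oplus> p \<otimes> (q \<otimes> p)"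
   using p q by (simp add: minus_eq a_ac r_neg1 r_neg2)
  finally have b: "p \<otimes> (\<one> \<ominus> q \<ominus> p \<oplus> q \<otimes> p) = \<ominus> (p \<otimes> q) \<oplus> p \<otimes> (q \<otimes> p)" .
  show ?thesis unfolding 2[OF q p] using p q
   by (simp add: 1 b) (simp add: minus_eq minus_add a_ac)
 qed
qed

lemma one_minus_zero_hecke:
 fixes G (structure)
 assumes "ring G" and "zero_hecke_monoid G n a"
 shows "zero_hecke_monoid G n (\<lambda>i. \<one> \<ominus> a i)"
proof -
 interpret R: ring G by fact
 interpret zero_hecke_monoid G n a by fact
 show ?thesis
 proof
  fix i j assume i: "i \<in> {1..<n}"
  note ci = gen_closed[OF i]
  show "\<one> \<ominus> a i \<in> carrier G" using ci by simp
  show "(\<one> \<ominus> a i) \<otimes> (\<one> \<ominus> a i) = \<one> \<ominus> a i"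
   unfolding R.one_minus_products(1)[OF ci ci] gen_idem[OF i]
   using ci by (simp add: R.minus_eq R.a_assoc R.l_neg)
  show "(\<one> \<ominus> a i) \<otimes> ((\<one> \<ominus> a (Suc i)) \<otimes> (\<one> \<ominus> a i)) =
   (\<one> \<ominus> a (Suc i)) \<otimes> ((\<one> \<ominus> a i) \<otimes> (\<one> \<ominus> a (Suc i)))" if j: "Suc i \<in> {1..<n}"
   unfolding R.one_minus_products(2)[OF ci gen_closed[OF j] gen_idem[OF i]]
    R.one_minus_products(2)[OF gen_closed[OF j] ci gen_idem[OF j]] gen_braid[OF i j]
   using ci gen_closed[OF j] by (simp add: R.minus_eq R.a_ac)
  show "(\<one> \<ominus> a i) \<otimes> (\<one> \<ominus> a j) = (\<one> \<ominus> a j) \<otimes> (\<one> \<ominus> a i)"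
   if j: "j \<in> {1..<n}" "i + 2 \<le> j"
   unfolding R.one_minus_products(1)[OF ci gen_closed[OF j(1)]]
    R.one_minus_products(1)[OF gen_closed[OF j(1)] ci] gen_commute[OF i j]
   using ci gen_closed[OF j(1)] by (simp add: R.minus_eq R.a_ac)
 qed
qed

lemma hecke_involution_bij:
 assumes "\<And>x. x \<in> carrier (HA n) ==> F x \<in> carrier (HA n)"
  and "\<And>x. x \<in> carrier (HA n) ==> F (F x) = x"
 shows "bij_betw F (carrier (HA n)) (carrier (HA n))"
 by (rule bij_betw_byWitness[of _ F]) (use assms in auto)

lemma restrict_ring_hom:
 assumes "ring A" "F \<in> ring_hom A B" shows "restrict F (carrier A) \<in> ring_hom A B"
proof -
 interpret ring A by fact
 show ?thesis using assms(2) unfolding ring_hom_def by auto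
qed

lemma additive_one_minus:
 fixes A (structure)
 assumes "ring A" and cl: "\<And>x. x \<in> carrier A ==> L x \<in> carrier A"
  and ad: "\<And>x y. x \<in> carrier A ==> y \<in> carrier A ==> L (x \<oplus> y) = L x \<oplus> L y"
  and one: "L \<one> = \<one>" and g: "g \<in> carrier A"
 shows "L (\<one> \<ominus> g) = \<one> \<ominus> L g"
proof -
 interpret ring A by fact
 have "L (\<one> \<ominus> g) \<oplus> L g = L (\<one> \<ominus> g \<oplus> g)" using ad g by simp
 also have "\<one> \<ominus> g \<oplus> g = \<one>" using g by (simp add: minus_eq a_assoc l_neg)
 finally have "L (\<one> \<ominus> g) \<oplus> L g \<ominus> L g = \<one> \<ominus> L g" using one by simp
 thus ?thesis using cl g by (simp add: minus_eq a_assoc r_neg)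
qed

text \<open>Both maps are produced by the universal property, for the generators \<open>1 - \<pi>\<^sub>i\<close> in the algebra itself and
 for the generators \<open>\<pi>\<^sub>i\<close> in the opposite algebra.  They are bijective because they are involutions,
 again by uniqueness, and uniqueness makes the descriptions in their definitions unambiguous.\<close>

lemma hecke_theta_props:
 shows "hecke_theta n \<in> ring_hom (HA n) (HA n)"
  and "hecke_theta n (hecke_scalar n c) = hecke_scalar n c"
  and "i \<in> {1..<n} ==> hecke_theta n (hecke_gen n i) = \<one>\<^bsub>HA n\<^esub> \<ominus>\<^bsub>HA n\<^esub> hecke_gen n i"
proof -
 let ?H = "HA n"
 interpret H: complex_algebra ?H "hecke_scalar n" by (rule complex_algebra_hecke_alg)
 interpret Z: zero_hecke_monoid ?H n "hecke_gen n" by (rule zero_hecke_monoid_hecke_alg)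
 interpret R: hecke_rep ?H "hecke_scalar n" n "\<lambda>i. \<one>\<^bsub>?H\<^esub> \<ominus>\<^bsub>?H\<^esub> hecke_gen n i"
  by (intro hecke_rep.intro complex_algebra_hecke_alg one_minus_zero_hecke[OF ring_hecke_alg]
    zero_hecke_monoid_hecke_alg)
 obtain L where L: "L \<in> ring_hom ?H ?H"
  "\<And>i. i \<in> {1..<n} ==> L (hecke_gen n i) = \<one>\<^bsub>?H\<^esub> \<ominus>\<^bsub>?H\<^esub> hecke_gen n i"
  "\<And>c. L (hecke_scalar n c) = hecke_scalar n c"
  using R.universal_property by metis
 have LL: "L (L x) = x" if "x \<in> carrier ?H" for x
  using that
 proof (induction rule: hecke_induct)
  case (scalar c)
  thus ?case by (simp add: L)
 next
  case (gen i h)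
  note g = hecke_gen_closed[OF gen.hyps(1)]
  have "L (L (hecke_gen n i)) = hecke_gen n i"
  proof -
   have "L (\<one>\<^bsub>?H\<^esub> \<ominus>\<^bsub>?H\<^esub> hecke_gen n i) = \<one>\<^bsub>?H\<^esub> \<ominus>\<^bsub>?H\<^esub> L (hecke_gen n i)"
    by (rule additive_one_minus[OF ring_hecke_alg])
     (use ring_hom_closed[OF L(1)] ring_hom_add[OF L(1)] ring_hom_one[OF L(1)] g in auto)
   thus ?thesis using L(2)[OF gen.hyps(1)] g by (simp add: H.minus_eq H.minus_add H.r_neg2)
  qed
  thus ?case using gen g ring_hom_closed[OF L(1)] by (simp add: ring_hom_mult[OF L(1)])
 next
  case (add h h')
  thus ?case using ring_hom_closed[OF L(1)] by (simp add: ring_hom_add[OF L(1)])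
 qed
 have P: "restrict L (carrier ?H) \<in> extensional (carrier ?H) \<and>
   restrict L (carrier ?H) \<in> ring_iso ?H ?H \<and> hecke_linear n (restrict L (carrier ?H)) \<and>
   (\<forall>i\<in>{1..<n}. restrict L (carrier ?H) (hecke_gen n i) = \<one>\<^bsub>?H\<^esub> \<ominus>\<^bsub>?H\<^esub> hecke_gen n i)"
 proof (intro conjI ballI)
  have "bij_betw L (carrier ?H) (carrier ?H)"
   using hecke_involution_bij[of n L] LL ring_hom_closed[OF L(1)] by blast
  hence "bij_betw (restrict L (carrier ?H)) (carrier ?H) (carrier ?H)"
   by (simp add: bij_betw_restrict_eq)
  thus "restrict L (carrier ?H) \<in> ring_iso ?H ?H"
   using restrict_ring_hom[OF ring_hecke_alg L(1)] by (simp add: ring_iso_def)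
  show "hecke_linear n (restrict L (carrier ?H))"
   unfolding hecke_linear_def using H.sc_closed by (simp add: ring_hom_mult[OF L(1)] L(3))
 qed (use L(2) hecke_gen_closed in auto)
 have U: "f = restrict L (carrier ?H)" if f: "f \<in> extensional (carrier ?H) \<and> f \<in> ring_iso ?H ?H \<and>
   hecke_linear n f \<and> (\<forall>i\<in>{1..<n}. f (hecke_gen n i) = \<one>\<^bsub>?H\<^esub> \<ominus>\<^bsub>?H\<^esub> hecke_gen n i)" for f
 proof (rule extensionalityI[of _ "carrier ?H"])
  fix x assume x: "x \<in> carrier ?H"
  have f': "f \<in> ring_hom ?H ?H" using f by (simp add: ring_iso_def)
  show "f x = restrict L (carrier ?H) x"
   using hecke_hom_unique[OF f' L(1) _ _ x] f L hecke_linear_scalar[OF f' refl] x by simp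
 qed (use f in auto)
 have T: "hecke_theta n = restrict L (carrier ?H)"
  unfolding hecke_theta_def by (rule the_equality[of _ "restrict L (carrier ?H)"]) (use P U in blast)+
 show "hecke_theta n \<in> ring_hom ?H ?H" unfolding T by (rule restrict_ring_hom[OF ring_hecke_alg L(1)])
 show "hecke_theta n (hecke_scalar n c) = hecke_scalar n c" unfolding T using L(3) H.sc_closed by simp
 show "i \<in> {1..<n} ==> hecke_theta n (hecke_gen n i) = \<one>\<^bsub>?H\<^esub> \<ominus>\<^bsub>?H\<^esub> hecke_gen n i"
  using P T by auto
qed

lemma hecke_chi_props:
 shows "hecke_chi n \<in> ring_hom (HA n) (opposite_ring (HA n))"
  and "hecke_chi n (hecke_scalar n c) = hecke_scalar n c"
  and "i \<in> {1..<n} ==> hecke_chi n (hecke_gen n i) = hecke_gen n i"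
proof -
 let ?H = "HA n" and ?O = "opposite_ring (HA n)"
 interpret H: complex_algebra ?H "hecke_scalar n" by (rule complex_algebra_hecke_alg)
 interpret Z: zero_hecke_monoid ?H n "hecke_gen n" by (rule zero_hecke_monoid_hecke_alg)
 interpret O: complex_algebra ?O "hecke_scalar n" by (rule opposite_complex_algebra[OF complex_algebra_hecke_alg])
 interpret R: hecke_rep ?O "hecke_scalar n" n "hecke_gen n"
 proof (intro hecke_rep.intro O.complex_algebra_axioms zero_hecke_monoid.intro braid_monoid.intro
   braid_monoid_axioms.intro zero_hecke_monoid_axioms.intro O.monoid_axioms)
  fix i assume i: "i \<in> {1..<n}"
  show "hecke_gen n i \<otimes>\<^bsub>?O\<^esub> (hecke_gen n (Suc i) \<otimes>\<^bsub>?O\<^esub> hecke_gen n i) =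
   hecke_gen n (Suc i) \<otimes>\<^bsub>?O\<^esub> (hecke_gen n i \<otimes>\<^bsub>?O\<^esub> hecke_gen n (Suc i))" if "Suc i \<in> {1..<n}"
   using Z.gen_braid[OF i that] Z.gen_closed[OF i] Z.gen_closed[OF that]
   by (simp add: opposite_ring_simps H.m_assoc)
  show "hecke_gen n i \<otimes>\<^bsub>?O\<^esub> hecke_gen n j = hecke_gen n j \<otimes>\<^bsub>?O\<^esub> hecke_gen n i"
   if "j \<in> {1..<n}" "i + 2 \<le> j" for j
   using Z.gen_commute[OF i that] by (simp add: opposite_ring_simps)
 qed (use Z.gen_closed Z.gen_idem in \<open>simp_all add: opposite_ring_simps\<close>)
 obtain L where L: "L \<in> ring_hom ?H ?O"
  "\<And>i. i \<in> {1..<n} ==> L (hecke_gen n i) = hecke_gen n i"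
  "\<And>c. L (hecke_scalar n c) = hecke_scalar n c"
  using R.universal_property by metis
 have cl: "L x \<in> carrier ?H" if "x \<in> carrier ?H" for x
  using ring_hom_closed[OF L(1) that] by (simp add: opposite_ring_simps)
 have mu: "L (x \<otimes>\<^bsub>?H\<^esub> y) = L y \<otimes>\<^bsub>?H\<^esub> L x" if "x \<in> carrier ?H" "y \<in> carrier ?H" for x y
  using ring_hom_mult[OF L(1) that] by (simp add: opposite_ring_simps)
 have ad: "L (x \<oplus>\<^bsub>?H\<^esub> y) = L x \<oplus>\<^bsub>?H\<^esub> L y" if "x \<in> carrier ?H" "y \<in> carrier ?H" for x y
  using ring_hom_add[OF L(1) that] by (simp add: opposite_ring_simps)
 have LL: "L (L x) = x" if "x \<in> carrier ?H" for x
  using that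
 proof (induction rule: hecke_induct)
  case (gen i h)
  thus ?case using hecke_gen_closed[OF gen.hyps(1)] by (simp add: mu cl L(2))
 qed (simp_all add: L ad cl)
 have P: "restrict L (carrier ?H) \<in> extensional (carrier ?H) \<and>
   restrict L (carrier ?H) \<in> ring_iso ?H ?O \<and> hecke_linear n (restrict L (carrier ?H)) \<and>
   (\<forall>i\<in>{1..<n}. restrict L (carrier ?H) (hecke_gen n i) = hecke_gen n i)"
 proof (intro conjI ballI)
  have "bij_betw L (carrier ?H) (carrier ?H)"
   using hecke_involution_bij[of n L] LL cl by blast
  hence "bij_betw (restrict L (carrier ?H)) (carrier ?H) (carrier ?O)"
   by (simp add: bij_betw_restrict_eq opposite_ring_simps)
  thus "restrict L (carrier ?H) \<in> ring_iso ?H ?O"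
   using restrict_ring_hom[OF ring_hecke_alg L(1)] by (simp add: ring_iso_def)
  show "hecke_linear n (restrict L (carrier ?H))"
   unfolding hecke_linear_def using H.sc_closed cl by (simp add: mu L(3) H.sc_central)
 qed (use L(2) hecke_gen_closed in auto)
 have U: "f = restrict L (carrier ?H)" if f: "f \<in> extensional (carrier ?H) \<and> f \<in> ring_iso ?H ?O \<and>
   hecke_linear n f \<and> (\<forall>i\<in>{1..<n}. f (hecke_gen n i) = hecke_gen n i)" for f
 proof (rule extensionalityI[of _ "carrier ?H"])
  fix x assume x: "x \<in> carrier ?H"
  have f': "f \<in> ring_hom ?H ?O" using f by (simp add: ring_iso_def)
  show "f x = restrict L (carrier ?H) x"
   using hecke_hom_unique[OF f' L(1) _ _ x] f L hecke_linear_scalar[OF f'] x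
   by (simp add: opposite_ring_simps)
 qed (use f in auto)
 have T: "hecke_chi n = restrict L (carrier ?H)"
  unfolding hecke_chi_def by (rule the_equality[of _ "restrict L (carrier ?H)"]) (use P U in blast)+
 show "hecke_chi n \<in> ring_hom ?H ?O" unfolding T by (rule restrict_ring_hom[OF ring_hecke_alg L(1)])
 show "hecke_chi n (hecke_scalar n c) = hecke_scalar n c" unfolding T using L(3) H.sc_closed by simp
 show "i \<in> {1..<n} ==> hecke_chi n (hecke_gen n i) = hecke_gen n i" using P T by auto
qed

lemma hecke_theta_hat_props:
 shows theta_hat_closed: "h \<in> carrier (HA n) ==> hecke_theta_hat n h \<in> carrier (HA n)"
  and theta_hat_add: "h \<in> carrier (HA n) ==> k \<in> carrier (HA n) ==>
   hecke_theta_hat n (h \<oplus>\<^bsub>HA n\<^esub> k) = hecke_theta_hat n h \<oplus>\<^bsub>HA n\<^esub> hecke_theta_hat n k"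
  and theta_hat_mult: "h \<in> carrier (HA n) ==> k \<in> carrier (HA n) ==>
   hecke_theta_hat n (h \<otimes>\<^bsub>HA n\<^esub> k) = hecke_theta_hat n k \<otimes>\<^bsub>HA n\<^esub> hecke_theta_hat n h"
  and theta_hat_one: "hecke_theta_hat n \<one>\<^bsub>HA n\<^esub> = \<one>\<^bsub>HA n\<^esub>"
  and theta_hat_scalar: "hecke_theta_hat n (hecke_scalar n c) = hecke_scalar n c"
  and theta_hat_gen: "i \<in> {1..<n} ==>
   hecke_theta_hat n (hecke_gen n i) = \<one>\<^bsub>HA n\<^esub> \<ominus>\<^bsub>HA n\<^esub> hecke_gen n i"
 using ring_hom_closed[OF hecke_theta_props(1)] ring_hom_closed[OF hecke_chi_props(1)]
  ring_hom_add[OF hecke_theta_props(1)] ring_hom_add[OF hecke_chi_props(1)]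
  ring_hom_mult[OF hecke_theta_props(1)] ring_hom_mult[OF hecke_chi_props(1)]
  ring_hom_one[OF hecke_theta_props(1)] ring_hom_one[OF hecke_chi_props(1)]
  hecke_theta_props(2,3) hecke_chi_props(2,3)
 by (simp_all add: hecke_theta_hat_def opposite_ring_simps)

lemma theta_hat_involution:
 assumes "h \<in> carrier (HA n)"
 shows "hecke_theta_hat n (hecke_theta_hat n h) = h"
 using assms
proof (induction rule: hecke_induct)
 case (scalar c)
 thus ?case by (simp add: theta_hat_scalar)
next
 case (gen i h)
 interpret H: ring "HA n" by (rule ring_hecke_alg)
 note g = hecke_gen_closed[OF gen.hyps(1)]
 let ?t = "hecke_theta_hat n"
 have "?t (\<one>\<^bsub>HA n\<^esub> \<ominus>\<^bsub>HA n\<^esub> hecke_gen n i) =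
   \<one>\<^bsub>HA n\<^esub> \<ominus>\<^bsub>HA n\<^esub> ?t (hecke_gen n i)"
  by (rule additive_one_minus[OF ring_hecke_alg])
   (use theta_hat_closed theta_hat_add theta_hat_one g in auto)
 hence "?t (?t (hecke_gen n i)) = hecke_gen n i"
  using g by (simp add: theta_hat_gen[OF gen.hyps(1)] H.minus_eq H.minus_add H.r_neg2)
 thus ?case using gen g by (simp add: theta_hat_mult theta_hat_closed)
next
 case (add h h')
 thus ?case by (simp add: theta_hat_add theta_hat_closed)
qed

section \<open>Modules over the 0-Hecke algebra\<close>

context left_module
begin

lemma lsmult_zero_left: "x \<in> carrier M ==> \<zero>\<^bsub>R\<^esub> \<odot>\<^bsub>M\<^esub> x = \<zero>\<^bsub>M\<^esub>"
 using lsmult_l_distr[of "\<zero>\<^bsub>R\<^esub>" "\<zero>\<^bsub>R\<^esub>" x] lsmult_closed[of "\<zero>\<^bsub>R\<^esub>" x]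
 by (metis M.add.l_cancel_one' R.l_zero R.zero_closed)

lemma lsmult_zero_right: "a \<in> carrier R ==> a \<odot>\<^bsub>M\<^esub> \<zero>\<^bsub>M\<^esub> = \<zero>\<^bsub>M\<^esub>"
 using lsmult_r_distr[of a "\<zero>\<^bsub>M\<^esub>" "\<zero>\<^bsub>M\<^esub>"] lsmult_closed[of a "\<zero>\<^bsub>M\<^esub>"]
 by (metis M.add.l_cancel_one' M.l_zero M.zero_closed)

lemma lsmult_minus_left: "a \<in> carrier R ==> x \<in> carrier M ==> (\<ominus>\<^bsub>R\<^esub> a) \<odot>\<^bsub>M\<^esub> x = \<ominus>\<^bsub>M\<^esub> (a \<odot>\<^bsub>M\<^esub> x)"
 using lsmult_l_distr[of "\<ominus>\<^bsub>R\<^esub> a" a x] lsmult_zero_left lsmult_closed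
 by (metis M.minus_equality R.a_inv_closed R.l_neg)

lemma submoduleI:
 assumes "H \<subseteq> carrier M" "\<zero>\<^bsub>M\<^esub> \<in> H"
  and "\<And>x y. x \<in> H ==> y \<in> H ==> x \<oplus>\<^bsub>M\<^esub> y \<in> H"
  and "\<And>a x. a \<in> carrier R ==> x \<in> H ==> a \<odot>\<^bsub>M\<^esub> x \<in> H"
 shows "submodule H R M"
proof (intro submodule.intro subgroup.intro submodule_axioms.intro)
 fix x assume x: "x \<in> H"
 have "\<ominus>\<^bsub>M\<^esub> x = (\<ominus>\<^bsub>R\<^esub> \<one>\<^bsub>R\<^esub>) \<odot>\<^bsub>M\<^esub> x"
  using lsmult_minus_left[of "\<one>\<^bsub>R\<^esub>" x] x assms(1) lsmult_one by auto
 thus "inv\<^bsub>add_monoid M\<^esub> x \<in> H" using assms(4)[OF _ x] by (simp add: a_inv_def)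
qed (use assms in auto)

lemma submoduleD:
 assumes "submodule H R M"
 shows "H \<subseteq> carrier M" "\<zero>\<^bsub>M\<^esub> \<in> H" "x \<in> H ==> y \<in> H ==> x \<oplus>\<^bsub>M\<^esub> y \<in> H"
  "a \<in> carrier R ==> x \<in> H ==> a \<odot>\<^bsub>M\<^esub> x \<in> H"
proof -
 interpret submodule H R M by fact
 show "H \<subseteq> carrier M" "\<zero>\<^bsub>M\<^esub> \<in> H" "x \<in> H ==> y \<in> H ==> x \<oplus>\<^bsub>M\<^esub> y \<in> H"
  "a \<in> carrier R ==> x \<in> H ==> a \<odot>\<^bsub>M\<^esub> x \<in> H"
  using subset one_closed m_closed smult_closed by auto
qed

end

lemma module_homD:
 assumes "f \<in> module_hom R M N"
 shows "x \<in> carrier M ==> f x \<in> carrier N"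
  "x \<in> carrier M ==> y \<in> carrier M ==> f (x \<oplus>\<^bsub>M\<^esub> y) = f x \<oplus>\<^bsub>N\<^esub> f y"
  "r \<in> carrier R ==> x \<in> carrier M ==> f (r \<odot>\<^bsub>M\<^esub> x) = r \<odot>\<^bsub>N\<^esub> f x"
 using assms by (auto simp: module_hom_def)

lemma module_homI:
 assumes "\<And>x. x \<in> carrier M ==> f x \<in> carrier N"
  "\<And>x y. x \<in> carrier M ==> y \<in> carrier M ==> f (x \<oplus>\<^bsub>M\<^esub> y) = f x \<oplus>\<^bsub>N\<^esub> f y"
  "\<And>r x. r \<in> carrier R ==> x \<in> carrier M ==> f (r \<odot>\<^bsub>M\<^esub> x) = r \<odot>\<^bsub>N\<^esub> f x"
 shows "f \<in> module_hom R M N"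
 using assms by (auto simp: module_hom_def)

lemma module_hom_comp:
 "f \<in> module_hom R M N ==> g \<in> module_hom R N Q ==> g o f \<in> module_hom R M Q"
 by (auto simp: module_hom_def Pi_iff)

lemma module_hom_inv_into:
 assumes f: "f \<in> module_hom R M N" and b: "bij_betw f (carrier M) (carrier N)"
  and M: "left_module R M"
 shows "inv_into (carrier M) f \<in> module_hom R N M"
  and "bij_betw (inv_into (carrier M) f) (carrier N) (carrier M)"
proof -
 interpret left_module R M by fact
 let ?g = "inv_into (carrier M) f"
 show g: "bij_betw ?g (carrier N) (carrier M)" by (rule bij_betw_inv_into[OF b])
 have gc: "?g y \<in> carrier M" "f (?g y) = y" if "y \<in> carrier N" for y
  using that b bij_betwE[OF g] bij_betw_inv_into_right[OF b] by auto
 have gf: "?g (f x) = x" if "x \<in> carrier M" for x using bij_betw_inv_into_left[OF b that] .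
 show "?g \<in> module_hom R N M"
 proof (rule module_homI)
  fix x y assume xy: "x \<in> carrier N" "y \<in> carrier N"
  show "?g (x \<oplus>\<^bsub>N\<^esub> y) = ?g x \<oplus>\<^bsub>M\<^esub> ?g y"
   using module_homD(2)[OF f, of "?g x" "?g y"] gc[OF xy(1)] gc[OF xy(2)] gf[of "?g x \<oplus>\<^bsub>M\<^esub> ?g y"] by simp
 next
  fix r x assume rx: "r \<in> carrier R" "x \<in> carrier N"
  show "?g (r \<odot>\<^bsub>N\<^esub> x) = r \<odot>\<^bsub>M\<^esub> ?g x"
   using module_homD(3)[OF f rx(1), of "?g x"] gc[OF rx(2)] gf[of "r \<odot>\<^bsub>M\<^esub> ?g x"]
    lsmult_closed[OF rx(1), of "?g x"] by simp
 qed (use gc in auto)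
qed

text \<open>Additivity and compatibility with scalars and generators suffice for a homomorphism and,
 likewise, for a submodule.\<close>

lemma hecke_module_homI:
 assumes M: "left_module (HA n) M" and N: "left_module (HA n) N"
  and cl: "\<And>x. x \<in> carrier M ==> f x \<in> carrier N"
  and ad: "\<And>x y. x \<in> carrier M ==> y \<in> carrier M ==> f (x \<oplus>\<^bsub>M\<^esub> y) = f x \<oplus>\<^bsub>N\<^esub> f y"
  and sc: "\<And>c x. x \<in> carrier M ==> f (hecke_scalar n c \<odot>\<^bsub>M\<^esub> x) = hecke_scalar n c \<odot>\<^bsub>N\<^esub> f x"
  and ge: "\<And>i x. i \<in> {1..<n} ==> x \<in> carrier M ==> f (hecke_gen n i \<odot>\<^bsub>M\<^esub> x) = hecke_gen n i \<odot>\<^bsub>N\<^esub> f x"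
 shows "f \<in> module_hom (HA n) M N"
proof (rule module_homI[OF cl ad])
 interpret M: left_module "HA n" M by fact
 interpret N: left_module "HA n" N by fact
 fix r x assume r: "r \<in> carrier (HA n)" and x: "x \<in> carrier M"
 show "f (r \<odot>\<^bsub>M\<^esub> x) = r \<odot>\<^bsub>N\<^esub> f x" using r
 proof (induction rule: hecke_induct)
  case (scalar c)
  thus ?case using sc x by blast
 next
  case (gen i h)
  note g = hecke_gen_closed[OF gen.hyps(1)]
  have "f ((hecke_gen n i \<otimes>\<^bsub>HA n\<^esub> h) \<odot>\<^bsub>M\<^esub> x) = f (hecke_gen n i \<odot>\<^bsub>M\<^esub> (h \<odot>\<^bsub>M\<^esub> x))"
   using M.lsmult_assoc[OF g gen.hyps(2) x] by simp
  also have "\<dots> = hecke_gen n i \<odot>\<^bsub>N\<^esub> (h \<odot>\<^bsub>N\<^esub> f x)"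
   using ge[OF gen.hyps(1) M.lsmult_closed[OF gen.hyps(2) x]] gen.IH by simp
  also have "\<dots> = (hecke_gen n i \<otimes>\<^bsub>HA n\<^esub> h) \<odot>\<^bsub>N\<^esub> f x"
   using N.lsmult_assoc[OF g gen.hyps(2) cl[OF x]] by simp
  finally show ?case .
 next
  case (add h h')
  thus ?case using x cl by (simp add: M.lsmult_l_distr N.lsmult_l_distr ad M.lsmult_closed)
 qed
qed auto

lemma hecke_submoduleI:
 assumes M: "left_module (HA n) M"
  and K: "K \<subseteq> carrier M" "\<zero>\<^bsub>M\<^esub> \<in> K"
  and ad: "\<And>x y. x \<in> K ==> y \<in> K ==> x \<oplus>\<^bsub>M\<^esub> y \<in> K"
  and sc: "\<And>c x. x \<in> K ==> hecke_scalar n c \<odot>\<^bsub>M\<^esub> x \<in> K"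
  and ge: "\<And>i x. i \<in> {1..<n} ==> x \<in> K ==> hecke_gen n i \<odot>\<^bsub>M\<^esub> x \<in> K"
 shows "submodule K (HA n) M"
proof -
 interpret M: left_module "HA n" M by fact
 have "r \<odot>\<^bsub>M\<^esub> x \<in> K" if r: "r \<in> carrier (HA n)" and x: "x \<in> K" for r x
  using r
 proof (induction rule: hecke_induct)
  case (gen i h)
  have "x \<in> carrier M" using x K(1) by blast
  thus ?case
   using M.lsmult_assoc[OF hecke_gen_closed[OF gen.hyps(1)] gen.hyps(2)] ge[OF gen.hyps(1) gen.IH] by simp
 next
  case (add h h')
  have "x \<in> carrier M" using x K(1) by blast
  thus ?case using M.lsmult_l_distr[OF add.hyps(1,2)] ad[OF add.IH] by simp
 qed (rule sc[OF x])
 thus ?thesis using M.submoduleI[OF K ad] by blast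
qed

section \<open>Modules with a basis of permutations\<close>

text \<open>This common feature of weak order intervals and of the sets \<open>\<Sigma>\<^sub>L(P)\<close> is all that the action requires.\<close>

definition weakly_convex :: "nat => (nat => nat) set => bool" where
 "weakly_convex n S \<longleftrightarrow> S \<subseteq> perms n \<and> (\<forall>w\<in>S. \<forall>r\<in>S. \<forall>u. u permutes {1..n} -->
   inversions n w \<subseteq> inversions n u --> inversions n u \<subseteq> inversions n r --> u \<in> S)"

lemma weakly_convexD:
 assumes "weakly_convex n S"
 shows "w \<in> S ==> w permutes {1..n}" "finite S"
 using assms finite_permutations[of "{1..n}"] finite_subset
 by (auto simp: weakly_convex_def)

definition restrict_vec :: "(nat => nat) set => pvec => pvec" where
 "restrict_vec S v = (\<lambda>w. if w \<in> S then v w else 0)"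

text \<open>The generators on the span of all permutations, where no basis vector is killed.\<close>

definition full_act :: "nat => nat => pvec => pvec" where
 "full_act n i v = (\<lambda>w. if w permutes {1..n} \<and> i \<in> Des_L n w then v w + v (tr i o w) else 0)"

text \<open>The coefficient of \<open>w\<close> in \<open>\<pi>\<^sub>i v\<close> collects the contributions of \<open>w\<close> and \<open>s\<^sub>i w\<close>.\<close>

lemma gen_act_apply:
 assumes S: "S \<subseteq> perms n" and i: "i \<in> {1..<n}"
 shows "gen_act n S i v w = (if w \<in> S \<and> i \<in> Des_L n w
  then v w + (if tr i o w \<in> S then v (tr i o w) else 0) else 0)"
proof -
 have fin: "finite S" using S finite_permutations[of "{1..n}"] finite_subset by blast
 have eq: "w = tr i o u \<longleftrightarrow> u = tr i o w" for u
  using simple_transp_invol(2) by metis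
 have "v u * gen_act_basis n S i u w =
   (if u = w then if i \<in> Des_L n w then v w else 0 else 0) +
   (if u = tr i o w then if w \<in> S \<and> i \<in> Des_L n w then v (tr i o w) else 0 else 0)"
  if u: "u \<in> S" for u
 proof (cases "i \<in> Des_L n u")
  case True
  have "\<not> (u = tr i o w \<and> w \<in> S \<and> i \<in> Des_L n w)"
   using Des_L_simple_transp_same[of w n i] S True i by blast
  thus ?thesis using True by (auto simp: gen_act_basis_def basis_vec_def)
 next
  case False
  have "i \<in> Des_L n (tr i o u)"
   using Des_L_simple_transp_same[of u n i] S u False i by blast
  thus ?thesis using False eq[of u] by (auto simp: gen_act_basis_def basis_vec_def)
 qed
 hence "gen_act n S i v w = (\<Sum>u\<in>S. (if u = w then if i \<in> Des_L n w then v w else 0 else 0) +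
   (if u = tr i o w then if w \<in> S \<and> i \<in> Des_L n w then v (tr i o w) else 0 else 0))"
  unfolding gen_act_def by (rule sum.cong[OF refl])
 also have "\<dots> = (if w \<in> S then if i \<in> Des_L n w then v w else 0 else 0) +
   (if tr i o w \<in> S then if w \<in> S \<and> i \<in> Des_L n w then v (tr i o w) else 0 else 0)"
  unfolding sum.distrib sum.delta[OF fin] ..
 finally show ?thesis by simp
qed

lemma Des_L_braid_swap:
 assumes w: "w permutes {1..n}" and i: "i \<in> {1..<n}" "Suc i \<in> {1..<n}"
 shows "i \<in> Des_L n (tr (Suc i) o (tr i o w)) \<longleftrightarrow> Suc i \<in> Des_L n w"
  and "Suc i \<in> Des_L n (tr i o (tr (Suc i) o w)) \<longleftrightarrow> i \<in> Des_L n w"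
proof -
 have 1: "tr i (Suc (Suc i)) = Suc (Suc i)" "tr (Suc i) i = i"
  by (auto simp: simple_transp_other)
 note p = tr_comp_permutes[OF i(1) w] tr_comp_permutes[OF i(2) w]
 show "i \<in> Des_L n (tr (Suc i) o (tr i o w)) \<longleftrightarrow> Suc i \<in> Des_L n w"
  unfolding Des_L_comp_iff[OF p(1) i(2)] Des_L_iff[OF w] inv_simple_transp_comp[OF w]
  using i 1 by simp
 show "Suc i \<in> Des_L n (tr i o (tr (Suc i) o w)) \<longleftrightarrow> i \<in> Des_L n w"
  unfolding Des_L_comp_iff[OF p(2) i(1)] Des_L_iff[OF w] inv_simple_transp_comp[OF w]
  using i 1 by simp
qed

lemma full_act_zero: "w permutes {1..n} ==> i \<notin> Des_L n w ==> full_act n i v w = 0"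
 by (simp add: full_act_def)

lemma full_act_desc: "w permutes {1..n} ==> i \<in> Des_L n w ==>
 full_act n i v w = v w + v (tr i o w)"
 by (simp add: full_act_def)

lemma full_act_nonperm: "\<not> w permutes {1..n} ==> full_act n i v w = 0"
 by (simp add: full_act_def)

lemma full_act_idem: "full_act n i (full_act n i v) = full_act n i v"
proof
 fix w
 show "full_act n i (full_act n i v) w = full_act n i v w"
 proof (cases "w permutes {1..n} \<and> i \<in> Des_L n w")
  case True
  hence i: "i \<in> {1..<n}" using Des_L_subset by blast
  have "full_act n i v (tr i o w) = 0"
   using full_act_zero[OF tr_comp_permutes[OF i]] Des_L_simple_transp_same[OF _ i] True by blast
  thus ?thesis using True full_act_desc by simp
 next
  case False
  thus ?thesis using full_act_zero full_act_nonperm by metis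
 qed
qed

lemma full_act_commute:
 assumes ij: "i \<in> {1..<n}" "j \<in> {1..<n}" "i + 2 \<le> j"
 shows "full_act n i (full_act n j v) = full_act n j (full_act n i v)"
proof
 fix w
 show "full_act n i (full_act n j v) w = full_act n j (full_act n i v) w"
 proof (cases "w permutes {1..n}")
  case True
  note p = tr_comp_permutes[OF ij(1) True] tr_comp_permutes[OF ij(2) True]
  have D: "j \<in> Des_L n (tr i o w) \<longleftrightarrow> j \<in> Des_L n w"
   "i \<in> Des_L n (tr j o w) \<longleftrightarrow> i \<in> Des_L n w"
   using Des_L_commute[OF True] ij by auto
  have c: "tr i o (tr j o w) = tr j o (tr i o w)"
   by (rule simple_transp_commute[OF ij(3)])
  show ?thesis
   using True p D c unfolding full_act_def by (cases "i \<in> Des_L n w"; cases "j \<in> Des_L n w") simp_all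
 qed (simp add: full_act_def)
qed

lemma full_act_braid:
 assumes i: "i \<in> {1..<n}" and j: "Suc i \<in> {1..<n}"
 shows "full_act n i (full_act n (Suc i) (full_act n i v)) =
  full_act n (Suc i) (full_act n i (full_act n (Suc i) v))"
proof
 fix w
 let ?a = "full_act n i" and ?b = "full_act n (Suc i)"
 let ?s = "\<lambda>r. tr i o r" and ?t = "\<lambda>r. tr (Suc i) o r"
 show "?a (?b (?a v)) w = ?b (?a (?b v)) w"
 proof (cases "w permutes {1..n}")
  case w: True
  note s = tr_comp_permutes[OF i] and t = tr_comp_permutes[OF j]
  note ps = s[OF w] and pt = t[OF w]
  note pts = t[OF ps] and pst = s[OF pt]
  have ns: "i \<notin> Des_L n (?s w)" if "i \<in> Des_L n w" using Des_L_simple_transp_same[OF w i] that by blast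
  have nt: "Suc i \<notin> Des_L n (?t w)" if "Suc i \<in> Des_L n w"
   using Des_L_simple_transp_same[OF w j] that by blast
  note sw = Des_L_braid_swap[OF w i j]
  consider "i \<in> Des_L n w" "Suc i \<in> Des_L n w" | "i \<in> Des_L n w" "Suc i \<notin> Des_L n w"
   | "i \<notin> Des_L n w" "Suc i \<in> Des_L n w" | "i \<notin> Des_L n w" "Suc i \<notin> Des_L n w" by blast
  thus ?thesis
  proof cases
   case 1
   note D = Des_L_braid[OF w 1]
   have "?a (?b (?a v)) w = v w + v (?s w) + (v (?t w) + v (?s (?t w))) +
     (v (?t (?s w)) + v (?s (?t (?s w))))"
    by (simp only: full_act_desc[OF w 1(1)] full_act_desc[OF w 1(2)] full_act_desc[OF ps D(1)]
      full_act_desc[OF pts D(2)] full_act_desc[OF pt D(3)] full_act_zero[OF ps ns[OF 1(1)]] add_0)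
   moreover have "?b (?a (?b v)) w = v w + v (?t w) + (v (?s w) + v (?t (?s w))) +
     (v (?s (?t w)) + v (?t (?s (?t w))))"
    by (simp only: full_act_desc[OF w 1(1)] full_act_desc[OF w 1(2)] full_act_desc[OF ps D(1)]
      full_act_desc[OF pst D(4)] full_act_desc[OF pt D(3)] full_act_zero[OF pt nt[OF 1(2)]] add_0)
   ultimately show ?thesis using simple_transp_braid[of i w] by (simp only: ac_simps)
  next
   case 2
   have "?b (?a v) (?s w) = 0"
   proof (cases "Suc i \<in> Des_L n (?s w)")
    case True
    thus ?thesis using full_act_desc[OF ps True] full_act_zero[OF ps ns[OF 2(1)]]
     full_act_zero[OF pts] sw(1) 2(2) by simp
   qed (rule full_act_zero[OF ps])
   thus ?thesis
    by (simp only: full_act_desc[OF w 2(1)] full_act_zero[OF w 2(2)] add_0)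
  next
   case 3
   have "?a (?b v) (?t w) = 0"
   proof (cases "i \<in> Des_L n (?t w)")
    case True
    thus ?thesis using full_act_desc[OF pt True] full_act_zero[OF pt nt[OF 3(2)]]
     full_act_zero[OF pst] sw(2) 3(1) by simp
   qed (rule full_act_zero[OF pt])
   thus ?thesis
    by (simp only: full_act_desc[OF w 3(2)] full_act_zero[OF w 3(1)] add_0)
  next
   case 4
   show ?thesis by (simp only: full_act_zero[OF w 4(1)] full_act_zero[OF w 4(2)])
  qed
 qed (simp add: full_act_def)
qed

text \<open>For a convex set the action is induced from that on all permutations: the span of
 everything above the set is a submodule, and what lies outside the set is a submodule of it.\<close>

definition supported_above :: "nat => (nat => nat) set => pvec => bool" where
 "supported_above n S v \<longleftrightarrow> (\<forall>w. v w \<noteq> 0 --> w permutes {1..n} \<and> (\<exists>d\<in>S. inversions n d \<subseteq> inversions n w))"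

lemma supported_above_full_act:
 assumes v: "supported_above n S v" and i: "i \<in> {1..<n}"
 shows "supported_above n S (full_act n i v)"
 unfolding supported_above_def
proof (intro allI impI)
 fix w assume "full_act n i v w \<noteq> 0"
 hence w: "w permutes {1..n}" "i \<in> Des_L n w" and "v w \<noteq> 0 \<or> v (tr i o w) \<noteq> 0"
  by (auto simp: full_act_def split: if_splits)
 then obtain d where "d \<in> S" "inversions n d \<subseteq> inversions n w \<or>
   inversions n d \<subseteq> inversions n (tr i o w)"
  using v unfolding supported_above_def by blast
 thus "w permutes {1..n} \<and> (\<exists>d\<in>S. inversions n d \<subseteq> inversions n w)"
  using w inversions_down(1)[OF w] by blast
qed

lemma restrict_full_act:
 assumes S: "weakly_convex n S" and v: "supported_above n S v" and i: "i \<in> {1..<n}"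
 shows "gen_act n S i (restrict_vec S v) = restrict_vec S (full_act n i v)"
proof
 fix w
 have sub: "S \<subseteq> perms n" using S by (simp add: weakly_convex_def)
 show "gen_act n S i (restrict_vec S v) w = restrict_vec S (full_act n i v) w"
 proof (cases "w \<in> S \<and> i \<in> Des_L n w")
  case True
  hence w: "w permutes {1..n}" using sub by blast
  have "v (tr i o w) = 0" if "tr i o w \<notin> S"
  proof (rule ccontr)
   assume "v (tr i o w) \<noteq> 0"
   then obtain d where "d \<in> S" "inversions n d \<subseteq> inversions n (tr i o w)"
    "tr i o w permutes {1..n}" using v unfolding supported_above_def by blast
   moreover have "inversions n (tr i o w) \<subseteq> inversions n w"
    using inversions_down(1)[OF w] True by blast
   ultimately show False using S True that unfolding weakly_convex_def by blast
  qed
  thus ?thesis using True w by (auto simp: gen_act_apply[OF sub i] restrict_vec_def full_act_def)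
 next
  case False
  thus ?thesis by (auto simp: gen_act_apply[OF sub i] restrict_vec_def full_act_def)
 qed
qed

lemma gen_act_restrict:
 assumes "S \<subseteq> perms n" "i \<in> {1..<n}"
 shows "gen_act n S i v = gen_act n S i (restrict_vec S v)"
 by (rule ext) (simp add: gen_act_apply[OF assms] restrict_vec_def)

lemma supported_above_restrict:
 assumes "S \<subseteq> perms n" shows "supported_above n S (restrict_vec S v)"
 using assms by (auto simp: supported_above_def restrict_vec_def)

text \<open>The relations hold on the span of all permutations and descend to the subquotient.\<close>

lemma gen_act_relations:
 assumes S: "weakly_convex n S" and i: "i \<in> {1..<n}"
 shows "gen_act n S i (gen_act n S i v) = gen_act n S i v"
  and "j \<in> {1..<n} ==> i + 2 \<le> j ==> gen_act n S i (gen_act n S j v) = gen_act n S j (gen_act n S i v)"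
  and "Suc i \<in> {1..<n} ==> gen_act n S i (gen_act n S (Suc i) (gen_act n S i v)) =
   gen_act n S (Suc i) (gen_act n S i (gen_act n S (Suc i) v))"
proof -
 have sub: "S \<subseteq> perms n" using S by (simp add: weakly_convex_def)
 let ?r = "restrict_vec S"
 have rr: "?r (?r v) = ?r v" by (auto simp: restrict_vec_def)
 note sa = supported_above_restrict[OF sub, of v]
 have g1: "gen_act n S k v = ?r (full_act n k (?r v))" if "k \<in> {1..<n}" for k
  using gen_act_restrict[OF sub that, of v] restrict_full_act[OF S sa that] rr by simp
 have g2: "gen_act n S l (gen_act n S k v) = ?r (full_act n l (full_act n k (?r v)))"
  if "k \<in> {1..<n}" "l \<in> {1..<n}" for k l
  using g1[OF that(1)] restrict_full_act[OF S supported_above_full_act[OF sa that(1)] that(2)] by simp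
 have g3: "gen_act n S m (gen_act n S l (gen_act n S k v)) = ?r (full_act n m (full_act n l (full_act n k (?r v))))"
  if "k \<in> {1..<n}" "l \<in> {1..<n}" "m \<in> {1..<n}" for k l m
  using g2[OF that(1,2)] restrict_full_act[OF S supported_above_full_act[OF
   supported_above_full_act[OF sa that(1)] that(2)] that(3)] by simp
 show "gen_act n S i (gen_act n S i v) = gen_act n S i v" using g1 g2 i full_act_idem by simp
 show "j \<in> {1..<n} ==> i + 2 \<le> j ==> gen_act n S i (gen_act n S j v) = gen_act n S j (gen_act n S i v)"
  using g2 i full_act_commute[OF i] by simp
 show "Suc i \<in> {1..<n} ==> gen_act n S i (gen_act n S (Suc i) (gen_act n S i v)) =
   gen_act n S (Suc i) (gen_act n S i (gen_act n S (Suc i) v))"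
  using g3 i full_act_braid[OF i] by simp
qed

text \<open>The representation is obtained by applying the universal property to this endomorphism algebra.\<close>

definition pvec_end :: "(pvec => pvec) ring" where
 "pvec_end = \<lparr>carrier = {F. (\<forall>u v. F (\<lambda>w. u w + v w) = (\<lambda>w. F u w + F v w)) \<and>
    (\<forall>c v. F (\<lambda>w. c * v w) = (\<lambda>w. c * F v w))},
   mult = (o), one = id, zero = (\<lambda>v w. 0), add = (\<lambda>F G v w. F v w + G v w)\<rparr>"

lemma pvec_end_simps:
 "mult pvec_end F G = F o G" "one pvec_end = id" "add pvec_end F G = (\<lambda>v w. F v w + G v w)"
 by (simp_all add: pvec_end_def)

lemma complex_algebra_pvec_end: "complex_algebra pvec_end (\<lambda>c v w. c * v w)"
proof -
 have "ring pvec_end"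
 proof (rule ringI)
  show "abelian_group pvec_end"
  proof (rule abelian_groupI)
   fix F assume "F \<in> carrier pvec_end"
   hence "(\<lambda>v w. - F v w) \<in> carrier pvec_end" by (simp add: pvec_end_def)
   moreover have "(\<lambda>v w. - F v w) \<oplus>\<^bsub>pvec_end\<^esub> F = \<zero>\<^bsub>pvec_end\<^esub>" by (simp add: pvec_end_def)
   ultimately show "\<exists>G\<in>carrier pvec_end. G \<oplus>\<^bsub>pvec_end\<^esub> F = \<zero>\<^bsub>pvec_end\<^esub>" by blast
  qed (simp_all add: pvec_end_def algebra_simps)
  show "Group.monoid pvec_end"
   by (rule Group.monoidI) (auto simp: pvec_end_def)
 qed (auto simp: pvec_end_def)
 thus ?thesis
  by (intro complex_algebra.intro complex_algebra_axioms.intro)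
   (auto simp: pvec_end_def algebra_simps fun_eq_iff)
qed

lemma gen_act_linear:
 "gen_act n S i (\<lambda>w. u w + v w) = (\<lambda>w. gen_act n S i u w + gen_act n S i v w)"
 "gen_act n S i (\<lambda>w. c * v w) = (\<lambda>w. c * gen_act n S i v w)"
 by (simp_all add: gen_act_def distrib_right sum.distrib sum_distrib_left mult.assoc)

lemma hecke_rep_gen_act:
 assumes "weakly_convex n S"
 shows "hecke_rep pvec_end (\<lambda>c v w. c * v w) n (gen_act n S)"
proof -
 interpret complex_algebra pvec_end "\<lambda>c v w. c * v w" by (rule complex_algebra_pvec_end)
 have c: "gen_act n S i \<in> carrier pvec_end" for i by (simp add: pvec_end_def gen_act_linear)
 show ?thesis
 proof
  fix i j assume i: "i \<in> {1..<n}"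
  show "gen_act n S i \<in> carrier pvec_end" by (rule c)
  show "gen_act n S i \<otimes>\<^bsub>pvec_end\<^esub> gen_act n S i = gen_act n S i"
   using gen_act_relations(1)[OF assms i] by (auto simp: pvec_end_def)
  show "gen_act n S i \<otimes>\<^bsub>pvec_end\<^esub> gen_act n S j = gen_act n S j \<otimes>\<^bsub>pvec_end\<^esub> gen_act n S i"
   if "j \<in> {1..<n}" "i + 2 \<le> j"
   using gen_act_relations(2)[OF assms i that] by (auto simp: pvec_end_def)
  show "gen_act n S i \<otimes>\<^bsub>pvec_end\<^esub> (gen_act n S (Suc i) \<otimes>\<^bsub>pvec_end\<^esub> gen_act n S i) =
   gen_act n S (Suc i) \<otimes>\<^bsub>pvec_end\<^esub> (gen_act n S i \<otimes>\<^bsub>pvec_end\<^esub> gen_act n S (Suc i))"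
   if "Suc i \<in> {1..<n}"
   using gen_act_relations(3)[OF assms i that] by (auto simp: pvec_end_def)
 qed
qed

lemma free_act_superset:
 assumes "finite W" "{w. f w \<noteq> 0} \<subseteq> W"
 shows "free_act n S f v u = (\<Sum>w\<in>W. f w * foldr (gen_act n S) w v u)"
 unfolding free_act_def by (rule sum.mono_neutral_left) (use assms in auto)

lemma pm_simps:
 "carrier (perm_module n S) = {v. \<forall>w. w \<notin> S --> v w = 0}"
 "zero (perm_module n S) = (\<lambda>w. 0)"
 "add (perm_module n S) = (\<lambda>u v w. u w + v w)"
 by (simp_all add: perm_module_def)

lemma perm_module_representation:
 assumes S: "weakly_convex n S"
 obtains L where "L \<in> ring_hom (HA n) pvec_end"
  "\<And>h v. h \<in> carrier (HA n) ==> h \<odot>\<^bsub>perm_module n S\<^esub> v = L h v"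
  "\<And>i. i \<in> {1..<n} ==> L (hecke_gen n i) = gen_act n S i"
  "\<And>c. L (hecke_scalar n c) = (\<lambda>v z. c * v z)"
proof -
 interpret R: hecke_rep pvec_end "\<lambda>c v z. c * v z" n "gen_act n S" by (rule hecke_rep_gen_act[OF S])
 let ?E = "free_act n S"
 have add: "?E (\<lambda>w. f w + g w) = ?E f \<oplus>\<^bsub>pvec_end\<^esub> ?E g"
  if f: "f \<in> carrier (free_alg n)" and g: "g \<in> carrier (free_alg n)" for f g
 proof (intro ext)
  fix v z
  let ?W = "{w. f w \<noteq> 0} \<union> {w. g w \<noteq> 0}"
  have W: "finite ?W" using f g by (simp add: free_alg_simps(1))
  have sub: "{w. f w + g w \<noteq> 0} \<subseteq> ?W" by auto
  have "?E (\<lambda>w. f w + g w) v z = ?E f v z + ?E g v z"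
   using free_act_superset[OF W, of f n S v z] free_act_superset[OF W, of g n S v z]
    free_act_superset[OF W sub, of n S v z]
   by (auto simp: distrib_right sum.distrib)
  thus "?E (\<lambda>w. f w + g w) v z = (?E f \<oplus>\<^bsub>pvec_end\<^esub> ?E g) v z" by (simp add: pvec_end_def)
 qed
 have word: "R.word_elt u v = foldr (gen_act n S) u v" for u v
  by (induction u) (simp_all add: pvec_end_simps)
 have trm: "?E (term_of c u) = (\<lambda>v z. c * v z) \<otimes>\<^bsub>pvec_end\<^esub> R.word_elt u" if "set u \<subseteq> {1..<n}" for c u
 proof (intro ext)
  fix v z
  have "?E (term_of c u) v z = c * foldr (gen_act n S) u v z"
   by (subst free_act_superset[of "{u}"]) (auto simp: term_of_apply)
  thus "?E (term_of c u) v z = ((\<lambda>v z. c * v z) \<otimes>\<^bsub>pvec_end\<^esub> R.word_elt u) v z"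
   by (simp add: pvec_end_simps word)
 qed
 have "h \<odot>\<^bsub>perm_module n S\<^esub> v = R.lift ?E h v" if hh: "h \<in> carrier (HA n)" for h v
 proof -
  obtain f where f: "f \<in> carrier (free_alg n)" "h = hecke_class n f" using hh by (rule hecke_class_cases)
  have "(\<lambda>f. ?E f v) ` h = (\<lambda>F. F v) ` (?E ` h)" by (simp add: image_image)
  also have "?E ` h = {?E f}" unfolding f(2) by (rule R.E_hecke_class[OF add trm f(1)])
  also have "(\<lambda>F. F v) ` {?E f} = {?E f v}" by blast
  finally have "h \<odot>\<^bsub>perm_module n S\<^esub> v = ?E f v" by (simp add: perm_module_def)
  moreover have "R.lift ?E h = ?E f" unfolding f(2) by (rule R.lift_hecke_class[OF add trm f(1)])
  ultimately show ?thesis by simp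
 qed
 thus ?thesis
  using that[OF R.lift_hom[OF add trm]] R.lift_gen[OF add trm] R.lift_scalar[OF add trm] by blast
qed

lemma gen_act_closed:
 "S \<subseteq> perms n ==> i \<in> {1..<n} ==> gen_act n S i v \<in> carrier (perm_module n S)"
 by (simp add: pm_simps gen_act_apply)

theorem perm_module_action:
 assumes S: "weakly_convex n S"
 shows "left_module (HA n) (perm_module n S)"
  and "i \<in> {1..<n} ==> hecke_gen n i \<odot>\<^bsub>perm_module n S\<^esub> v = gen_act n S i v"
  and "hecke_scalar n c \<odot>\<^bsub>perm_module n S\<^esub> v = (\<lambda>w. c * v w)"
proof -
 let ?M = "perm_module n S"
 have sub: "S \<subseteq> perms n" using S by (simp add: weakly_convex_def)
 obtain L where L: "L \<in> ring_hom (HA n) pvec_end"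
  "\<And>h v. h \<in> carrier (HA n) ==> h \<odot>\<^bsub>?M\<^esub> v = L h v"
  "\<And>i. i \<in> {1..<n} ==> L (hecke_gen n i) = gen_act n S i"
  "\<And>c. L (hecke_scalar n c) = (\<lambda>v w. c * v w)" using perm_module_representation[OF S] by blast
 interpret R: ring "HA n" by (rule ring_hecke_alg)
 have ag: "abelian_group ?M"
 proof (rule abelian_groupI)
  fix v assume "v \<in> carrier ?M"
  hence "(\<lambda>w. - v w) \<in> carrier ?M" by (simp add: pm_simps)
  moreover have "(\<lambda>w. - v w) \<oplus>\<^bsub>?M\<^esub> v = \<zero>\<^bsub>?M\<^esub>" by (simp add: pm_simps)
  ultimately show "\<exists>u\<in>carrier ?M. u \<oplus>\<^bsub>?M\<^esub> v = \<zero>\<^bsub>?M\<^esub>" by blast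
 qed (simp_all add: pm_simps algebra_simps)
 have cl: "L h v \<in> carrier ?M" if "h \<in> carrier (HA n)" "v \<in> carrier ?M" for h v
  using that(1)
 proof (induction rule: hecke_induct)
  case (scalar c)
  thus ?case using that(2) by (simp add: L pm_simps)
 next
  case (gen i h)
  thus ?case using gen_act_closed[OF sub gen.hyps(1), of "L h v"]
   by (simp add: ring_hom_mult[OF L(1)] hecke_gen_closed L(3)) (simp add: pvec_end_def)
 next
  case (add h h')
  thus ?case by (simp add: ring_hom_add[OF L(1)]) (simp add: pvec_end_def pm_simps)
 qed
 have lin: "L h (\<lambda>w. u w + v w) = (\<lambda>w. L h u w + L h v w)" if "h \<in> carrier (HA n)" for h u v
  using ring_hom_closed[OF L(1) that] by (simp add: pvec_end_def)
 show "left_module (HA n) ?M"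
 proof (intro left_module.intro left_module_axioms.intro ring_hecke_alg ag)
  fix a b x y
  assume a: "a \<in> carrier (HA n)" and x: "x \<in> carrier ?M"
  show "a \<odot>\<^bsub>?M\<^esub> x \<in> carrier ?M" using cl[OF a x] L(2)[OF a] by simp
  show "(a \<oplus>\<^bsub>HA n\<^esub> b) \<odot>\<^bsub>?M\<^esub> x = a \<odot>\<^bsub>?M\<^esub> x \<oplus>\<^bsub>?M\<^esub> b \<odot>\<^bsub>?M\<^esub> x" if b: "b \<in> carrier (HA n)"
   using a b by (simp add: L(2) ring_hom_add[OF L(1)] pm_simps) (simp add: pvec_end_def)
  show "a \<odot>\<^bsub>?M\<^esub> (x \<oplus>\<^bsub>?M\<^esub> y) = a \<odot>\<^bsub>?M\<^esub> x \<oplus>\<^bsub>?M\<^esub> a \<odot>\<^bsub>?M\<^esub> y" if "y \<in> carrier ?M"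
   using a by (simp add: L(2) pm_simps lin)
  show "(a \<otimes>\<^bsub>HA n\<^esub> b) \<odot>\<^bsub>?M\<^esub> x = a \<odot>\<^bsub>?M\<^esub> (b \<odot>\<^bsub>?M\<^esub> x)" if b: "b \<in> carrier (HA n)"
   using a b by (simp add: L(2) ring_hom_mult[OF L(1)]) (simp add: pvec_end_def)
 next
  fix x assume "x \<in> carrier ?M"
  show "\<one>\<^bsub>HA n\<^esub> \<odot>\<^bsub>?M\<^esub> x = x"
   by (simp add: L(2) ring_hom_one[OF L(1)]) (simp add: pvec_end_def)
 qed
 show "i \<in> {1..<n} ==> hecke_gen n i \<odot>\<^bsub>?M\<^esub> v = gen_act n S i v"
  using L(2)[OF hecke_gen_closed] L(3) by simp
 show "hecke_scalar n c \<odot>\<^bsub>?M\<^esub> v = (\<lambda>w. c * v w)" using L(2)[OF scalar_closed] L(4) by simp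
qed

lemma basis_vec_closed: "u \<in> S ==> basis_vec u \<in> carrier (perm_module n S)"
 by (auto simp: pm_simps basis_vec_def)

lemma gen_act_basis_vec:
 assumes "S \<subseteq> perms n" "i \<in> {1..<n}" "u \<in> S"
 shows "gen_act n S i (basis_vec u) = gen_act_basis n S i u"
proof -
 have fin: "finite S" using assms(1) finite_permutations[of "{1..n}"] finite_subset by blast
 have "basis_vec u d * gen_act_basis n S i d w = (if d = u then gen_act_basis n S i u w else 0)" for d w
  by (simp add: basis_vec_def)
 thus ?thesis using fin assms(3) by (simp add: gen_act_def sum.delta)
qed

lemma pvec_induct [consumes 2, case_names zero step]:
 assumes "finite S" "v \<in> carrier (perm_module n S)"
  and "Q (\<lambda>w. 0)"
  and "\<And>v c u. v \<in> carrier (perm_module n S) ==> Q v ==> u \<in> S ==> Q (\<lambda>w. v w + c * basis_vec u w)"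
 shows "Q v"
proof -
 have "T \<subseteq> S ==> Q (restrict_vec T v)" if "finite T" for T
  using that
 proof (induction T rule: finite_induct)
  case empty
  thus ?case using assms(3) by (simp add: restrict_vec_def)
 next
  case (insert u T)
  have "restrict_vec (insert u T) v = (\<lambda>w. restrict_vec T v w + v u * basis_vec u w)"
   using insert(2) by (auto simp: restrict_vec_def basis_vec_def)
  moreover have "restrict_vec T v \<in> carrier (perm_module n S)"
   using insert by (auto simp: pm_simps restrict_vec_def)
  ultimately show ?case using assms(4) insert by simp
 qed
 from this[OF assms(1)] have "Q (restrict_vec S v)" by simp
 moreover have "restrict_vec S v = v" using assms(2) by (auto simp: pm_simps restrict_vec_def)
 ultimately show ?thesis by simp
qed

lemma finitely_generated_perm_module:
 assumes S: "weakly_convex n S"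
 shows "finitely_generated_module (HA n) (perm_module n S)"
 unfolding finitely_generated_module_def
proof (intro conjI exI allI impI)
 interpret M: left_module "HA n" "perm_module n S" by (rule perm_module_action[OF S])
 show "left_module (HA n) (perm_module n S)" by (rule perm_module_action[OF S])
 show "finite (basis_vec ` S)" using weakly_convexD(2)[OF S] by simp
 show "basis_vec ` S \<subseteq> carrier (perm_module n S)" using basis_vec_closed by blast
 fix K assume K: "submodule K (HA n) (perm_module n S)" "basis_vec ` S \<subseteq> K"
 have "v \<in> K" if "v \<in> carrier (perm_module n S)" for v
  using weakly_convexD(2)[OF S] that
 proof (induction rule: pvec_induct)
  case zero
  thus ?case using M.submoduleD(2)[OF K(1)] by (simp add: pm_simps)
 next
  case (step v c u)
  have "hecke_scalar n c \<odot>\<^bsub>perm_module n S\<^esub> basis_vec u \<in> K"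
   using M.submoduleD(4)[OF K(1) scalar_closed] K(2) step by blast
  thus ?case using M.submoduleD(3)[OF K(1) step.IH]
   by (simp add: perm_module_action(3)[OF S] pm_simps)
 qed
 thus "K = carrier (perm_module n S)" using M.submoduleD(1)[OF K(1)] by blast
qed

section \<open>The twisted dual\<close>

lemma twist_module_simps:
 "carrier (twist_module n M) = {d \<in> extensional (carrier M).
     (\<forall>x\<in>carrier M. \<forall>y\<in>carrier M. d (x \<oplus>\<^bsub>M\<^esub> y) = d x + d y) \<and>
     (\<forall>c. \<forall>x\<in>carrier M. d (hecke_scalar n c \<odot>\<^bsub>M\<^esub> x) = c * d x)}"
 "zero (twist_module n M) = (\<lambda>x\<in>carrier M. 0)"
 "add (twist_module n M) = (\<lambda>d \<epsilon>. \<lambda>x\<in>carrier M. d x + \<epsilon> x)"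
 "smult (twist_module n M) = (\<lambda>h d. \<lambda>x\<in>carrier M. d (hecke_theta_hat n h \<odot>\<^bsub>M\<^esub> x))"
 by (simp_all add: twist_module_def)

lemma left_module_twist:
 assumes M: "left_module (HA n) M"
 shows "left_module (HA n) (twist_module n M)"
proof -
 interpret M: left_module "HA n" M by fact
 interpret H: complex_algebra "HA n" "hecke_scalar n" by (rule complex_algebra_hecke_alg)
 let ?T = "twist_module n M"
 have m1: "hecke_scalar n (-1) \<odot>\<^bsub>M\<^esub> x \<in> carrier M" if "x \<in> carrier M" for x
  using M.lsmult_closed[OF H.sc_closed that] .
 have ag: "abelian_group ?T"
 proof (rule abelian_groupI)
  fix v assume d: "v \<in> carrier ?T"
  hence "(\<lambda>x\<in>carrier M. - v x) \<in> carrier ?T"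
   using M.lsmult_closed[OF H.sc_closed] by (simp add: twist_module_simps)
  moreover have "(\<lambda>x\<in>carrier M. - v x) \<oplus>\<^bsub>?T\<^esub> v = \<zero>\<^bsub>?T\<^esub>"
   by (auto simp: twist_module_simps)
  ultimately show "\<exists>\<epsilon>\<in>carrier ?T. \<epsilon> \<oplus>\<^bsub>?T\<^esub> v = \<zero>\<^bsub>?T\<^esub>" by blast
 next
  fix v assume d: "v \<in> carrier ?T"
  thus "\<zero>\<^bsub>?T\<^esub> \<oplus>\<^bsub>?T\<^esub> v = v"
   by (auto simp: twist_module_simps extensional_def fun_eq_iff)
 qed (use M.lsmult_closed[OF H.sc_closed] in
   \<open>auto simp: twist_module_simps algebra_simps fun_eq_iff\<close>)
 note th = theta_hat_closed M.lsmult_closed[OF theta_hat_closed] M.lsmult_closed[OF H.sc_closed]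
 have sc: "hecke_theta_hat n a \<odot>\<^bsub>M\<^esub> (hecke_scalar n c \<odot>\<^bsub>M\<^esub> x) =
   hecke_scalar n c \<odot>\<^bsub>M\<^esub> (hecke_theta_hat n a \<odot>\<^bsub>M\<^esub> x)"
  if a: "a \<in> carrier (HA n)" and x: "x \<in> carrier M" for a c x
  using M.lsmult_assoc[OF theta_hat_closed[OF a] H.sc_closed x]
   M.lsmult_assoc[OF H.sc_closed theta_hat_closed[OF a] x]
   H.sc_central[OF theta_hat_closed[OF a]] by metis
 show ?thesis
 proof (intro left_module.intro left_module_axioms.intro ring_hecke_alg ag)
  fix a b v \<epsilon>
  assume a: "a \<in> carrier (HA n)" and d: "v \<in> carrier ?T"
  show "a \<odot>\<^bsub>?T\<^esub> v \<in> carrier ?T"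
   using d th(1,2)[OF a] by (simp add: twist_module_simps M.lsmult_r_distr theta_hat_closed[OF a] sc[OF a] th(3))
  show "(a \<oplus>\<^bsub>HA n\<^esub> b) \<odot>\<^bsub>?T\<^esub> v = a \<odot>\<^bsub>?T\<^esub> v \<oplus>\<^bsub>?T\<^esub> b \<odot>\<^bsub>?T\<^esub> v" if b: "b \<in> carrier (HA n)"
   using d th(1,2)[OF a] th(1,2)[OF b]
   by (auto simp: twist_module_simps theta_hat_add[OF a b] M.lsmult_l_distr fun_eq_iff)
  show "a \<odot>\<^bsub>?T\<^esub> (v \<oplus>\<^bsub>?T\<^esub> \<epsilon>) = a \<odot>\<^bsub>?T\<^esub> v \<oplus>\<^bsub>?T\<^esub> a \<odot>\<^bsub>?T\<^esub> \<epsilon>"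
   using th(2)[OF a] by (auto simp: twist_module_simps fun_eq_iff)
  show "(a \<otimes>\<^bsub>HA n\<^esub> b) \<odot>\<^bsub>?T\<^esub> v = a \<odot>\<^bsub>?T\<^esub> (b \<odot>\<^bsub>?T\<^esub> v)" if b: "b \<in> carrier (HA n)"
   using th(1,2)[OF a] th(1,2)[OF b]
   by (auto simp: twist_module_simps theta_hat_mult[OF a b] M.lsmult_assoc fun_eq_iff)
 next
  fix v assume d: "v \<in> carrier ?T"
  thus "\<one>\<^bsub>HA n\<^esub> \<odot>\<^bsub>?T\<^esub> v = v"
   by (auto simp: twist_module_simps theta_hat_one M.lsmult_one extensional_def fun_eq_iff)
 qed
qed

section \<open>Retracts of the regular module\<close>

text \<open>The map \<open>s\<close> splits the homomorphism \<open>h \<mapsto> h x\<close> from the regular module.\<close>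

definition regular_retract ::
 "('r, 'k) ring_scheme => ('r, 'p) module => 'p => ('p => 'r) => bool" where
 "regular_retract R P x s \<longleftrightarrow> left_module R P \<and> x \<in> carrier P \<and>
   (\<forall>p\<in>carrier P. s p \<in> carrier R \<and> s p \<odot>\<^bsub>P\<^esub> x = p) \<and>
   (\<forall>p\<in>carrier P. \<forall>q\<in>carrier P. s (p \<oplus>\<^bsub>P\<^esub> q) = s p \<oplus>\<^bsub>R\<^esub> s q) \<and>
   (\<forall>r\<in>carrier R. \<forall>p\<in>carrier P. s (r \<odot>\<^bsub>P\<^esub> p) = r \<otimes>\<^bsub>R\<^esub> s p)"

theorem regular_retract_projective:
 fixes R :: "('r, 'k) ring_scheme" and TX :: "'x itself" and TY :: "'y itself"
 assumes "regular_retract R P x s"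
 shows "projective_module TX TY R P"
 unfolding projective_module_def
proof (intro conjI allI impI)
 show P: "left_module R P" using assms by (simp add: regular_retract_def)
 fix M :: "('r, 'x) module" and N :: "('r, 'y) module" and g f
 assume M: "left_module R M" and N: "left_module R N" and g: "g \<in> module_epi R M N"
  and f: "f \<in> module_hom R P N"
 interpret M: left_module R M by fact
 interpret N: left_module R N by fact
 have s: "s p \<in> carrier R" "s p \<odot>\<^bsub>P\<^esub> x = p" if "p \<in> carrier P" for p
  using assms that by (auto simp: regular_retract_def)
 have x: "x \<in> carrier P" using assms by (simp add: regular_retract_def)
 have gh: "g \<in> module_hom R M N" "g ` carrier M = carrier N" using g by (auto simp: module_epi_def)
 obtain m where m: "m \<in> carrier M" "g m = f x"
  using gh(2) module_homD(1)[OF f x] by (metis imageE)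
 let ?h = "\<lambda>p. s p \<odot>\<^bsub>M\<^esub> m"
 have hom: "?h \<in> module_hom R P M"
 proof (rule module_homI)
  fix p assume p: "p \<in> carrier P"
  show "s p \<odot>\<^bsub>M\<^esub> m \<in> carrier M" by (rule M.lsmult_closed[OF s(1)[OF p] m(1)])
  show "s (p \<oplus>\<^bsub>P\<^esub> q) \<odot>\<^bsub>M\<^esub> m = s p \<odot>\<^bsub>M\<^esub> m \<oplus>\<^bsub>M\<^esub> s q \<odot>\<^bsub>M\<^esub> m" if q: "q \<in> carrier P" for q
   using assms p q M.lsmult_l_distr[OF s(1)[OF p] s(1)[OF q] m(1)] by (simp add: regular_retract_def)
  show "s (r \<odot>\<^bsub>P\<^esub> p) \<odot>\<^bsub>M\<^esub> m = r \<odot>\<^bsub>M\<^esub> (s p \<odot>\<^bsub>M\<^esub> m)" if r: "r \<in> carrier R" for r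
   using assms p r M.lsmult_assoc[OF r s(1)[OF p] m(1)] by (simp add: regular_retract_def)
 qed
 have ext: "g (?h p) = f p" if "p \<in> carrier P" for p
  using module_homD(3)[OF gh(1) s(1)[OF that] m(1)] module_homD(3)[OF f s(1)[OF that] x] m s(2)[OF that]
  by simp
 show "\<exists>h\<in>module_hom R P M. \<forall>p\<in>carrier P. g (h p) = f p"
  by (rule bexI[OF _ hom]) (use ext in auto)
qed

text \<open>A module over the algebra is a complex vector space through the scalars of the algebra.\<close>

locale hecke_module = left_module "HA n" M for n :: nat and M :: "(hecke, 'a) module"
begin

sublocale H: complex_algebra "HA n" "hecke_scalar n" by (rule complex_algebra_hecke_alg)

abbreviation cscale :: "complex => 'a => 'a" (infixr "\<cdot>" 75) where
 "c \<cdot> x \<equiv> hecke_scalar n c \<odot>\<^bsub>M\<^esub> x"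

lemma cscale_closed: "x \<in> carrier M ==> c \<cdot> x \<in> carrier M"
 by (rule lsmult_closed[OF H.sc_closed])

lemma cscale_add_left: "x \<in> carrier M ==> (c + d) \<cdot> x = c \<cdot> x \<oplus>\<^bsub>M\<^esub> d \<cdot> x"
 using lsmult_l_distr[OF H.sc_closed H.sc_closed] by (simp add: H.sc_add)

lemma cscale_add_right: "x \<in> carrier M ==> y \<in> carrier M ==> c \<cdot> (x \<oplus>\<^bsub>M\<^esub> y) = c \<cdot> x \<oplus>\<^bsub>M\<^esub> c \<cdot> y"
 by (rule lsmult_r_distr[OF H.sc_closed])

lemma cscale_cscale: "x \<in> carrier M ==> c \<cdot> d \<cdot> x = (c * d) \<cdot> x"
 using lsmult_assoc[OF H.sc_closed H.sc_closed] by (simp add: H.sc_mult)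

lemma cscale_one: "x \<in> carrier M ==> 1 \<cdot> x = x"
 using lsmult_one by (simp add: H.sc_one)

lemma cscale_zero: "x \<in> carrier M ==> 0 \<cdot> x = \<zero>\<^bsub>M\<^esub>"
 using lsmult_zero_left by (simp add: H.sc_zero)

lemma cscale_zero_right: "c \<cdot> \<zero>\<^bsub>M\<^esub> = \<zero>\<^bsub>M\<^esub>"
 by (rule lsmult_zero_right[OF H.sc_closed])

lemma cscale_minus: "x \<in> carrier M ==> x \<oplus>\<^bsub>M\<^esub> (-1) \<cdot> x = \<zero>\<^bsub>M\<^esub>"
 using cscale_add_left[of x 1 "-1"] by (simp add: cscale_one cscale_zero)

lemma smult_cscale:
 assumes "h \<in> carrier (HA n)" "x \<in> carrier M"
 shows "h \<odot>\<^bsub>M\<^esub> (c \<cdot> x) = c \<cdot> (h \<odot>\<^bsub>M\<^esub> x)"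
 using lsmult_assoc[OF assms(1) H.sc_closed assms(2)] lsmult_assoc[OF H.sc_closed assms]
  H.sc_central[OF assms(1)] by metis

definition complex_subspace :: "'a set => bool" where
 "complex_subspace U \<longleftrightarrow> U \<subseteq> carrier M \<and> \<zero>\<^bsub>M\<^esub> \<in> U \<and> (\<forall>x\<in>U. \<forall>y\<in>U. x \<oplus>\<^bsub>M\<^esub> y \<in> U) \<and>
   (\<forall>c. \<forall>x\<in>U. c \<cdot> x \<in> U)"

lemma complex_subspace_adjoin:
 assumes L: "complex_subspace L" and y: "y \<in> carrier M"
 shows "complex_subspace {l \<oplus>\<^bsub>M\<^esub> c \<cdot> y |l c. l \<in> L}"
 unfolding complex_subspace_def
proof (intro conjI ballI allI)
 have Lc: "l \<in> carrier M" if "l \<in> L" for l using L that by (auto simp: complex_subspace_def)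
 show "{l \<oplus>\<^bsub>M\<^esub> c \<cdot> y |l c. l \<in> L} \<subseteq> carrier M" using Lc cscale_closed[OF y] by blast
 have "\<zero>\<^bsub>M\<^esub> = \<zero>\<^bsub>M\<^esub> \<oplus>\<^bsub>M\<^esub> 0 \<cdot> y" using y by (simp add: cscale_zero)
 thus "\<zero>\<^bsub>M\<^esub> \<in> {l \<oplus>\<^bsub>M\<^esub> c \<cdot> y |l c. l \<in> L}" using L unfolding complex_subspace_def by blast
 fix x assume "x \<in> {l \<oplus>\<^bsub>M\<^esub> c \<cdot> y |l c. l \<in> L}"
 then obtain l c where x: "x = l \<oplus>\<^bsub>M\<^esub> c \<cdot> y" "l \<in> L" by blast
 show "d \<cdot> x \<in> {l \<oplus>\<^bsub>M\<^esub> c \<cdot> y |l c. l \<in> L}" for d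
 proof -
  have "d \<cdot> x = d \<cdot> l \<oplus>\<^bsub>M\<^esub> (d * c) \<cdot> y"
   using x Lc y by (simp add: cscale_add_right cscale_closed cscale_cscale)
  thus ?thesis using L x(2) unfolding complex_subspace_def by blast
 qed
 fix x' assume "x' \<in> {l \<oplus>\<^bsub>M\<^esub> c \<cdot> y |l c. l \<in> L}"
 then obtain l' c' where x': "x' = l' \<oplus>\<^bsub>M\<^esub> c' \<cdot> y" "l' \<in> L" by blast
 have "x \<oplus>\<^bsub>M\<^esub> x' = (l \<oplus>\<^bsub>M\<^esub> l') \<oplus>\<^bsub>M\<^esub> (c + c') \<cdot> y"
  unfolding x(1) x'(1) cscale_add_left[OF y]
  using Lc[OF x(2)] Lc[OF x'(2)] cscale_closed[OF y] by (simp add: M.a_ac)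
 moreover have "l \<oplus>\<^bsub>M\<^esub> l' \<in> L" using L x(2) x'(2) by (simp add: complex_subspace_def)
 ultimately show "x \<oplus>\<^bsub>M\<^esub> x' \<in> {l \<oplus>\<^bsub>M\<^esub> c \<cdot> y |l c. l \<in> L}" by blast
qed

text \<open>By Zorn's lemma there is a maximal subspace meeting \<open>U\<close> trivially; maximality makes it a
 complement of \<open>U\<close>.\<close>

lemma complement_exists:
 assumes U: "complex_subspace U"
 obtains L where "complex_subspace L" "L \<inter> U = {\<zero>\<^bsub>M\<^esub>}"
  "\<And>y. y \<in> carrier M ==> \<exists>u\<in>U. \<exists>l\<in>L. y = u \<oplus>\<^bsub>M\<^esub> l"
proof -
 let ?A = "{L. complex_subspace L \<and> L \<inter> U = {\<zero>\<^bsub>M\<^esub>}}"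
 have "{\<zero>\<^bsub>M\<^esub>} \<in> ?A" using U by (auto simp: complex_subspace_def cscale_zero_right)
 hence ne: "?A \<noteq> {}" by blast
 have ch: "\<Union>C \<in> ?A" if C: "C \<noteq> {}" "subset.chain ?A C" for C
 proof -
  have CA: "L \<in> ?A" if "L \<in> C" for L using C(2) that by (auto simp: subset_chain_def)
  have lin: "L \<subseteq> L' \<or> L' \<subseteq> L" if "L \<in> C" "L' \<in> C" for L L'
   using C(2) that by (auto simp: subset_chain_def)
  have "complex_subspace (\<Union>C)"
   unfolding complex_subspace_def
  proof (intro conjI ballI allI)
   show "\<Union>C \<subseteq> carrier M" using CA unfolding complex_subspace_def by blast
   show "\<zero>\<^bsub>M\<^esub> \<in> \<Union>C" using CA C(1) by blast
   fix x assume "x \<in> \<Union>C"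
   then obtain L where L: "L \<in> C" "x \<in> L" by blast
   thus "c \<cdot> x \<in> \<Union>C" for c using CA[OF L(1)] unfolding complex_subspace_def by blast
   fix y assume "y \<in> \<Union>C"
   then obtain L' where L': "L' \<in> C" "y \<in> L'" by blast
   obtain K where K: "K \<in> C" "x \<in> K" "y \<in> K" using lin[OF L(1) L'(1)] L L' by blast
   thus "x \<oplus>\<^bsub>M\<^esub> y \<in> \<Union>C" using CA[OF K(1)] unfolding complex_subspace_def by blast
  qed
  moreover have "\<Union>C \<inter> U = {\<zero>\<^bsub>M\<^esub>}" using CA C(1) by blast
  ultimately show ?thesis by blast
 qed
 have "\<exists>L\<in>?A. \<forall>X\<in>?A. L \<subseteq> X --> X = L" by (rule subset_Zorn_nonempty[OF ne ch])
 then obtain L where L: "L \<in> ?A" and max: "\<forall>X\<in>?A. L \<subseteq> X --> X = L" by (rule bexE)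
 have Ls: "complex_subspace L" and LU: "L \<inter> U = {\<zero>\<^bsub>M\<^esub>}" using L by blast+
 have Lc: "l \<in> carrier M" if "l \<in> L" for l using Ls that by (auto simp: complex_subspace_def)
 have Uc: "u \<in> carrier M" if "u \<in> U" for u using U that by (auto simp: complex_subspace_def)
 have "\<exists>u\<in>U. \<exists>l\<in>L. y = u \<oplus>\<^bsub>M\<^esub> l" if y: "y \<in> carrier M" for y
 proof (rule ccontr)
  assume no: "\<not> ?thesis"
  let ?L = "{l \<oplus>\<^bsub>M\<^esub> c \<cdot> y |l c. l \<in> L}"
  have "w = \<zero>\<^bsub>M\<^esub>" if w: "w \<in> ?L" "w \<in> U" for w
  proof -
   obtain l c where lc: "w = l \<oplus>\<^bsub>M\<^esub> c \<cdot> y" "l \<in> L" using w by blast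
   have "c = 0"
   proof (rule ccontr)
    assume c: "c \<noteq> 0"
    have "(1 / c) \<cdot> w \<oplus>\<^bsub>M\<^esub> (-1) \<cdot> (1 / c) \<cdot> l = y"
     unfolding lc(1) using Lc[OF lc(2)] y c
     by (simp add: cscale_add_right cscale_closed cscale_cscale cscale_one M.a_ac)
      (metis (no_types, lifting) M.a_assoc M.a_comm M.l_zero add.commute add.left_inverse
       cscale_add_left cscale_closed cscale_zero)
    moreover have "(1 / c) \<cdot> w \<in> U" "(-1) \<cdot> (1 / c) \<cdot> l \<in> L"
     using U Ls w(2) lc(2) by (simp_all add: complex_subspace_def)
    ultimately show False using no by metis
   qed
   hence "w = l" using lc Lc y by (simp add: cscale_zero)
   thus ?thesis using LU w(2) lc(2) by blast
  qed
  moreover have "complex_subspace ?L" by (rule complex_subspace_adjoin[OF Ls y])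
  ultimately have "?L \<in> ?A" using U unfolding complex_subspace_def by blast
  moreover have "L \<subseteq> ?L"
  proof
   fix l assume l: "l \<in> L"
   hence "l = l \<oplus>\<^bsub>M\<^esub> 0 \<cdot> y" using Lc y by (simp add: cscale_zero)
   thus "l \<in> ?L" using l by blast
  qed
  ultimately have "?L = L" by (rule max[rule_format])
  moreover have "y = \<zero>\<^bsub>M\<^esub> \<oplus>\<^bsub>M\<^esub> 1 \<cdot> y" using y by (simp add: cscale_one)
  hence "y \<in> ?L" using Ls unfolding complex_subspace_def by blast
  ultimately have "y \<in> L" by blast
  moreover have "y = \<zero>\<^bsub>M\<^esub> \<oplus>\<^bsub>M\<^esub> y" using y by simp
  ultimately show False using no U unfolding complex_subspace_def by blast
 qed
 thus ?thesis using that Ls LU by blast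
qed

text \<open>Project along a complement of the subspace.\<close>

lemma functional_extension:
 assumes U: "complex_subspace U"
  and t_add: "\<And>x y. x \<in> U ==> y \<in> U ==> t (x \<oplus>\<^bsub>M\<^esub> y) = t x + (t y :: complex)"
  and t_scale: "\<And>c x. x \<in> U ==> t (c \<cdot> x) = c * t x"
 obtains T :: "'a => complex" where
  "\<And>x y. x \<in> carrier M ==> y \<in> carrier M ==> T (x \<oplus>\<^bsub>M\<^esub> y) = T x + T y"
  "\<And>c x. x \<in> carrier M ==> T (c \<cdot> x) = c * T x"
  "\<And>x. x \<in> U ==> T x = t x"
proof -
 obtain L where L: "complex_subspace L" "L \<inter> U = {\<zero>\<^bsub>M\<^esub>}"
  and dec: "\<And>y. y \<in> carrier M ==> \<exists>u\<in>U. \<exists>l\<in>L. y = u \<oplus>\<^bsub>M\<^esub> l"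
  using complement_exists[OF U] by blast
 have Lc: "l \<in> carrier M" if "l \<in> L" for l using L(1) that by (auto simp: complex_subspace_def)
 have Uc: "u \<in> carrier M" if "u \<in> U" for u using U that by (auto simp: complex_subspace_def)
 have uniq: "u = u'" if eq: "u \<oplus>\<^bsub>M\<^esub> l = u' \<oplus>\<^bsub>M\<^esub> l'" and m: "u \<in> U" "u' \<in> U" "l \<in> L" "l' \<in> L" for u u' l l'
 proof -
  note c = Uc[OF m(1)] Uc[OF m(2)] Lc[OF m(3)] Lc[OF m(4)]
  have a: "l' \<oplus>\<^bsub>M\<^esub> (-1) \<cdot> l = u \<oplus>\<^bsub>M\<^esub> (-1) \<cdot> u'"
  proof -
   have "u \<oplus>\<^bsub>M\<^esub> (-1) \<cdot> u' = (u \<oplus>\<^bsub>M\<^esub> (-1) \<cdot> u') \<oplus>\<^bsub>M\<^esub> (l \<oplus>\<^bsub>M\<^esub> (-1) \<cdot> l)"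
    using c cscale_closed by (simp add: cscale_minus)
   also have "\<dots> = (u \<oplus>\<^bsub>M\<^esub> l) \<oplus>\<^bsub>M\<^esub> ((-1) \<cdot> u' \<oplus>\<^bsub>M\<^esub> (-1) \<cdot> l)"
    using c cscale_closed by (simp add: M.a_ac)
   also have "\<dots> = (u' \<oplus>\<^bsub>M\<^esub> l') \<oplus>\<^bsub>M\<^esub> ((-1) \<cdot> u' \<oplus>\<^bsub>M\<^esub> (-1) \<cdot> l)" using eq by simp
   also have "\<dots> = (l' \<oplus>\<^bsub>M\<^esub> (-1) \<cdot> l) \<oplus>\<^bsub>M\<^esub> (u' \<oplus>\<^bsub>M\<^esub> (-1) \<cdot> u')"
    using c cscale_closed by (simp add: M.a_ac)
   also have "\<dots> = l' \<oplus>\<^bsub>M\<^esub> (-1) \<cdot> l"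
    using c cscale_closed by (simp add: cscale_minus)
   finally show ?thesis by simp
  qed
  have "l' \<oplus>\<^bsub>M\<^esub> (-1) \<cdot> l \<in> L" using L(1) m unfolding complex_subspace_def by blast
  moreover have "u \<oplus>\<^bsub>M\<^esub> (-1) \<cdot> u' \<in> U" using U m unfolding complex_subspace_def by blast
  ultimately have z: "u \<oplus>\<^bsub>M\<^esub> (-1) \<cdot> u' = \<zero>\<^bsub>M\<^esub>" using a L(2) by auto
  hence "u \<oplus>\<^bsub>M\<^esub> ((-1) \<cdot> u' \<oplus>\<^bsub>M\<^esub> u') = u'"
   using c cscale_closed[OF c(2)] by (simp add: M.a_assoc[symmetric])
  moreover have "(-1) \<cdot> u' \<oplus>\<^bsub>M\<^esub> u' = \<zero>\<^bsub>M\<^esub>"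
   using cscale_minus[OF c(2)] M.a_comm[OF c(2) cscale_closed[OF c(2)]] by simp
  ultimately show ?thesis using c by simp
 qed
 define p where "p y = (THE u. u \<in> U \<and> (\<exists>l\<in>L. y = u \<oplus>\<^bsub>M\<^esub> l))" for y
 have p_eq: "p y = u" if "u \<in> U" "l \<in> L" "y = u \<oplus>\<^bsub>M\<^esub> l" for y u l
  unfolding p_def by (rule the_equality) (use that uniq in blast)+
 have "t (p (x \<oplus>\<^bsub>M\<^esub> y)) = t (p x) + t (p y)" if xy: "x \<in> carrier M" "y \<in> carrier M" for x y
 proof -
  obtain u l where ul: "u \<in> U" "l \<in> L" "x = u \<oplus>\<^bsub>M\<^esub> l" using dec[OF xy(1)] by blast
  obtain u' l' where ul': "u' \<in> U" "l' \<in> L" "y = u' \<oplus>\<^bsub>M\<^esub> l'" using dec[OF xy(2)] by blast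
  have "x \<oplus>\<^bsub>M\<^esub> y = (u \<oplus>\<^bsub>M\<^esub> u') \<oplus>\<^bsub>M\<^esub> (l \<oplus>\<^bsub>M\<^esub> l')"
   unfolding ul(3) ul'(3) using Uc ul(1) ul'(1) Lc ul(2) ul'(2) by (simp add: M.a_ac)
  moreover have "u \<oplus>\<^bsub>M\<^esub> u' \<in> U" "l \<oplus>\<^bsub>M\<^esub> l' \<in> L"
   using U L(1) ul ul' by (simp_all add: complex_subspace_def)
  ultimately have "p (x \<oplus>\<^bsub>M\<^esub> y) = u \<oplus>\<^bsub>M\<^esub> u'" using p_eq by blast
  thus ?thesis using p_eq[OF ul] p_eq[OF ul'] t_add ul(1) ul'(1) by simp
 qed
 moreover have "t (p (c \<cdot> x)) = c * t (p x)" if x: "x \<in> carrier M" for c x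
 proof -
  obtain u l where ul: "u \<in> U" "l \<in> L" "x = u \<oplus>\<^bsub>M\<^esub> l" using dec[OF x] by blast
  have "c \<cdot> x = c \<cdot> u \<oplus>\<^bsub>M\<^esub> c \<cdot> l"
   unfolding ul(3) using Uc[OF ul(1)] Lc[OF ul(2)] by (rule cscale_add_right)
  moreover have "c \<cdot> u \<in> U" "c \<cdot> l \<in> L" using U L(1) ul by (simp_all add: complex_subspace_def)
  ultimately have "p (c \<cdot> x) = c \<cdot> u" using p_eq by blast
  thus ?thesis using p_eq[OF ul] t_scale[OF ul(1)] by simp
 qed
 moreover have "t (p u) = t u" if "u \<in> U" for u
  using p_eq[OF that, of "\<zero>\<^bsub>M\<^esub>" u] L(1) Uc[OF that] by (simp add: complex_subspace_def)
 ultimately show ?thesis using that[of "\<lambda>y. t (p y)"] by blast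
qed

end

text \<open>A homomorphism \<open>f\<close> into the dual of a retract is determined by the functional
 \<open>y \<mapsto> f y x\<close>, which extends to every larger module as a plain functional; the splitting turns the
 extended functional back into a homomorphism.\<close>

theorem twist_regular_retract_injective:
 fixes TX :: "'x itself" and TY :: "'y itself"
 assumes ret: "regular_retract (HA n) Q x s"
 shows "injective_module TX TY (HA n) (twist_module n Q)"
 unfolding injective_module_def
proof (intro conjI allI impI)
 let ?H = "HA n" and ?T = "twist_module n Q" and ?th = "hecke_theta_hat n"
 have Q: "left_module ?H Q" using ret by (simp add: regular_retract_def)
 show "left_module ?H ?T" by (rule left_module_twist[OF Q])
 fix M :: "(hecke, 'x) module" and N :: "(hecke, 'y) module" and g f
 assume M: "left_module ?H M" and N: "left_module ?H N" and g: "g \<in> module_mono ?H M N"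
  and f: "f \<in> module_hom ?H M ?T"
 interpret Q: hecke_module n Q by (rule hecke_module.intro[OF Q])
 interpret M: hecke_module n M by (rule hecke_module.intro[OF M])
 interpret N: hecke_module n N by (rule hecke_module.intro[OF N])
 have x: "x \<in> carrier Q" using ret by (simp add: regular_retract_def)
 have s: "s q \<in> carrier ?H" "s q \<odot>\<^bsub>Q\<^esub> x = q" if "q \<in> carrier Q" for q
  using ret that by (auto simp: regular_retract_def)
 have s_add: "s (p \<oplus>\<^bsub>Q\<^esub> q) = s p \<oplus>\<^bsub>?H\<^esub> s q" if "p \<in> carrier Q" "q \<in> carrier Q" for p q
  using ret that by (auto simp: regular_retract_def)
 have s_smult: "s (r \<odot>\<^bsub>Q\<^esub> p) = r \<otimes>\<^bsub>?H\<^esub> s p" if "r \<in> carrier ?H" "p \<in> carrier Q" for r p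
  using ret that by (auto simp: regular_retract_def)
 have gh: "g \<in> module_hom ?H M N" and inj: "inj_on g (carrier M)" using g by (auto simp: module_mono_def)
 let ?U = "g ` carrier M"
 let ?t = "\<lambda>y. f (inv_into (carrier M) g y) x"
 have inv: "inv_into (carrier M) g (g m) = m" if "m \<in> carrier M" for m using inv_into_f_f[OF inj that] .
 have fadd: "f (m \<oplus>\<^bsub>M\<^esub> m') q = f m q + f m' q"
  if "m \<in> carrier M" "m' \<in> carrier M" "q \<in> carrier Q" for m m' q
  using module_homD(2)[OF f that(1,2)] that(3) by (simp add: twist_module_simps)
 have fsm: "f (r \<odot>\<^bsub>M\<^esub> m) q = f m (?th r \<odot>\<^bsub>Q\<^esub> q)"
  if "r \<in> carrier ?H" "m \<in> carrier M" "q \<in> carrier Q" for r m q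
  using module_homD(3)[OF f that(1,2)] that(3) by (simp add: twist_module_simps)
 have fsc: "f (hecke_scalar n c \<odot>\<^bsub>M\<^esub> m) q = c * f m q" if "m \<in> carrier M" "q \<in> carrier Q" for c m q
  using fsm[OF scalar_closed that] module_homD(1)[OF f that(1)] that(2)
  by (simp add: theta_hat_scalar twist_module_simps)
 have U: "N.complex_subspace ?U"
  unfolding N.complex_subspace_def
 proof (intro conjI ballI allI)
  show "?U \<subseteq> carrier N" using module_homD(1)[OF gh] by blast
  have "g \<zero>\<^bsub>M\<^esub> = g (\<zero>\<^bsub>?H\<^esub> \<odot>\<^bsub>M\<^esub> \<zero>\<^bsub>M\<^esub>)" using M.lsmult_zero_left by simp
  also have "\<dots> = \<zero>\<^bsub>N\<^esub>" using module_homD(3)[OF gh, of "\<zero>\<^bsub>?H\<^esub>" "\<zero>\<^bsub>M\<^esub>"] N.lsmult_zero_left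
   module_homD(1)[OF gh] by simp
  finally show "\<zero>\<^bsub>N\<^esub> \<in> ?U" by (metis M.M.zero_closed image_eqI)
 next
  fix a b assume "a \<in> ?U" "b \<in> ?U"
  then obtain m m' where "m \<in> carrier M" "m' \<in> carrier M" "a = g m" "b = g m'" by blast
  thus "a \<oplus>\<^bsub>N\<^esub> b \<in> ?U" using module_homD(2)[OF gh, of m m'] by (metis M.M.a_closed image_eqI)
 next
  fix c a assume "a \<in> ?U"
  then obtain m where "m \<in> carrier M" "a = g m" by blast
  thus "hecke_scalar n c \<odot>\<^bsub>N\<^esub> a \<in> ?U"
   using module_homD(3)[OF gh scalar_closed, of m c] M.cscale_closed by (metis image_eqI)
 qed
 obtain T :: "'y => complex" where
  T_add: "\<And>a b. a \<in> carrier N ==> b \<in> carrier N ==> T (a \<oplus>\<^bsub>N\<^esub> b) = T a + T b"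
  and T_scale: "\<And>c a. a \<in> carrier N ==> T (hecke_scalar n c \<odot>\<^bsub>N\<^esub> a) = c * T a"
  and T_ext: "\<And>a. a \<in> ?U ==> T a = ?t a"
 proof (rule N.functional_extension[OF U, of ?t])
  fix a b assume "a \<in> ?U" "b \<in> ?U"
  then obtain m m' where m: "m \<in> carrier M" "m' \<in> carrier M" "a = g m" "b = g m'" by blast
  thus "?t (a \<oplus>\<^bsub>N\<^esub> b) = ?t a + ?t b"
   using module_homD(2)[OF gh m(1,2)] fadd[OF m(1,2) x] inv M.M.a_closed by metis
 next
  fix c a assume "a \<in> ?U"
  then obtain m where m: "m \<in> carrier M" "a = g m" by blast
  thus "?t (hecke_scalar n c \<odot>\<^bsub>N\<^esub> a) = c * ?t a"
   using module_homD(3)[OF gh scalar_closed m(1)] fsc[OF m(1) x] inv M.cscale_closed by metis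
 qed blast
 let ?h = "\<lambda>y. \<lambda>q\<in>carrier Q. T (?th (s q) \<odot>\<^bsub>N\<^esub> y)"
 have ths: "?th (s q) \<in> carrier ?H" if "q \<in> carrier Q" for q using theta_hat_closed[OF s(1)[OF that]] .
 have h: "?h \<in> module_hom ?H N ?T"
 proof (rule module_homI)
  fix y assume y: "y \<in> carrier N"
  have "T (?th (s (p \<oplus>\<^bsub>Q\<^esub> q)) \<odot>\<^bsub>N\<^esub> y) = T (?th (s p) \<odot>\<^bsub>N\<^esub> y) + T (?th (s q) \<odot>\<^bsub>N\<^esub> y)"
   if "p \<in> carrier Q" "q \<in> carrier Q" for p q
   using that y ths by (simp add: s_add s theta_hat_add N.lsmult_l_distr T_add N.lsmult_closed)
  moreover have "T (?th (s (hecke_scalar n c \<odot>\<^bsub>Q\<^esub> q)) \<odot>\<^bsub>N\<^esub> y) = c * T (?th (s q) \<odot>\<^bsub>N\<^esub> y)"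
   if q: "q \<in> carrier Q" for c q
  proof -
   have "?th (s (hecke_scalar n c \<odot>\<^bsub>Q\<^esub> q)) = ?th (s q) \<otimes>\<^bsub>?H\<^esub> hecke_scalar n c"
    using q by (simp add: s_smult[OF scalar_closed q] theta_hat_mult[OF scalar_closed s(1)] theta_hat_scalar)
   thus ?thesis
    using N.lsmult_assoc[OF ths[OF q] scalar_closed y] N.smult_cscale[OF ths[OF q] y]
     T_scale[OF N.lsmult_closed[OF ths[OF q] y]] by simp
  qed
  ultimately show "?h y \<in> carrier ?T"
   using Q.cscale_closed by (simp add: twist_module_simps)
 next
  fix y y' assume y: "y \<in> carrier N" "y' \<in> carrier N"
  show "?h (y \<oplus>\<^bsub>N\<^esub> y') = ?h y \<oplus>\<^bsub>?T\<^esub> ?h y'"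
   using y ths by (auto simp: twist_module_simps fun_eq_iff N.lsmult_r_distr T_add N.lsmult_closed)
 next
  fix r y assume r: "r \<in> carrier ?H" and y: "y \<in> carrier N"
  have "T (?th (s q) \<odot>\<^bsub>N\<^esub> (r \<odot>\<^bsub>N\<^esub> y)) = T (?th (s (?th r \<odot>\<^bsub>Q\<^esub> q)) \<odot>\<^bsub>N\<^esub> y)" if q: "q \<in> carrier Q" for q
  proof -
   have "?th (s (?th r \<odot>\<^bsub>Q\<^esub> q)) = ?th (s q) \<otimes>\<^bsub>?H\<^esub> r"
    using q r by (simp add: s_smult theta_hat_closed theta_hat_mult s(1) theta_hat_involution)
   thus ?thesis using N.lsmult_assoc[OF ths[OF q] r y] by simp
  qed
  thus "?h (r \<odot>\<^bsub>N\<^esub> y) = r \<odot>\<^bsub>?T\<^esub> ?h y"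
   using Q.lsmult_closed[OF theta_hat_closed[OF r]] by (auto simp: twist_module_simps fun_eq_iff)
 qed
 have ext: "?h (g m) = f m" if m: "m \<in> carrier M" for m
 proof (rule extensionalityI[of _ "carrier Q"])
  show "f m \<in> extensional (carrier Q)" using module_homD(1)[OF f m] by (simp add: twist_module_simps)
  fix q assume q: "q \<in> carrier Q"
  let ?r = "?th (s q)"
  have "T (?r \<odot>\<^bsub>N\<^esub> g m) = T (g (?r \<odot>\<^bsub>M\<^esub> m))" using module_homD(3)[OF gh ths[OF q] m] by simp
  also have "\<dots> = f (?r \<odot>\<^bsub>M\<^esub> m) x"
   using T_ext inv[OF M.lsmult_closed[OF ths[OF q] m]] M.lsmult_closed[OF ths[OF q] m] by simp
  also have "\<dots> = f m (s q \<odot>\<^bsub>Q\<^esub> x)" using fsm[OF ths[OF q] m x] theta_hat_involution[OF s(1)[OF q]] by simp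
  finally show "?h (g m) q = f m q" using q s(2) by simp
 qed auto
 show "\<exists>h\<in>module_hom ?H N ?T. \<forall>m\<in>carrier M. h (g m) = f m"
  by (rule bexI[OF _ h]) (use ext in blast)
qed

lemma injective_module_iso:
 fixes R :: "('r, 'k) ring_scheme" and TX :: "'x itself" and TY :: "'y itself"
 assumes I: "injective_module TX TY R I" and J: "left_module R J"
  and \<phi>: "\<phi> \<in> module_hom R I J" and b: "bij_betw \<phi> (carrier I) (carrier J)"
 shows "injective_module TX TY R J"
 unfolding injective_module_def
proof (intro conjI allI impI)
 show "left_module R J" by (rule J)
 have I': "left_module R I" using I by (simp add: injective_module_def)
 note psi = module_hom_inv_into[OF \<phi> b I']
 fix M :: "('r, 'x) module" and N :: "('r, 'y) module" and g f
 assume M: "left_module R M" and N: "left_module R N" and g: "g \<in> module_mono R M N"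
  and f: "f \<in> module_hom R M J"
 from I M N g module_hom_comp[OF f psi(1)] obtain h where h: "h \<in> module_hom R N I"
  "\<And>x. x \<in> carrier M ==> h (g x) = inv_into (carrier I) \<phi> (f x)"
  unfolding injective_module_def comp_def by metis
 have "(\<phi> o h) (g x) = f x" if "x \<in> carrier M" for x
  using h(2)[OF that] bij_betw_inv_into_right[OF b module_homD(1)[OF f that]] by simp
 thus "\<exists>h\<in>module_hom R N J. \<forall>x\<in>carrier M. h (g x) = f x"
  using module_hom_comp[OF h(1) \<phi>] by blast
qed

section \<open>Duality for modules with a basis of permutations\<close>

lemma longest_perm_involution:
 "longest_perm n o longest_perm n = id" "inv' (longest_perm n) = longest_perm n"
proof -
 have "longest_perm n (longest_perm n a) = a" for a
 proof (cases "a \<in> {1..n}")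
  case True
  hence "longest_perm n a \<in> {1..n}" using permutes_in_image[OF longest_perm(1)] by blast
  thus ?thesis using longest_perm(2) True by auto
 next
  case False
  thus ?thesis using permutes_not_in[OF longest_perm(1)] by metis
 qed
 thus 1: "longest_perm n o longest_perm n = id" by (auto simp: fun_eq_iff)
 show "inv' (longest_perm n) = longest_perm n" by (rule inv_unique_comp[OF 1 1])
qed

lemma comp_longest_perm_twice: "(u o longest_perm n) o longest_perm n = u"
 by (simp add: comp_assoc longest_perm_involution(1))

lemma comp_longest_perm_permutes: "u permutes {1..n} ==> u o longest_perm n permutes {1..n}"
 using permutes_compose[OF longest_perm(1)] .

lemma Des_L_comp_longest_perm:
 assumes u: "u permutes {1..n}" and i: "i \<in> {1..<n}"
 shows "i \<in> Des_L n (u o longest_perm n) \<longleftrightarrow> i \<notin> Des_L n u"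
proof -
 have inv: "inv' (u o longest_perm n) = longest_perm n o inv' u"
  using o_inv_distrib[OF permutes_bij[OF u] permutes_bij[OF longest_perm(1)]]
  by (simp add: longest_perm_involution(2))
 have "inv' u i \<in> {1..n}" "inv' u (Suc i) \<in> {1..n}"
  using permutes_in_image[OF permutes_inv[OF u]] i by auto
 thus ?thesis
  unfolding Des_L_iff[OF comp_longest_perm_permutes[OF u]] not_Des_L_iff[OF u i] inv
  using i by (auto simp: longest_perm(2))
qed

lemma sign_flip:
 assumes "u permutes {1..n}" "r permutes {1..n}" "i \<in> {1..<n}"
 shows "(-1) ^ len n (tr i o u o inv' r) =
  - ((-1) ^ len n (u o inv' r) :: complex)"
proof -
 have p: "u o inv' r permutes {1..n}" using permutes_compose[OF permutes_inv[OF assms(2)] assms(1)] .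
 show ?thesis
 proof (cases "i \<in> Des_L n (u o inv' r)")
  case True
  thus ?thesis using inversions_down(2)[OF p True] by (simp add: comp_assoc)
 next
  case False
  thus ?thesis using inversions_up(2)[OF p assms(3) False] by (simp add: comp_assoc)
 qed
qed

lemma dual_to_perm_apply:
 assumes "finite S"
 shows "dual_to_perm n S r d w = (if w o longest_perm n \<in> S
  then d (basis_vec (w o longest_perm n)) * (-1) ^ len n (w o longest_perm n o inv' r) else 0)"
proof -
 have eq: "w = u o longest_perm n \<longleftrightarrow> u = w o longest_perm n" for u
  using comp_longest_perm_twice by metis
 have "dual_to_perm n S r d w = (\<Sum>u\<in>S. if u = w o longest_perm n
   then d (basis_vec u) * (-1) ^ len n (u o inv' r) else 0)"
  unfolding dual_to_perm_def by (rule sum.cong) (auto simp: basis_vec_def eq)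
 thus ?thesis unfolding sum.delta[OF assms] .
qed

lemma twist_perm_linear:
 assumes S: "weakly_convex n S" and d: "z \<in> carrier (twist_module n (perm_module n S))"
  and uv: "u \<in> carrier (perm_module n S)" "v \<in> carrier (perm_module n S)"
 shows "z (\<lambda>w. u w + v w) = z u + z v" "z (\<lambda>w. c * u w) = c * z u" "z (\<lambda>w. 0) = 0"
proof -
 show 1: "z (\<lambda>w. u w + v w) = z u + z v" and 2: "z (\<lambda>w. c * u w) = c * z u" for c
  using d uv by (auto simp: twist_module_simps pm_simps(3) perm_module_action(3)[OF S])
 from 2[of 0] show "z (\<lambda>w. 0) = 0" by simp
qed

text \<open>Here \<open>\<chi>\<close> fixes \<open>\<pi>\<^sub>i\<close> and \<open>\<theta>\<close> sends it to \<open>1 - \<pi>\<^sub>i\<close>.\<close>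

lemma twist_perm_gen:
 assumes S: "weakly_convex n S" and d: "z \<in> carrier (twist_module n (perm_module n S))"
  and i: "i \<in> {1..<n}" and v: "v \<in> carrier (perm_module n S)"
 shows "(hecke_gen n i \<odot>\<^bsub>twist_module n (perm_module n S)\<^esub> z) v = z v - z (gen_act n S i v)"
proof -
 let ?M = "perm_module n S"
 interpret M: hecke_module n ?M by (rule hecke_module.intro[OF perm_module_action(1)[OF S]])
 have sub: "S \<subseteq> perms n" using S by (simp add: weakly_convex_def)
 note gc = gen_act_closed[OF sub i]
 have neg: "(\<lambda>u. (-1) * w u) \<in> carrier ?M" if "w \<in> carrier ?M" for w
  using that by (simp add: pm_simps)
 have "(\<one>\<^bsub>HA n\<^esub> \<ominus>\<^bsub>HA n\<^esub> hecke_gen n i) \<odot>\<^bsub>?M\<^esub> v =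
   v \<oplus>\<^bsub>?M\<^esub> \<ominus>\<^bsub>?M\<^esub> (hecke_gen n i \<odot>\<^bsub>?M\<^esub> v)"
  using hecke_gen_closed[OF i] v
  by (simp add: M.R.minus_eq M.lsmult_l_distr M.lsmult_minus_left M.lsmult_one)
 also have "\<ominus>\<^bsub>?M\<^esub> (hecke_gen n i \<odot>\<^bsub>?M\<^esub> v) = (\<lambda>u. (-1) * gen_act n S i v u)"
  unfolding perm_module_action(2)[OF S i]
  by (rule M.M.minus_equality[OF _ gc neg[OF gc]]) (simp add: pm_simps)
 finally have 1: "hecke_theta_hat n (hecke_gen n i) \<odot>\<^bsub>?M\<^esub> v = (\<lambda>u. v u + (-1) * gen_act n S i v u)"
  unfolding theta_hat_gen[OF i] by (simp add: pm_simps)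
 have "z (\<lambda>u. v u + (-1) * gen_act n S i v u) = z v + (-1) * z (gen_act n S i v)"
  using twist_perm_linear(1)[OF S d v neg[OF gc]] twist_perm_linear(2)[OF S d gc gc, of "-1"] by simp
 thus ?thesis using v 1 by (simp add: twist_module_simps)
qed

lemma twist_perm_scalar:
 assumes S: "weakly_convex n S" and d: "u \<in> carrier (twist_module n (perm_module n S))"
  and v: "v \<in> carrier (perm_module n S)"
 shows "(hecke_scalar n c \<odot>\<^bsub>twist_module n (perm_module n S)\<^esub> u) v = c * u v"
 using v d by (simp add: twist_module_simps theta_hat_scalar)

text \<open>Passing from \<open>p\<close> to \<open>p w\<^sub>0\<close> turns descents into ascents, as does transposing \<open>1 - \<pi>\<^sub>i\<close>; the sign absorbs
 the minus in front of \<open>\<pi>\<^sub>i\<close>, since neighbours in the weak order have lengths of different parity.\<close>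

theorem dual_to_perm_iso:
 assumes S: "weakly_convex n S" and S': "weakly_convex n S'"
  and SS': "\<And>y. y \<in> S' \<longleftrightarrow> y o longest_perm n \<in> S" and r: "r permutes {1..n}"
 shows "dual_to_perm n S r \<in> module_hom (HA n) (twist_module n (perm_module n S)) (perm_module n S')"
  and "bij_betw (dual_to_perm n S r) (carrier (twist_module n (perm_module n S))) (carrier (perm_module n S'))"
proof -
 let ?M = "perm_module n S" and ?T = "twist_module n (perm_module n S)" and ?N = "perm_module n S'"
 let ?g = "dual_to_perm n S r" and ?w = "longest_perm n"
 let ?e = "\<lambda>p. (-1) ^ len n (p o inv' r) :: complex"
 have sub: "S \<subseteq> perms n" "S' \<subseteq> perms n" using S S' by (simp_all add: weakly_convex_def)
 have fin: "finite S" by (rule weakly_convexD(2)[OF S])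
 have g: "?g \<delta> y = (if y \<in> S' then \<delta> (basis_vec (y o ?w)) * ?e (y o ?w) else 0)" for \<delta> y
  unfolding dual_to_perm_apply[OF fin] SS' ..
 note M = perm_module_action(1)[OF S]
 note N = perm_module_action(1)[OF S']
 have cl: "?g \<delta> \<in> carrier ?N" for \<delta> by (simp add: pm_simps g)
 have bc: "basis_vec (y o ?w) \<in> carrier ?M" if "y \<in> S'" for y
  using basis_vec_closed SS' that by blast
 show "?g \<in> module_hom (HA n) ?T ?N"
 proof (rule hecke_module_homI[OF left_module_twist[OF M] N cl])
  fix \<delta> \<epsilon> assume d: "\<delta> \<in> carrier ?T" "\<epsilon> \<in> carrier ?T"
  show "?g (\<delta> \<oplus>\<^bsub>?T\<^esub> \<epsilon>) = ?g \<delta> \<oplus>\<^bsub>?N\<^esub> ?g \<epsilon>"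
   using bc by (auto simp: pm_simps g twist_module_simps distrib_right)
 next
  fix c \<delta> assume d: "\<delta> \<in> carrier ?T"
  show "?g (hecke_scalar n c \<odot>\<^bsub>?T\<^esub> \<delta>) = hecke_scalar n c \<odot>\<^bsub>?N\<^esub> ?g \<delta>"
   using bc by (auto simp: perm_module_action(3)[OF S'] g twist_perm_scalar[OF S d])
 next
  fix i \<delta> assume i: "i \<in> {1..<n}" and d: "\<delta> \<in> carrier ?T"
  show "?g (hecke_gen n i \<odot>\<^bsub>?T\<^esub> \<delta>) = hecke_gen n i \<odot>\<^bsub>?N\<^esub> ?g \<delta>"
  proof
   fix y
   show "?g (hecke_gen n i \<odot>\<^bsub>?T\<^esub> \<delta>) y = (hecke_gen n i \<odot>\<^bsub>?N\<^esub> ?g \<delta>) y"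
   proof (cases "y \<in> S'")
    case y: True
    define p where "p = y o ?w"
    have p: "p \<in> S" "p permutes {1..n}" using SS' y sub unfolding p_def by blast+
    have y_p: "y permutes {1..n}" using y sub by blast
    have D: "i \<in> Des_L n p \<longleftrightarrow> i \<notin> Des_L n y"
     unfolding p_def by (rule Des_L_comp_longest_perm[OF y_p i])
    have sw: "(tr i o y) o ?w = tr i o p" by (simp add: p_def comp_assoc)
    have in': "tr i o y \<in> S' \<longleftrightarrow> tr i o p \<in> S" unfolding SS' sw ..
    have L: "?g (hecke_gen n i \<odot>\<^bsub>?T\<^esub> \<delta>) y = (\<delta> (basis_vec p) - \<delta> (gen_act_basis n S i p)) * ?e p"
     using y twist_perm_gen[OF S d i bc[OF y]] gen_act_basis_vec[OF sub(1) i p(1)]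
     by (simp add: g p_def)
    have e: "?e (tr i o p) = - ?e p" by (rule sign_flip[OF p(2) r i])
    have g1: "?g \<delta> y = \<delta> (basis_vec p) * ?e p" using y unfolding g p_def by simp
    have g2: "?g \<delta> (tr i o y) =
      (if tr i o p \<in> S then - (\<delta> (basis_vec (tr i o p)) * ?e p) else 0)"
     unfolding g in' sw e by simp
    have R: "(hecke_gen n i \<odot>\<^bsub>?N\<^esub> ?g \<delta>) y = (if i \<in> Des_L n y then \<delta> (basis_vec p) * ?e p +
      (if tr i o p \<in> S then - (\<delta> (basis_vec (tr i o p)) * ?e p) else 0) else 0)"
     unfolding perm_module_action(2)[OF S' i] gen_act_apply[OF sub(2) i] g1 g2 in' using y by simp
    have z: "\<delta> (\<lambda>y. 0) = 0" using twist_perm_linear(3)[OF S d bc[OF y] bc[OF y]] .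
    show ?thesis unfolding L R gen_act_basis_def using D z by (auto simp: algebra_simps)
   next
    case False
    thus ?thesis
     by (simp add: g perm_module_action(2)[OF S' i] gen_act_apply[OF sub(2) i])
   qed
  qed
 qed
 show "bij_betw ?g (carrier ?T) (carrier ?N)"
 proof (rule bij_betwI')
  fix \<delta> \<epsilon> assume d: "\<delta> \<in> carrier ?T" "\<epsilon> \<in> carrier ?T"
  show "(?g \<delta> = ?g \<epsilon>) = (\<delta> = \<epsilon>)"
  proof
   assume eq: "?g \<delta> = ?g \<epsilon>"
   have b: "\<delta> (basis_vec p) = \<epsilon> (basis_vec p)" if "p \<in> S" for p
   proof -
    have "p o ?w \<in> S'" unfolding SS' comp_longest_perm_twice by (rule that)
    thus ?thesis using fun_cong[OF eq, of "p o ?w"] unfolding g comp_longest_perm_twice by simp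
   qed
   have "\<delta> v = \<epsilon> v" if "v \<in> carrier ?M" for v
    using fin that
   proof (induction rule: pvec_induct)
    case zero
    have "(\<lambda>y. 0) \<in> carrier ?M" by (simp add: pm_simps)
    thus ?case using twist_perm_linear(3)[OF S d(1)] twist_perm_linear(3)[OF S d(2)] by metis
   next
    case (step v c p)
    note bg = basis_vec_closed[OF step.hyps(2), of n]
    have cb: "(\<lambda>y. c * basis_vec p y) \<in> carrier ?M" using bg by (simp add: pm_simps)
    show ?case
     unfolding twist_perm_linear(1)[OF S d(1) step.hyps(1) cb] twist_perm_linear(1)[OF S d(2) step.hyps(1) cb]
      twist_perm_linear(2)[OF S d(1) bg bg] twist_perm_linear(2)[OF S d(2) bg bg]
     using step.IH b[OF step.hyps(2)] by simp
   qed
   thus "\<delta> = \<epsilon>" using d by (intro extensionalityI[of _ "carrier ?M"]) (auto simp: twist_module_simps)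
  qed simp
 next
  fix u assume u: "u \<in> carrier ?N"
  let ?d = "\<lambda>v\<in>carrier ?M. \<Sum>p\<in>S. v p * (u (p o ?w) * ?e p)"
  have "?d \<in> carrier ?T"
   by (auto simp: twist_module_simps pm_simps perm_module_action(3)[OF S]
     distrib_right sum.distrib sum_distrib_left mult.assoc)
  moreover have "u = ?g ?d"
  proof
   fix y
   show "u y = ?g ?d y"
   proof (cases "y \<in> S'")
    case True
    have "(\<Sum>p\<in>S. basis_vec (y o ?w) p * (u (p o ?w) * ?e p)) =
      (\<Sum>p\<in>S. if p = y o ?w then u y * ?e (y o ?w) else 0)"
     by (rule sum.cong) (auto simp: basis_vec_def comp_longest_perm_twice)
    also have "\<dots> = u y * ?e (y o ?w)" unfolding sum.delta[OF fin] using True SS' by simp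
    finally have "?d (basis_vec (y o ?w)) = u y * ?e (y o ?w)" using bc[OF True] by simp
    moreover have "?e p * ?e p = 1" for p by (simp add: power_add[symmetric] power_mult_distrib[symmetric] flip: power2_eq_square power_mult)
    ultimately show ?thesis unfolding g using True by (simp add: mult.assoc)
   next
    case False
    thus ?thesis using u unfolding g by (simp add: pm_simps)
   qed
  qed
  ultimately show "\<exists>\<delta>\<in>carrier ?T. u = ?g \<delta>" by blast
 qed (rule cl)
qed

section \<open>Simple quotients and simple submodules\<close>

text \<open>The generators either fix a basis vector, kill it, or move it to a longer one.  Hence the
 span of the longer basis vectors gives one-dimensional subquotients, and every simple quotient
 and every simple submodule is one-dimensional.\<close>

lemma longest_element_exists:
 assumes "S \<subseteq> perms n" "u \<in> S" "Q u"
 shows "\<exists>u\<in>S. Q u \<and> (\<forall>d\<in>S. Q d --> len n d \<le> len n u)"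
proof -
 have "\<forall>d. d \<in> S \<and> Q d --> len n d < Suc (card ({1..n} \<times> {1..n}))"
  using perm_length_less assms(1) by blast
 from Lattices_Big.ex_has_greatest_nat[of "\<lambda>d. d \<in> S \<and> Q d", OF _ this] assms(2,3)
 show ?thesis by blast
qed

text \<open>The nonzero ones are the homomorphisms onto one-dimensional modules.\<close>

definition eigenfunctional :: "nat => (nat => nat) set => (pvec => complex) => bool" where
 "eigenfunctional n S \<phi> \<longleftrightarrow>
   (\<forall>u\<in>carrier (perm_module n S). \<forall>v\<in>carrier (perm_module n S). \<phi> (\<lambda>w. u w + v w) = \<phi> u + \<phi> v) \<and>
   (\<forall>c. \<forall>v\<in>carrier (perm_module n S). \<phi> (\<lambda>w. c * v w) = c * \<phi> v) \<and>
   (\<forall>i\<in>{1..<n}. (\<forall>v\<in>carrier (perm_module n S). \<phi> (gen_act n S i v) = \<phi> v) \<or>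
    (\<forall>v\<in>carrier (perm_module n S). \<phi> (gen_act n S i v) = 0))"

text \<open>For a longest basis vector \<open>e\<close> outside \<open>K\<close>, the vectors congruent to a multiple of \<open>e\<close> form a
 submodule, hence everything; the functional takes the coefficient of \<open>e\<close> modulo \<open>K\<close>.\<close>

lemma maximal_submodule_functional:
 assumes S: "weakly_convex n S" and K: "maximal_submodule K (HA n) (perm_module n S)"
 obtains \<phi> where "eigenfunctional n S \<phi>" "K = {v \<in> carrier (perm_module n S). \<phi> v = 0}"
proof -
 let ?M = "perm_module n S"
 interpret M: hecke_module n ?M by (rule hecke_module.intro[OF perm_module_action(1)[OF S]])
 have sub: "S \<subseteq> perms n" using S by (simp add: weakly_convex_def)
 have Ks: "submodule K (HA n) ?M" and Kne: "K \<noteq> carrier ?M"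
  and Kmax: "\<And>L. submodule L (HA n) ?M ==> K \<subseteq> L ==> L = K \<or> L = carrier ?M"
  using K by (auto simp: maximal_submodule_def)
 note KD = M.submoduleD[OF Ks] and act = perm_module_action(2,3)[OF S]
 have Kadd: "(\<lambda>w. u w + v w) \<in> K" if "u \<in> K" "v \<in> K" for u v
  using KD(3)[OF that] by (simp add: pm_simps)
 have Kscale: "(\<lambda>w. c * u w) \<in> K" if "u \<in> K" for u c
  using KD(4)[OF scalar_closed that] by (simp add: act(2))
 have Kgen: "gen_act n S i u \<in> K" if "i \<in> {1..<n}" "u \<in> K" for i u
  using KD(4)[OF hecke_gen_closed[OF that(1)] that(2)] by (simp add: act(1)[OF that(1)])
 have K0: "(\<lambda>w. 0) \<in> K" using KD(2) by (simp add: pm_simps)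
 have "\<exists>z\<in>S. basis_vec z \<notin> K"
 proof (rule ccontr)
  assume a: "\<not> ?thesis"
  have "v \<in> K" if "v \<in> carrier ?M" for v using weakly_convexD(2)[OF S] that
  proof (induction rule: pvec_induct)
   case (step v c z)
   thus ?case using a Kadd Kscale by blast
  qed (rule K0)
  thus False using KD(1) Kne by blast
 qed
 then obtain z0 where g0: "z0 \<in> S" "basis_vec z0 \<notin> K"
  and mx: "\<And>\<delta>. \<delta> \<in> S ==> basis_vec \<delta> \<notin> K ==> len n \<delta> \<le> len n z0"
  using longest_element_exists[OF sub, of _ "\<lambda>z. basis_vec z \<notin> K"] by metis
 let ?e = "basis_vec z0"
 let ?P = "\<lambda>v c. (\<lambda>w. v w + (- c) * ?e w) \<in> K"
 let ?\<epsilon> = "\<lambda>i. if i \<in> Des_L n z0 then 1 else 0"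
 have Padd: "?P (\<lambda>w. u w + v w) (c + d)" if "?P u c" "?P v d" for u v c d
  using Kadd[OF that] by (simp add: algebra_simps)
 have Pscale: "?P (\<lambda>w. a * v w) (a * c)" if "?P v c" for a v c
  using Kscale[OF that, of a] by (simp add: algebra_simps)
 have Pe: "?P (gen_act n S i ?e) (?\<epsilon> i)" if i: "i \<in> {1..<n}" for i
 proof (cases "i \<in> Des_L n z0")
  case False
  have "basis_vec (tr i o z0) \<in> K" if "tr i o z0 \<in> S"
   using mx[OF that] inversions_up(2)[of z0 n i] i False g0(1) sub by force
  thus ?thesis using False K0 by (simp add: gen_act_basis_vec[OF sub i g0(1)] gen_act_basis_def)
 qed (use K0 in \<open>simp add: gen_act_basis_vec[OF sub i g0(1)] gen_act_basis_def\<close>)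
 have Pgen: "?P (gen_act n S i v) (?\<epsilon> i * c)" if i: "i \<in> {1..<n}" and v: "?P v c" for i v c
 proof -
  have "(\<lambda>w. gen_act n S i v w + (- c) * gen_act n S i ?e w) \<in> K"
   using Kgen[OF i v] unfolding gen_act_linear .
  from Kadd[OF this Kscale[OF Pe[OF i], of c]] show ?thesis by (simp add: algebra_simps)
 qed
 let ?L = "{v \<in> carrier ?M. \<exists>c. ?P v c}"
 have Ls: "submodule ?L (HA n) ?M"
 proof (rule hecke_submoduleI[OF perm_module_action(1)[OF S]])
  show "\<zero>\<^bsub>?M\<^esub> \<in> ?L" by (rule CollectI, rule conjI[OF _ exI[of _ 0]]) (use K0 in \<open>simp_all add: pm_simps\<close>)
  show "x \<oplus>\<^bsub>?M\<^esub> y \<in> ?L" if xy: "x \<in> ?L" "y \<in> ?L" for x y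
  proof -
   obtain c d where "?P x c" "?P y d" using xy by blast
   hence "?P (\<lambda>w. x w + y w) (c + d)" by (rule Padd)
   moreover have "x \<oplus>\<^bsub>?M\<^esub> y = (\<lambda>w. x w + y w)" by (simp add: pm_simps)
   moreover have "x \<oplus>\<^bsub>?M\<^esub> y \<in> carrier ?M" using xy by blast
   ultimately show ?thesis by (intro CollectI conjI exI[of _ "c + d"]) simp_all
  qed
  show "hecke_scalar n d \<odot>\<^bsub>?M\<^esub> x \<in> ?L" if "x \<in> ?L" for d x
   using that Pscale[of x _ d] M.lsmult_closed[OF scalar_closed[of n d], of x] unfolding act(2) by blast
  show "hecke_gen n i \<odot>\<^bsub>?M\<^esub> x \<in> ?L" if i: "i \<in> {1..<n}" and "x \<in> ?L" for i x
   using that(2) Pgen[OF i, of x] gen_act_closed[OF sub i] unfolding act(1)[OF i] by blast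
 qed blast
 have "k \<in> ?L" if "k \<in> K" for k
  by (rule CollectI, rule conjI[OF subsetD[OF KD(1) that] exI[of _ 0]]) (use that in simp)
 hence "K \<subseteq> ?L" by blast
 moreover have "?e \<in> ?L"
  by (rule CollectI, rule conjI[OF basis_vec_closed[OF g0(1)] exI[of _ 1]]) (use K0 in simp)
 ultimately have ex: "\<exists>c. ?P v c" if "v \<in> carrier ?M" for v using Kmax[OF Ls] g0(2) that by blast
 have uniq: "c = d" if "?P v c" "?P v d" for v c d
 proof (rule ccontr)
  assume ne: "c \<noteq> d"
  have "(\<lambda>w. (d - c) * ?e w) \<in> K" using Kadd[OF that(1) Kscale[OF that(2), of "-1"]] by (simp add: algebra_simps)
  from Kscale[OF this, of "1 / (d - c)"] show False using g0(2) ne by simp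
 qed
 define \<phi> where "\<phi> v = (SOME c. ?P v c)" for v
 have P: "?P v (\<phi> v)" if "v \<in> carrier ?M" for v unfolding \<phi>_def by (rule someI_ex[OF ex[OF that]])
 have \<phi>: "\<phi> v = c" if "v \<in> carrier ?M" "?P v c" for v c by (rule uniq[OF P[OF that(1)] that(2)])
 show ?thesis
 proof (rule that)
  show "eigenfunctional n S \<phi>"
   unfolding eigenfunctional_def
  proof (intro conjI ballI allI)
   fix u v assume uv: "u \<in> carrier ?M" "v \<in> carrier ?M"
   show "\<phi> (\<lambda>w. u w + v w) = \<phi> u + \<phi> v"
    by (rule \<phi>[OF _ Padd[OF P[OF uv(1)] P[OF uv(2)]]]) (use uv in \<open>simp add: pm_simps\<close>)
  next
   fix c v assume v: "v \<in> carrier ?M"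
   show "\<phi> (\<lambda>w. c * v w) = c * \<phi> v"
    by (rule \<phi>[OF _ Pscale[OF P[OF v]]]) (use v in \<open>simp add: pm_simps\<close>)
  next
   fix i assume i: "i \<in> {1..<n}"
   have "\<phi> (gen_act n S i v) = ?\<epsilon> i * \<phi> v" if "v \<in> carrier ?M" for v
    by (rule \<phi>[OF gen_act_closed[OF sub i] Pgen[OF i P[OF that]]])
   thus "(\<forall>v\<in>carrier ?M. \<phi> (gen_act n S i v) = \<phi> v) \<or> (\<forall>v\<in>carrier ?M. \<phi> (gen_act n S i v) = 0)"
    by (cases "i \<in> Des_L n z0") simp_all
  qed
  show "K = {v \<in> carrier ?M. \<phi> v = 0}"
  proof (intro equalityI subsetI)
   fix v assume v: "v \<in> K"
   hence "v \<in> carrier ?M" using KD(1) by blast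
   thus "v \<in> {v \<in> carrier ?M. \<phi> v = 0}" using \<phi>[of v 0] v by simp
  next
   fix v assume "v \<in> {v \<in> carrier ?M. \<phi> v = 0}"
   thus "v \<in> K" using P[of v] by simp
  qed
 qed
qed

text \<open>Evaluation at a shortest permutation \<open>z\<close> in the support of \<open>L\<close> is an eigenfunctional: the other
 term contributing to \<open>(\<pi>\<^sub>i u) z\<close> is the value of \<open>u\<close> at the shorter permutation \<open>s\<^sub>i z\<close>.  Its kernel in \<open>L\<close>
 is therefore a proper submodule, that is, zero.\<close>

lemma irreducible_submodule_eigenvector:
 assumes S: "weakly_convex n S" and L: "irreducible_submodule L (HA n) (perm_module n S)"
 obtains v where "v \<in> L" "v \<noteq> (\<lambda>w. 0)" "\<And>x. x \<in> L ==> \<exists>c. x = (\<lambda>w. c * v w)"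
  "\<And>i. i \<in> {1..<n} ==> gen_act n S i v = v \<or> gen_act n S i v = (\<lambda>w. 0)"
proof -
 let ?M = "perm_module n S"
 interpret M: hecke_module n ?M by (rule hecke_module.intro[OF perm_module_action(1)[OF S]])
 have sub: "S \<subseteq> perms n" using S by (simp add: weakly_convex_def)
 have Ls: "submodule L (HA n) ?M" and Lne: "L \<noteq> {\<zero>\<^bsub>?M\<^esub>}"
  and Lmin: "\<And>K. submodule K (HA n) ?M ==> K \<subseteq> L ==> K = {\<zero>\<^bsub>?M\<^esub>} \<or> K = L"
  using L by (auto simp: irreducible_submodule_def)
 note LD = M.submoduleD[OF Ls] and act = perm_module_action(2,3)[OF S]
 have Ladd: "(\<lambda>w. u w + v w) \<in> L" if "u \<in> L" "v \<in> L" for u v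
  using LD(3)[OF that] by (simp add: pm_simps)
 have Lscale: "(\<lambda>w. c * u w) \<in> L" if "u \<in> L" for u c
  using LD(4)[OF scalar_closed that] by (simp add: act(2))
 have Lgen: "gen_act n S i u \<in> L" if "i \<in> {1..<n}" "u \<in> L" for i u
  using LD(4)[OF hecke_gen_closed[OF that(1)] that(2)] by (simp add: act(1)[OF that(1)])
 let ?supp = "\<lambda>w. \<exists>u\<in>L. u w \<noteq> 0"
 have "\<exists>w. ?supp w" using Lne LD(2) by (auto simp: pm_simps fun_eq_iff)
 then obtain z where z: "?supp z" and short: "\<And>t. ?supp t ==> len n z \<le> len n t"
  using ex_has_least_nat[of ?supp _ "len n"] by blast
 then obtain v where v: "v \<in> L" "v z \<noteq> 0" by blast
 have z_S: "z \<in> S" using v LD(1) by (auto simp: pm_simps)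
 have eig: "gen_act n S i u z = (if i \<in> Des_L n z then u z else 0)" if i: "i \<in> {1..<n}" and u: "u \<in> L" for i u
 proof -
  have "u (tr i o z) = 0" if "i \<in> Des_L n z"
   using short[of "tr i o z"] inversions_down(2)[of z n i] that u z_S sub by fastforce
  thus ?thesis using z_S by (simp add: gen_act_apply[OF sub i])
 qed
 let ?K = "{u \<in> L. u z = 0}"
 have Ks: "submodule ?K (HA n) ?M"
 proof (rule hecke_submoduleI[OF perm_module_action(1)[OF S]])
  show "?K \<subseteq> carrier ?M" "\<zero>\<^bsub>?M\<^esub> \<in> ?K" using LD(1,2) by (auto simp: pm_simps)
  show "x \<oplus>\<^bsub>?M\<^esub> y \<in> ?K" if "x \<in> ?K" "y \<in> ?K" for x y
   using that Ladd by (simp add: pm_simps)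
  show "hecke_scalar n d \<odot>\<^bsub>?M\<^esub> x \<in> ?K" if "x \<in> ?K" for d x
   using that Lscale by (simp add: act(2))
  show "hecke_gen n i \<odot>\<^bsub>?M\<^esub> x \<in> ?K" if "i \<in> {1..<n}" "x \<in> ?K" for i x
   using that Lgen eig by (simp add: act(1))
 qed
 have "?K \<noteq> L" using v by blast
 hence "?K = {\<zero>\<^bsub>?M\<^esub>}" using Lmin[OF Ks] by blast
 hence "?K = {\<lambda>w. 0}" by (simp only: pm_simps)
 hence K: "u = (\<lambda>w. 0)" if "u \<in> L" "u z = 0" for u using that by blast
 have line: "\<exists>c. x = (\<lambda>w. c * v w)" if x: "x \<in> L" for x
 proof -
  define c where "c = - (x z / v z)"
  have "(\<lambda>w. x w + c * v w) = (\<lambda>w. 0)"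
   by (rule K[OF Ladd[OF x Lscale[OF v(1)]]]) (use v(2) in \<open>simp add: c_def\<close>)
  hence "x w = (- c) * v w" for w by (simp add: fun_eq_iff eq_neg_iff_add_eq_0)
  thus ?thesis by blast
 qed
 have "gen_act n S i v = v \<or> gen_act n S i v = (\<lambda>w. 0)" if i: "i \<in> {1..<n}" for i
 proof -
  obtain c where c: "gen_act n S i v = (\<lambda>w. c * v w)" using line[OF Lgen[OF i v(1)]] by blast
  have "c * v z = v z \<or> c * v z = 0" using eig[OF i v(1)] unfolding c by (auto split: if_splits)
  hence "c = 1 \<or> c = 0" using v(2) by auto
  thus ?thesis unfolding c by auto
 qed
 moreover have "v \<noteq> (\<lambda>w. 0)" using v(2) by auto
 ultimately show ?thesis using that v(1) line by blast
qed

section \<open>Permutations with prescribed descents and ascents\<close>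

text \<open>Stated through inversions, convexity in the weak order is immediate.\<close>

definition descent_set :: "nat => nat set => nat set => (nat => nat) set" where
 "descent_set n J K = {u \<in> perms n. block_pairs n J \<subseteq> inversions n u \<and>
   inversions n u \<inter> block_pairs n K = {}}"

lemma descent_set_iff:
 assumes "J \<subseteq> {1..<n}" "K \<subseteq> {1..<n}"
 shows "u \<in> descent_set n J K \<longleftrightarrow> u permutes {1..n} \<and>
  (\<forall>j\<in>J. u (Suc j) < u j) \<and> (\<forall>k\<in>K. u k < u (Suc k))"
proof (cases "u permutes {1..n}")
 case True
 have inj: "u k \<noteq> u (Suc k)" for k using permutes_inj[OF True] by (metis injD n_not_Suc_n)
 have pair: "(k, Suc k) \<in> block_pairs n I" if "k \<in> I" "I \<subseteq> {1..<n}" for k I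
  using that by (auto simp: block_pairs_def same_block_Suc)
 have 1: "block_pairs n J \<subseteq> inversions n u \<longleftrightarrow> (\<forall>j\<in>J. u (Suc j) < u j)"
 proof
  assume a: "block_pairs n J \<subseteq> inversions n u"
  show "\<forall>j\<in>J. u (Suc j) < u j"
  proof
   fix j assume "j \<in> J"
   hence "(j, Suc j) \<in> inversions n u" using a pair[OF _ assms(1)] by blast
   thus "u (Suc j) < u j" by (simp add: inversions_def)
  qed
 qed (use block_pairs_subset_inversions[OF True assms(1)] in blast)
 have 2: "inversions n u \<inter> block_pairs n K = {} \<longleftrightarrow> (\<forall>k\<in>K. u k < u (Suc k))"
 proof
  assume a: "inversions n u \<inter> block_pairs n K = {}"
  show "\<forall>k\<in>K. u k < u (Suc k)"
  proof
   fix k assume k: "k \<in> K"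
   hence "(k, Suc k) \<notin> inversions n u" using a pair[OF k assms(2)] by blast
   hence "\<not> u (Suc k) < u k" using k assms(2) by (auto simp: inversions_def)
   thus "u k < u (Suc k)" using inj[of k] by linarith
  qed
 next
  assume a: "\<forall>k\<in>K. u k < u (Suc k)"
  have False if ab: "(a, b) \<in> inversions n u" "(a, b) \<in> block_pairs n K" for a b
  proof -
   have "same_block K a b" using ab(2) by (simp add: block_pairs_def)
   from same_block_imp_descent[OF ab(1) this True] a show False by (meson less_asym)
  qed
  thus "inversions n u \<inter> block_pairs n K = {}" by auto
 qed
 show ?thesis using True 1 2 by (simp add: descent_set_def)
qed (simp add: descent_set_def)

lemma weakly_convex_descent_set: "weakly_convex n (descent_set n J K)"
 unfolding weakly_convex_def descent_set_def by blast

lemma inversions_top: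
 assumes K: "K \<subseteq> {1..<n}"
 shows "inversions n (longest_perm n o longest_parabolic n K) =
  {(a, b). a \<in> {1..n} \<and> b \<in> {1..n} \<and> a < b \<and> (a, b) \<notin> block_pairs n K}"
proof -
 let ?w = "longest_parabolic n K"
 note w = longest_parabolic[OF K]
 have "(a, b) \<in> inversions n (longest_perm n o ?w) \<longleftrightarrow> (a, b) \<notin> block_pairs n K"
  if ab: "a \<in> {1..n}" "b \<in> {1..n}" "a < b" for a b
 proof -
  have i: "?w a \<in> {1..n}" "?w b \<in> {1..n}" using permutes_in_image[OF w(1)] ab by blast+
  have "?w a \<noteq> ?w b" using permutes_inj[OF w(1)] ab by (auto dest: injD)
  hence "(a, b) \<in> inversions n (longest_perm n o ?w) \<longleftrightarrow> (a, b) \<notin> inversions n ?w"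
   using ab i by (auto simp: inversions_def longest_perm(2))
  thus ?thesis using w(4) by simp
 qed
 moreover have "inversions n (longest_perm n o ?w) \<subseteq> {(a, b). a \<in> {1..n} \<and> b \<in> {1..n} \<and> a < b}"
  by (auto simp: inversions_def)
 ultimately show ?thesis by blast
qed

lemma weak_interval_eq_descent_set:
 assumes "J \<subseteq> {1..<n}" "K \<subseteq> {1..<n}"
 shows "weak_interval n (longest_parabolic n J) (longest_perm n o longest_parabolic n K) = descent_set n J K"
proof -
 have p: "longest_perm n o longest_parabolic n K permutes {1..n}"
  using permutes_compose[OF longest_parabolic(1)[OF assms(2)] longest_perm(1)] .
 have "inversions n u \<subseteq> {(a, b). a \<in> {1..n} \<and> b \<in> {1..n} \<and> a < b}" for u
  by (auto simp: inversions_def)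
 hence "inversions n u \<subseteq> inversions n (longest_perm n o longest_parabolic n K) \<longleftrightarrow>
   inversions n u \<inter> block_pairs n K = {}" for u
  unfolding inversions_top[OF assms(2)] by blast
 thus ?thesis
  unfolding weak_interval_eq[OF longest_parabolic(1)[OF assms(1)] p] descent_set_def
   longest_parabolic(4)[OF assms(1)] by blast
qed

lemma block_preserving_Des_L:
 assumes u: "u permutes {1..n}" and bp: "block_preserving I u" and i: "i \<in> Des_L n u"
 shows "i \<in> I" and "block_preserving I (tr i o u)"
proof -
 have "(inv' u (Suc i), inv' u i) \<in> inversions n u" using inversions_down(1)[OF u i] by blast
 hence "same_block I (inv' u (Suc i)) (inv' u i)" by (rule block_preserving_inversions[OF u bp])
 moreover have "same_block I (inv' u k) k" for k
  using bp permutes_inverses(1)[OF u, of k] unfolding block_preserving_def by metis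
 ultimately have "same_block I i (Suc i)" using same_block_trans same_block_sym by meson
 thus "i \<in> I" by (simp add: same_block_Suc)
 thus "block_preserving I (tr i o u)"
  using block_preserving_comp[OF block_preserving_simple_transp bp] by blast
qed

definition regular_module :: "('r, 'k) ring_scheme => ('r, 'r) module" where
 "regular_module R = \<lparr>carrier = carrier R, mult = mult R, one = one R, zero = zero R, add = add R, smult = mult R\<rparr>"

lemma left_module_regular:
 assumes "ring R" shows "left_module R (regular_module R)"
proof -
 interpret ring R by fact
 have "abelian_group (regular_module R)"
 proof (rule abelian_groupI)
  fix x assume "x \<in> carrier (regular_module R)"
  thus "\<exists>y\<in>carrier (regular_module R). y \<oplus>\<^bsub>regular_module R\<^esub> x = \<zero>\<^bsub>regular_module R\<^esub>"
   by (intro bexI[of _ "\<ominus>\<^bsub>R\<^esub> x"]) (simp_all add: regular_module_def l_neg)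
 qed (simp_all add: regular_module_def a_assoc, simp add: a_comm)
 thus ?thesis
  by (intro left_module.intro left_module_axioms.intro assms)
   (simp_all add: regular_module_def l_distr r_distr m_assoc)
qed

text \<open>The prescribed descents are at \<open>J\<close> and the prescribed ascents at \<open>K\<close>.\<close>

locale descent_module =
 fixes n :: nat and J K :: "nat set"
 assumes J: "J \<subseteq> {1..<n}" and K: "K \<subseteq> {1..<n}" and JK: "J \<inter> K = {}"
begin

abbreviation "S \<equiv> descent_set n J K"
abbreviation "M \<equiv> perm_module n S"
abbreviation "x \<equiv> longest_parabolic n J"
abbreviation "e \<equiv> basis_vec"
abbreviation "g \<equiv> hecke_gen n"

lemma S_convex: "weakly_convex n S" by (rule weakly_convex_descent_set)
lemma S_sub: "S \<subseteq> perms n" by (auto simp: descent_set_def)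
lemma S_fin: "finite S" by (rule weakly_convexD(2)[OF S_convex])

sublocale M: hecke_module n M
 by (rule hecke_module.intro[OF perm_module_action(1)[OF S_convex]])

sublocale Z: zero_hecke_monoid "HA n" n g by (rule zero_hecke_monoid_hecke_alg)

lemma g_act: "i \<in> {1..<n} ==> g i \<odot>\<^bsub>M\<^esub> v = gen_act n S i v"
 by (rule perm_module_action(2)[OF S_convex])

lemma sc_act: "hecke_scalar n c \<odot>\<^bsub>M\<^esub> v = (\<lambda>w. c * v w)"
 by (rule perm_module_action(3)[OF S_convex])

lemma zero_M: "\<zero>\<^bsub>M\<^esub> = (\<lambda>w. 0)" by (simp add: pm_simps)

lemma x_perm: "x permutes {1..n}" by (rule longest_parabolic(1)[OF J])

lemma x_inversions: "inversions n x = block_pairs n J" by (rule longest_parabolic(4)[OF J])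

lemma S_iff: "u \<in> S \<longleftrightarrow> u permutes {1..n} \<and> inversions n x \<subseteq> inversions n u \<and>
  inversions n u \<inter> block_pairs n K = {}"
 by (simp add: descent_set_def x_inversions)

lemma x_in_S: "x \<in> S"
proof -
 have False if "(a, b) \<in> block_pairs n J" "(a, b) \<in> block_pairs n K" for a b
 proof -
  have ab: "a < b" "same_block J a b" "same_block K a b" using that by (simp_all add: block_pairs_def)
  hence "{a..<b} \<subseteq> J" "{a..<b} \<subseteq> K" using same_block_less[of a b] by simp_all
  moreover have "a \<in> {a..<b}" using ab(1) by simp
  ultimately show False using JK by blast
 qed
 thus ?thesis unfolding S_iff using x_perm x_inversions by auto
qed

lemma e_closed: "u \<in> S ==> e u \<in> carrier M" by (rule basis_vec_closed)

lemma g_e: "i \<in> {1..<n} ==> u \<in> S ==> g i \<odot>\<^bsub>M\<^esub> e u = gen_act_basis n S i u"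
 by (simp add: g_act gen_act_basis_vec[OF S_sub])

lemma g_x: assumes j: "j \<in> J" shows "g j \<odot>\<^bsub>M\<^esub> e x = e x"
proof -
 have "j \<in> {1..<n}" "j \<in> Des_L n x" using j J longest_parabolic(3)[OF J] by blast+
 thus ?thesis using g_e[OF _ x_in_S, of j] by (simp only: gen_act_basis_def if_True)
qed

lemma elt_x: "u permutes {1..n} ==> block_preserving J u ==> Z.elt u \<odot>\<^bsub>M\<^esub> e x = e x"
proof (induction "len n u" arbitrary: u rule: less_induct)
 case less
 show ?case
 proof (cases "Des_L n u = {}")
  case True
  have "u = id" by (rule Des_L_empty_imp_id[OF less(2) True])
  thus ?thesis using M.lsmult_one[OF e_closed[OF x_in_S]] Z.elt_id by metis
 next
  case False
  then obtain i where i: "i \<in> Des_L n u" by blast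
  note i' = Des_L_subset[OF i]
  note bp = block_preserving_Des_L[OF less(2,3) i]
  note p = tr_comp_permutes[OF i' less(2)]
  have IH: "Z.elt (tr i o u) \<odot>\<^bsub>M\<^esub> e x = e x"
   by (rule less(1)[OF _ p bp(2)]) (use inversions_down(2)[OF less(2) i] in simp)
  show ?thesis
   unfolding Z.elt_rec[OF less(2) i]
    M.lsmult_assoc[OF hecke_gen_closed[OF i'] Z.elt_closed[OF p] e_closed[OF x_in_S]] IH
   by (rule g_x[OF bp(1)])
 qed
qed

text \<open>Climbing from \<open>x\<close> in the weak order moves the basis vector inside the set; a step out of the set
 kills it, and convexity prevents a return.\<close>

lemma elt_above:
 "u permutes {1..n} ==> inversions n x \<subseteq> inversions n u ==>
  Z.elt u \<odot>\<^bsub>M\<^esub> e x = (if u \<in> S then e u else \<zero>\<^bsub>M\<^esub>)"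
proof (induction "len n u" arbitrary: u rule: less_induct)
 case less
 show ?case
 proof (cases "u = x")
  case True
  thus ?thesis using elt_x[OF x_perm longest_parabolic(2)[OF J]] x_in_S by simp
 next
  case False
  from weak_step_down[OF x_perm less(2,3)] False obtain i where
   i: "i \<in> Des_L n u" "inversions n x \<subseteq> inversions n (tr i o u)" by metis
  note i' = Des_L_subset[OF i(1)]
  let ?d = "tr i o u"
  note p = tr_comp_permutes[OF i' less(2)]
  have sub: "inversions n ?d \<subseteq> inversions n u" using inversions_down(1)[OF less(2) i(1)] by blast
  have IH: "Z.elt ?d \<odot>\<^bsub>M\<^esub> e x = (if ?d \<in> S then e ?d else \<zero>\<^bsub>M\<^esub>)"
   by (rule less(1)[OF _ p i(2)]) (use inversions_down(2)[OF less(2) i(1)] in simp)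
  have 1: "Z.elt u \<odot>\<^bsub>M\<^esub> e x = g i \<odot>\<^bsub>M\<^esub> (Z.elt ?d \<odot>\<^bsub>M\<^esub> e x)"
   unfolding Z.elt_rec[OF less(2) i(1)]
    M.lsmult_assoc[OF hecke_gen_closed[OF i'] Z.elt_closed[OF p] e_closed[OF x_in_S]] ..
  show ?thesis
  proof (cases "?d \<in> S")
   case True
   have nd: "i \<notin> Des_L n ?d" using Des_L_simple_transp_same[OF less(2) i'] i(1) by blast
   show ?thesis unfolding 1 IH using True g_e[OF i' True] nd
    by (simp add: gen_act_basis_def zero_M)
  next
   case False
   hence "u \<notin> S" using p i(2) sub unfolding S_iff by blast
   thus ?thesis unfolding 1 IH using False M.lsmult_zero_right[OF hecke_gen_closed[OF i']] by simp
  qed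
 qed
qed

text \<open>The filtration by length; the maps below are the identity on its successive quotients.\<close>

definition V_ge :: "nat => pvec set" where
 "V_ge l = carrier (perm_module n {u \<in> S. l \<le> len n u})"

lemma V_ge_iff: "v \<in> V_ge l \<longleftrightarrow> v \<in> carrier M \<and> (\<forall>w. v w \<noteq> 0 --> l \<le> len n w)"
 unfolding V_ge_def pm_simps by blast

lemma V_ge_carrier: "v \<in> V_ge l ==> v \<in> carrier M" by (simp add: V_ge_iff)

lemma V_ge_mono: "l \<le> l' ==> v \<in> V_ge l' ==> v \<in> V_ge l" unfolding V_ge_iff using le_trans by blast

lemma V_ge_lincomb: "u \<in> V_ge l ==> v \<in> V_ge l ==> (\<lambda>w. u w + c * v w) \<in> V_ge l"
 unfolding V_ge_def pm_simps by simp

lemma V_ge_zero: "(\<lambda>w. 0) \<in> V_ge l" unfolding V_ge_def pm_simps by simp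

lemma elt_right_gen:
 assumes "u permutes {1..n}" "k \<in> {1..<n}"
 obtains u' where "u' permutes {1..n}" "Z.elt u \<otimes>\<^bsub>HA n\<^esub> g k = Z.elt u'" "len n u \<le> len n u'"
  "u k < u (Suc k) ==> len n u' = Suc (len n u)"
proof (cases "u (Suc k) < u k")
 case True
 thus ?thesis using that[of u] assms(1) Z.elt_right_descent(1)[OF assms True] by simp
next
 case False
 moreover have "u k \<noteq> u (Suc k)" using permutes_inj[OF assms(1)] by (metis injD n_not_Suc_n)
 ultimately have lt: "u k < u (Suc k)" by linarith
 have p: "u o tr k permutes {1..n}"
  using permutes_compose[OF simple_transp_permutes[OF assms(2)] assms(1)] .
 show ?thesis
  by (rule that[OF p Z.elt_right_ascent(1)[OF assms lt]]) (use Z.elt_right_ascent(2)[OF assms lt] in simp_all)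
qed

text \<open>Among the permutations whose element has the same effect on the generator, a longest one has
 descents throughout \<open>J\<close>, since \<open>\<pi>\<^sub>j\<close> with \<open>j \<in> J\<close> fixes the generator.\<close>

lemma elt_length_bound:
 assumes u: "u permutes {1..n}"
 shows "Z.elt u \<odot>\<^bsub>M\<^esub> e x \<in> V_ge (len n u)"
proof -
 let ?Q = "\<lambda>v. len n u \<le> len n v \<and> Z.elt v \<odot>\<^bsub>M\<^esub> e x = Z.elt u \<odot>\<^bsub>M\<^esub> e x"
 obtain v where d: "v permutes {1..n}" "len n u \<le> len n v"
   "Z.elt v \<odot>\<^bsub>M\<^esub> e x = Z.elt u \<odot>\<^bsub>M\<^esub> e x"
  and mx: "\<And>v'. v' permutes {1..n} ==> ?Q v' ==> len n v' \<le> len n v"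
  using longest_element_exists[of "perms n" n u ?Q] u by auto
 have "v (Suc j) < v j" if j: "j \<in> J" for j
 proof (rule ccontr)
  assume "\<not> ?thesis"
  moreover have "v j \<noteq> v (Suc j)" using permutes_inj[OF d(1)] by (metis injD n_not_Suc_n)
  ultimately have lt: "v j < v (Suc j)" by linarith
  have j': "j \<in> {1..<n}" using j J by blast
  from elt_right_gen[OF d(1) j'] lt obtain v' where d': "v' permutes {1..n}"
   "Z.elt v \<otimes>\<^bsub>HA n\<^esub> g j = Z.elt v'" "len n v' = Suc (len n v)" by metis
  have "Z.elt v' \<odot>\<^bsub>M\<^esub> e x = Z.elt v \<odot>\<^bsub>M\<^esub> e x"
   unfolding d'(2)[symmetric]
    M.lsmult_assoc[OF Z.elt_closed[OF d(1)] hecke_gen_closed[OF j'] e_closed[OF x_in_S]] g_x[OF j] ..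
  thus False using mx[OF d'(1)] d(2,3) d'(3) by simp
 qed
 hence "inversions n x \<subseteq> inversions n v"
  unfolding x_inversions by (rule block_pairs_subset_inversions[OF d(1) J])
 from elt_above[OF d(1) this] have "Z.elt u \<odot>\<^bsub>M\<^esub> e x = (if v \<in> S then e v else \<zero>\<^bsub>M\<^esub>)" using d(3) by simp
 thus ?thesis using d(2) V_ge_zero zero_M by (auto simp: V_ge_iff basis_vec_def pm_simps)
qed

text \<open>An element annihilated from the left by all \<open>\<pi>\<^sub>k\<close> with \<open>k \<in> K\<close> is found here, and membership is all
 that the computation of leading terms uses.\<close>

inductive_set bar_K :: "hecke set" where
 one: "\<one>\<^bsub>HA n\<^esub> \<in> bar_K"
| step: "k \<in> K ==> q \<in> bar_K ==> (\<one>\<^bsub>HA n\<^esub> \<ominus>\<^bsub>HA n\<^esub> g k) \<otimes>\<^bsub>HA n\<^esub> q \<in> bar_K"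

lemma bar_K_closed: "q \<in> bar_K ==> q \<in> carrier (HA n)"
proof (induction rule: bar_K.induct)
 case (step k q)
 thus ?case using K hecke_gen_closed by (simp add: subset_eq)
qed simp

lemma bar_K_expand:
 assumes q: "q \<in> carrier (HA n)" and k: "k \<in> K" and v: "v permutes {1..n}"
 shows "Z.elt v \<odot>\<^bsub>M\<^esub> (((\<one>\<^bsub>HA n\<^esub> \<ominus>\<^bsub>HA n\<^esub> g k) \<otimes>\<^bsub>HA n\<^esub> q) \<odot>\<^bsub>M\<^esub> e x) =
  (\<lambda>u. (Z.elt v \<odot>\<^bsub>M\<^esub> (q \<odot>\<^bsub>M\<^esub> e x)) u + (-1) * ((Z.elt v \<otimes>\<^bsub>HA n\<^esub> g k) \<odot>\<^bsub>M\<^esub> (q \<odot>\<^bsub>M\<^esub> e x)) u)"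
proof -
 note ex = e_closed[OF x_in_S]
 have k': "k \<in> {1..<n}" using k K by blast
 note gk = hecke_gen_closed[OF k'] and eg = Z.elt_closed[OF v]
 have qx: "q \<odot>\<^bsub>M\<^esub> e x \<in> carrier M" by (rule M.lsmult_closed[OF q ex])
 have gqx: "g k \<odot>\<^bsub>M\<^esub> (q \<odot>\<^bsub>M\<^esub> e x) \<in> carrier M" by (rule M.lsmult_closed[OF gk qx])
 have neg: "\<ominus>\<^bsub>M\<^esub> w = hecke_scalar n (-1) \<odot>\<^bsub>M\<^esub> w" if "w \<in> carrier M" for w
  using M.M.minus_equality[of "hecke_scalar n (-1) \<odot>\<^bsub>M\<^esub> w" w] M.cscale_minus[OF that]
   M.M.a_comm[OF that M.cscale_closed[OF that]] that M.cscale_closed[OF that] by simp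
 have "((\<one>\<^bsub>HA n\<^esub> \<ominus>\<^bsub>HA n\<^esub> g k) \<otimes>\<^bsub>HA n\<^esub> q) \<odot>\<^bsub>M\<^esub> e x = (\<one>\<^bsub>HA n\<^esub> \<ominus>\<^bsub>HA n\<^esub> g k) \<odot>\<^bsub>M\<^esub> (q \<odot>\<^bsub>M\<^esub> e x)"
  by (rule M.lsmult_assoc[OF _ q ex]) (use gk in simp)
 also have "\<dots> = q \<odot>\<^bsub>M\<^esub> e x \<oplus>\<^bsub>M\<^esub> hecke_scalar n (-1) \<odot>\<^bsub>M\<^esub> (g k \<odot>\<^bsub>M\<^esub> (q \<odot>\<^bsub>M\<^esub> e x))"
  using gk qx gqx by (simp add: M.R.minus_eq M.lsmult_l_distr M.lsmult_minus_left M.lsmult_one neg)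
 finally have "Z.elt v \<odot>\<^bsub>M\<^esub> (((\<one>\<^bsub>HA n\<^esub> \<ominus>\<^bsub>HA n\<^esub> g k) \<otimes>\<^bsub>HA n\<^esub> q) \<odot>\<^bsub>M\<^esub> e x) = Z.elt v \<odot>\<^bsub>M\<^esub> (q \<odot>\<^bsub>M\<^esub> e x) \<oplus>\<^bsub>M\<^esub>
   hecke_scalar n (-1) \<odot>\<^bsub>M\<^esub> (Z.elt v \<odot>\<^bsub>M\<^esub> (g k \<odot>\<^bsub>M\<^esub> (q \<odot>\<^bsub>M\<^esub> e x)))"
  using M.lsmult_r_distr[OF eg qx M.cscale_closed[OF gqx, of "-1"]] M.smult_cscale[OF eg gqx, of "-1"] by simp
 thus ?thesis unfolding M.lsmult_assoc[OF eg gk qx] sc_act by (simp add: pm_simps)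
qed

lemma bar_K_length_bound:
 "q \<in> bar_K ==> u permutes {1..n} ==> Z.elt u \<odot>\<^bsub>M\<^esub> (q \<odot>\<^bsub>M\<^esub> e x) \<in> V_ge (len n u)"
proof (induction arbitrary: u rule: bar_K.induct)
 case one
 thus ?case using elt_length_bound M.lsmult_one[OF e_closed[OF x_in_S]] by simp
next
 case (step k q)
 have k': "k \<in> {1..<n}" using step.hyps(1) K by blast
 obtain u' where g': "u' permutes {1..n}" "Z.elt u \<otimes>\<^bsub>HA n\<^esub> g k = Z.elt u'"
  "len n u \<le> len n u'" using elt_right_gen[OF step.prems k'] by metis
 show ?case
  unfolding bar_K_expand[OF bar_K_closed[OF step.hyps(2)] step.hyps(1) step.prems] g'(2)
  by (rule V_ge_lincomb[OF step.IH[OF step.prems] V_ge_mono[OF g'(3) step.IH[OF g'(1)]]])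
qed

text \<open>Multiplying on the right by a generator at an ascent lengthens \<open>u\<close>; so replacing \<open>x\<close> by
 \<open>q x\<close> changes \<open>\<pi>\<^sub>u x\<close> only by longer basis vectors.\<close>

lemma bar_K_leading_term:
 "q \<in> bar_K ==> u \<in> S ==> \<exists>r\<in>V_ge (Suc (len n u)). Z.elt u \<odot>\<^bsub>M\<^esub> (q \<odot>\<^bsub>M\<^esub> e x) = (\<lambda>w. e u w + r w)"
proof (induction rule: bar_K.induct)
 case one
 have "Z.elt u \<odot>\<^bsub>M\<^esub> e x = e u" using elt_above one unfolding S_iff by simp
 thus ?case using M.lsmult_one[OF e_closed[OF x_in_S]] by (intro bexI[OF _ V_ge_zero]) simp
next
 case (step k q)
 have u: "u permutes {1..n}" using step.prems S_sub by blast
 have k': "k \<in> {1..<n}" using step.hyps(1) K by blast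
 have "u k < u (Suc k)" using step.prems step.hyps(1) descent_set_iff[OF J K] by blast
 then obtain u' where g': "u' permutes {1..n}" "Z.elt u \<otimes>\<^bsub>HA n\<^esub> g k = Z.elt u'"
  "len n u' = Suc (len n u)" using elt_right_gen[OF u k'] by metis
 obtain r where r: "r \<in> V_ge (Suc (len n u))" "Z.elt u \<odot>\<^bsub>M\<^esub> (q \<odot>\<^bsub>M\<^esub> e x) = (\<lambda>w. e u w + r w)"
  using step.IH[OF step.prems] by blast
 have r': "Z.elt u' \<odot>\<^bsub>M\<^esub> (q \<odot>\<^bsub>M\<^esub> e x) \<in> V_ge (Suc (len n u))"
  using bar_K_length_bound[OF step.hyps(2) g'(1)] g'(3) by simp
 show ?case
  unfolding bar_K_expand[OF bar_K_closed[OF step.hyps(2)] step.hyps(1) u] g'(2) r(2)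
  by (rule bexI[OF _ V_ge_lincomb[OF r(1) r', of "-1"]]) (auto simp: fun_eq_iff algebra_simps)
qed

lemma bar_K_absorbing:
 obtains q where "q \<in> bar_K" "\<And>k. k \<in> K ==> g k \<otimes>\<^bsub>HA n\<^esub> q = \<zero>\<^bsub>HA n\<^esub>"
proof -
 interpret B: zero_hecke_monoid "HA n" n "\<lambda>i. \<one>\<^bsub>HA n\<^esub> \<ominus>\<^bsub>HA n\<^esub> g i"
  by (rule one_minus_zero_hecke[OF ring_hecke_alg zero_hecke_monoid_hecke_alg])
 have mem: "u permutes {1..n} ==> block_preserving K u ==> B.elt u \<in> bar_K" for u
 proof (induction "len n u" arbitrary: u rule: less_induct)
  case less
  show ?case
  proof (cases "Des_L n u = {}")
   case True
   have "u = id" by (rule Des_L_empty_imp_id[OF less(2) True])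
   thus ?thesis using bar_K.one B.elt_id by metis
  next
   case False
   then obtain i where i: "i \<in> Des_L n u" by blast
   note bp = block_preserving_Des_L[OF less(2,3) i]
   note p = tr_comp_permutes[OF Des_L_subset[OF i] less(2)]
   have "B.elt (tr i o u) \<in> bar_K"
    by (rule less(1)[OF _ p bp(2)]) (use inversions_down(2)[OF less(2) i] in simp)
   thus ?thesis unfolding B.elt_rec[OF less(2) i] by (rule bar_K.step[OF bp(1)])
  qed
 qed
 let ?q = "B.elt (longest_parabolic n K)"
 note w = longest_parabolic[OF K]
 have q: "?q \<in> bar_K" by (rule mem[OF w(1,2)])
 note qc = bar_K_closed[OF q]
 have "g k \<otimes>\<^bsub>HA n\<^esub> ?q = \<zero>\<^bsub>HA n\<^esub>" if k: "k \<in> K" for k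
 proof -
  have gk: "g k \<in> carrier (HA n)" using k K hecke_gen_closed by blast
  have "(\<one>\<^bsub>HA n\<^esub> \<ominus>\<^bsub>HA n\<^esub> g k) \<otimes>\<^bsub>HA n\<^esub> ?q = ?q" using B.elt_absorb[OF w(1)] w(3) k by blast
  hence "?q \<oplus>\<^bsub>HA n\<^esub> \<ominus>\<^bsub>HA n\<^esub> (g k \<otimes>\<^bsub>HA n\<^esub> ?q) = ?q"
   using gk qc by (simp add: M.R.minus_eq M.R.l_distr M.R.l_minus)
  hence "\<ominus>\<^bsub>HA n\<^esub> (g k \<otimes>\<^bsub>HA n\<^esub> ?q) = \<zero>\<^bsub>HA n\<^esub>"
   using gk qc by (metis M.R.a_inv_closed M.R.add.l_cancel_one' M.R.m_closed)
  thus ?thesis using gk qc by (metis M.R.m_closed M.R.minus_minus M.R.minus_zero)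
 qed
 thus ?thesis using that q by blast
qed

text \<open>The map sending \<open>z\<close> to \<open>\<pi>\<^sub>z q\<close> is a homomorphism to the regular module: where \<open>s\<^sub>i z\<close> leaves
 the set it has a descent in \<open>K\<close>, which \<open>q\<close> annihilates.\<close>

lemma hom_to_regular:
 obtains s q where "q \<in> bar_K" "s \<in> module_hom (HA n) M (regular_module (HA n))"
  "\<And>z. z \<in> S ==> s (e z) = Z.elt z \<otimes>\<^bsub>HA n\<^esub> q"
proof -
 obtain q where q: "q \<in> bar_K" "\<And>k. k \<in> K ==> g k \<otimes>\<^bsub>HA n\<^esub> q = \<zero>\<^bsub>HA n\<^esub>" using bar_K_absorbing by blast
 note qc = bar_K_closed[OF q(1)]
 let ?b = "\<lambda>z. Z.elt z \<otimes>\<^bsub>HA n\<^esub> q"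
 let ?s = "\<lambda>v. \<Oplus>\<^bsub>HA n\<^esub>z\<in>S. hecke_scalar n (v z) \<otimes>\<^bsub>HA n\<^esub> ?b z"
 have bc: "?b z \<in> carrier (HA n)" if "z \<in> S" for z using Z.elt_closed S_sub that qc by blast
 have cb: "hecke_scalar n c \<otimes>\<^bsub>HA n\<^esub> ?b z \<in> carrier (HA n)" if "z \<in> S" for c z
  using bc[OF that] scalar_closed by simp
 have sc: "?s v \<in> carrier (HA n)" for v by (rule M.R.finsum_closed) (use cb in blast)
 have s_add: "?s (\<lambda>w. u w + v w) = ?s u \<oplus>\<^bsub>HA n\<^esub> ?s v" for u v
 proof -
  have "?s (\<lambda>w. u w + v w) = (\<Oplus>\<^bsub>HA n\<^esub>z\<in>S. hecke_scalar n (u z) \<otimes>\<^bsub>HA n\<^esub> ?b z \<oplus>\<^bsub>HA n\<^esub> hecke_scalar n (v z) \<otimes>\<^bsub>HA n\<^esub> ?b z)"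
   by (rule M.R.finsum_cong') (use cb bc scalar_closed in \<open>auto simp: M.H.sc_add M.R.l_distr\<close>)
  also have "\<dots> = ?s u \<oplus>\<^bsub>HA n\<^esub> ?s v" by (rule M.R.finsum_addf) (use cb in auto)
  finally show ?thesis .
 qed
 have s_scale: "?s (\<lambda>w. c * v w) = hecke_scalar n c \<otimes>\<^bsub>HA n\<^esub> ?s v" for c v
 proof -
  have "?s (\<lambda>w. c * v w) = (\<Oplus>\<^bsub>HA n\<^esub>z\<in>S. hecke_scalar n c \<otimes>\<^bsub>HA n\<^esub> (hecke_scalar n (v z) \<otimes>\<^bsub>HA n\<^esub> ?b z))"
   by (rule M.R.finsum_cong') (use cb bc scalar_closed in \<open>auto simp: M.H.sc_mult M.R.m_assoc\<close>)
  also have "\<dots> = hecke_scalar n c \<otimes>\<^bsub>HA n\<^esub> ?s v"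
   by (rule M.R.finsum_rdistr[symmetric]) (use S_fin scalar_closed cb in auto)
  finally show ?thesis .
 qed
 have s_e: "?s (e z) = ?b z" if g: "z \<in> S" for z
 proof -
  have "?s (e z) = (\<Oplus>\<^bsub>HA n\<^esub>d\<in>S. if z = d then ?b d else \<zero>\<^bsub>HA n\<^esub>)"
   by (rule M.R.finsum_cong') (use bc in \<open>auto simp: basis_vec_def M.H.sc_one M.H.sc_zero\<close>)
  also have "\<dots> = ?b z" by (rule M.R.finsum_singleton[OF g S_fin]) (use bc in auto)
  finally show ?thesis .
 qed
 have s0: "?s (\<lambda>w. 0) = \<zero>\<^bsub>HA n\<^esub>"
 proof -
  have "?s (\<lambda>w. 0) = (\<Oplus>\<^bsub>HA n\<^esub>z\<in>S. \<zero>\<^bsub>HA n\<^esub>)"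
   by (rule M.R.finsum_cong') (use bc in \<open>auto simp: M.H.sc_zero\<close>)
  thus ?thesis by (simp only: M.R.finsum_zero)
 qed
 have s_gb: "?s (gen_act n S i (e z)) = g i \<otimes>\<^bsub>HA n\<^esub> ?b z" if i: "i \<in> {1..<n}" and g: "z \<in> S" for i z
 proof -
  have z: "z permutes {1..n}" using g S_sub by blast
  have as: "g i \<otimes>\<^bsub>HA n\<^esub> ?b z = (g i \<otimes>\<^bsub>HA n\<^esub> Z.elt z) \<otimes>\<^bsub>HA n\<^esub> q"
   using hecke_gen_closed[OF i] Z.elt_closed[OF z] qc by (simp add: M.R.m_assoc)
  consider "i \<in> Des_L n z" | "i \<notin> Des_L n z" "tr i o z \<in> S"
   | "i \<notin> Des_L n z" "tr i o z \<notin> S" by blast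
  thus ?thesis
  proof cases
   case 1
   thus ?thesis unfolding gen_act_basis_vec[OF S_sub i g] gen_act_basis_def as
    using s_e[OF g] Z.elt_absorb[OF z 1] by simp
  next
   case 2
   thus ?thesis unfolding gen_act_basis_vec[OF S_sub i g] gen_act_basis_def as
    using s_e[OF 2(2)] Z.elt_up[OF z i 2(1)] by simp
  next
   case 3
   let ?d = "tr i o z"
   have p: "?d permutes {1..n}" by (rule tr_comp_permutes[OF i z])
   have "inversions n x \<subseteq> inversions n ?d" using g inversions_up(1)[OF z i 3(1)] unfolding S_iff by blast
   then obtain a b where ab: "(a, b) \<in> inversions n ?d" "(a, b) \<in> block_pairs n K"
    using 3(2) p unfolding S_iff by auto
   hence "same_block K a b" by (simp add: block_pairs_def)
   from same_block_imp_descent[OF ab(1) this p] obtain k where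
    k: "k \<in> K" "k \<in> {1..<n}" "?d (Suc k) < ?d k" by blast
   have "Z.elt ?d \<otimes>\<^bsub>HA n\<^esub> q = Z.elt ?d \<otimes>\<^bsub>HA n\<^esub> (g k \<otimes>\<^bsub>HA n\<^esub> q)"
    using Z.elt_right_descent(1)[OF p k(2,3)] Z.elt_closed[OF p] hecke_gen_closed[OF k(2)] qc
    by (metis M.R.m_assoc)
   also have "\<dots> = \<zero>\<^bsub>HA n\<^esub>" using q(2)[OF k(1)] Z.elt_closed[OF p] by simp
   finally show ?thesis unfolding gen_act_basis_vec[OF S_sub i g] gen_act_basis_def as
    using 3 s0 Z.elt_up[OF z i 3(1)] by simp
  qed
 qed
 have "?s \<in> module_hom (HA n) M (regular_module (HA n))"
 proof (rule hecke_module_homI[OF perm_module_action(1)[OF S_convex] left_module_regular[OF ring_hecke_alg]])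
  fix i v assume i: "i \<in> {1..<n}" and v: "v \<in> carrier M"
  note gi = hecke_gen_closed[OF i]
  have "?s (gen_act n S i v) = g i \<otimes>\<^bsub>HA n\<^esub> ?s v" using S_fin v
  proof (induction rule: pvec_induct)
   case zero
   thus ?case using s0 gi gen_act_linear(2)[of n S i 0 "\<lambda>w. 0"] by simp
  next
   case (step v c z)
   show ?case
    unfolding gen_act_linear s_add s_scale step.IH s_gb[OF i step.hyps(2)] s_e[OF step.hyps(2)]
    using gi sc bc[OF step.hyps(2)] scalar_closed[of n c] M.H.sc_central[OF gi, of c]
    by (simp add: M.R.r_distr M.R.m_assoc[symmetric])
  qed
  thus "?s (g i \<odot>\<^bsub>M\<^esub> v) = g i \<odot>\<^bsub>regular_module (HA n)\<^esub> ?s v"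
   by (simp add: g_act[OF i] regular_module_def)
 qed (use sc s_add s_scale in \<open>simp_all add: regular_module_def pm_simps(3) sc_act\<close>)
 thus ?thesis using that q(1) s_e by blast
qed

text \<open>The lowest term of a vector survives, whence injectivity; surjectivity follows by correcting a
 vector from the bottom up, which ends as lengths are bounded.\<close>

lemma unitriangular_bijective:
 assumes \<phi>: "\<phi> \<in> module_hom (HA n) M M"
  and tri: "\<And>y. y \<in> S ==> \<exists>r\<in>V_ge (Suc (len n y)). \<phi> (e y) = (\<lambda>z. e y z + r z)"
 shows "bij_betw \<phi> (carrier M) (carrier M)"
proof -
 have add: "\<phi> (\<lambda>z. u z + v z) = (\<lambda>z. \<phi> u z + \<phi> v z)" if "u \<in> carrier M" "v \<in> carrier M" for u v
  using module_homD(2)[OF \<phi> that] by (simp add: pm_simps(3))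
 have scale: "\<phi> (\<lambda>z. c * v z) = (\<lambda>z. c * \<phi> v z)" if "v \<in> carrier M" for c v
  using module_homD(3)[OF \<phi> scalar_closed that, of c] by (simp add: sc_act)
 have cl: "\<phi> v \<in> carrier M" if "v \<in> carrier M" for v using module_homD(1)[OF \<phi> that] .
 have cscale: "(\<lambda>z. c * v z) \<in> carrier M" if "v \<in> carrier M" for c v using that by (simp add: pm_simps)
 have zM: "(\<lambda>z. 0) \<in> carrier M" by (simp add: pm_simps)
 have phi0: "\<phi> (\<lambda>z. 0) = (\<lambda>z. 0)" using scale[OF zM, of 0] by simp
 have diff: "(\<lambda>z. \<phi> v z - v z) \<in> V_ge (Suc l)" if "v \<in> V_ge l" for v l
 proof -
  have f: "finite {y \<in> S. l \<le> len n y}" using S_fin by simp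
  show ?thesis using f that[unfolded V_ge_def]
  proof (induction rule: pvec_induct)
   case zero
   thus ?case using V_ge_zero by (simp add: phi0)
  next
   case (step v c y)
   have v: "v \<in> carrier M" using step.hyps(1) V_ge_carrier unfolding V_ge_def by blast
   have g: "y \<in> S" "Suc l \<le> Suc (len n y)" using step.hyps(2) by auto
   obtain r where r: "r \<in> V_ge (Suc (len n y))" "\<phi> (e y) = (\<lambda>z. e y z + r z)" using tri[OF g(1)] by blast
   have "(\<lambda>z. \<phi> (\<lambda>z. v z + c * e y z) z - (v z + c * e y z)) = (\<lambda>z. (\<phi> v z - v z) + c * r z)"
    unfolding add[OF v cscale[OF e_closed[OF g(1)]]] scale[OF e_closed[OF g(1)]] r(2)
    by (simp add: algebra_simps)
   thus ?case using V_ge_lincomb[OF step.IH V_ge_mono[OF g(2) r(1)]] by simp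
  qed
 qed
 have inj0: "v = (\<lambda>z. 0)" if v: "v \<in> carrier M" "\<phi> v = (\<lambda>z. 0)" for v
 proof (rule ccontr)
  assume "v \<noteq> (\<lambda>z. 0)"
  then obtain y' where "v y' \<noteq> 0" by auto
  from ex_has_least_nat[of "\<lambda>t. v t \<noteq> 0" y' "len n", OF this] obtain y where
   y: "v y \<noteq> 0" "\<And>t. v t \<noteq> 0 ==> len n y \<le> len n t" by blast
  have "v \<in> V_ge (len n y)" using v(1) y(2) by (simp add: V_ge_iff)
  from diff[OF this] have "(\<lambda>z. - v z) \<in> V_ge (Suc (len n y))" using v(2) by simp
  thus False using y(1) by (force simp: V_ge_iff)
 qed
 have "inj_on \<phi> (carrier M)"
 proof (rule inj_onI)
  fix u v assume uv: "u \<in> carrier M" "v \<in> carrier M" "\<phi> u = \<phi> v"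
  have "\<phi> (\<lambda>z. u z + (-1) * v z) = (\<lambda>z. 0)"
   unfolding add[OF uv(1) cscale[OF uv(2)]] scale[OF uv(2)] uv(3) by simp
  moreover have "(\<lambda>z. u z + (-1) * v z) \<in> carrier M" using uv(1,2) by (simp add: pm_simps)
  ultimately have "(\<lambda>z. u z + (-1) * v z) = (\<lambda>z. 0)" using inj0 by blast
  thus "u = v" by (auto simp: fun_eq_iff)
 qed
 have surj: "\<exists>v\<in>carrier M. \<phi> v = w" if "w \<in> V_ge l" "l + m = Suc (card ({1..n} \<times> {1..n}))" for w l m
  using that
 proof (induction m arbitrary: w l)
  case 0
  have "w z = 0" for z
  proof (rule ccontr)
   assume a: "w z \<noteq> 0"
   have "w \<in> carrier M" by (rule V_ge_carrier[OF 0(1)])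
   hence "z permutes {1..n}" using a S_sub unfolding pm_simps by blast
   from perm_length_less[OF this] show False using a 0 by (force simp: V_ge_iff)
  qed
  hence "w = (\<lambda>z. 0)" by auto
  thus ?case using phi0 zM by blast
 next
  case (Suc m)
  note w = V_ge_carrier[OF Suc.prems(1)]
  let ?d = "\<lambda>z. 0 + (-1) * (\<phi> w z - w z)"
  have "?d \<in> V_ge (Suc l)" by (rule V_ge_lincomb[OF V_ge_zero diff[OF Suc.prems(1)]])
  from Suc.IH[OF this] Suc.prems(2) obtain v where v: "v \<in> carrier M" "\<phi> v = ?d" by auto
  have "\<phi> (\<lambda>z. w z + v z) = w" unfolding add[OF w v(1)] v(2) by auto
  moreover have "(\<lambda>z. w z + v z) \<in> carrier M" using w v(1) by (simp add: pm_simps)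
  ultimately show ?case by blast
 qed
 have "\<phi> ` carrier M = carrier M"
 proof -
  have "\<exists>v\<in>carrier M. \<phi> v = w" if "w \<in> carrier M" for w
   using surj[of w 0 "Suc (card ({1..n} \<times> {1..n}))"] that by (simp add: V_ge_iff)
  thus ?thesis using cl by blast
 qed
 with \<open>inj_on \<phi> (carrier M)\<close> show ?thesis unfolding bij_betw_def by blast
qed

text \<open>Correct the homomorphism to the regular module by the inverse of a unitriangular endomorphism.\<close>

theorem regular_retract_M: "\<exists>s. regular_retract (HA n) M (e x) s"
proof -
 obtain q s where sq: "q \<in> bar_K" "s \<in> module_hom (HA n) M (regular_module (HA n))"
  "\<And>z. z \<in> S ==> s (e z) = Z.elt z \<otimes>\<^bsub>HA n\<^esub> q" by (rule hom_to_regular) (rule that)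
 note ex = e_closed[OF x_in_S]
 have sc: "s v \<in> carrier (HA n)" if "v \<in> carrier M" for v
  using module_homD(1)[OF sq(2) that] by (simp add: regular_module_def)
 have s_add: "s (u \<oplus>\<^bsub>M\<^esub> v) = s u \<oplus>\<^bsub>HA n\<^esub> s v" if "u \<in> carrier M" "v \<in> carrier M" for u v
  using module_homD(2)[OF sq(2) that] by (simp add: regular_module_def)
 have s_smult: "s (h \<odot>\<^bsub>M\<^esub> v) = h \<otimes>\<^bsub>HA n\<^esub> s v" if "h \<in> carrier (HA n)" "v \<in> carrier M" for h v
  using module_homD(3)[OF sq(2) that] by (simp add: regular_module_def)
 let ?\<phi> = "\<lambda>v. s v \<odot>\<^bsub>M\<^esub> e x"
 have \<phi>: "?\<phi> \<in> module_hom (HA n) M M"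
  by (rule module_homI)
   (simp_all add: M.lsmult_closed[OF sc ex] s_add s_smult M.lsmult_l_distr[OF sc sc ex] M.lsmult_assoc[OF _ sc ex])
 have b: "bij_betw ?\<phi> (carrier M) (carrier M)"
 proof (rule unitriangular_bijective[OF \<phi>])
  fix z assume g: "z \<in> S"
  hence "z permutes {1..n}" using S_sub by blast
  hence "?\<phi> (e z) = Z.elt z \<odot>\<^bsub>M\<^esub> (q \<odot>\<^bsub>M\<^esub> e x)"
   using sq(3)[OF g] M.lsmult_assoc[OF Z.elt_closed bar_K_closed[OF sq(1)] ex] by simp
  thus "\<exists>r\<in>V_ge (Suc (len n z)). ?\<phi> (e z) = (\<lambda>w. e z w + r w)"
   using bar_K_leading_term[OF sq(1) g] by simp
 qed
 note inv = module_hom_inv_into[OF \<phi> b perm_module_action(1)[OF S_convex]]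
 let ?\<psi> = "inv_into (carrier M) ?\<phi>"
 note psi = module_homD[OF inv(1)]
 have "regular_retract (HA n) M (e x) (\<lambda>v. s (?\<psi> v))"
  unfolding regular_retract_def
 proof (intro conjI ballI)
  show "left_module (HA n) M" by (rule perm_module_action(1)[OF S_convex])
  show "e x \<in> carrier M" by (rule ex)
  fix p assume p: "p \<in> carrier M"
  show "s (?\<psi> p) \<in> carrier (HA n)" by (rule sc[OF psi(1)[OF p]])
  show "s (?\<psi> p) \<odot>\<^bsub>M\<^esub> e x = p" using bij_betw_inv_into_right[OF b p] .
  show "s (?\<psi> (p \<oplus>\<^bsub>M\<^esub> p')) = s (?\<psi> p) \<oplus>\<^bsub>HA n\<^esub> s (?\<psi> p')" if p': "p' \<in> carrier M" for p'
   unfolding psi(2)[OF p p'] by (rule s_add[OF psi(1)[OF p] psi(1)[OF p']])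
  show "s (?\<psi> (r \<odot>\<^bsub>M\<^esub> p)) = r \<otimes>\<^bsub>HA n\<^esub> s (?\<psi> p)" if r: "r \<in> carrier (HA n)" for r
   unfolding psi(3)[OF r p] by (rule s_smult[OF r psi(1)[OF p]])
 qed
 thus ?thesis by blast
qed

text \<open>Let \<open>E\<close> be the set of generators fixing \<open>\<phi>\<close>.  A basis vector on which \<open>\<phi>\<close> does not vanish arises
 from \<open>x\<close> through generators in \<open>E\<close> only, so its permutation preserves the blocks of \<open>E\<close>.  The longest
 such permutation reverses these blocks, so \<open>E\<close> and \<open>K\<close> are disjoint.\<close>

theorem eigenfunctional_support:
 assumes \<phi>: "eigenfunctional n S \<phi>" and u: "u \<in> S" "\<phi> (e u) \<noteq> 0"
 shows "inversions n u \<subseteq> block_pairs n ({1..<n} - K)"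
proof -
 have scale: "\<phi> (\<lambda>w. c * v w) = c * \<phi> v" if "v \<in> carrier M" for v c
  using \<phi> that unfolding eigenfunctional_def by blast
 have \<phi>0: "\<phi> (\<lambda>w. 0) = 0" using scale[OF e_closed[OF x_in_S], of 0] by simp
 define E where "E = {i \<in> {1..<n}. \<forall>v\<in>carrier M. \<phi> (gen_act n S i v) = \<phi> v}"
 have E: "E \<subseteq> {1..<n}" by (auto simp: E_def)
 have fixE: "\<phi> (gen_act n S i (e z)) = \<phi> (e z)" if "i \<in> E" "z \<in> S" for i z
  using that e_closed[OF that(2)] by (auto simp: E_def)
 have kill: "i \<in> E" if "i \<in> {1..<n}" "z \<in> S" "\<phi> (gen_act n S i (e z)) \<noteq> 0" for i z
  using \<phi> that e_closed[OF that(2)] unfolding eigenfunctional_def E_def by blast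
 have bp: "z \<in> S ==> \<phi> (e z) \<noteq> 0 ==> block_preserving E z" for z
 proof (induction "len n z" arbitrary: z rule: less_induct)
  case less
  have z: "z permutes {1..n}" "inversions n x \<subseteq> inversions n z" using less(2) unfolding S_iff by blast+
  show ?case
  proof (cases "z = x")
   case True
   have "J \<subseteq> E"
   proof
    fix j assume j: "j \<in> J"
    hence j': "j \<in> {1..<n}" using J by blast
    show "j \<in> E"
     by (rule kill[OF j' x_in_S]) (use less(3) True g_x[OF j] in \<open>simp add: g_act[OF j']\<close>)
   qed
   thus ?thesis using block_preserving_mono[OF _ longest_parabolic(2)[OF J]] True by simp
  next
   case False
   from weak_step_down[OF x_perm z] False obtain i where
    i: "i \<in> Des_L n z" "inversions n x \<subseteq> inversions n (tr i o z)" by metis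
   note i' = Des_L_subset[OF i(1)]
   let ?t = "tr i o z"
   have p: "?t permutes {1..n}" by (rule tr_comp_permutes[OF i' z(1)])
   have t: "?t \<in> S" using less(2) p i(2) inversions_down(1)[OF z(1) i(1)] unfolding S_iff by blast
   have nd: "i \<notin> Des_L n ?t" using Des_L_simple_transp_same[OF z(1) i'] i(1) by blast
   have act: "gen_act n S i (e ?t) = e z"
    unfolding gen_act_basis_vec[OF S_sub i' t] gen_act_basis_def using nd less(2) by simp
   have iE: "i \<in> E" using kill[OF i' t] act less(3) by simp
   hence "block_preserving E ?t"
    using less(1)[OF _ t] inversions_down(2)[OF z(1) i(1)] fixE[OF iE t] act less(3) by simp
   from block_preserving_comp[OF block_preserving_simple_transp[OF iE] this] show ?thesis by simp
  qed
 qed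
 have EK: "E \<inter> K = {}"
 proof -
  obtain z where d: "z \<in> S" "\<phi> (e z) \<noteq> 0"
   and mx: "\<And>z'. z' \<in> S ==> \<phi> (e z') \<noteq> 0 ==> len n z' \<le> len n z"
   using longest_element_exists[OF S_sub u(1), of "\<lambda>u. \<phi> (e u) \<noteq> 0"] u(2) by auto
  have z: "z permutes {1..n}" using d(1) S_sub by blast
  have "E \<subseteq> Des_L n z"
  proof
   fix i assume i: "i \<in> E"
   hence i': "i \<in> {1..<n}" using E by blast
   show "i \<in> Des_L n z"
   proof (rule ccontr)
    assume nd: "i \<notin> Des_L n z"
    have "\<phi> (gen_act n S i (e z)) \<noteq> 0" using fixE[OF i d(1)] d(2) by simp
    hence "tr i o z \<in> S" "\<phi> (e (tr i o z)) \<noteq> 0"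
     unfolding gen_act_basis_vec[OF S_sub i' d(1)] gen_act_basis_def using nd \<phi>0
     by (auto split: if_splits)
    thus False using mx inversions_up(2)[OF z i' nd] by fastforce
   qed
  qed
  note dec = block_preserving_decreasing[OF z bp[OF d] this]
  have False if k: "k \<in> E" "k \<in> K" for k
  proof -
   have "z (Suc k) < z k" using dec[of k "Suc k"] k(1) same_block_Suc by blast
   moreover have "z k < z (Suc k)" using d(1) k(2) descent_set_iff[OF J K] by blast
   ultimately show False by simp
  qed
  thus ?thesis by blast
 qed
 have p: "u permutes {1..n}" using u(1) S_sub by blast
 show ?thesis
 proof (rule subrelI)
  fix a b assume ab: "(a, b) \<in> inversions n u"
  have "same_block E a b" by (rule block_preserving_inversions[OF p bp[OF u] ab])
  hence "same_block ({1..<n} - K) a b" by (rule same_block_mono[rotated]) (use E EK in blast)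
  thus "(a, b) \<in> block_pairs n ({1..<n} - K)" using ab by (auto simp: block_pairs_def inversions_def)
 qed
qed

lemma eigenfunctional_zero:
 assumes \<phi>: "eigenfunctional n S \<phi>" and v: "v \<in> carrier M"
  and z: "\<And>p. p \<in> S ==> inversions n p \<subseteq> block_pairs n ({1..<n} - K) ==> v p = 0"
 shows "\<phi> v = 0"
proof -
 have add: "\<phi> (\<lambda>y. u y + w y) = \<phi> u + \<phi> w" and scale: "\<phi> (\<lambda>y. c * u y) = c * \<phi> u"
  if "u \<in> carrier M" "w \<in> carrier M" for u w c
  using \<phi> that unfolding eigenfunctional_def by (blast, blast)
 let ?S = "{p \<in> S. \<not> inversions n p \<subseteq> block_pairs n ({1..<n} - K)}"
 have "finite ?S" using S_fin by simp
 moreover have "v \<in> carrier (perm_module n ?S)" using v z unfolding pm_simps by blast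
 ultimately show ?thesis
 proof (induction rule: pvec_induct)
  case zero
  show ?case using scale[OF e_closed[OF x_in_S] e_closed[OF x_in_S], of 0] by simp
 next
  case (step v c p)
  have v: "v \<in> carrier M" using step.hyps(1) by (auto simp: pm_simps)
  have p: "e p \<in> carrier M" "\<phi> (e p) = 0" using step.hyps(2) e_closed eigenfunctional_support[OF \<phi>] by blast+
  have "(\<lambda>y. c * e p y) \<in> carrier M" using p(1) by (simp add: pm_simps)
  thus ?case using add[OF v] scale[OF p(1) p(1), of c] step.IH p(2) by simp
 qed
qed

corollary in_radical:
 assumes v: "v \<in> carrier M"
  and z: "\<And>u. u \<in> S ==> inversions n u \<subseteq> block_pairs n ({1..<n} - K) ==> v u = 0"
 shows "v \<in> module_rad (HA n) M"
 unfolding module_rad_def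
proof (intro CollectI conjI allI impI v)
 fix K0 assume max: "maximal_submodule K0 (HA n) M"
 obtain \<phi> where \<phi>: "eigenfunctional n S \<phi>" "K0 = {v \<in> carrier M. \<phi> v = 0}"
  by (rule maximal_submodule_functional[OF S_convex max])
 show "v \<in> K0" unfolding \<phi>(2) using v eigenfunctional_zero[OF \<phi>(1) v z] by blast
qed

end

section \<open>Compositions and their sets of partial sums\<close>

lemma comp_set_Nil [simp]: "comp_set [] = {}"
 by (auto simp: comp_set_def)

lemma comp_set_Cons: "comp_set (a # b) = (if b = [] then {} else insert a ((+) a ` comp_set b))"
proof (cases "b = []")
 case False
 have "x \<in> comp_set (a # b) \<longleftrightarrow> x \<in> insert a ((+) a ` comp_set b)" for x
 proof
  assume "x \<in> comp_set (a # b)"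
  then obtain k where k: "1 \<le> k" "k < Suc (length b)" "x = sum_list (take k (a # b))"
   by (auto simp: comp_set_def)
  then obtain k' where "k = Suc k'" by (cases k) auto
  thus "x \<in> insert a ((+) a ` comp_set b)"
   using k by (cases "k' = 0") (auto simp: comp_set_def intro!: imageI)
 next
  assume "x \<in> insert a ((+) a ` comp_set b)"
  then consider "x = a" | k where "1 \<le> k" "k < length b" "x = a + sum_list (take k b)"
   by (auto simp: comp_set_def)
  thus "x \<in> comp_set (a # b)"
  proof cases
   case 1
   thus ?thesis using False unfolding comp_set_def by (intro CollectI exI[of _ 1]) simp
  next
   case 2
   thus ?thesis unfolding comp_set_def by (intro CollectI exI[of _ "Suc k"]) simp
  qed
 qed
 thus ?thesis using False by auto
qed (auto simp: comp_set_def)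

lemma comp_set_subset: "0 \<notin> set b ==> comp_set b \<subseteq> {1..<sum_list b}"
proof (induction b)
 case (Cons a b)
 hence "b \<noteq> [] ==> 0 < sum_list b" by (cases b) auto
 thus ?case using Cons by (auto simp: comp_set_Cons)
qed simp

lemma composition_exists: "A \<subseteq> {1..<n} ==> \<exists>c. composition n c \<and> comp_set c = A"
proof (induction n arbitrary: A rule: less_induct)
 case (less n)
 show ?case
 proof (cases "A = {}")
  case True
  show ?thesis
  proof (cases "n = 0")
   case True
   thus ?thesis using \<open>A = {}\<close> by (intro exI[of _ "[]"]) (simp add: composition_def)
  next
   case False
   thus ?thesis using \<open>A = {}\<close> by (intro exI[of _ "[n]"]) (simp add: composition_def comp_set_Cons)
  qed
 next
  case False
  have fin: "finite A" using less(2) finite_subset by blast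
  define a where "a = Min A"
  have a: "a \<in> A" "\<And>x. x \<in> A ==> a \<le> x" using fin False by (auto simp: a_def)
  have an: "1 \<le> a" "a < n" using a(1) less(2) by auto
  let ?A = "(\<lambda>x. x - a) ` (A - {a})"
  have "?A \<subseteq> {1..<n - a}"
  proof
   fix y assume "y \<in> ?A"
   then obtain x where x: "x \<in> A" "x \<noteq> a" "y = x - a" by blast
   hence "a < x" "x < n" using a(2)[OF x(1)] less(2) by auto
   thus "y \<in> {1..<n - a}" using x by auto
  qed
  from less(1)[OF _ this] an obtain c where b: "composition (n - a) c" "comp_set c = ?A" by auto
  have "c \<noteq> []" using b(1) an by (auto simp: composition_def)
  moreover have "(+) a ` ?A = A - {a}"
  proof
   show "(+) a ` ?A \<subseteq> A - {a}" using a(2) by (auto simp: image_image)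
   show "A - {a} \<subseteq> (+) a ` ?A"
   proof
    fix x assume x: "x \<in> A - {a}"
    hence "x = a + (x - a)" using a(2)[of x] by simp
    thus "x \<in> (+) a ` ?A" using x by blast
   qed
  qed
  ultimately have "comp_set (a # c) = A" using b(2) a(1) by (auto simp: comp_set_Cons)
  moreover have "composition n (a # c)" using b(1) an by (auto simp: composition_def)
  ultimately show ?thesis by blast
 qed
qed

lemma composition_unique:
 "composition n c ==> composition n u ==> comp_set c = comp_set u ==> c = u"
proof (induction c arbitrary: u n)
 case Nil
 thus ?case by (cases u) (auto simp: composition_def)
next
 case (Cons a c)
 then obtain b v where u: "u = b # v" by (cases u) (auto simp: composition_def)
 have pos: "x > 0" if "x \<in> comp_set c \<or> x \<in> comp_set v" for x
  using that comp_set_subset[of c] comp_set_subset[of v] Cons.prems(1,2) u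
  by (auto simp: composition_def)
 show ?case
 proof (cases "c = []")
  case True
  thus ?thesis using Cons.prems u by (cases "v = []") (auto simp: composition_def comp_set_Cons)
 next
  case False
  hence d: "v \<noteq> []" using Cons.prems(3) u by (auto simp: comp_set_Cons)
  have eq: "insert a ((+) a ` comp_set c) = insert b ((+) b ` comp_set v)"
   using Cons.prems(3) u False d by (simp add: comp_set_Cons)
  have "a \<in> insert b ((+) b ` comp_set v)" "b \<in> insert a ((+) a ` comp_set c)" using eq by auto
  hence ab: "a = b" by auto
  have "a \<notin> (+) a ` comp_set c" "a \<notin> (+) a ` comp_set v" using pos[of 0] by (auto simp: image_iff)
  hence "(+) a ` comp_set c = (+) a ` comp_set v" using eq unfolding ab by (metis insert_ident)
  hence "comp_set c = comp_set v" by (simp add: inj_image_eq_iff)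
  moreover have "composition (n - a) c" "composition (n - a) v"
   using Cons.prems(1,2) u ab by (auto simp: composition_def)
  ultimately show ?thesis using Cons.IH u ab by blast
 qed
qed

lemma comp_compl:
 assumes "0 \<notin> set \<alpha>"
 shows "composition (sum_list \<alpha>) (comp_compl \<alpha>)"
  and "comp_set (comp_compl \<alpha>) = {1..<sum_list \<alpha>} - comp_set \<alpha>"
proof -
 obtain c where b: "composition (sum_list \<alpha>) c \<and> comp_set c = {1..<sum_list \<alpha>} - comp_set \<alpha>"
  using composition_exists[of "{1..<sum_list \<alpha>} - comp_set \<alpha>" "sum_list \<alpha>"] by blast
 have "comp_compl \<alpha> = c"
  unfolding comp_compl_def by (rule the_equality[of _ c]) (use b composition_unique in auto)
 thus "composition (sum_list \<alpha>) (comp_compl \<alpha>)"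
  "comp_set (comp_compl \<alpha>) = {1..<sum_list \<alpha>} - comp_set \<alpha>" using b by auto
qed

lemma comp_set_append:
 "\<alpha> \<noteq> [] ==> b \<noteq> [] ==>
  comp_set (\<alpha> @ b) = comp_set \<alpha> \<union> insert (sum_list \<alpha>) ((+) (sum_list \<alpha>) ` comp_set b)"
proof (induction \<alpha>)
 case (Cons a \<alpha>)
 show ?case
 proof (cases "\<alpha> = []")
  case False
  thus ?thesis using Cons by (simp add: comp_set_Cons image_Un image_image add.assoc insert_commute)
 qed (use Cons in \<open>simp add: comp_set_Cons\<close>)
qed simp

lemma comp_set_near_concat2:
 "\<alpha> \<noteq> [] ==> c \<noteq> [] ==>
  comp_set (near_concat2 \<alpha> c) = comp_set \<alpha> \<union> (+) (sum_list \<alpha>) ` comp_set c"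
proof (induction \<alpha>)
 case (Cons a \<alpha>)
 obtain b u where c: "c = b # u" using Cons by (cases c) auto
 show ?case
 proof (cases "\<alpha> = []")
  case True
  thus ?thesis by (simp add: near_concat2_def c comp_set_Cons image_image add.assoc)
 next
  case False
  hence "near_concat2 (a # \<alpha>) c = a # near_concat2 \<alpha> c" using Cons.prems by (simp add: near_concat2_def)
  moreover have "near_concat2 \<alpha> c \<noteq> []" using False Cons.prems by (simp add: near_concat2_def)
  ultimately show ?thesis using Cons False
   by (simp add: comp_set_Cons image_Un image_image add.assoc)
 qed
qed simp

lemma near_concat_Cons: "near_concat (b # A) = near_concat2 b (near_concat A)"
 by (simp add: near_concat_def)

lemma near_concat_eq_Nil: "\<forall>b\<in>set A. b \<noteq> [] ==> near_concat A = [] \<longleftrightarrow> A = []"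
 by (cases A) (auto simp: near_concat_def near_concat2_def)

text \<open>The generalized compositions below have no empty components.\<close>

definition proper_gcomp :: "gcomp => bool" where
 "proper_gcomp A \<longleftrightarrow> (\<forall>b\<in>set A. b \<noteq> [] \<and> 0 \<notin> set b)"

lemma comp_set_near_concat_Cons:
 "proper_gcomp (b # A) ==> comp_set (near_concat (b # A)) =
  comp_set b \<union> (+) (sum_list b) ` comp_set (near_concat A)"
 using near_concat_eq_Nil[of A] comp_set_near_concat2[of b "near_concat A"]
 by (cases "A = []") (auto simp: proper_gcomp_def near_concat_Cons near_concat_def near_concat2_def)

lemma comp_set_concat_Cons:
 "proper_gcomp (b # A) ==> comp_set (concat (b # A)) = comp_set b \<union>
  (if A = [] then {} else insert (sum_list b) ((+) (sum_list b) ` comp_set (concat A)))"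
 using comp_set_append[of b "concat A"] by (auto simp: proper_gcomp_def)

lemma comp_set_concat_near_subset:
 assumes "proper_gcomp A"
 shows "comp_set (near_concat A) \<subseteq> comp_set (concat A)" "comp_set (concat A) \<subseteq> {1..<sum_list (concat A)}"
proof -
 show "comp_set (near_concat A) \<subseteq> comp_set (concat A)" using assms
 proof (induction A)
  case (Cons b A)
  hence "proper_gcomp A" by (simp add: proper_gcomp_def)
  thus ?case using Cons comp_set_near_concat_Cons[OF Cons.prems] comp_set_concat_Cons[OF Cons.prems]
   by (cases "A = []") (auto simp: near_concat_def)
 qed (simp add: near_concat_def)
 show "comp_set (concat A) \<subseteq> {1..<sum_list (concat A)}"
  by (rule comp_set_subset) (use assms in \<open>auto simp: proper_gcomp_def\<close>)
qed

lemma sum_list_comp_compl: "0 \<notin> set b ==> sum_list (comp_compl b) = sum_list b"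
 using comp_compl(1) by (simp add: composition_def)

lemma proper_map_comp_compl:
 assumes "proper_gcomp A" shows "proper_gcomp (map comp_compl A)"
proof -
 have "comp_compl b \<noteq> [] \<and> 0 \<notin> set (comp_compl b)" if "b \<noteq> []" "0 \<notin> set b" for b
 proof -
  have "sum_list b \<noteq> 0" using that by (cases b) auto
  thus ?thesis using comp_compl(1)[OF that(2)] by (auto simp: composition_def)
 qed
 thus ?thesis using assms by (auto simp: proper_gcomp_def)
qed

lemma interval_split_compl:
 assumes "X \<subseteq> {1..<b}" "Y \<subseteq> {1..<(m::nat)}" "0 < b" "0 < m"
 shows "{1..<b + m} - (X \<union> (+) b ` Y) = ({1..<b} - X) \<union> insert b ((+) b ` ({1..<m} - Y))"
  "{1..<b + m} - (X \<union> insert b ((+) b ` Y)) = ({1..<b} - X) \<union> ((+) b ` ({1..<m} - Y))"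
proof -
 have "z \<in> (+) b ` Z \<longleftrightarrow> b \<le> z \<and> z - b \<in> Z" for z Z by force
 thus "{1..<b + m} - (X \<union> (+) b ` Y) = ({1..<b} - X) \<union> insert b ((+) b ` ({1..<m} - Y))"
  "{1..<b + m} - (X \<union> insert b ((+) b ` Y)) = ({1..<b} - X) \<union> ((+) b ` ({1..<m} - Y))"
  using assms by auto
qed

text \<open>Complementing every component turns concatenation into near-concatenation, since the
 boundaries between components are the only positions on which the two differ.\<close>

lemma comp_set_map_comp_compl:
 "proper_gcomp A ==>
  comp_set (concat (map comp_compl A)) = {1..<sum_list (concat A)} - comp_set (near_concat A) \<and>
  comp_set (near_concat (map comp_compl A)) = {1..<sum_list (concat A)} - comp_set (concat A) \<and>
  sum_list (concat (map comp_compl A)) = sum_list (concat A)"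
proof (induction A)
 case (Cons d A)
 have p: "proper_gcomp A" "d \<noteq> []" "0 \<notin> set d" using Cons.prems by (auto simp: proper_gcomp_def)
 note IH = Cons.IH[OF p(1), THEN conjunct1] Cons.IH[OF p(1), THEN conjunct2, THEN conjunct1]
  Cons.IH[OF p(1), THEN conjunct2, THEN conjunct2]
 have pc: "proper_gcomp (comp_compl d # map comp_compl A)"
  using proper_map_comp_compl[OF Cons.prems] by simp
 note c = comp_compl(2)[OF p(3)] sum_list_comp_compl[OF p(3)]
 have b: "0 < sum_list d" using p(2,3) by (cases d) auto
 have bs: "comp_set d \<subseteq> {1..<sum_list d}" by (rule comp_set_subset[OF p(3)])
 have sm: "sum_list (concat (d # A)) = sum_list d + sum_list (concat A)" by simp
 have "sum_list (concat (map comp_compl (d # A))) = sum_list (concat (d # A))" using c IH by simp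
 moreover have "comp_set (concat (map comp_compl (d # A))) =
   {1..<sum_list (concat (d # A))} - comp_set (near_concat (d # A)) \<and>
  comp_set (near_concat (map comp_compl (d # A))) =
   {1..<sum_list (concat (d # A))} - comp_set (concat (d # A))"
 proof (cases "A = []")
  case True
  moreover have "comp_compl d \<noteq> []" using pc by (simp add: proper_gcomp_def)
  ultimately show ?thesis using c p(2) by (simp add: near_concat_def near_concat2_def)
 next
  case False
  then obtain u A' where A': "A = u # A'" by (cases A) auto
  hence "u \<noteq> []" "0 \<notin> set u" using p(1) by (auto simp: proper_gcomp_def)
  hence m: "0 < sum_list (concat A)" unfolding A' by (cases u) auto
  note s = interval_split_compl[OF bs _ b m]
  have sub: "comp_set (near_concat A) \<subseteq> {1..<sum_list (concat A)}" "comp_set (concat A) \<subseteq> {1..<sum_list (concat A)}"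
   using comp_set_concat_near_subset[OF p(1)] by blast+
  have "comp_set (concat (map comp_compl (d # A))) =
    {1..<sum_list (concat (d # A))} - comp_set (near_concat (d # A))"
   unfolding list.map comp_set_concat_Cons[OF pc] comp_set_near_concat_Cons[OF Cons.prems] c IH sm s(1)[OF sub(1)]
   using False by simp
  moreover have "comp_set (near_concat (map comp_compl (d # A))) =
    {1..<sum_list (concat (d # A))} - comp_set (concat (d # A))"
   unfolding list.map comp_set_near_concat_Cons[OF pc] comp_set_concat_Cons[OF Cons.prems] c IH sm
   using False s(2)[OF sub(2)] by simp
  ultimately show ?thesis by blast
 qed
 ultimately show ?case by blast
qed (simp add: near_concat_def)

lemma comp_set_rev: "comp_set (rev b) = (\<lambda>z. sum_list b - z) ` comp_set b"
proof (induction b)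
 case (Cons a b)
 show ?case
 proof (cases "b = []")
  case False
  hence "comp_set (rev (a # b)) = comp_set (rev b) \<union> {sum_list b}"
   using comp_set_append[of "rev b" "[a]"] by (simp add: comp_set_Cons sum_list_rev)
  thus ?thesis using Cons.IH False by (simp add: comp_set_Cons image_image)
 qed (simp add: comp_set_Cons)
qed simp

lemma comp_set_near_concat_append:
 "proper_gcomp A ==> proper_gcomp B ==> comp_set (near_concat (A @ B)) =
  comp_set (near_concat A) \<union> (+) (sum_list (concat A)) ` comp_set (near_concat B)"
proof (induction A)
 case (Cons b A)
 have p: "proper_gcomp A" "proper_gcomp (b # (A @ B))" using Cons.prems by (auto simp: proper_gcomp_def)
 show ?case
  using comp_set_near_concat_Cons[OF p(2)] comp_set_near_concat_Cons[OF Cons.prems(1)] Cons.IH[OF p(1) Cons.prems(2)]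
  by (auto simp: image_Un image_image add.assoc)
qed (simp add: near_concat_def)

lemma near_concat_rev:
 "proper_gcomp A ==> comp_set (near_concat (rev (map rev A))) =
  (\<lambda>z. sum_list (concat A) - z) ` comp_set (near_concat A)"
proof (induction A)
 case (Cons b A)
 have p: "proper_gcomp A" "proper_gcomp (rev (map rev A))" "proper_gcomp [rev b]" "0 \<notin> set b"
  using Cons.prems by (auto simp: proper_gcomp_def)
 have s: "sum_list (concat (rev (map rev A))) = sum_list (concat A)"
  by (induction A) (simp_all add: sum_list_rev)
 have "comp_set (near_concat (rev (map rev (b # A)))) =
   (\<lambda>z. sum_list (concat A) - z) ` comp_set (near_concat A) \<union> (+) (sum_list (concat A)) ` comp_set (rev b)"
  using comp_set_near_concat_append[OF p(2,3)] Cons.IH[OF p(1)] s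
  by (simp add: near_concat_def near_concat2_def)
 moreover have "(\<lambda>z. sum_list b + sum_list (concat A) - z) ` comp_set b = (+) (sum_list (concat A)) ` comp_set (rev b)"
  unfolding comp_set_rev image_image
  by (rule image_cong[OF refl]) (use comp_set_subset[OF p(4)] in auto)
 ultimately show ?case
  unfolding comp_set_near_concat_Cons[OF Cons.prems] by (simp add: image_Un image_image Un_commute)
qed (simp add: near_concat_def)

text \<open>Complementing and reversing trades the two kinds of concatenation and reflects the partial sums.\<close>

lemma gcomp_cr_sets:
 assumes "proper_gcomp A"
 shows "comp_set (concat (gcomp_cr A)) = (\<lambda>z. sum_list (concat A) - z) ` ({1..<sum_list (concat A)} - comp_set (near_concat A))"
  and "comp_set (near_concat (gcomp_cr A)) = (\<lambda>z. sum_list (concat A) - z) ` ({1..<sum_list (concat A)} - comp_set (concat A))"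
  and "proper_gcomp (gcomp_cr A)" and "sum_list (concat (gcomp_cr A)) = sum_list (concat A)"
proof -
 let ?B = "map comp_compl A"
 have g: "gcomp_cr A = rev (map rev ?B)" by (simp add: gcomp_cr_def comp_def)
 have c: "concat (gcomp_cr A) = rev (concat ?B)" unfolding g by (simp add: rev_concat rev_map)
 note p = proper_map_comp_compl[OF assms] and m = comp_set_map_comp_compl[OF assms, THEN conjunct1]
  comp_set_map_comp_compl[OF assms, THEN conjunct2, THEN conjunct1]
  comp_set_map_comp_compl[OF assms, THEN conjunct2, THEN conjunct2]
 show "comp_set (concat (gcomp_cr A)) = (\<lambda>z. sum_list (concat A) - z) ` ({1..<sum_list (concat A)} - comp_set (near_concat A))"
  unfolding c comp_set_rev m ..
 show "comp_set (near_concat (gcomp_cr A)) = (\<lambda>z. sum_list (concat A) - z) ` ({1..<sum_list (concat A)} - comp_set (concat A))"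
  unfolding g near_concat_rev[OF p] m ..
 show "proper_gcomp (gcomp_cr A)" using p unfolding g by (auto simp: proper_gcomp_def)
 show "sum_list (concat (gcomp_cr A)) = sum_list (concat A)" unfolding c using m(3) by (simp add: sum_list_rev)
qed

section \<open>Diagrams of skew shapes\<close>

lemma part_nth: "1 \<le> i ==> i \<le> length p ==> part p i = p ! (i - 1)"
 by (simp add: part_def)

lemma part_antimono:
 assumes "is_partition p" "1 \<le> i" "i \<le> k"
 shows "part p k \<le> part p i"
proof (cases "i = k \<or> length p < k")
 case False
 hence "i - 1 < k - 1" "k - 1 < length p" using assms by auto
 hence "p ! (k - 1) \<le> p ! (i - 1)" using assms(1) unfolding is_partition_def sorted_wrt_iff_nth_less by blast
 thus ?thesis using False assms by (simp add: part_def)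
qed (auto simp: part_def)

lemma part_pos_iff:
 assumes "is_partition p" shows "0 < part p i \<longleftrightarrow> 1 \<le> i \<and> i \<le> length p"
proof -
 have "p ! (i - 1) \<noteq> 0" if "1 \<le> i" "i \<le> length p"
 proof -
  have "p ! (i - 1) \<in> set p" using that by (intro nth_mem) auto
  thus ?thesis using assms by (metis is_partition_def)
 qed
 thus ?thesis by (auto simp: part_def)
qed

lemma partition_eqI:
 assumes "is_partition p" "is_partition q" "\<And>i. part p i = part q i"
 shows "p = q"
proof -
 have iff: "1 \<le> i \<and> i \<le> length p \<longleftrightarrow> 1 \<le> i \<and> i \<le> length q" for i
  using part_pos_iff[OF assms(1), of i] part_pos_iff[OF assms(2), of i] assms(3)[of i] by simp
 have len: "length p = length q"
  using iff[of "length p"] iff[of "length q"] by (cases "length p = 0"; cases "length q = 0") auto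
 show ?thesis
 proof (rule nth_equalityI[OF len])
  fix i assume "i < length p"
  thus "p ! i = q ! i" using assms(3)[of "Suc i"] len by (simp add: part_def)
 qed
qed

definition nw :: "nat \<times> nat => nat \<times> nat => bool" where
 "nw a b \<longleftrightarrow> fst a \<le> fst b \<and> snd a \<le> snd b"

definition rect_closed :: "(nat \<times> nat) set => bool" where
 "rect_closed D \<longleftrightarrow> (\<forall>a\<in>D. \<forall>b\<in>D. \<forall>c. nw a c --> nw c b --> c \<in> D)"

locale skew_shape =
 fixes sk :: skew
 assumes sp: "skew_partition sk" and ba: "basic sk"
begin

abbreviation "D \<equiv> diagram sk"
abbreviation "lam i \<equiv> part (fst sk) i"
abbreviation "mu i \<equiv> part (snd sk) i"
abbreviation "nrows \<equiv> length (fst sk)"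

lemma in_D: "(i, j) \<in> D \<longleftrightarrow> mu i < j \<and> j \<le> lam i"
 by (simp add: diagram_def)

lemma parts: "is_partition (fst sk)" "is_partition (snd sk)" "mu i \<le> lam i"
 using sp by (auto simp: skew_partition_def)

lemma lam_antimono: "1 \<le> i ==> i \<le> k ==> lam k \<le> lam i"
 using part_antimono[OF parts(1)] .

lemma mu_antimono: "1 \<le> i ==> i \<le> k ==> mu k \<le> mu i"
 using part_antimono[OF parts(2)] .

lemma D_bounds: "a \<in> D ==> 1 \<le> fst a \<and> fst a \<le> nrows \<and> 1 \<le> snd a \<and> snd a \<le> lam 1"
proof -
 assume a: "a \<in> D"
 obtain i j where ij: "a = (i, j)" by (cases a)
 have "0 < lam i" "1 \<le> j" "j \<le> lam i" using a unfolding ij in_D by auto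
 hence i: "1 \<le> i" "i \<le> nrows" using part_pos_iff[OF parts(1), of i] by auto
 thus ?thesis using lam_antimono[of 1 i] \<open>1 \<le> j\<close> \<open>j \<le> lam i\<close> ij by auto
qed

lemma finite_D [simp]: "finite D"
 by (rule finite_subset[of _ "{1..nrows} \<times> {1..lam 1}"]) (use D_bounds in force)+

lemma row_nonempty: "1 \<le> i ==> i \<le> nrows ==> mu i < lam i"
proof -
 assume "1 \<le> i" "i \<le> nrows"
 then obtain j where "(i, j) \<in> D" using ba unfolding basic_def by (metis atLeastAtMost_iff)
 thus ?thesis by (simp add: in_D)
qed

lemma fst_D: "fst ` D = {1..nrows}"
proof
 show "{1..nrows} \<subseteq> fst ` D"
 proof
  fix i assume "i \<in> {1..nrows}"
  hence "(i, lam i) \<in> D" using row_nonempty by (simp add: in_D)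
  thus "i \<in> fst ` D" by force
 qed
qed (use D_bounds in force)

lemma snd_D: "snd ` D = {1..lam 1}"
proof
 show "{1..lam 1} \<subseteq> snd ` D" using ba unfolding basic_def by force
qed (use D_bounds in force)

lemma rect: assumes "a \<in> D" "b \<in> D" "nw a c" "nw c b" shows "c \<in> D"
proof -
 obtain i j k l p q where e: "a = (i, j)" "b = (k, l)" "c = (p, q)" by (cases a, cases b, cases c) auto
 have "1 \<le> i" using D_bounds[OF assms(1)] e by simp
 hence "mu p \<le> mu i" "lam k \<le> lam p" using assms e by (auto simp: nw_def intro: mu_antimono lam_antimono)
 thus ?thesis using assms unfolding e in_D nw_def by simp
qed

text \<open>The blocks of this set are the components.\<close>

definition links :: "nat set" where
 "links = {i. \<exists>j. (i, j) \<in> D \<and> (Suc i, j) \<in> D}"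

lemma links_iff: "1 \<le> i ==> i < nrows ==> i \<in> links \<longleftrightarrow> mu i < lam (Suc i)"
proof
 assume i: "1 \<le> i" "i < nrows" and "mu i < lam (Suc i)"
 moreover have "lam (Suc i) \<le> lam i" "mu (Suc i) \<le> mu i" using i lam_antimono mu_antimono by auto
 ultimately show "i \<in> links" unfolding links_def in_D by (intro CollectI exI[of _ "lam (Suc i)"]) auto
qed (auto simp: links_def in_D)

text \<open>At a missing link the next row ends before the present one begins, and rows move to the left going
 down.\<close>

lemma unlinked_left:
 assumes a: "a \<in> D" and b: "b \<in> D" and i: "fst a \<le> i" "i < fst b" "i \<notin> links"
 shows "snd b < snd a"
proof -
 have r: "1 \<le> fst a" "fst b \<le> nrows" using D_bounds[OF a] D_bounds[OF b] by auto
 hence "lam (Suc i) \<le> mu i" using links_iff[of i] i by auto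
 moreover have "lam (fst b) \<le> lam (Suc i)" "mu i \<le> mu (fst a)" using r i lam_antimono mu_antimono by auto
 moreover have "snd b \<le> lam (fst b)" "mu (fst a) < snd a"
  using a b in_D[of "fst a" "snd a"] in_D[of "fst b" "snd b"] by simp_all
 ultimately show ?thesis by linarith
qed

lemma not_same_run_left:
 assumes a: "a \<in> D" and b: "b \<in> D" and i: "fst a < fst b" "\<not> same_block links (fst a) (fst b)"
 shows "snd b < snd a"
proof -
 have "\<not> {fst a..<fst b} \<subseteq> links" using i same_block_less[of "fst a" "fst b"] by simp
 then obtain k where "k \<in> {fst a..<fst b}" "k \<notin> links" by blast
 thus ?thesis using unlinked_left[OF a b, of k] by simp
qed

lemma nw_same_run:
 assumes "a \<in> D" "b \<in> D" "nw a b" shows "same_block links (fst a) (fst b)"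
proof -
 have "i \<in> links" if "i \<in> {fst a..<fst b}" for i
 proof -
  have "(i, snd a) \<in> D" "(Suc i, snd a) \<in> D"
   by (rule rect[OF assms(1,2)]; use that assms(3) in \<open>simp add: nw_def\<close>)+
  thus ?thesis by (auto simp: links_def)
 qed
 thus ?thesis using assms(3) same_block_less[of "fst a" "fst b"] by (auto simp: nw_def)
qed

lemma card_row: "card {a \<in> D. fst a = i} = lam i - mu i"
proof -
 have "{a \<in> D. fst a = i} = Pair i ` {mu i<..lam i}" by (auto simp: in_D)
 thus ?thesis by (simp add: card_image inj_on_def)
qed

definition rowsum :: "nat => nat" where
 "rowsum k = (\<Sum>i=1..k. lam i - mu i)"

lemma card_rows_le: "card {a \<in> D. fst a \<le> k} = rowsum k"
proof (induction k)
 case 0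
 have "{a \<in> D. fst a \<le> 0} = {}" using D_bounds by fastforce
 thus ?case by (simp only: rowsum_def) simp
next
 case (Suc k)
 have "{a \<in> D. fst a \<le> Suc k} = {a \<in> D. fst a \<le> k} \<union> {a \<in> D. fst a = Suc k}" by auto
 moreover have "card ({a \<in> D. fst a \<le> k} \<union> {a \<in> D. fst a = Suc k}) =
   card {a \<in> D. fst a \<le> k} + card {a \<in> D. fst a = Suc k}"
  by (rule card_Un_disjoint) auto
 ultimately show ?case using Suc card_row by (simp add: rowsum_def)
qed

lemma sum_list_part: "length p \<le> m ==> sum_list p = (\<Sum>i=1..m. part p i)"
proof -
 assume m: "length p \<le> m"
 have "sum_list p = (\<Sum>i<length p. p ! i)" by (simp add: sum_list_sum_nth atLeast0LessThan)
 also have "\<dots> = (\<Sum>i\<in>{1..length p}. part p i)"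
  by (rule sum.reindex_bij_witness[of _ "\<lambda>i. i - 1" Suc]) (auto simp: part_def)
 also have "\<dots> = (\<Sum>i=1..m. part p i)"
  by (rule sum.mono_neutral_left) (use m in \<open>auto simp: part_def\<close>)
 finally show ?thesis .
qed

lemma card_D: "card D = skew_size sk" "rowsum nrows = skew_size sk"
proof -
 have "{a \<in> D. fst a \<le> nrows} = D" using D_bounds by auto
 hence 1: "card D = rowsum nrows" using card_rows_le[of nrows] by simp
 have "length (snd sk) \<le> nrows"
 proof (cases "length (snd sk) = 0")
  case False
  hence "0 < mu (length (snd sk))" using part_pos_iff[OF parts(2)] by (simp add: Suc_le_eq)
  hence "0 < lam (length (snd sk))" using parts(3) by (rule less_le_trans)
  thus ?thesis using part_pos_iff[OF parts(1)] by blast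
 qed simp
 hence "skew_size sk = (\<Sum>i=1..nrows. lam i) - (\<Sum>i=1..nrows. mu i)"
  unfolding skew_size_def
  using sum_list_part[of "fst sk" nrows] sum_list_part[of "snd sk" nrows] by simp
 also have "\<dots> = rowsum nrows" unfolding rowsum_def by (rule sum_subtractf_nat[symmetric]) (use parts(3) in auto)
 finally show "rowsum nrows = skew_size sk" by simp
 thus "card D = skew_size sk" using 1 by simp
qed

end

lemma diagram_inject:
 assumes "skew_partition sk" "basic sk" "skew_partition sk'" "basic sk'" "diagram sk = diagram sk'"
 shows "sk = sk'"
proof -
 interpret A: skew_shape sk by unfold_locales (use assms in auto)
 interpret B: skew_shape sk' by unfold_locales (use assms in auto)
 have "card {1..A.nrows} = card {1..B.nrows}" using A.fst_D B.fst_D assms(5) by metis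
 hence r: "A.nrows = B.nrows" by simp
 have eq: "A.mu i < j \<and> j \<le> A.lam i \<longleftrightarrow> B.mu i < j \<and> j \<le> B.lam i" for i j
  using assms(5) A.in_D B.in_D by metis
 have "A.lam i = B.lam i \<and> A.mu i = B.mu i" for i
 proof (cases "1 \<le> i \<and> i \<le> A.nrows")
  case True
  hence 1: "A.mu i < A.lam i" "B.mu i < B.lam i" using A.row_nonempty B.row_nonempty r by auto
  have "A.lam i = B.lam i" using eq[of i "A.lam i"] eq[of i "B.lam i"] 1 by simp
  moreover have "A.mu i = B.mu i" using eq[of i "Suc (A.mu i)"] eq[of i "Suc (B.mu i)"] 1 by simp
  ultimately show ?thesis by simp
 next
  case False
  hence "A.lam i = 0" "B.lam i = 0" using r by (auto simp: part_def)
  thus ?thesis using A.parts(3)[of i] B.parts(3)[of i] by simp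
 qed
 thus ?thesis using partition_eqI[OF A.parts(1) B.parts(1)] partition_eqI[OF A.parts(2) B.parts(2)]
  by (auto intro: prod_eqI)
qed

text \<open>Conversely, a finite set closed under taking boxes between comparable boxes, without empty
 rows and columns, is a diagram: monotonicity of the row ends is a case of closedness.\<close>

lemma rect_closed_is_diagram:
 assumes fin: "finite D" and rc: "rect_closed D" and rows: "fst ` D = {1..r}" and cols: "snd ` D = {1..c}"
 obtains sk where "skew_partition sk" "basic sk" "diagram sk = D"
proof -
 let ?R = "\<lambda>i. {j. (i, j) \<in> D}"
 have finR: "finite (?R i)" for i by (rule finite_subset[of _ "snd ` D"]) (use fin in force)+
 have neR: "?R i \<noteq> {}" if "i \<in> {1..r}" for i using that rows by force
 define hi where "hi i = Max (?R i)" for i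
 define lo where "lo i = Min (?R i) - 1" for i
 have jpos: "1 \<le> j" if "(i, j) \<in> D" for i j using that cols by force
 have ipos: "i \<in> {1..r}" if "(i, j) \<in> D" for i j using that rows by force
 have hiD: "(i, hi i) \<in> D" and hi_ge: "\<And>j. (i, j) \<in> D ==> j \<le> hi i" if "i \<in> {1..r}" for i
  using Max_in[OF finR neR[OF that]] Max_ge[OF finR, of _ i] by (auto simp: hi_def)
 have loD: "(i, Suc (lo i)) \<in> D" and lo_le: "\<And>j. (i, j) \<in> D ==> lo i < j" if "i \<in> {1..r}" for i
 proof -
  have m: "(i, Min (?R i)) \<in> D" using Min_in[OF finR neR[OF that]] by blast
  have "Suc (lo i) = Min (?R i)" using jpos[OF m] by (simp add: lo_def)
  thus "(i, Suc (lo i)) \<in> D" using m by simp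
  show "lo i < j" if "(i, j) \<in> D" for j
   using Min_le[OF finR, of j i] that jpos[OF that] by (auto simp: lo_def)
 qed
 have row: "(i, j) \<in> D \<longleftrightarrow> lo i < j \<and> j \<le> hi i" if i: "i \<in> {1..r}" for i j
 proof
  assume "lo i < j \<and> j \<le> hi i"
  hence "nw (i, Suc (lo i)) (i, j)" "nw (i, j) (i, hi i)" by (auto simp: nw_def)
  thus "(i, j) \<in> D" using rc loD[OF i] hiD[OF i] unfolding rect_closed_def by blast
 qed (use hi_ge[OF i] lo_le[OF i] in blast)
 have hi_anti: "hi k \<le> hi i" if ik: "i \<in> {1..r}" "k \<in> {1..r}" "i \<le> k" for i k
 proof (rule ccontr)
  assume no: "\<not> hi k \<le> hi i"
  hence "nw (i, hi i) (i, hi k)" "nw (i, hi k) (k, hi k)" using ik by (auto simp: nw_def)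
  hence "(i, hi k) \<in> D" using rc hiD ik unfolding rect_closed_def by blast
  thus False using hi_ge[OF ik(1)] no by blast
 qed
 have lo_anti: "lo k \<le> lo i" if ik: "i \<in> {1..r}" "k \<in> {1..r}" "i \<le> k" for i k
 proof (rule ccontr)
  assume no: "\<not> lo k \<le> lo i"
  hence "nw (i, Suc (lo i)) (k, Suc (lo i))" "nw (k, Suc (lo i)) (k, Suc (lo k))" using ik by (auto simp: nw_def)
  hence "(k, Suc (lo i)) \<in> D" using rc loD ik unfolding rect_closed_def by blast
  thus False using lo_le[OF ik(2)] no by force
 qed
 define l where "l = map hi [1..<Suc r]"
 define m0 where "m0 = map lo [1..<Suc r]"
 define m where "m = takeWhile (\<lambda>x. 0 < x) m0"
 have len: "length l = r" "length m0 = r" by (simp_all add: l_def m0_def)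
 have pl: "part l i = (if i \<in> {1..r} then hi i else 0)" for i by (auto simp: part_def l_def nth_append simp del: upt_Suc)
 have m0n: "m0 ! k = lo (Suc k)" if "k < r" for k using that by (simp add: m0_def nth_append del: upt_Suc)
 have lm: "length m \<le> r" unfolding m_def using length_takeWhile_le[of _ m0] len by metis
 have pm: "part m i = (if i \<in> {1..r} then lo i else 0)" for i
 proof (cases "1 \<le> i \<and> i \<le> length m")
  case True
  hence "m ! (i - 1) = m0 ! (i - 1)" unfolding m_def by (intro takeWhile_nth) auto
  thus ?thesis using True m0n[of "i - 1"] lm by (auto simp: part_def)
 next
  case False
  have "lo i = 0" if i: "i \<in> {1..r}"
  proof -
   have k: "length m < r" "length m < i" using False i lm by auto
   hence "m0 ! length m = 0"
    using nth_length_takeWhile[of "\<lambda>x. 0 < x" m0] len unfolding m_def by simp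
   hence "lo (Suc (length m)) = 0" using m0n k by simp
   moreover have "lo i \<le> lo (Suc (length m))" by (rule lo_anti) (use k i in auto)
   ultimately show ?thesis by simp
  qed
  thus ?thesis using False by (auto simp: part_def)
 qed
 have isl: "is_partition l"
  unfolding is_partition_def
 proof
  show "sorted_wrt (\<ge>) l" unfolding l_def sorted_wrt_iff_nth_less
   by (auto simp: nth_append simp del: upt_Suc intro!: hi_anti)
  have "hi i \<noteq> 0" if "i \<in> {1..r}" for i using jpos[OF hiD[OF that]] by simp
  thus "0 \<notin> set l" by (force simp: l_def simp del: upt_Suc)
 qed
 have "sorted_wrt (\<ge>) m0" unfolding m0_def sorted_wrt_iff_nth_less
  by (auto simp: nth_append simp del: upt_Suc intro!: lo_anti)
 hence "sorted_wrt (\<ge>) m" unfolding m_def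
  using sorted_wrt_append[of "(\<ge>)" "takeWhile (\<lambda>x. 0 < x) m0" "dropWhile (\<lambda>x. 0 < x) m0"] by simp
 moreover have "0 \<notin> set m" unfolding m_def using set_takeWhileD[of 0 "\<lambda>x. 0 < x" m0] by blast
 ultimately have ism: "is_partition m" unfolding is_partition_def by blast
 have "lo i \<le> hi i" if "i \<in> {1..r}" for i using hi_ge[OF that loD[OF that]] by simp
 hence sp: "skew_partition (l, m)" using isl ism by (simp add: skew_partition_def pl pm)
 have dia: "diagram (l, m) = D"
 proof (rule Set.set_eqI)
  fix a :: "nat \<times> nat"
  obtain i j where a: "a = (i, j)" by (cases a)
  have d: "a \<in> diagram (l, m) \<longleftrightarrow> part m i < j \<and> j \<le> part l i" by (simp add: diagram_def a)
  show "a \<in> diagram (l, m) \<longleftrightarrow> a \<in> D"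
  proof (cases "i \<in> {1..r}")
   case True
   show ?thesis unfolding d pl pm using row[OF True, of j] True a by (simp only: if_True)
  next
   case False
   hence "a \<notin> D" using ipos a by blast
   thus ?thesis unfolding d pl pm if_not_P[OF False] by auto
  qed
 qed
 have "basic (l, m)"
  unfolding basic_def dia
 proof (intro conjI ballI)
  fix i assume "i \<in> {1..length (fst (l, m))}"
  thus "\<exists>j. (i, j) \<in> D" using hiD len by auto
 next
  fix j assume j: "j \<in> {1..part (fst (l, m)) 1}"
  hence r1: "1 \<in> {1..r}" by (auto simp: pl split: if_splits)
  have "hi 1 \<in> {1..c}" using hiD[OF r1] cols by force
  hence "j \<in> {1..c}" using j r1 by (auto simp: pl)
  thus "\<exists>i. (i, j) \<in> D" using cols by force
 qed
 thus ?thesis using that sp dia by blast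
qed

lemma part_transpose:
 assumes p: "is_partition p" and j: "1 \<le> j"
 shows "i \<ge> 1 ==> i \<le> part (transpose_partition p) j \<longleftrightarrow> j \<le> part p i"
proof -
 assume i: "i \<ge> 1"
 let ?c = "length (filter (\<lambda>x. j \<le> x) p)"
 have c_eq: "?c = card {k. k < length p \<and> j \<le> p ! k}" by (simp add: length_filter_conv_card)
 have down: "k' \<in> {k. k < length p \<and> j \<le> p ! k}" if "k \<in> {k. k < length p \<and> j \<le> p ! k}" "k' \<le> k" for k k'
  using part_antimono[OF p, of "Suc k'" "Suc k"] that by (auto simp: part_def)
 have "{k. k < length p \<and> j \<le> p ! k} = {..<?c}"
 proof -
  let ?A = "{k. k < length p \<and> j \<le> p ! k}"
  have f: "finite ?A" by simp
  have "k < card ?A" if "k \<in> ?A" for k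
  proof -
   have "{..k} \<subseteq> ?A" using down that by blast
   hence "card {..k} \<le> card ?A" by (rule card_mono[OF f])
   thus ?thesis by simp
  qed
  hence "?A \<subseteq> {..<card ?A}" by blast
  hence "?A = {..<card ?A}" by (intro card_subset_eq) auto
  thus ?thesis using c_eq by simp
 qed
 hence count: "i \<le> ?c \<longleftrightarrow> j \<le> part p i" if "i \<ge> 1" for i
  using that j by (auto simp: part_def set_eq_iff dest!: spec[of _ "i - 1"])
 have "part (transpose_partition p) j = ?c"
 proof (cases "j \<le> part p 1")
  case True
  hence "part (transpose_partition p) j = transpose_partition p ! (j - 1)"
   using j by (intro part_nth) (simp_all add: transpose_partition_def)
  thus ?thesis using j True by (simp add: transpose_partition_def del: upt_Suc)
 next
  case False
  hence "\<not> 1 \<le> ?c" using count[of 1] by blast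
  hence "?c = 0" by linarith
  thus ?thesis using False by (auto simp: part_def transpose_partition_def simp del: upt_Suc)
 qed
 thus ?thesis using count[OF i] by simp
qed

lemma length_transpose_partition: "length (transpose_partition p) = part p 1"
 by (simp add: transpose_partition_def)

lemma is_partition_transpose:
 assumes p: "is_partition p" shows "is_partition (transpose_partition p)"
 unfolding is_partition_def
proof
 have "transpose_partition p ! k \<ge> transpose_partition p ! l"
  if kl: "k < l" "l < length (transpose_partition p)" for k l
 proof (rule ccontr)
  assume a: "\<not> ?thesis"
  let ?t = "transpose_partition p"
  have e: "part ?t (Suc l) = ?t ! l" "part ?t (Suc k) = ?t ! k" using kl by (auto simp: part_def)
  have pos: "1 \<le> part ?t (Suc l)" using a e by simp
  have "Suc l \<le> part p (part ?t (Suc l))" using part_transpose[OF p, of "Suc l" "part ?t (Suc l)"] pos by simp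
  hence "Suc k \<le> part p (part ?t (Suc l))" using kl by simp
  hence "part ?t (Suc l) \<le> part ?t (Suc k)" using part_transpose[OF p, of "Suc k" "part ?t (Suc l)"] pos by simp
  thus False using a e by simp
 qed
 thus "sorted_wrt (\<ge>) (transpose_partition p)" unfolding sorted_wrt_iff_nth_less by blast
 have "transpose_partition p ! k \<noteq> 0" if "k < part p 1" for k
 proof -
  have "1 \<le> part (transpose_partition p) (Suc k)" using part_transpose[OF p, of "Suc k" 1] that by simp
  thus ?thesis using that by (simp add: part_def[of "transpose_partition p"] length_transpose_partition)
 qed
 thus "0 \<notin> set (transpose_partition p)" by (metis in_set_conv_nth length_transpose_partition)
qed

context skew_shape
begin

lemma in_transpose: "(j, i) \<in> diagram (transpose_skew sk) \<longleftrightarrow> (i, j) \<in> D"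
proof (cases "1 \<le> i \<and> 1 \<le> j")
 case True
 thus ?thesis
  using part_transpose[OF parts(1), of j i] part_transpose[OF parts(2), of j i]
  by (auto simp: diagram_def transpose_skew_def)
next
 case False
 hence "(i, j) \<notin> D" using D_bounds[of "(i, j)"] by auto
 moreover have "(j, i) \<notin> diagram (transpose_skew sk)"
  using False by (auto simp: diagram_def transpose_skew_def part_def)
 ultimately show ?thesis by blast
qed

lemma diagram_transpose: "diagram (transpose_skew sk) = prod.swap ` D"
proof (rule Set.set_eqI)
 fix a show "a \<in> diagram (transpose_skew sk) \<longleftrightarrow> a \<in> prod.swap ` D"
  using in_transpose[of "fst a" "snd a"] by (cases a) (auto simp: image_iff prod.swap_def, force)
qed

lemma skew_shape_transpose: "skew_shape (transpose_skew sk)"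
proof
 have "part (transpose_partition (snd sk)) j \<le> part (transpose_partition (fst sk)) j" for j
 proof (cases "1 \<le> j \<and> 1 \<le> part (transpose_partition (snd sk)) j")
  case True
  let ?i = "part (transpose_partition (snd sk)) j"
  have "j \<le> mu ?i" using part_transpose[OF parts(2), of j ?i] True by simp
  hence "j \<le> lam ?i" using parts(3)[of ?i] by simp
  thus ?thesis using part_transpose[OF parts(1), of j ?i] True by simp
 qed (auto simp: part_def)
 thus "skew_partition (transpose_skew sk)"
  using is_partition_transpose parts(1,2) by (simp add: skew_partition_def transpose_skew_def)
 show "basic (transpose_skew sk)"
  unfolding basic_def
 proof (intro conjI ballI)
  fix j assume "j \<in> {1..length (fst (transpose_skew sk))}"
  hence "j \<in> snd ` D" using snd_D by (simp add: transpose_skew_def length_transpose_partition)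
  thus "\<exists>i. (j, i) \<in> diagram (transpose_skew sk)" using in_transpose by force
 next
  fix i assume i: "i \<in> {1..part (fst (transpose_skew sk)) 1}"
  hence "1 \<le> lam i" using part_transpose[OF parts(1), of 1 i] by (simp add: transpose_skew_def)
  hence "i \<in> fst ` D" using part_pos_iff[OF parts(1), of i] fst_D by auto
  thus "\<exists>j. (j, i) \<in> diagram (transpose_skew sk)" using in_transpose by force
 qed
qed

lemma skew_size_transpose: "skew_size (transpose_skew sk) = skew_size sk"
proof -
 interpret T: skew_shape "transpose_skew sk" by (rule skew_shape_transpose)
 have "inj_on prod.swap D" by (auto simp: inj_on_def)
 thus ?thesis using card_D(1) T.card_D(1) card_image unfolding diagram_transpose by metis
qed

end

section \<open>Labelings of a skew shape\<close>

lemma rank_total_order: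
 assumes fin: "finite D"
  and refl: "\<And>a. a \<in> D ==> bef a a"
  and antisym: "\<And>a b. a \<in> D ==> b \<in> D ==> bef a b ==> bef b a ==> a = b"
  and trans: "\<And>a b c. a \<in> D ==> b \<in> D ==> c \<in> D ==> bef a b ==> bef b c ==> bef a c"
  and total: "\<And>a b. a \<in> D ==> b \<in> D ==> bef a b \<or> bef b a"
 shows "bij_betw (\<lambda>b. card {a \<in> D. bef a b}) D {1..card D}"
  and "a \<in> D ==> b \<in> D ==> card {x \<in> D. bef x a} \<le> card {x \<in> D. bef x b} \<longleftrightarrow> bef a b"
proof -
 let ?r = "\<lambda>b. card {a \<in> D. bef a b}"
 have iff: "?r a \<le> ?r b \<longleftrightarrow> bef a b" if ab: "a \<in> D" "b \<in> D" for a b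
 proof
  assume "bef a b"
  hence "{x \<in> D. bef x a} \<subseteq> {x \<in> D. bef x b}" using trans ab by blast
  thus "?r a \<le> ?r b" using fin by (intro card_mono) auto
 next
  assume r: "?r a \<le> ?r b"
  show "bef a b"
  proof (rule ccontr)
   assume no: "\<not> bef a b"
   hence ba: "bef b a" using total ab by blast
   have "{x \<in> D. bef x b} \<subseteq> {x \<in> D. bef x a}" using trans[OF _ ab(2,1) _ ba] by blast
   moreover have "a \<in> {x \<in> D. bef x a}" "a \<notin> {x \<in> D. bef x b}" using no refl ab by auto
   ultimately have "{x \<in> D. bef x b} \<subset> {x \<in> D. bef x a}" by blast
   hence "?r b < ?r a" using fin by (intro psubset_card_mono) auto
   thus False using r by simp
  qed
 qed
 thus "a \<in> D ==> b \<in> D ==> ?r a \<le> ?r b \<longleftrightarrow> bef a b" by blast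
 have inj: "inj_on ?r D" 
 proof (rule inj_onI)
  fix a b assume ab: "a \<in> D" "b \<in> D" "?r a = ?r b"
  hence "bef a b" "bef b a" using iff[of a b] iff[of b a] by simp_all
  thus "a = b" by (rule antisym[OF ab(1,2)])
 qed
 have "?r ` D \<subseteq> {1..card D}"
 proof
  fix k assume "k \<in> ?r ` D"
  then obtain b where b: "b \<in> D" "k = ?r b" by blast
  have "{b} \<subseteq> {a \<in> D. bef a b}" using refl b(1) by blast
  hence "card {b} \<le> ?r b" using fin by (intro card_mono) auto
  moreover have "?r b \<le> card D" using fin by (intro card_mono) auto
  ultimately show "k \<in> {1..card D}" using b(2) by simp
 qed
 hence "?r ` D = {1..card D}" by (intro card_subset_eq) (simp_all add: card_image[OF inj])
 thus "bij_betw ?r D {1..card D}" using inj by (simp add: bij_betw_def)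
qed

context skew_shape
begin

abbreviation "N \<equiv> skew_size sk"

definition standard :: "(nat \<times> nat => nat) => bool" where
 "standard f \<longleftrightarrow> (\<forall>a\<in>D. \<forall>b\<in>D. nw a b --> a \<noteq> b --> f a < f b)"

text \<open>All labelings with this property give isomorphic modules, and those of regular posets have it.\<close>

definition distinguished :: "(nat \<times> nat => nat) => bool" where
 "distinguished f \<longleftrightarrow> (\<forall>a\<in>D. \<forall>b\<in>D. fst a \<le> fst b --> snd b \<le> snd a --> a \<noteq> b --> f a < f b)"

definition labeling :: "tableau => bool" where
 "labeling T \<longleftrightarrow> shape T = sk \<and> entry T \<in> extensional D \<and> bij_betw (entry T) D {1..N}"

lemma labeling_iff: "labeling T \<longleftrightarrow> shape T = sk \<and> bijective_tableau N T"
 using sp ba by (auto simp: labeling_def bijective_tableau_def)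

lemma standard_iff: "standard f \<longleftrightarrow>
  (\<forall>i j j'. (i, j) \<in> D --> (i, j') \<in> D --> j < j' --> f (i, j) < f (i, j')) \<and>
  (\<forall>i i' j. (i, j) \<in> D --> (i', j) \<in> D --> i < i' --> f (i, j) < f (i', j))" (is "_ = (?R \<and> ?C)")
proof
 assume "standard f"
 thus "?R \<and> ?C" unfolding standard_def nw_def by fastforce
next
 assume RC: "?R \<and> ?C"
 show "standard f"
  unfolding standard_def
 proof (intro ballI impI)
  fix a b assume ab: "a \<in> D" "b \<in> D" "nw a b" "a \<noteq> b"
  obtain i j k l where e: "a = (i, j)" "b = (k, l)" by (cases a, cases b) auto
  have c: "(i, l) \<in> D" by (rule rect[OF ab(1,2)]) (use ab(3) e in \<open>simp_all add: nw_def\<close>)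
  have 1: "j < l ==> f (i, j) < f (i, l)" using RC ab(1) c e by blast
  have 2: "i < k ==> f (i, l) < f (k, l)" using RC ab(2) c e by blast
  have "i \<le> k" "j \<le> l" "i < k \<or> j < l" using ab(3,4) e by (auto simp: nw_def)
  thus "f a < f b" using 1 2 unfolding e by (cases "i < k"; cases "j < l") auto
 qed
qed

lemma SYT_iff: "T \<in> SYT sk \<longleftrightarrow> labeling T \<and> standard (entry T)"
 unfolding SYT_def labeling_iff standard_iff rows_increase_def columns_increase_def by auto

lemma tab_poset_eq:
 "shape T = sk ==> tab_poset T = {(entry T a, entry T b) | a b. a \<in> D \<and> b \<in> D \<and> nw a b}"
 by (simp add: tab_poset_def nw_def)

lemma Sigma_L_iff:
 assumes T: "labeling T"
 shows "w \<in> Sigma_L N (tab_poset T) \<longleftrightarrow> w permutes {1..N} \<and> standard (w o entry T)"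
proof -
 have b: "bij_betw (entry T) D {1..N}" and sh: "shape T = sk" using T by (auto simp: labeling_def)
 have "(\<forall>(i, j)\<in>tab_poset T. w i \<le> w j) \<longleftrightarrow> standard (w o entry T)" if w: "w permutes {1..N}"
 proof
  assume a: "\<forall>(i, j)\<in>tab_poset T. w i \<le> w j"
  show "standard (w o entry T)"
   unfolding standard_def
  proof (intro ballI impI)
   fix x y assume xy: "x \<in> D" "y \<in> D" "nw x y" "x \<noteq> y"
   hence "(entry T x, entry T y) \<in> tab_poset T" unfolding tab_poset_eq[OF sh] by blast
   hence "w (entry T x) \<le> w (entry T y)" using a by blast
   moreover have "entry T x \<noteq> entry T y" using b xy by (auto simp: bij_betw_def inj_on_def)
   hence "w (entry T x) \<noteq> w (entry T y)" using permutes_inj[OF w] by (auto dest: injD)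
   ultimately show "(w o entry T) x < (w o entry T) y" by simp
  qed
 next
  assume st: "standard (w o entry T)"
  have "w (entry T x) \<le> w (entry T y)" if "x \<in> D" "y \<in> D" "nw x y" for x y
   using st that unfolding standard_def by (cases "x = y") (auto intro: less_imp_le)
  thus "\<forall>(i, j)\<in>tab_poset T. w i \<le> w j" unfolding tab_poset_eq[OF sh] by blast
 qed
 thus ?thesis unfolding Sigma_L_def sym_group_carrier by blast
qed

lemma read_tab_entry:
 assumes "labeling t" "a \<in> D"
 shows "read_tab t T (entry t a) = entry T a"
 using assms by (auto simp: read_tab_def labeling_def bij_betw_def inv_into_f_f)

lemma read_tab_outside: "labeling t ==> k \<notin> {1..N} ==> read_tab t T k = k"
 by (auto simp: read_tab_def labeling_def bij_betw_def)

lemma label_cases: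
 assumes "labeling t" "k \<in> {1..N}"
 obtains a where "a \<in> D" "entry t a = k"
proof -
 have "k \<in> entry t ` D" using assms by (simp add: labeling_def bij_betw_def)
 thus thesis using that by blast
qed

lemma entry_range: "labeling t ==> a \<in> D ==> entry t a \<in> {1..N}"
 by (auto simp: labeling_def dest: bij_betwE)

lemma entry_inj: "labeling t ==> a \<in> D ==> b \<in> D ==> entry t a = entry t b \<longleftrightarrow> a = b"
 by (auto simp: labeling_def bij_betw_def inj_on_def)

lemma read_tab_permutes:
 assumes t: "labeling t" and T: "labeling T"
 shows "read_tab t T permutes {1..N}"
proof (rule bij_imp_permutes)
 have "bij_betw (inv_into D (entry t)) {1..N} D" using t by (intro bij_betw_inv_into) (simp add: labeling_def)
 from bij_betw_trans[OF this, of "entry T" "{1..N}"] T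
 have "bij_betw (entry T o inv_into D (entry t)) {1..N} {1..N}" by (simp add: labeling_def)
 moreover have "read_tab t T k = (entry T o inv_into D (entry t)) k" if "k \<in> {1..N}" for k
  using t that by (auto simp: read_tab_def labeling_def bij_betw_def)
 ultimately show "bij_betw (read_tab t T) {1..N} {1..N}" using bij_betw_cong[of "{1..N}" "read_tab t T"] by metis
qed (rule read_tab_outside[OF t])

text \<open>The inverse of reading.\<close>

definition unread :: "tableau => (nat => nat) => tableau" where
 "unread t w = (sk, restrict (w o entry t) D)"

lemma unread_labeling:
 assumes t: "labeling t" and w: "w permutes {1..N}"
 shows "labeling (unread t w)"
proof -
 have "bij_betw (w o entry t) D {1..N}"
  using bij_betw_trans[OF _ permutes_imp_bij[OF w]] t by (auto simp: labeling_def)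
 thus ?thesis by (simp add: labeling_def unread_def shape_def entry_def bij_betw_restrict_eq)
qed

lemma unread_standard: "standard (entry (unread t w)) \<longleftrightarrow> standard (w o entry t)"
 by (simp add: standard_def unread_def entry_def)

lemma read_unread:
 assumes t: "labeling t" and w: "w permutes {1..N}"
 shows "read_tab t (unread t w) = w"
proof
 fix k show "read_tab t (unread t w) k = w k"
 proof (cases "k \<in> {1..N}")
  case True
  then obtain a where "a \<in> D" "entry t a = k" using label_cases[OF t] by blast
  thus ?thesis using read_tab_entry[OF t, of a "unread t w"] by (simp add: unread_def entry_def)
 next
  case False
  thus ?thesis using read_tab_outside[OF t] permutes_not_in[OF w] by simp
 qed
qed

lemma unread_read:
 assumes t: "labeling t" and T: "labeling T"
 shows "unread t (read_tab t T) = T"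
proof -
 have "restrict (read_tab t T o entry t) D = entry T"
  by (rule extensionalityI[of _ D]) (use T read_tab_entry[OF t] in \<open>auto simp: labeling_def\<close>)
 moreover have "sk = fst T" using T by (simp add: labeling_def shape_def)
 ultimately show ?thesis unfolding unread_def entry_def by (metis prod.collapse)
qed

lemma read_bij: "labeling t ==> bij_betw (read_tab t) (SYT sk) (Sigma_L N (tab_poset t))"
proof -
 assume t: "labeling t"
 have 1: "read_tab t T \<in> Sigma_L N (tab_poset t)" if "T \<in> SYT sk" for T
 proof -
  have T: "labeling T" "standard (entry T)" using that SYT_iff by auto
  thus ?thesis using Sigma_L_iff[OF t] read_tab_permutes[OF t T(1)] unread_read[OF t T(1)]
   unread_standard[of t "read_tab t T"] by simp
 qed
 have 2: "unread t w \<in> SYT sk" if "w \<in> Sigma_L N (tab_poset t)" for w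
  using that unread_labeling[OF t] unread_standard unfolding SYT_iff Sigma_L_iff[OF t] by blast
 show ?thesis
 proof (rule bij_betw_byWitness[of _ "unread t"])
  show "\<forall>T\<in>SYT sk. unread t (read_tab t T) = T" using unread_read[OF t] SYT_iff by blast
  show "\<forall>w\<in>Sigma_L N (tab_poset t). read_tab t (unread t w) = w"
   using read_unread[OF t] Sigma_L_iff[OF t] by blast
 qed (use 1 2 in blast)+
qed

lemma tab_poset_range: "labeling t ==> tab_poset t \<subseteq> {1..N} \<times> {1..N}"
 using entry_range tab_poset_eq[of t] unfolding labeling_def by fastforce

end

text \<open>For each comparable pair of positions, the condition prescribes presence or absence of an inversion.\<close>

lemma weakly_convex_Sigma_L:
 assumes P: "P \<subseteq> {1..n} \<times> {1..n}"
 shows "weakly_convex n (Sigma_L n P)"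
 unfolding weakly_convex_def
proof (intro conjI ballI allI impI)
 show "Sigma_L n P \<subseteq> perms n" by (auto simp: Sigma_L_def sym_group_carrier)
 fix w q u assume w: "w \<in> Sigma_L n P" and q: "q \<in> Sigma_L n P" and u: "u permutes {1..n}"
  and i: "inversions n w \<subseteq> inversions n u" "inversions n u \<subseteq> inversions n q"
 have "u a \<le> u b" if ab: "(a, b) \<in> P" for a b
 proof -
  have r: "a \<in> {1..n}" "b \<in> {1..n}" using ab P by auto
  have s: "w a \<le> w b" "q a \<le> q b" "w permutes {1..n}"
   using w q ab by (auto simp: Sigma_L_def sym_group_carrier)
  consider "a = b" | "a < b" | "b < a" by linarith
  thus ?thesis
  proof cases
   case 2
   have "(a, b) \<notin> inversions n q" using s(2) by (auto simp: inversions_def)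
   hence "(a, b) \<notin> inversions n u" using i(2) by blast
   thus ?thesis using r 2 by (auto simp: inversions_def)
  next
   case 3
   hence "w a \<noteq> w b" using permutes_inj[OF s(3)] by (auto dest: injD)
   hence "(b, a) \<in> inversions n w" using s(1) r 3 by (auto simp: inversions_def)
   hence "(b, a) \<in> inversions n u" using i(1) by blast
   thus ?thesis by (simp add: inversions_def)
  qed simp
 qed
 thus "u \<in> Sigma_L n P" using u by (auto simp: Sigma_L_def sym_group_carrier)
qed

text \<open>The action depends on positions only through left descents.\<close>

lemma relabel_iso:
 assumes S0: "weakly_convex n S0" and S1: "weakly_convex n S1" and \<kappa>: "\<kappa> permutes {1..n}"
  and mem: "\<And>w. w permutes {1..n} ==> w \<in> S1 \<longleftrightarrow> w o \<kappa> \<in> S0"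
  and Des: "\<And>w i. w \<in> S1 ==> i \<in> {1..<n} ==> i \<in> Des_L n (w o \<kappa>) \<longleftrightarrow> i \<in> Des_L n w"
  and f: "\<And>v w. f v w = (if w \<in> S1 then v (w o \<kappa>) else 0)"
 shows "f \<in> module_hom (HA n) (perm_module n S0) (perm_module n S1)"
  and "bij_betw f (carrier (perm_module n S0)) (carrier (perm_module n S1))"
proof -
 have sub: "S0 \<subseteq> perms n" "S1 \<subseteq> perms n" using S0 S1 by (simp_all add: weakly_convex_def)
 show "f \<in> module_hom (HA n) (perm_module n S0) (perm_module n S1)"
 proof (rule hecke_module_homI[OF perm_module_action(1)[OF S0] perm_module_action(1)[OF S1]])
  fix i v assume i: "i \<in> {1..<n}" and v: "v \<in> carrier (perm_module n S0)"
  show "f (hecke_gen n i \<odot>\<^bsub>perm_module n S0\<^esub> v) = hecke_gen n i \<odot>\<^bsub>perm_module n S1\<^esub> f v"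
   unfolding perm_module_action(2)[OF S0 i] perm_module_action(2)[OF S1 i]
  proof
   fix w
   show "f (gen_act n S0 i v) w = gen_act n S1 i (f v) w"
   proof (cases "w \<in> S1")
    case True
    hence w: "w permutes {1..n}" using sub by blast
    have m: "tr i o w \<in> S1 \<longleftrightarrow> tr i o (w o \<kappa>) \<in> S0"
     using mem[OF tr_comp_permutes[OF i w]] by (simp add: comp_assoc)
    have s: "(tr i o w) o \<kappa> = tr i o (w o \<kappa>)" by (simp add: comp_assoc)
    have "w o \<kappa> \<in> S0" using mem[OF w] True by blast
    thus ?thesis
     unfolding f gen_act_apply[OF sub(1) i] gen_act_apply[OF sub(2) i] s using m Des[OF True i] True by simp
   qed (simp add: f gen_act_apply[OF sub(2) i])
  qed
 qed (auto simp: pm_simps f perm_module_action(3)[OF S0] perm_module_action(3)[OF S1])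
 let ?g = "\<lambda>u w. if w \<in> S0 then u (w o inv' \<kappa>) else 0"
 have k: "(w o \<kappa>) o inv' \<kappa> = w" "(w o inv' \<kappa>) o \<kappa> = w" for w :: "nat => nat"
  using permutes_inv_o[OF \<kappa>] by (simp_all add: comp_assoc)
 have mem': "w o inv' \<kappa> \<in> S1" if "w \<in> S0" for w
  using mem[of "w o inv' \<kappa>"] permutes_compose[OF permutes_inv[OF \<kappa>], of w] sub that k by auto
 show "bij_betw f (carrier (perm_module n S0)) (carrier (perm_module n S1))"
 proof (rule bij_betw_byWitness[of _ ?g])
  show "\<forall>v\<in>carrier (perm_module n S0). ?g (f v) = v"
  proof (intro ballI ext)
   fix v w assume v: "v \<in> carrier (perm_module n S0)"
   show "?g (f v) w = v w"
   proof (cases "w \<in> S0")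
    case True
    thus ?thesis unfolding f k using mem'[OF True] by simp
   next
    case False
    thus ?thesis using v by (simp add: pm_simps)
   qed
  qed
  show "\<forall>u\<in>carrier (perm_module n S1). f (?g u) = u"
  proof (intro ballI ext)
   fix u w assume u: "u \<in> carrier (perm_module n S1)"
   show "f (?g u) w = u w"
   proof (cases "w \<in> S1")
    case True
    hence "w o \<kappa> \<in> S0" using mem sub by blast
    thus ?thesis unfolding f k using True by simp
   next
    case False
    thus ?thesis using u by (simp add: f pm_simps)
   qed
  qed
 next
  show "f ` carrier (perm_module n S0) \<subseteq> carrier (perm_module n S1)" by (auto simp: pm_simps f)
  show "?g ` carrier (perm_module n S1) \<subseteq> carrier (perm_module n S0)" by (auto simp: pm_simps)
 qed
qed

context skew_shape
begin

lemma filling_labeling: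
 assumes "\<And>a. a \<in> D ==> bef a a"
  and "\<And>a b. a \<in> D ==> b \<in> D ==> bef a b ==> bef b a ==> a = b"
  and "\<And>a b c. a \<in> D ==> b \<in> D ==> c \<in> D ==> bef a b ==> bef b c ==> bef a c"
  and "\<And>a b. a \<in> D ==> b \<in> D ==> bef a b \<or> bef b a"
 shows "labeling (filling bef sk)"
  and "a \<in> D ==> b \<in> D ==> entry (filling bef sk) a \<le> entry (filling bef sk) b \<longleftrightarrow> bef a b"
proof -
 note r = rank_total_order[of D bef, OF finite_D assms]
 show "labeling (filling bef sk)"
  using r(1) by (simp add: labeling_def filling_def shape_def entry_def bij_betw_restrict_eq card_D)
 show "a \<in> D ==> b \<in> D ==> entry (filling bef sk) a \<le> entry (filling bef sk) b \<longleftrightarrow> bef a b"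
  using r(2) by (simp add: filling_def entry_def)
qed

lemma tau0: "labeling (tau0 sk)"
  "a \<in> D ==> b \<in> D ==> entry (tau0 sk) a \<le> entry (tau0 sk) b \<longleftrightarrow>
   fst a < fst b \<or> fst a = fst b \<and> snd b \<le> snd a"
proof -
 let ?le = "\<lambda>(i, j) (i', j'). i < i' \<or> i = i' \<and> j \<ge> j'"
 show "labeling (tau0 sk)" unfolding tau0_def by (rule filling_labeling(1); force)
 show "entry (tau0 sk) a \<le> entry (tau0 sk) b \<longleftrightarrow>
   fst a < fst b \<or> fst a = fst b \<and> snd b \<le> snd a" if ab: "a \<in> D" "b \<in> D"
 proof -
  have "entry (tau0 sk) a \<le> entry (tau0 sk) b \<longleftrightarrow> ?le a b"
   unfolding tau0_def by (rule filling_labeling(2)[OF _ _ _ _ ab]; force)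
  thus ?thesis by (simp add: case_prod_beta)
 qed
qed

lemma tau1: "labeling (tau1 sk)"
  "a \<in> D ==> b \<in> D ==> entry (tau1 sk) a \<le> entry (tau1 sk) b \<longleftrightarrow>
   snd b < snd a \<or> snd a = snd b \<and> fst a \<le> fst b"
proof -
 let ?le = "\<lambda>(i, j) (i', j'). j > j' \<or> j = j' \<and> i \<le> i'"
 show "labeling (tau1 sk)" unfolding tau1_def by (rule filling_labeling(1); force)
 show "entry (tau1 sk) a \<le> entry (tau1 sk) b \<longleftrightarrow>
   snd b < snd a \<or> snd a = snd b \<and> fst a \<le> fst b" if ab: "a \<in> D" "b \<in> D"
 proof -
  have "entry (tau1 sk) a \<le> entry (tau1 sk) b \<longleftrightarrow> ?le a b"
   unfolding tau1_def by (rule filling_labeling(2)[OF _ _ _ _ ab]; force)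
  thus ?thesis by (simp add: case_prod_beta)
 qed
qed

lemma T_col: "labeling (T_col sk)"
  "a \<in> D ==> b \<in> D ==> entry (T_col sk) a \<le> entry (T_col sk) b \<longleftrightarrow>
   snd a < snd b \<or> snd a = snd b \<and> fst a \<le> fst b"
proof -
 let ?le = "\<lambda>(i, j) (i', j'). j < j' \<or> j = j' \<and> i \<le> i'"
 show "labeling (T_col sk)" unfolding T_col_def by (rule filling_labeling(1); force)
 show "entry (T_col sk) a \<le> entry (T_col sk) b \<longleftrightarrow>
   snd a < snd b \<or> snd a = snd b \<and> fst a \<le> fst b" if ab: "a \<in> D" "b \<in> D"
 proof -
  have "entry (T_col sk) a \<le> entry (T_col sk) b \<longleftrightarrow> ?le a b"
   unfolding T_col_def by (rule filling_labeling(2)[OF _ _ _ _ ab]; force)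
  thus ?thesis by (simp add: case_prod_beta)
 qed
qed

abbreviation "f0 \<equiv> entry (tau0 sk)"

lemma f0_less: "a \<in> D ==> b \<in> D ==> f0 a < f0 b \<longleftrightarrow> fst a < fst b \<or> fst a = fst b \<and> snd b < snd a"
 using tau0(2)[of b a] by (auto simp flip: not_le)

lemma distinguished_tau0: "distinguished f0"
 unfolding distinguished_def using f0_less by (metis nat_less_le prod_eq_iff)

lemma distinguished_tau1: "distinguished (entry (tau1 sk))"
 unfolding distinguished_def using tau1(2) by (metis leD leI nat_less_le prod_eq_iff)

text \<open>In a standard filling, consecutive entries lie in north-east/south-west position: a box
 strictly south-east of another is separated from it by the entry of a corner.  Which of the
 two comes first in a distinguished labeling therefore does not depend on the labeling.\<close>

lemma consecutive_comparison:
 assumes g: "standard g" and ab: "a \<in> D" "b \<in> D" "g b = Suc (g a)"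
  and f: "distinguished f" "distinguished f'"
 shows "f b < f a \<longleftrightarrow> f' b < f' a"
proof -
 have ne: "a \<noteq> b" using ab(3) by auto
 have no: "\<not> nw b a" using g ab ne unfolding standard_def by fastforce
 have "\<not> (fst a < fst b \<and> snd a < snd b)"
 proof
  assume lt: "fst a < fst b \<and> snd a < snd b"
  let ?c = "(fst a, snd b)"
  have nwc: "nw a ?c" "nw ?c b" using lt by (auto simp: nw_def)
  have c: "?c \<in> D" by (rule rect[OF ab(1,2) nwc])
  have "a \<noteq> ?c" "?c \<noteq> b" using lt by (metis less_irrefl snd_conv, metis less_irrefl fst_conv)
  hence "g a < g ?c" "g ?c < g b" using g ab(1,2) c nwc unfolding standard_def by blast+
  thus False using ab(3) by simp
 qed
 then consider "fst a \<le> fst b" "snd b \<le> snd a" | "fst b \<le> fst a" "snd a \<le> snd b"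
  using no unfolding nw_def by linarith
 thus ?thesis
 proof cases
  case 1
  hence "f a < f b" "f' a < f' b" using f ab ne unfolding distinguished_def by blast+
  thus ?thesis by simp
 next
  case 2
  hence "f b < f a" "f' b < f' a" using f ab ne unfolding distinguished_def by blast+
  thus ?thesis by simp
 qed
qed

text \<open>Reading with another labeling relabels positions, and left descents are comparisons of consecutive
 entries.\<close>

theorem f_map_iso:
 assumes t: "labeling t" and dis: "distinguished (entry t)" and tau: "tau N Q = t" "tab_poset t = Q"
 shows "f_map N Q \<in> module_hom (HA N) (M_module N (tab_poset (tau0 sk))) (M_module N Q)"
  and "bij_betw (f_map N Q) (carrier (M_module N (tab_poset (tau0 sk)))) (carrier (M_module N Q))"
proof -
 let ?k = "read_tab (tau0 sk) t"
 note t0 = tau0(1)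
 have sh: "shape t = sk" using t by (simp add: labeling_def)
 have k: "?k permutes {1..N}" by (rule read_tab_permutes[OF t0 t])
 have kf: "?k (f0 a) = entry t a" if "a \<in> D" for a by (rule read_tab_entry[OF t0 that])
 let ?S0 = "Sigma_L N (tab_poset (tau0 sk))" and ?S1 = "Sigma_L N (tab_poset t)"
 have c: "weakly_convex N ?S0" "weakly_convex N ?S1"
  using weakly_convex_Sigma_L tab_poset_range t t0 by auto
 have std: "standard ((w o ?k) o f0) \<longleftrightarrow> standard (w o entry t)" for w
  using kf by (simp add: standard_def)
 have mem: "w \<in> ?S1 \<longleftrightarrow> w o ?k \<in> ?S0" if "w permutes {1..N}" for w
  unfolding Sigma_L_iff[OF t] Sigma_L_iff[OF t0] std using that permutes_compose[OF k that] by blast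
 have Des: "i \<in> Des_L N (w o ?k) \<longleftrightarrow> i \<in> Des_L N w" if w: "w \<in> ?S1" and i: "i \<in> {1..<N}" for w i
 proof -
  have p: "w permutes {1..N}" and st: "standard (w o entry t)" using w Sigma_L_iff[OF t] by auto
  have pk: "w o ?k permutes {1..N}" by (rule permutes_compose[OF k p])
  have "inv' w i \<in> {1..N}" "inv' w (Suc i) \<in> {1..N}" using permutes_in_image[OF permutes_inv[OF p]] i by auto
  then obtain a b where ab: "a \<in> D" "entry t a = inv' w i" "b \<in> D" "entry t b = inv' w (Suc i)"
   using label_cases[OF t] by metis
  have v: "w (entry t a) = i" "w (entry t b) = Suc i" using ab permutes_inverses(1)[OF p] by auto
  have "(w o ?k) (f0 a) = i" "(w o ?k) (f0 b) = Suc i" using v kf ab by auto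
  hence iv: "inv' (w o ?k) i = f0 a" "inv' (w o ?k) (Suc i) = f0 b"
   using permutes_inverses(2)[OF pk] by metis+
  have "f0 b < f0 a \<longleftrightarrow> entry t b < entry t a"
   by (rule consecutive_comparison[OF st ab(1,3) _ distinguished_tau0 dis]) (use v in simp)
  thus ?thesis unfolding Des_L_iff[OF p] Des_L_iff[OF pk] iv using ab by simp
 qed
 have f: "f_map N Q v w = (if w \<in> ?S1 then v (w o ?k) else 0)" for v w
 proof -
  have "f_map N Q v w = (\<Sum>T\<in>SYT sk. v (read_tab (tau0 sk) T) * basis_vec (read_tab t T) w)"
   unfolding f_map_def tau(1) sh Let_def ..
  also have "\<dots> = (\<Sum>r\<in>?S1. v (read_tab (tau0 sk) (unread t r)) * basis_vec r w)"
   by (rule sum.reindex_bij_witness[of _ "unread t" "read_tab t"])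
    (use read_bij[OF t] unread_read[OF t] read_unread[OF t] SYT_iff Sigma_L_iff[OF t]
     unread_labeling[OF t] unread_standard in \<open>auto simp: bij_betw_def\<close>)
  also have "\<dots> = (\<Sum>r\<in>?S1. if r = w then v (read_tab (tau0 sk) (unread t w)) else 0)"
   by (rule sum.cong) (auto simp: basis_vec_def)
  also have "\<dots> = (if w \<in> ?S1 then v (read_tab (tau0 sk) (unread t w)) else 0)"
   by (rule sum.delta) (rule weakly_convexD(2)[OF c(2)])
  also have "\<dots> = (if w \<in> ?S1 then v (w o ?k) else 0)"
  proof (cases "w \<in> ?S1")
   case True
   hence p: "w permutes {1..N}" using Sigma_L_iff[OF t] by blast
   have "read_tab (tau0 sk) (unread t w) x = (w o ?k) x" for x
   proof (cases "x \<in> {1..N}")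
    case True
    then obtain a where a: "a \<in> D" "f0 a = x" using label_cases[OF t0] by blast
    thus ?thesis using read_tab_entry[OF t0 a(1), of "unread t w"] kf[OF a(1)]
     by (simp add: unread_def entry_def)
   next
    case False
    thus ?thesis using read_tab_outside[OF t0 False] permutes_not_in[OF p False] by simp
   qed
   hence "read_tab (tau0 sk) (unread t w) = w o ?k" by blast
   thus ?thesis by simp
  qed simp
  finally show ?thesis .
 qed
 show "f_map N Q \<in> module_hom (HA N) (M_module N (tab_poset (tau0 sk))) (M_module N Q)"
  "bij_betw (f_map N Q) (carrier (M_module N (tab_poset (tau0 sk)))) (carrier (M_module N Q))"
  unfolding M_module_def tau(2)[symmetric] using relabel_iso[of N ?S0 ?S1 ?k "f_map N Q"] c k mem Des f
  unfolding tau(2) by blast+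
qed

end

section \<open>Row lengths as generalized compositions\<close>

text \<open>The partial sums of the values up to those indices that are linked to the next one.\<close>

fun boundary_sums :: "('a => 'a => bool) => ('a => nat) => 'a list => nat set" where
 "boundary_sums L r [] = {}"
| "boundary_sums L r [x] = {}"
| "boundary_sums L r (x # y # xs) =
  (let B = (+) (r x) ` boundary_sums L r (y # xs) in if L x y then insert (r x) B else B)"

lemma boundary_sums_upt:
 "m \<le> l ==> boundary_sums L r [m..<Suc l] = {\<Sum>i=m..k. r i | k. m \<le> k \<and> k < l \<and> L k (Suc k)}"
proof (induction m rule: inc_induct)
 case (step m)
 have u: "[m..<Suc l] = m # Suc m # [Suc (Suc m)..<Suc l]" "[Suc m..<Suc l] = Suc m # [Suc (Suc m)..<Suc l]"
  using step.hyps by (simp_all add: upt_conv_Cons)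
 have s: "r m + (\<Sum>i=Suc m..k. r i) = (\<Sum>i=m..k. r i)" if "m \<le> k" for k
  using sum.atLeast_Suc_atMost[OF that, of r] by simp
 have "(+) (r m) ` {\<Sum>i=Suc m..k. r i | k. Suc m \<le> k \<and> k < l \<and> L k (Suc k)} =
   {\<Sum>i=m..k. r i | k. Suc m \<le> k \<and> k < l \<and> L k (Suc k)}" (is "?A = ?B")
 proof -
  have "?A = {r m + (\<Sum>i=Suc m..k. r i) | k. Suc m \<le> k \<and> k < l \<and> L k (Suc k)}" by blast
  also have "\<dots> = ?B" using s by (metis (no_types, lifting) Suc_leD)
  finally show ?thesis .
 qed
 hence 1: "boundary_sums L r [m..<Suc l] = (if L m (Suc m) then insert (r m) ?B else ?B)"
  unfolding u(1) boundary_sums.simps Let_def using step.IH unfolding u(2) by simp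
 have "(m \<le> k \<and> k < l \<and> L k (Suc k)) \<longleftrightarrow> (k = m \<and> L m (Suc m)) \<or> (Suc m \<le> k \<and> k < l \<and> L k (Suc k))" for k
  using step.hyps le_less_Suc_eq[of m k] not_less_eq_eq[of m k] by (cases "k = m") auto
 hence "{\<Sum>i=m..k. r i | k. m \<le> k \<and> k < l \<and> L k (Suc k)} = {\<Sum>i=m..k. r i | k. k = m \<and> L m (Suc m)} \<union> ?B"
  by blast
 thus ?case unfolding 1 by auto
qed simp

lemma comp_set_map: "comp_set (map r xs) = boundary_sums (\<lambda>_ _. True) r xs"
 by (induction xs rule: induct_list012) (simp_all add: comp_set_Cons)

lemma maximal_runs_Nil: "maximal_runs L xs = [] \<longleftrightarrow> xs = []"
 by (cases "(L, xs)" rule: maximal_runs.cases) (auto simp: Let_def)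

lemma maximal_runs_nonempty: "[] \<notin> set (maximal_runs L xs)"
proof (induction L xs rule: maximal_runs.induct)
 case (3 L x y xs)
 have "maximal_runs L (y # xs) \<noteq> []" by (simp add: maximal_runs_Nil)
 thus ?case using 3 by (cases "maximal_runs L (y # xs)") (auto simp: Let_def)
qed auto

lemma concat_maximal_runs: "concat (maximal_runs L xs) = xs"
proof (induction L xs rule: maximal_runs.induct)
 case (3 L x y xs)
 have "maximal_runs L (y # xs) \<noteq> []" by (simp add: maximal_runs_Nil)
 thus ?case using 3 by (cases "maximal_runs L (y # xs)") (auto simp: Let_def)
qed auto

lemma near_concat_maximal_runs:
 "(\<And>x. x \<in> set xs ==> 0 < r x) ==>
  comp_set (near_concat (map (map r) (maximal_runs L xs))) = boundary_sums L r xs"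
proof (induction L xs rule: maximal_runs.induct)
 case (3 L x y xs)
 let ?bs = "maximal_runs L (y # xs)"
 obtain h t where bs: "?bs = h # t" using maximal_runs_Nil[of L "y # xs"] by (cases ?bs) auto
 have h: "h \<noteq> []" using maximal_runs_nonempty[of L "y # xs"] bs by auto
 have mem: "set (concat ?bs) = set (y # xs)" by (simp only: concat_maximal_runs)
 have pr: "proper_gcomp (map (map r) ?bs)"
  unfolding proper_gcomp_def
 proof
  fix b assume "b \<in> set (map (map r) ?bs)"
  then obtain rs where rs: "rs \<in> set ?bs" "b = map r rs" by auto
  hence "set rs \<subseteq> set (y # xs)" using mem by auto
  thus "b \<noteq> [] \<and> 0 \<notin> set b" using rs maximal_runs_nonempty[of L "y # xs"] 3(2) by fastforce
 qed
 have IH: "comp_set (near_concat (map (map r) ?bs)) = boundary_sums L r (y # xs)" using 3 by simp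
 have IH': "comp_set (map r h) \<union> (+) (sum_list (map r h)) ` comp_set (near_concat (map (map r) t)) =
   boundary_sums L r (y # xs)"
  using IH comp_set_near_concat_Cons[of "map r h" "map (map r) t"] pr bs by simp
 show ?case
 proof (cases "L x y")
  case True
  have p: "proper_gcomp ((r x # map r h) # map (map r) t)" using pr bs 3(2)[of x] by (auto simp: proper_gcomp_def)
  have "comp_set (near_concat (map (map r) (maximal_runs L (x # y # xs)))) =
    insert (r x) ((+) (r x) ` comp_set (map r h)) \<union> (+) (r x + sum_list (map r h)) ` comp_set (near_concat (map (map r) t))"
   using True bs comp_set_near_concat_Cons[OF p] h by (simp add: Let_def comp_set_Cons)
  also have "\<dots> = insert (r x) ((+) (r x) ` boundary_sums L r (y # xs))"
   unfolding IH'[symmetric] by (auto simp: image_Un image_image add.assoc)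
  finally show ?thesis using True by (simp add: Let_def)
 next
  case False
  have p: "proper_gcomp ([r x] # map (map r) ?bs)" using pr 3(2)[of x] by (auto simp: proper_gcomp_def)
  have "comp_set (near_concat (map (map r) (maximal_runs L (x # y # xs)))) = (+) (r x) ` boundary_sums L r (y # xs)"
   using False comp_set_near_concat_Cons[OF p] IH by (simp add: Let_def comp_set_Cons)
  thus ?thesis using False by (simp add: Let_def)
 qed
qed (simp_all add: near_concat_def near_concat2_def comp_set_Cons)

context skew_shape
begin

definition row_len :: "nat => nat" where "row_len i = lam i - mu i"

lemma alpha_proj_eq: "alpha_proj sk = map (map row_len) (components sk)"
 unfolding alpha_proj_def row_len_def ..

lemma concat_alpha_proj: "concat (alpha_proj sk) = map row_len [1..<Suc nrows]"
 unfolding alpha_proj_eq map_concat[symmetric] components_def concat_maximal_runs ..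

lemma row_len_pos: "x \<in> set [1..<Suc nrows] ==> 0 < row_len x"
 using row_nonempty[of x] by (auto simp: row_len_def)

lemma proper_alpha_proj: "proper_gcomp (alpha_proj sk)"
 unfolding proper_gcomp_def
proof
 fix c assume b: "c \<in> set (alpha_proj sk)"
 hence "c \<noteq> []" using maximal_runs_nonempty unfolding alpha_proj_eq components_def by fastforce
 moreover have "set c \<subseteq> set (concat (alpha_proj sk))" using b by auto
 hence "0 \<notin> set c" unfolding concat_alpha_proj using row_len_pos by fastforce
 ultimately show "c \<noteq> [] \<and> 0 \<notin> set c" by blast
qed

lemma rowsum_eq: "rowsum k = (\<Sum>i=1..k. row_len i)"
 by (simp add: rowsum_def row_len_def)

lemma sum_alpha_proj: "sum_list (concat (alpha_proj sk)) = N"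
 unfolding concat_alpha_proj using card_D(2)
 by (simp add: rowsum_eq interv_sum_list_conv_sum_set_nat atLeastLessThanSuc_atLeastAtMost del: upt_Suc)

lemma comp_set_concat_alpha: "comp_set (concat (alpha_proj sk)) = {rowsum k | k. 1 \<le> k \<and> k < nrows}"
proof (cases "nrows = 0")
 case False
 hence "1 \<le> nrows" by (simp add: Suc_le_eq)
 thus ?thesis unfolding concat_alpha_proj comp_set_map rowsum_eq
  by (subst boundary_sums_upt) auto
qed (simp add: concat_alpha_proj)

lemma comp_set_near_alpha:
 "comp_set (near_concat (alpha_proj sk)) = {rowsum k | k. 1 \<le> k \<and> k < nrows \<and> k \<in> links}"
proof (cases "nrows = 0")
 case True
 thus ?thesis by (simp add: alpha_proj_eq components_def near_concat_def)
next
 case False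
 hence "1 \<le> nrows" by (simp add: Suc_le_eq)
 have "comp_set (near_concat (map (map row_len) (maximal_runs L [1..<Suc nrows]))) =
   boundary_sums L row_len [1..<Suc nrows]" for L
  by (rule near_concat_maximal_runs) (rule row_len_pos)
 with \<open>1 \<le> nrows\<close> show ?thesis
  unfolding alpha_proj_eq components_def rowsum_eq
  by (simp add: boundary_sums_upt links_def del: upt_Suc)
qed

definition Jset :: "nat set" where "Jset = {1..<N} - comp_set (concat (alpha_proj sk))"
definition Kset :: "nat set" where "Kset = comp_set (near_concat (alpha_proj sk))"

lemma JK: "Jset \<subseteq> {1..<N}" "Kset \<subseteq> {1..<N}" "Jset \<inter> Kset = {}"
 using comp_set_concat_near_subset[OF proper_alpha_proj] unfolding sum_alpha_proj Jset_def Kset_def by auto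

lemma proj_lower_eq: "proj_lower N (alpha_proj sk) = longest_parabolic N Jset"
proof -
 have "0 \<notin> set (concat (alpha_proj sk))" using proper_alpha_proj by (auto simp: proper_gcomp_def)
 from comp_compl(2)[OF this] show ?thesis
  unfolding proj_lower_def w0_comp_def sum_alpha_proj Jset_def by simp
qed

lemma proj_upper_eq: "proj_upper N (alpha_proj sk) = longest_perm N o longest_parabolic N Kset"
 unfolding proj_upper_def w0_comp_def Kset_def ..

lemma f0_le_rowsum: "b \<in> D ==> f0 b \<le> rowsum k \<longleftrightarrow> fst b \<le> k"
proof
 assume b: "b \<in> D"
 have e: "f0 b = card {a \<in> D. fst a < fst b \<or> fst a = fst b \<and> snd b \<le> snd a}"
  using b by (simp add: tau0_def filling_def entry_def case_prod_beta)
 show "fst b \<le> k" if "f0 b \<le> rowsum k"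
 proof (rule ccontr)
  assume "\<not> fst b \<le> k"
  hence "insert b {a \<in> D. fst a \<le> k} \<subseteq> {a \<in> D. fst a < fst b \<or> fst a = fst b \<and> snd b \<le> snd a}"
   "b \<notin> {a \<in> D. fst a \<le> k}" using b by auto
  hence "Suc (card {a \<in> D. fst a \<le> k}) \<le> f0 b"
   unfolding e using card_mono[of "{a \<in> D. fst a < fst b \<or> fst a = fst b \<and> snd b \<le> snd a}"
    "insert b {a \<in> D. fst a \<le> k}"] by simp
  thus False using that card_rows_le[of k] by simp
 qed
 show "f0 b \<le> rowsum k" if "fst b \<le> k"
  unfolding e card_rows_le[symmetric] by (rule card_mono) (use that in auto)
qed

lemma same_block_J:
 assumes ab: "a \<in> D" "b \<in> D" "f0 a \<le> f0 b"
 shows "same_block Jset (f0 a) (f0 b) \<longleftrightarrow> fst a = fst b"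
proof
 assume sb: "same_block Jset (f0 a) (f0 b)"
 show "fst a = fst b"
 proof (rule ccontr)
  assume "fst a \<noteq> fst b"
  hence lt: "fst a < fst b" using tau0(2)[OF ab(1,2)] ab(3) by auto
  hence "rowsum (fst a) \<in> {f0 a..<f0 b}" using f0_le_rowsum[OF ab(1), of "fst a"] f0_le_rowsum[OF ab(2), of "fst a"] by auto
  hence "rowsum (fst a) \<in> Jset" using sb same_block_less[OF ab(3)] by blast
  moreover have "1 \<le> fst a" "fst a < nrows" using D_bounds[OF ab(1)] D_bounds[OF ab(2)] lt by auto
  ultimately show False unfolding Jset_def comp_set_concat_alpha by blast
 qed
next
 assume eq: "fst a = fst b"
 have "c \<in> Jset" if c: "c \<in> {f0 a..<f0 b}" for c
 proof -
  have "c \<noteq> rowsum k" for k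
   using c f0_le_rowsum[OF ab(1), of k] f0_le_rowsum[OF ab(2), of k] eq by auto
  moreover have "c \<in> {1..<N}" using c entry_range[OF tau0(1) ab(1)] entry_range[OF tau0(1) ab(2)] by auto
  ultimately show ?thesis unfolding Jset_def comp_set_concat_alpha by blast
 qed
 thus "same_block Jset (f0 a) (f0 b)" using same_block_less[OF ab(3)] by blast
qed

text \<open>Without a link through \<open>K\<close> the rows belong to different components.\<close>

lemma same_block_not_K:
 assumes ab: "a \<in> D" "b \<in> D" "fst a < fst b" and sb: "same_block ({1..<N} - Kset) (f0 a) (f0 b)"
 shows "snd b < snd a"
proof -
 have le: "f0 a \<le> f0 b" using tau0(2)[OF ab(1,2)] ab(3) by simp
 have "rowsum (fst a) \<in> {f0 a..<f0 b}"
  using f0_le_rowsum[OF ab(1), of "fst a"] f0_le_rowsum[OF ab(2), of "fst a"] ab(3)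
  unfolding atLeastLessThan_iff by linarith
 hence "rowsum (fst a) \<notin> Kset" using sb unfolding same_block_less[OF le] by blast
 moreover have "1 \<le> fst a" "fst a < nrows" using D_bounds[OF ab(1)] D_bounds[OF ab(2)] ab(3) by auto
 ultimately have "fst a \<notin> links" unfolding Kset_def comp_set_near_alpha by blast
 thus ?thesis using unlinked_left[OF ab(1,2) order_refl ab(3)] by blast
qed

abbreviation "S0 \<equiv> Sigma_L N (tab_poset (tau0 sk))"
abbreviation "SA \<equiv> descent_set N Jset Kset"

lemma S0_iff: "w \<in> S0 \<longleftrightarrow> w permutes {1..N} \<and> standard (w o f0)"
 by (rule Sigma_L_iff[OF tau0(1)])

lemma f0_cases: "k \<in> {1..N} ==> \<exists>a\<in>D. f0 a = k"
 using label_cases[OF tau0(1)] by blast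

lemma standard_J:
 assumes "standard (w o f0)" "(p, q) \<in> block_pairs N Jset" shows "w q < w p"
proof -
 obtain a b where ab: "a \<in> D" "f0 a = p" "b \<in> D" "f0 b = q"
  using assms(2) f0_cases unfolding block_pairs_def by blast
 have pq: "p < q" "same_block Jset p q" using assms(2) by (auto simp: block_pairs_def)
 hence "fst a = fst b" using same_block_J[OF ab(1,3)] ab by simp
 moreover from this have "snd b < snd a" using f0_less[OF ab(1,3)] pq ab by simp
 ultimately have "nw b a" "b \<noteq> a" by (auto simp: nw_def)
 thus ?thesis using assms(1) ab unfolding standard_def by auto
qed

lemma S0_subset_SA: "S0 \<subseteq> SA"
proof
 fix w assume "w \<in> S0"
 hence w: "w permutes {1..N}" and st: "standard (w o f0)" using S0_iff by auto
 have "w (Suc j) < w j" if j: "j \<in> Jset" for j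
 proof -
  have "(j, Suc j) \<in> block_pairs N Jset" using j JK(1) by (auto simp: block_pairs_def same_block_Suc)
  thus ?thesis by (rule standard_J[OF st])
 qed
 moreover have "w k < w (Suc k)" if k: "k \<in> Kset" for k
 proof -
  have kN: "k \<in> {1..N}" "Suc k \<in> {1..N}" using k JK(2) by auto
  obtain i where i: "k = rowsum i" "1 \<le> i" "i < nrows" "i \<in> links" using k unfolding Kset_def comp_set_near_alpha by blast
  obtain a where a: "a \<in> D" "f0 a = k" using f0_cases[OF kN(1)] by blast
  obtain b where b: "b \<in> D" "f0 b = Suc k" using f0_cases[OF kN(2)] by blast
  have mn: "mu i < lam (Suc i)" using links_iff[OF i(2,3)] i(4) by blast
  have c: "(i, Suc (mu i)) \<in> D" using row_nonempty[of i] i by (simp add: in_D)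
  have d: "(Suc i, lam (Suc i)) \<in> D" using row_nonempty[of "Suc i"] i by (simp add: in_D)
  have "f0 (i, Suc (mu i)) \<le> f0 a" using f0_le_rowsum[OF c, of i] a i by simp
  hence a': "i < fst a \<or> i = fst a \<and> snd a \<le> Suc (mu i)" using tau0(2)[OF c a(1)] by simp
  have "fst a \<le> i" using f0_le_rowsum[OF a(1), of i] a i by simp
  hence a'': "fst a = i" "snd a \<le> Suc (mu i)" using a' by auto
  have "f0 b \<le> f0 (Suc i, lam (Suc i))" using f0_le_rowsum[OF d, of i] b i by simp
  hence b': "fst b < Suc i \<or> fst b = Suc i \<and> lam (Suc i) \<le> snd b" using tau0(2)[OF b(1) d] by simp
  have "\<not> fst b \<le> i" using f0_le_rowsum[OF b(1), of i] b i by simp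
  hence "nw a b" "a \<noteq> b" using a'' b' mn by (auto simp: nw_def)
  hence "(w o f0) a < (w o f0) b" using st a(1) b(1) unfolding standard_def by blast
  thus ?thesis using a(2) b(2) by simp
 qed
 ultimately show "w \<in> SA" unfolding descent_set_iff[OF JK(1,2)] using w by blast
qed

text \<open>Comparable boxes in different rows must not be inverted, and those in one row are inverted because
 of the descents in \<open>J\<close>.\<close>

lemma S0_if_not_inverting:
 assumes u: "u permutes {1..N}" and J: "block_pairs N Jset \<subseteq> inversions N u"
  and left: "\<And>a b. a \<in> D ==> b \<in> D ==> (f0 a, f0 b) \<in> inversions N u ==> fst a < fst b ==> snd b < snd a"
 shows "u \<in> S0"
 unfolding S0_iff standard_def
proof (intro conjI u ballI impI)
 fix a b assume ab: "a \<in> D" "b \<in> D" "nw a b" "a \<noteq> b"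
 note r = entry_range[OF tau0(1) ab(1)] entry_range[OF tau0(1) ab(2)]
 show "(u o f0) a < (u o f0) b"
 proof (cases "fst a = fst b")
  case True
  hence "snd a < snd b" using ab(3,4) by (auto simp: nw_def prod_eq_iff)
  hence lt: "f0 b < f0 a" using f0_less[OF ab(2,1)] True by simp
  hence "same_block Jset (f0 b) (f0 a)" using same_block_J[OF ab(2,1)] True by simp
  hence "(f0 b, f0 a) \<in> block_pairs N Jset" using lt r by (simp add: block_pairs_def)
  thus ?thesis using J by (auto simp: inversions_def)
 next
  case False
  hence lt: "fst a < fst b" "snd a \<le> snd b" using ab(3) by (auto simp: nw_def)
  hence f: "f0 a < f0 b" using f0_less[OF ab(1,2)] by simp
  have "(f0 a, f0 b) \<notin> inversions N u" using left[OF ab(1,2)] lt by auto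
  hence "u (f0 a) \<le> u (f0 b)" using f r by (auto simp: inversions_def)
  moreover have "u (f0 a) \<noteq> u (f0 b)" using f permutes_inj[OF u] by (metis injD less_irrefl)
  ultimately show ?thesis by simp
 qed
qed

text \<open>This is where the radical meets the combinatorics: what survives in simple quotients comes from
 standard fillings.\<close>

lemma S0_if_within_blocks:
 assumes "u \<in> SA" "inversions N u \<subseteq> block_pairs N ({1..<N} - Kset)"
 shows "u \<in> S0"
proof (rule S0_if_not_inverting)
 show "u permutes {1..N}" "block_pairs N Jset \<subseteq> inversions N u" using assms(1) by (auto simp: descent_set_def)
 fix a b assume ab: "a \<in> D" "b \<in> D" "(f0 a, f0 b) \<in> inversions N u" "fst a < fst b"
 hence "same_block ({1..<N} - Kset) (f0 a) (f0 b)" using assms(2) by (auto simp: block_pairs_def)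
 thus "snd b < snd a" by (rule same_block_not_K[OF ab(1,2,4)])
qed

abbreviation "rho \<equiv> read_tab (tau0 sk) (T_col sk)"

lemma rho_permutes: "rho permutes {1..N}"
 by (rule read_tab_permutes[OF tau0(1) T_col(1)])

text \<open>The reading word of the column filling inverts every pair of boxes that a standard filling may
 invert.\<close>

lemma S0_iff_inversions:
 "u \<in> S0 \<longleftrightarrow> u permutes {1..N} \<and> block_pairs N Jset \<subseteq> inversions N u \<and> inversions N u \<subseteq> inversions N rho"
proof -
 have rf: "rho (f0 a) = entry (T_col sk) a" if "a \<in> D" for a by (rule read_tab_entry[OF tau0(1) that])
 have inv_rho: "(f0 a, f0 b) \<in> inversions N rho \<longleftrightarrow> f0 a < f0 b \<and> snd b < snd a" if ab: "a \<in> D" "b \<in> D" for a b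
 proof -
  have "entry (T_col sk) b < entry (T_col sk) a \<longleftrightarrow> snd b < snd a \<or> snd b = snd a \<and> fst b < fst a"
   using T_col(2)[OF ab] by (auto simp flip: not_le)
  thus ?thesis
   using entry_range[OF tau0(1) ab(1)] entry_range[OF tau0(1) ab(2)] rf ab f0_less[OF ab]
   by (auto simp: inversions_def)
 qed
 show ?thesis
 proof
  assume "u \<in> S0"
  hence u: "u permutes {1..N}" "standard (u o f0)" using S0_iff by auto
  have "block_pairs N Jset \<subseteq> inversions N u" using S0_subset_SA \<open>u \<in> S0\<close> by (auto simp: descent_set_def)
  moreover have "(p, q) \<in> inversions N rho" if pq: "(p, q) \<in> inversions N u" for p q
  proof -
   have "p \<in> {1..N}" "q \<in> {1..N}" "p < q" "u q < u p" using pq by (auto simp: inversions_def)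
   then obtain a b where ab: "a \<in> D" "f0 a = p" "b \<in> D" "f0 b = q" "f0 a < f0 b" "u (f0 b) < u (f0 a)"
    using f0_cases by metis
   have "\<not> nw a b" using u(2) ab unfolding standard_def by fastforce
   hence "snd b < snd a" using f0_less[OF ab(1,3)] ab(5) by (auto simp: nw_def)
   thus ?thesis using inv_rho[OF ab(1,3)] ab by blast
  qed
  ultimately show "u permutes {1..N} \<and> block_pairs N Jset \<subseteq> inversions N u \<and> inversions N u \<subseteq> inversions N rho"
   using u by auto
 next
  assume a: "u permutes {1..N} \<and> block_pairs N Jset \<subseteq> inversions N u \<and> inversions N u \<subseteq> inversions N rho"
  thus "u \<in> S0" by (intro S0_if_not_inverting) (use inv_rho in blast)+
 qed
qed

theorem interval_eq_S0: "weak_interval N (proj_lower N (alpha_proj sk)) rho = S0"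
 using S0_iff_inversions
 unfolding weak_interval_eq[OF longest_parabolic(1)[OF JK(1)] rho_permutes] proj_lower_eq longest_parabolic(4)[OF JK(1)]
 by blast

lemma P_module_eq: "P_module N (alpha_proj sk) = perm_module N SA"
 unfolding P_module_def B_module_def proj_lower_eq proj_upper_eq weak_interval_eq_descent_set[OF JK(1,2)] ..

end

section \<open>Connected components and the order in which they appear\<close>

text \<open>Runs are blocks for the set of linked indices, and different runs are separated by a missing link.\<close>

lemma maximal_runs_blocks:
 fixes L :: "nat => nat => bool"
 defines "I \<equiv> {i. L i (Suc i)}"
 shows "r \<in> set (maximal_runs L [m..<l]) ==> u \<in> set r ==> v \<in> set r ==> same_block I u v"
  and "sorted_wrt (\<lambda>r r'. \<forall>u\<in>set r. \<forall>v\<in>set r'. u < v \<and> \<not> same_block I u v) (maximal_runs L [m..<l])"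
proof -
 let ?W = "sorted_wrt (\<lambda>r r'. \<forall>u\<in>set r. \<forall>v\<in>set r'. u < v \<and> \<not> same_block I u v)"
 have "(\<forall>r\<in>set (maximal_runs L [m..<l]). \<forall>u\<in>set r. \<forall>v\<in>set r. same_block I u v) \<and> ?W (maximal_runs L [m..<l])"
 proof (induction "l - m" arbitrary: m)
  case 0
  thus ?case by simp
 next
  case (Suc d)
  have IH0: "d = l - Suc m" "m < l" using Suc.hyps(2) by auto
  from Suc.hyps(1)[OF IH0(1)] IH0(2) have ml: "m < l" and IH: "(\<forall>r\<in>set (maximal_runs L [Suc m..<l]). \<forall>u\<in>set r. \<forall>v\<in>set r. same_block I u v) \<and>
    ?W (maximal_runs L [Suc m..<l])" by blast+
  show ?case
  proof (cases "Suc m < l")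
   case False
   hence "[m..<l] = [m]" using ml by (simp add: upt_conv_Cons)
   thus ?thesis by simp
  next
   case True
   let ?bs = "maximal_runs L [Suc m..<l]"
   have u: "[Suc m..<l] = Suc m # [Suc (Suc m)..<l]" "[m..<l] = m # Suc m # [Suc (Suc m)..<l]"
    using True by (simp_all add: upt_conv_Cons)
   obtain h t where bs: "?bs = h # t" using maximal_runs_Nil[of L "[Suc m..<l]"] True by (cases ?bs) auto
   have h: "h \<noteq> []" using maximal_runs_nonempty[of L "[Suc m..<l]"] bs by auto
   have cc: "h @ concat t = Suc m # [Suc (Suc m)..<l]" using concat_maximal_runs[of L "[Suc m..<l]"] bs u by simp
   hence mh: "Suc m \<in> set h" using h by (cases h) auto
   have big: "m < v" if "r \<in> set ?bs" "v \<in> set r" for r v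
   proof -
    have "v \<in> set (concat ?bs)" using that by auto
    thus ?thesis unfolding concat_maximal_runs by simp
   qed
   have W: "?W ?bs" and sb: "\<And>r u v. r \<in> set ?bs ==> u \<in> set r ==> v \<in> set r ==> same_block I u v"
    using IH by blast+
   show ?thesis
   proof (cases "L m (Suc m)")
    case True
    hence e: "maximal_runs L [m..<l] = (m # h) # t" unfolding u(2) using bs u(1) by simp
    have mI: "same_block I m (Suc m)" using True by (simp add: same_block_Suc I_def)
    have mu: "same_block I m u" if "u \<in> set h" for u
     using same_block_trans[OF mI sb[of h "Suc m" u]] bs mh that by simp
    have mm: "same_block I u v" if "u \<in> set (m # h)" "v \<in> set (m # h)" for u v
     using that mu sb[of h u v] bs same_block_sym[OF mu, of u] by auto
    have "\<not> same_block I m v" if "r \<in> set t" "v \<in> set r" for r v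
    proof
     assume "same_block I m v"
     hence "same_block I (Suc m) v" using same_block_trans[OF same_block_sym[OF mI]] by blast
     thus False using W bs mh that by auto
    qed
    moreover have "m < v" if "r \<in> set t" "v \<in> set r" for r v using big[of r v] that bs by simp
    ultimately have "?W ((m # h) # t)" using W unfolding bs by auto
    moreover have "\<forall>r\<in>set ((m # h) # t). \<forall>u\<in>set r. \<forall>v\<in>set r. same_block I u v"
    proof (intro ballI)
     fix r u v assume r: "r \<in> set ((m # h) # t)" "u \<in> set r" "v \<in> set r"
     then consider "r = m # h" | "r \<in> set ?bs" using bs by auto
     thus "same_block I u v" by cases (use r mm sb in blast)+
    qed
    ultimately show ?thesis unfolding e by blast
   next
    case False
    hence e: "maximal_runs L [m..<l] = [m] # ?bs" unfolding u(2) using u(1) by simp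
    have "\<not> same_block I m v" if "m < v" for v
    proof -
     have "m \<in> {m..<v}" "m \<notin> I" using that False by (auto simp: I_def)
     thus ?thesis using same_block_less[OF less_imp_le[OF that], of I] by (metis subsetD)
    qed
    thus ?thesis using sb W big unfolding e by auto
   qed
  qed
 qed
 thus "r \<in> set (maximal_runs L [m..<l]) ==> u \<in> set r ==> v \<in> set r ==> same_block I u v"
  "?W (maximal_runs L [m..<l])" by blast+
qed

text \<open>The components of the diagram, seen on labels, and the invariant by which they are ordered.\<close>

definition conn :: "(nat \<times> nat) set => (nat \<times> nat) set" where
 "conn P = (P \<union> P\<inverse>)\<^sup>*"

definition pmin :: "(nat \<times> nat) set => nat => nat" where
 "pmin P x = Min {y. (x, y) \<in> conn P}"

lemma conn_sym: "(x, y) \<in> conn P ==> (y, x) \<in> conn P"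
proof -
 have "sym (conn P)" unfolding conn_def by (rule sym_rtrancl) (auto simp: sym_def)
 thus "(x, y) \<in> conn P ==> (y, x) \<in> conn P" by (rule symD)
qed

lemma conn_trans: "(x, y) \<in> conn P ==> (y, z) \<in> conn P ==> (x, z) \<in> conn P"
 unfolding conn_def by (rule rtrancl_trans)

lemma conn_base: "(x, y) \<in> P ==> (x, y) \<in> conn P"
 unfolding conn_def by blast

lemma pmin_cong: "(x, y) \<in> conn P ==> pmin P x = pmin P y"
 unfolding pmin_def using conn_sym conn_trans by (intro arg_cong[of _ _ Min]) blast

context skew_shape
begin

lemma poset_iff:
 assumes t: "labeling t" and ab: "a \<in> D" "b \<in> D"
 shows "(entry t a, entry t b) \<in> tab_poset t \<longleftrightarrow> nw a b"
proof -
 have sh: "shape t = sk" using t by (simp add: labeling_def)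
 show ?thesis unfolding tab_poset_eq[OF sh] using ab entry_inj[OF t] by blast
qed

lemma conn_imp_same_run:
 assumes t: "labeling t" and a: "a \<in> D" and c: "(entry t a, y) \<in> conn (tab_poset t)"
 shows "\<exists>b\<in>D. entry t b = y \<and> same_block links (fst a) (fst b)"
 using c unfolding conn_def
proof (induction rule: rtrancl_induct)
 case base
 thus ?case using a by auto
next
 case (step y z)
 obtain b where b: "b \<in> D" "entry t b = y" "same_block links (fst a) (fst b)" using step.IH by blast
 have "z \<in> {1..N}" using step.hyps(2) tab_poset_range[OF t] by blast
 then obtain c where c: "c \<in> D" "entry t c = z" by (rule label_cases[OF t])
 hence "nw b c \<or> nw c b" using step.hyps(2) poset_iff[OF t b(1) c(1)] poset_iff[OF t c(1) b(1)] b(2) by blast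
 hence "same_block links (fst b) (fst c)"
  using b(1) c(1) nw_same_run[of b c] nw_same_run[of c b] same_block_sym by blast
 thus ?case using c b same_block_trans by blast
qed

lemma same_row_conn:
 assumes t: "labeling t" and ab: "a \<in> D" "b \<in> D" "fst a = fst b"
 shows "(entry t a, entry t b) \<in> conn (tab_poset t)"
proof -
 have "nw a b \<or> nw b a" using ab(3) by (auto simp: nw_def)
 thus ?thesis
 proof
  assume "nw a b"
  thus ?thesis using poset_iff[OF t ab(1,2)] by (intro conn_base) blast
 next
  assume "nw b a"
  hence "(entry t b, entry t a) \<in> conn (tab_poset t)" using poset_iff[OF t ab(2,1)] by (intro conn_base) blast
  thus ?thesis by (rule conn_sym)
 qed
qed

lemma same_run_conn:
 assumes t: "labeling t" and ab: "a \<in> D" "b \<in> D" "same_block links (fst a) (fst b)"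
 shows "(entry t a, entry t b) \<in> conn (tab_poset t)"
proof -
 have main: "(entry t a, entry t b) \<in> conn (tab_poset t)"
  if "a \<in> D" "b \<in> D" "fst a \<le> fst b" "{fst a..<fst b} \<subseteq> links" for a b
  using that
 proof (induction "fst b - fst a" arbitrary: a)
  case 0
  thus ?case using same_row_conn[OF t] by simp
 next
  case (Suc d)
  hence lt: "fst a < fst b" by simp
  hence "fst a \<in> links" using Suc.prems by auto
  then obtain j where j: "(fst a, j) \<in> D" "(Suc (fst a), j) \<in> D" by (auto simp: links_def)
  have "(entry t a, entry t (fst a, j)) \<in> conn (tab_poset t)" by (rule same_row_conn[OF t]) (use Suc.prems j in auto)
  moreover have "(entry t (fst a, j), entry t (Suc (fst a), j)) \<in> conn (tab_poset t)"
   using poset_iff[OF t j] by (intro conn_base) (simp add: nw_def)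
  moreover have "(entry t (Suc (fst a), j), entry t b) \<in> conn (tab_poset t)"
   by (rule Suc.hyps(1)) (use Suc lt j in auto)
  ultimately show ?case using conn_trans by blast
 qed
 show ?thesis
 proof (cases "fst a \<le> fst b")
  case True
  thus ?thesis using main ab same_block_less[OF True] by blast
 next
  case False
  hence "fst b \<le> fst a" by simp
  thus ?thesis using main[of b a] ab same_block_less[of "fst b" "fst a"] same_block_sym conn_sym by blast
 qed
qed

lemma conn_iff:
 assumes t: "labeling t" and ab: "a \<in> D" "b \<in> D"
 shows "(entry t a, entry t b) \<in> conn (tab_poset t) \<longleftrightarrow> same_block links (fst a) (fst b)"
 using conn_imp_same_run[OF t ab(1)] same_run_conn[OF t ab] entry_inj[OF t _ ab(2)] by blast

lemma pmin_eq:
 assumes t: "labeling t" and a: "a \<in> D"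
 shows "pmin (tab_poset t) (entry t a) = Min (entry t ` {c \<in> D. same_block links (fst a) (fst c)})"
proof -
 have "{y. (entry t a, y) \<in> conn (tab_poset t)} = entry t ` {c \<in> D. same_block links (fst a) (fst c)}"
  using conn_imp_same_run[OF t a] same_run_conn[OF t a] by blast
 thus ?thesis unfolding pmin_def by simp
qed

lemma pmin_attained:
 assumes t: "labeling t" and a: "a \<in> D"
 obtains c where "c \<in> D" "entry t c = pmin (tab_poset t) (entry t a)" "same_block links (fst a) (fst c)"
proof -
 have "Min (entry t ` {c \<in> D. same_block links (fst a) (fst c)}) \<in> entry t ` {c \<in> D. same_block links (fst a) (fst c)}"
 proof (rule Min_in)
  have "a \<in> {c \<in> D. same_block links (fst a) (fst c)}" using a by simp
  thus "entry t ` {c \<in> D. same_block links (fst a) (fst c)} \<noteq> {}" by blast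
 qed simp
 then obtain c where "c \<in> D" "same_block links (fst a) (fst c)"
  "Min (entry t ` {c \<in> D. same_block links (fst a) (fst c)}) = entry t c" by blast
 thus thesis using that[of c] unfolding pmin_eq[OF t a] by metis
qed

lemma pmin_le:
 assumes t: "labeling t" and a: "a \<in> D" "c \<in> D" "same_block links (fst a) (fst c)"
 shows "pmin (tab_poset t) (entry t a) \<le> entry t c"
 unfolding pmin_eq[OF t a(1)] by (rule Min_le) (use a in auto)

lemma pmin_eq_iff:
 assumes t: "labeling t" and ab: "a \<in> D" "b \<in> D"
 shows "pmin (tab_poset t) (entry t a) = pmin (tab_poset t) (entry t b) \<longleftrightarrow> same_block links (fst a) (fst b)"
proof
 assume e: "pmin (tab_poset t) (entry t a) = pmin (tab_poset t) (entry t b)"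
 obtain c where c: "c \<in> D" "entry t c = pmin (tab_poset t) (entry t a)" "same_block links (fst a) (fst c)"
  by (rule pmin_attained[OF t ab(1)])
 obtain d where d: "d \<in> D" "entry t d = pmin (tab_poset t) (entry t b)" "same_block links (fst b) (fst d)"
  by (rule pmin_attained[OF t ab(2)])
 have "c = d" using entry_inj[OF t c(1) d(1)] c d e by simp
 thus "same_block links (fst a) (fst b)" using c(3) d(3) same_block_sym same_block_trans by blast
qed (use pmin_cong same_run_conn[OF t ab] in blast)

text \<open>The condition on component minima that selects \<open>\<tau>\<^sub>P\<close>, freed from the list of components.\<close>

definition ordered :: "tableau => bool" where
 "ordered t \<longleftrightarrow> (\<forall>a\<in>D. \<forall>b\<in>D. fst a < fst b --> \<not> same_block links (fst a) (fst b) -->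
   pmin (tab_poset t) (entry t a) < pmin (tab_poset t) (entry t b))"

lemma sorted_component_mins:
 assumes t: "labeling t"
 shows "sorted_wrt (<) (component_mins t) \<longleftrightarrow> ordered t"
proof -
 have sh: "shape t = sk" using t by (simp add: labeling_def)
 let ?L = "\<lambda>i i'. \<exists>j. (i, j) \<in> D \<and> (i', j) \<in> D"
 let ?bs = "maximal_runs ?L [1..<Suc nrows]"
 have I: "{i. ?L i (Suc i)} = links" by (simp add: links_def)
 note sb = maximal_runs_blocks(1)[of _ ?L 1 "Suc nrows", unfolded I]
 have W: "\<forall>i j. i < j --> j < length ?bs -->
   (\<forall>u\<in>set (?bs ! i). \<forall>v\<in>set (?bs ! j). u < v \<and> \<not> same_block links u v)"
  using maximal_runs_blocks(2)[of ?L 1 "Suc nrows", unfolded I] unfolding sorted_wrt_iff_nth_less .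
 have W': "u < v \<and> \<not> same_block links u v"
  if "i < j" "j < length ?bs" "u \<in> set (?bs ! i)" "v \<in> set (?bs ! j)" for i j u v
  using W that by blast
 have sb': "same_block links u v" if "i < length ?bs" "u \<in> set (?bs ! i)" "v \<in> set (?bs ! i)" for i u v
  using sb[OF nth_mem[OF that(1)] that(2,3)] .
 have all: "\<exists>i<length ?bs. u \<in> set (?bs ! i)" if "u \<in> {1..nrows}" for u
 proof -
  have "u \<in> set (concat ?bs)" unfolding concat_maximal_runs using that by auto
  then obtain r where "r \<in> set ?bs" "u \<in> set r" unfolding set_concat by blast
  thus ?thesis unfolding in_set_conv_nth[of r] by blast
 qed
 have rng: "u \<in> {1..nrows}" if "i < length ?bs" "u \<in> set (?bs ! i)" for i u
 proof -
  have "u \<in> set (concat ?bs)" unfolding set_concat using that(2) nth_mem[OF that(1)] by blast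
  thus ?thesis unfolding concat_maximal_runs by (simp only: set_upt) simp
 qed
 let ?F = "\<lambda>rs. Min (entry t ` {b \<in> D. fst b \<in> set rs})"
 have F: "?F (?bs ! i) = pmin (tab_poset t) (entry t a)"
  if i: "i < length ?bs" and a: "a \<in> D" "fst a \<in> set (?bs ! i)" for i a
 proof -
  have "fst b \<in> set (?bs ! i) \<longleftrightarrow> same_block links (fst a) (fst b)" if b: "b \<in> D" for b
  proof
   assume s: "same_block links (fst a) (fst b)"
   have "fst b \<in> {1..nrows}" using D_bounds[OF b] by simp
   then obtain j where j: "j < length ?bs" "fst b \<in> set (?bs ! j)" using all by blast
   have "\<not> i < j" using W'[of i j "fst a" "fst b"] a j s by blast
   moreover have "\<not> j < i" using W'[of j i "fst b" "fst a"] a i j same_block_sym[OF s] by blast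
   ultimately have "i = j" by simp
   thus "fst b \<in> set (?bs ! i)" using j by simp
  qed (use sb'[OF i a(2)] in blast)
  hence "{b \<in> D. fst b \<in> set (?bs ! i)} = {c \<in> D. same_block links (fst a) (fst c)}" by blast
  thus ?thesis unfolding pmin_eq[OF t a(1)] by simp
 qed
 have cm: "component_mins t = map ?F ?bs" unfolding component_mins_def components_def sh ..
 show ?thesis
 proof
  assume s: "sorted_wrt (<) (component_mins t)"
  show "ordered t"
   unfolding ordered_def
  proof (intro ballI impI)
   fix a b assume ab: "a \<in> D" "b \<in> D" "fst a < fst b" "\<not> same_block links (fst a) (fst b)"
   obtain i where i: "i < length ?bs" "fst a \<in> set (?bs ! i)" using all[of "fst a"] D_bounds[OF ab(1)] by auto
   obtain j where j: "j < length ?bs" "fst b \<in> set (?bs ! j)" using all[of "fst b"] D_bounds[OF ab(2)] by auto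
   have "i \<noteq> j" using sb'[OF i(1,2), of "fst b"] j ab(4) by blast
   moreover have "\<not> j < i" using W'[of j i "fst b" "fst a"] i j ab(3) by auto
   ultimately have "i < j" by simp
   hence "?F (?bs ! i) < ?F (?bs ! j)" using s j unfolding cm sorted_wrt_iff_nth_less by simp
   thus "pmin (tab_poset t) (entry t a) < pmin (tab_poset t) (entry t b)"
    using F[OF i(1) ab(1) i(2)] F[OF j(1) ab(2) j(2)] by simp
  qed
 next
  assume o: "ordered t"
  have "?F (?bs ! i) < ?F (?bs ! j)" if ij: "i < j" "j < length ?bs" for i j
  proof -
   have il: "i < length ?bs" using ij by simp
   have ne: "\<exists>u. u \<in> set r" if "r \<in> set ?bs" for r
    using maximal_runs_nonempty[of ?L "[1..<Suc nrows]"] that by (cases r) auto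
   obtain u where u: "u \<in> set (?bs ! i)" using ne[OF nth_mem[OF il]] by blast
   obtain v where v: "v \<in> set (?bs ! j)" using ne[OF nth_mem[OF ij(2)]] by blast
   note uv = u v
   obtain a where a: "a \<in> D" "fst a = u" using rng[OF il uv(1)] fst_D by (metis imageE)
   obtain b where b: "b \<in> D" "fst b = v" using rng[OF ij(2) uv(2)] fst_D by (metis imageE)
   have "pmin (tab_poset t) (entry t a) < pmin (tab_poset t) (entry t b)"
    using o a b W'[OF ij uv] unfolding ordered_def by blast
   thus ?thesis using F[OF il a(1)] F[OF ij(2) b(1)] uv a b by simp
  qed
  thus "sorted_wrt (<) (component_mins t)" unfolding cm sorted_wrt_iff_nth_less by simp
 qed
qed

definition schur :: "(nat \<times> nat => nat) => bool" where
 "schur f \<longleftrightarrow> (\<forall>i j j'. (i, j) \<in> D --> (i, j') \<in> D --> j < j' --> f (i, j') < f (i, j)) \<and>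
  (\<forall>i i' j. (i, j) \<in> D --> (i', j) \<in> D --> i < i' --> f (i, j) < f (i', j))"

lemma schur_labeling_iff: "schur_labeling N t \<and> shape t = sk \<longleftrightarrow> labeling t \<and> schur (entry t)"
 unfolding schur_labeling_def labeling_iff schur_def rows_decrease_def columns_increase_def by auto

lemma distinguished_schur: "distinguished f ==> schur f"
 unfolding distinguished_def schur_def by fastforce

text \<open>Components appear from the north-east to the south-west, so all labels of an earlier one are smaller.\<close>

lemma distinguished_ordered:
 assumes t: "labeling t" and d: "distinguished (entry t)"
 shows "ordered t"
 unfolding ordered_def
proof (intro ballI impI)
 fix a b assume ab: "a \<in> D" "b \<in> D" "fst a < fst b" "\<not> same_block links (fst a) (fst b)"
 obtain c where c: "c \<in> D" "entry t c = pmin (tab_poset t) (entry t b)" "same_block links (fst b) (fst c)"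
  by (rule pmin_attained[OF t ab(2)])
 have ac: "\<not> same_block links (fst a) (fst c)" using ab(4) c(3) same_block_sym same_block_trans by blast
 have "fst a < fst c"
 proof (rule ccontr)
  assume "\<not> fst a < fst c"
  hence le: "fst c \<le> fst a" by simp
  have "{fst c..<fst b} \<subseteq> links" using same_block_sym[OF c(3)] same_block_less[of "fst c" "fst b" links] le ab(3) by simp
  hence "{fst c..<fst a} \<subseteq> links" using ab(3) by auto
  thus False using ac same_block_sym same_block_less[OF le, of links] by blast
 qed
 hence "entry t a < entry t c" using d ab(1) c(1) not_same_run_left[OF ab(1) c(1) _ ac] unfolding distinguished_def
  by (metis less_imp_le nat_less_le)
 moreover have "pmin (tab_poset t) (entry t a) \<le> entry t a" by (rule pmin_le[OF t]) (use ab in auto)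
 ultimately show "pmin (tab_poset t) (entry t a) < pmin (tab_poset t) (entry t b)" using c(2) by simp
qed

end

section \<open>Regular posets have distinguished labelings\<close>

text \<open>A component is connected by comparabilities, and regularity forbids one of them to jump over a label
 of another component.\<close>

lemma regular_conn_interval:
 assumes reg: "\<And>x y z. (x, z) \<in> P ==> x < y \<and> y < z \<or> z < y \<and> y < x ==> (x, y) \<in> P \<or> (y, z) \<in> P"
  and y: "(x, y) \<notin> conn P" and z: "(x, z) \<in> conn P"
 shows "x < y \<longleftrightarrow> z < y"
 using z unfolding conn_def
proof (induction rule: rtrancl_induct)
 case (step u v)
 have uv: "(u, v) \<in> conn P" "(x, u) \<in> conn P" using step.hyps unfolding conn_def by (blast, blast)
 hence xv: "(x, v) \<in> conn P" using conn_trans by blast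
 have ne: "u \<noteq> y" "v \<noteq> y" using y uv(2) xv by auto
 have "\<not> (u < y \<and> y < v)" "\<not> (v < y \<and> y < u)"
 proof -
  have no: "(u, y) \<notin> P" "(y, u) \<notin> P" "(v, y) \<notin> P" "(y, v) \<notin> P"
   using y uv(2) xv conn_base conn_sym conn_trans by meson+
  consider "(u, v) \<in> P" | "(v, u) \<in> P" using step.hyps(2) by blast
  hence "\<not> (u < y \<and> y < v) \<and> \<not> (v < y \<and> y < u)"
  proof cases
   case 1
   thus ?thesis using reg[of u v y] no by blast
  next
   case 2
   thus ?thesis using reg[of v u y] no by blast
  qed
  thus "\<not> (u < y \<and> y < v)" "\<not> (v < y \<and> y < u)" by blast+
 qed
 thus ?case using step.IH ne by linarith
qed simp

context skew_shape
begin

text \<open>Inside a component one reaches every box to the south-west by steps down and to the left, along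
 which the labels of a Schur labeling increase.  Different components occupy disjoint intervals of
 labels by regularity, in the order of their minima.\<close>

lemma regular_distinguished:
 assumes t: "labeling t" and s: "schur (entry t)" and o: "ordered t"
  and reg: "\<And>x y z. (x, z) \<in> tab_poset t ==> x < y \<and> y < z \<or> z < y \<and> y < x ==>
   (x, y) \<in> tab_poset t \<or> (y, z) \<in> tab_poset t"
 shows "distinguished (entry t)"
proof -
 let ?f = "entry t"
 have within: "?f a < ?f b"
  if "a \<in> D" "b \<in> D" "fst a \<le> fst b" "snd b \<le> snd a" "a \<noteq> b" "{fst a..<fst b} \<subseteq> links" for a b
  using that
 proof (induction "fst b - fst a + (snd a - snd b)" arbitrary: a rule: less_induct)
  case less
  obtain i j k l where e: "a = (i, j)" "b = (k, l)" by (cases a, cases b) auto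
  note p = less.prems[unfolded e fst_conv snd_conv]
  show ?case
  proof (cases "i = k")
   case True
   hence "l < j" using p(4,5) by auto
   thus ?thesis using s p(1,2) True unfolding schur_def e by blast
  next
   case False
   hence ik: "i < k" using p(3) by simp
   have step: "?f a < ?f b" if c: "c \<in> D" "?f a < ?f c" "fst c \<le> k" "l \<le> snd c" "i \<le> fst c"
    "k - fst c + (snd c - l) < k - i + (j - l)" for c
   proof (cases "c = b")
    case False
    have "?f c < ?f b"
    proof (rule less.hyps)
     show "{fst c..<fst b} \<subseteq> links" using p(6) c(5) unfolding e fst_conv by auto
    qed (use c False p e in auto)
    thus ?thesis using c(2) by simp
   qed (use c in simp)
   show ?thesis
   proof (cases "(Suc i, j) \<in> D")
    case True
    hence "?f a < ?f (Suc i, j)" using s p(1) unfolding schur_def e by blast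
    thus ?thesis using step[OF True] ik p(4) by simp
   next
    case no: False
    have "i \<in> links" using p(6) ik by auto
    then obtain j0 where j0: "(i, j0) \<in> D" "(Suc i, j0) \<in> D" by (auto simp: links_def)
    have "\<not> j \<le> j0"
    proof
     assume "j \<le> j0"
     hence "nw (i, j) (Suc i, j)" "nw (Suc i, j) (Suc i, j0)" by (auto simp: nw_def)
     thus False using rect[OF p(1) j0(2)] no by blast
    qed
    hence "nw (i, j0) (i, j - 1)" "nw (i, j - 1) (i, j)" and j1: "j - 1 < j" by (auto simp: nw_def)
    hence d: "(i, j - 1) \<in> D" using rect[OF j0(1) p(1)] by blast
    have "l \<noteq> j"
    proof
     assume "l = j"
     hence "nw (i, j) (Suc i, j)" "nw (Suc i, j) (k, l)" using ik by (auto simp: nw_def)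
     thus False using rect[OF p(1,2)] no by blast
    qed
    hence l: "l \<le> j - 1" using p(4) by simp
    have "?f a < ?f (i, j - 1)" using s p(1) d j1 unfolding schur_def e by blast
    thus ?thesis by (rule step[OF d]) (use ik l j1 in auto)
   qed
  qed
 qed
 show ?thesis
  unfolding distinguished_def
 proof (intro ballI impI)
  fix a b assume ab: "a \<in> D" "b \<in> D" "fst a \<le> fst b" "snd b \<le> snd a" "a \<noteq> b"
  show "?f a < ?f b"
  proof (cases "same_block links (fst a) (fst b)")
   case True
   thus ?thesis using within[OF ab] same_block_less[OF ab(3)] by blast
  next
   case False
   hence "fst a \<noteq> fst b" by (metis same_block_refl)
   hence lt: "pmin (tab_poset t) (?f a) < pmin (tab_poset t) (?f b)"
    using o ab(1-3) False unfolding ordered_def by simp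
   have nc: "(?f a, ?f b) \<notin> conn (tab_poset t)" using conn_iff[OF t ab(1,2)] False by blast
   obtain c where c: "c \<in> D" "?f c = pmin (tab_poset t) (?f a)" "same_block links (fst a) (fst c)"
    by (rule pmin_attained[OF t ab(1)])
   have "(?f a, ?f c) \<in> conn (tab_poset t)" using conn_iff[OF t ab(1) c(1)] c(3) by blast
   hence "?f a < ?f b \<longleftrightarrow> ?f c < ?f b" using regular_conn_interval[OF reg nc] by blast
   moreover have "pmin (tab_poset t) (?f b) \<le> ?f b" by (rule pmin_le[OF t ab(2) ab(2)]) simp
   ultimately show ?thesis using lt c(2) by simp
  qed
 qed
qed

end

section \<open>A poset determines its ordered Schur labeling\<close>

lemma rank_function_unique:
 fixes f g :: "'a => nat"
 assumes f: "f ` A = {1..r}" and g: "g ` A = {1..r'}"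
  and iff: "\<And>x y. x \<in> A ==> y \<in> A ==> f x < f y \<longleftrightarrow> g x < g y"
 shows "x \<in> A ==> f x = g x"
proof (induction "f x" arbitrary: x rule: less_induct)
 case less
 have IH: "f y = g y" if "y \<in> A" "f y < f x" for y using less that by blast
 have bounds: "1 \<le> f x" "f x \<le> r" "1 \<le> g x" "g x \<le> r'" using f g less(2) by auto
 have "\<not> g x < f x"
 proof
  assume lt: "g x < f x"
  hence "g x \<in> f ` A" using f bounds by simp
  then obtain y where y: "y \<in> A" "f y = g x" by force
  hence "g y = g x" using IH[of y] lt by simp
  thus False using iff[OF y(1) less(2)] y lt by simp
 qed
 moreover have "\<not> f x < g x"
 proof
  assume lt: "f x < g x"
  hence "f x \<in> g ` A" using g bounds by simp
  then obtain z where z: "z \<in> A" "g z = f x" by force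
  hence "f z < f x" using iff[OF z(1) less(2)] lt by simp
  thus False using IH[OF z(1)] z(2) by simp
 qed
 ultimately show ?case by simp
qed

context skew_shape
begin

lemma adjacent_boxes:
 assumes ac: "a \<in> D" "c \<in> D" "nw a c" "a \<noteq> c"
  and no: "\<And>d. d \<in> D ==> nw a d ==> nw d c ==> d = a \<or> d = c"
 shows "c = (Suc (fst a), snd a) \<or> c = (fst a, Suc (snd a))"
proof -
 obtain i j k l where e: "a = (i, j)" "c = (k, l)" by (cases a, cases c) auto
 have le: "i \<le> k" "j \<le> l" "i < k \<or> j < l" using ac(3,4) e by (auto simp: nw_def)
 show ?thesis
 proof (cases "i < k")
  case True
  hence n: "nw a (Suc i, j)" "nw (Suc i, j) c" using le e by (auto simp: nw_def)
  have "(Suc i, j) \<in> D" by (rule rect[OF ac(1,2) n])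
  thus ?thesis using no[of "(Suc i, j)"] n e by auto
 next
  case False
  hence n: "nw a (i, Suc j)" "nw (i, Suc j) c" using le e by (auto simp: nw_def)
  have "(i, Suc j) \<in> D" by (rule rect[OF ac(1,2) n])
  thus ?thesis using no[of "(i, Suc j)"] n e by auto
 qed
qed

abbreviation "box t \<equiv> inv_into D (entry t)"

lemma box: assumes "labeling t" "x \<in> {1..N}" shows "box t x \<in> D" "entry t (box t x) = x"
proof -
 have "x \<in> entry t ` D" using assms by (auto simp: labeling_def bij_betw_def)
 thus "box t x \<in> D" "entry t (box t x) = x" by (auto intro: inv_into_into f_inv_into_f)
qed

lemma box_entry: "labeling t ==> a \<in> D ==> box t (entry t a) = a"
 by (auto simp: labeling_def bij_betw_def)

text \<open>A cover joins adjacent boxes, and the labels tell whether the step goes down or to the right.\<close>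

lemma cover_step:
 assumes t: "labeling t" and s: "schur (entry t)" and xz: "(x, z) \<in> tab_poset t" "x \<noteq> z"
  and no: "\<And>y. (x, y) \<in> tab_poset t ==> (y, z) \<in> tab_poset t ==> y = x \<or> y = z"
 shows "box t z = (if x < z then (Suc (fst (box t x)), snd (box t x)) else (fst (box t x), Suc (snd (box t x))))"
proof -
 have r: "x \<in> {1..N}" "z \<in> {1..N}" using tab_poset_range[OF t] xz by auto
 note bx = box[OF t r(1)] and bz = box[OF t r(2)]
 have n: "nw (box t x) (box t z)" using poset_iff[OF t bx(1) bz(1)] xz bx bz by simp
 have "box t z = (Suc (fst (box t x)), snd (box t x)) \<or> box t z = (fst (box t x), Suc (snd (box t x)))"
 proof (rule adjacent_boxes[OF bx(1) bz(1) n])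
  show "box t x \<noteq> box t z" using bx(2) bz(2) xz(2) by metis
  fix d assume d: "d \<in> D" "nw (box t x) d" "nw d (box t z)"
  hence "entry t d = x \<or> entry t d = z" using no[of "entry t d"] poset_iff[OF t] bx bz by metis
  thus "d = box t x \<or> d = box t z" using box_entry[OF t d(1)] by metis
 qed
 thus ?thesis
 proof
  assume e: "box t z = (Suc (fst (box t x)), snd (box t x))"
  have "entry t (fst (box t x), snd (box t x)) < entry t (Suc (fst (box t x)), snd (box t x))"
   using s bx(1) bz(1) e unfolding schur_def by (metis lessI prod.collapse)
  hence "x < z" using bx(2) bz(2) e by simp
  thus ?thesis using e by simp
 next
  assume e: "box t z = (fst (box t x), Suc (snd (box t x)))"
  have "entry t (fst (box t x), Suc (snd (box t x))) < entry t (fst (box t x), snd (box t x))"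
   using s bx(1) bz(1) e unfolding schur_def by (metis lessI prod.collapse)
  hence "z < x" using bx(2) bz(2) e by simp
  thus ?thesis using e by simp
 qed
qed

lemma cover_below:
 assumes t: "labeling t" and xy: "(x, y) \<in> tab_poset t" "x \<noteq> y"
 obtains z where "(x, z) \<in> tab_poset t" "(z, y) \<in> tab_poset t" "x \<noteq> z"
  "\<And>w. (x, w) \<in> tab_poset t ==> (w, z) \<in> tab_poset t ==> w = x \<or> w = z"
  "fst (box t y) - fst (box t z) + (snd (box t y) - snd (box t z)) <
   fst (box t y) - fst (box t x) + (snd (box t y) - snd (box t x))"
proof -
 have r: "x \<in> {1..N}" "y \<in> {1..N}" using tab_poset_range[OF t] xy by auto
 note bx = box[OF t r(1)] and bY = box[OF t r(2)]
 have n: "nw (box t x) (box t y)" using poset_iff[OF t bx(1) bY(1)] xy bx bY by simp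
 obtain i j k l where e: "box t x = (i, j)" "box t y = (k, l)" by (cases "box t x", cases "box t y") auto
 have ne: "(i, j) \<noteq> (k, l)" using bx(2) bY(2) xy(2) e by metis
 have le: "i \<le> k" "j \<le> l" using n e by (auto simp: nw_def)
 define c where "c = (if i < k then (Suc i, j) else (i, Suc j))"
 have cn: "nw (i, j) c" "nw c (k, l)" using le ne by (auto simp: nw_def c_def)
 have c: "c \<in> D" by (rule rect[OF bx(1) bY(1)]) (use cn e in auto)
 have between: "d = (i, j) \<or> d = c" if "nw (i, j) d" "nw d c" for d
  using that by (cases d) (auto simp: nw_def c_def split: if_splits)
 have cz: "box t (entry t c) = c" by (rule box_entry[OF t c])
 show thesis
 proof (rule that[of "entry t c"])
  show "(x, entry t c) \<in> tab_poset t" "(entry t c, y) \<in> tab_poset t"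
   using poset_iff[OF t bx(1) c] poset_iff[OF t c bY(1)] cn bx(2) bY(2) e by auto
  show "x \<noteq> entry t c" using cz e by (auto simp: c_def split: if_splits)
  show "w = x \<or> w = entry t c" if w: "(x, w) \<in> tab_poset t" "(w, entry t c) \<in> tab_poset t" for w
  proof -
   have wr: "w \<in> {1..N}" using tab_poset_range[OF t] w by auto
   note bw = box[OF t wr]
   have "nw (i, j) (box t w)" "nw (box t w) c"
    using w poset_iff[OF t bx(1) bw(1)] poset_iff[OF t bw(1) c] bx(2) bw(2) e by auto
   hence "box t w = box t x \<or> box t w = c" using between e by metis
   thus ?thesis using bw(2) bx(2) by metis
  qed
  show "fst (box t y) - fst (box t (entry t c)) + (snd (box t y) - snd (box t (entry t c))) <
   fst (box t y) - fst (box t x) + (snd (box t y) - snd (box t x))"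
   unfolding cz e using le ne by (auto simp: c_def)
 qed
qed

lemma row_less_iff:
 assumes t: "labeling t" and o: "ordered t" and xy: "x \<in> {1..N}" "y \<in> {1..N}" "(x, y) \<notin> conn (tab_poset t)"
 shows "fst (box t x) < fst (box t y) \<longleftrightarrow> pmin (tab_poset t) x < pmin (tab_poset t) y"
  and "snd (box t x) < snd (box t y) \<longleftrightarrow> pmin (tab_poset t) y < pmin (tab_poset t) x"
proof -
 note bx = box[OF t xy(1)] and bY = box[OF t xy(2)]
 have nb: "\<not> same_block links (fst (box t x)) (fst (box t y))" "\<not> same_block links (fst (box t y)) (fst (box t x))"
  using conn_iff[OF t bx(1) bY(1)] xy(3) bx(2) bY(2) same_block_sym by metis+
 hence "fst (box t x) \<noteq> fst (box t y)" by (metis same_block_refl)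
 then consider "fst (box t x) < fst (box t y)" | "fst (box t y) < fst (box t x)" by linarith
 hence "(fst (box t x) < fst (box t y) \<longleftrightarrow> pmin (tab_poset t) x < pmin (tab_poset t) y) \<and>
  (snd (box t x) < snd (box t y) \<longleftrightarrow> pmin (tab_poset t) y < pmin (tab_poset t) x)"
 proof cases
  case 1
  hence "pmin (tab_poset t) x < pmin (tab_poset t) y" using o nb bx bY unfolding ordered_def by metis
  thus ?thesis using 1 not_same_run_left[OF bx(1) bY(1) 1 nb(1)] by auto
 next
  case 2
  hence "pmin (tab_poset t) y < pmin (tab_poset t) x" using o nb bx bY unfolding ordered_def by metis
  thus ?thesis using 2 not_same_run_left[OF bY(1) bx(1) 2 nb(2)] by auto
 qed
 thus "fst (box t x) < fst (box t y) \<longleftrightarrow> pmin (tab_poset t) x < pmin (tab_poset t) y"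
  "snd (box t x) < snd (box t y) \<longleftrightarrow> pmin (tab_poset t) y < pmin (tab_poset t) x" by blast+
qed

end

text \<open>Rows are determined up to a constant on each component by the covers, and the components are
 ordered by their minima.  Two surjections onto initial segments that induce the same order are equal.\<close>

theorem ordered_schur_unique:
 assumes A: "skew_shape sk" and B: "skew_shape sk'"
  and t: "skew_shape.labeling sk t" "skew_shape.schur sk (entry t)" "skew_shape.ordered sk t"
  and t': "skew_shape.labeling sk' t'" "skew_shape.schur sk' (entry t')" "skew_shape.ordered sk' t'"
  and eq: "tab_poset t' = tab_poset t" "skew_size sk' = skew_size sk"
 shows "t' = t"
proof -
 interpret A: skew_shape sk by fact
 interpret B: skew_shape sk' by fact
 let ?P = "tab_poset t"
 let ?p = "A.box t" and ?q = "B.box t'"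
 have N: "B.N = A.N" by (rule eq(2))
 have diff: "int (fst (?q y)) - int (fst (?q x)) = int (fst (?p y)) - int (fst (?p x)) \<and>
   int (snd (?q y)) - int (snd (?q x)) = int (snd (?p y)) - int (snd (?p x))"
  if "(x, y) \<in> ?P" for x y
  using that
 proof (induction "fst (?p y) - fst (?p x) + (snd (?p y) - snd (?p x))" arbitrary: x rule: less_induct)
  case less
  show ?case
  proof (cases "x = y")
   case False
   obtain z where z: "(x, z) \<in> ?P" "(z, y) \<in> ?P" "x \<noteq> z"
    "\<And>w. (x, w) \<in> ?P ==> (w, z) \<in> ?P ==> w = x \<or> w = z"
    "fst (?p y) - fst (?p z) + (snd (?p y) - snd (?p z)) < fst (?p y) - fst (?p x) + (snd (?p y) - snd (?p x))"
    by (rule A.cover_below[OF t(1) less.prems False]) (rule that)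
   note IH = less.hyps[OF z(5,2)]
   have "?p z = (if x < z then (Suc (fst (?p x)), snd (?p x)) else (fst (?p x), Suc (snd (?p x))))"
    by (rule A.cover_step[OF t(1,2) z(1,3,4)])
   moreover have "?q z = (if x < z then (Suc (fst (?q x)), snd (?q x)) else (fst (?q x), Suc (snd (?q x))))"
    using B.cover_step[OF t'(1,2), of x z] z(1,3,4) unfolding eq(1) by blast
   ultimately show ?thesis using IH by (cases "x < z") auto
  qed simp
 qed
 have diff_conn: "int (fst (?q y)) - int (fst (?q x)) = int (fst (?p y)) - int (fst (?p x)) \<and>
   int (snd (?q y)) - int (snd (?q x)) = int (snd (?p y)) - int (snd (?p x))"
  if "(x, y) \<in> conn ?P" for x y
  using that unfolding conn_def
 proof (induction rule: rtrancl_induct)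
  case (step y z)
  then consider "(y, z) \<in> ?P" | "(z, y) \<in> ?P" by blast
  thus ?case
  proof cases
   case 1 thus ?thesis using diff[OF 1] step.IH by linarith
  next
   case 2 thus ?thesis using diff[OF 2] step.IH by linarith
  qed
 qed simp
 have order: "(fst (?p x) < fst (?p y) \<longleftrightarrow> fst (?q x) < fst (?q y)) \<and> (snd (?p x) < snd (?p y) \<longleftrightarrow> snd (?q x) < snd (?q y))"
  if xy: "x \<in> {1..A.N}" "y \<in> {1..A.N}" for x y
 proof (cases "(x, y) \<in> conn ?P")
  case True
  thus ?thesis using diff_conn[OF True] by linarith
 next
  case False
  thus ?thesis
   using A.row_less_iff[OF t(1,3) xy False] B.row_less_iff[OF t'(1,3), of x y] xy unfolding eq(1) N by simp
 qed
 have imA: "?p ` {1..A.N} = A.D"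
  using t(1) bij_betw_inv_into[of "entry t" A.D "{1..A.N}"] by (auto simp: A.labeling_def bij_betw_def)
 have imB: "?q ` {1..A.N} = B.D"
  using t'(1) bij_betw_inv_into[of "entry t'" B.D "{1..B.N}"] unfolding N by (auto simp: B.labeling_def bij_betw_def N)
 have im: "(fst o ?p) ` {1..A.N} = {1..A.nrows}" "(snd o ?p) ` {1..A.N} = {1..A.lam 1}"
  "(fst o ?q) ` {1..A.N} = {1..B.nrows}" "(snd o ?q) ` {1..A.N} = {1..B.lam 1}"
  unfolding image_comp[symmetric] imA imB A.fst_D A.snd_D B.fst_D B.snd_D by (rule refl)+
 have "(fst o ?p) x = (fst o ?q) x" if "x \<in> {1..A.N}" for x
  by (rule rank_function_unique[OF im(1,3) _ that]) (use order in simp)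
 moreover have "(snd o ?p) x = (snd o ?q) x" if "x \<in> {1..A.N}" for x
  by (rule rank_function_unique[OF im(2,4) _ that]) (use order in simp)
 ultimately have pq: "?p x = ?q x" if "x \<in> {1..A.N}" for x using that by (simp add: prod_eq_iff)
 hence "A.D = B.D" using imA imB by (metis image_cong)
 hence sk: "sk = sk'" by (rule diagram_inject[OF A.sp A.ba B.sp B.ba])
 have "entry t' a = entry t a" for a
 proof (cases "a \<in> A.D")
  case True
  have r: "entry t a \<in> {1..A.N}" by (rule A.entry_range[OF t(1) True])
  have "?q (entry t a) = a" using pq[OF r] A.box_entry[OF t(1) True] by simp
  thus ?thesis using B.box(2)[OF t'(1), of "entry t a"] r N by simp
 next
  case False
  have "entry t a = undefined" using t(1) False unfolding A.labeling_def extensional_def by blast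
  moreover have "entry t' a = undefined" using t'(1) False unfolding sk B.labeling_def extensional_def by blast
  ultimately show ?thesis by simp
 qed
 hence "entry t' = entry t" by blast
 moreover have "fst t' = fst t" using t(1) t'(1) sk unfolding A.labeling_def B.labeling_def shape_def by simp
 ultimately show ?thesis unfolding entry_def by (rule prod_eqI[rotated])
qed

section \<open>Existence of ordered Schur labelings\<close>

definition dense_rank :: "'a set => ('a => nat) => 'a => nat" where
 "dense_rank A f x = card {v \<in> f ` A. v \<le> f x}"

lemma dense_rank:
 assumes "finite A"
 shows "x \<in> A ==> y \<in> A ==> dense_rank A f x \<le> dense_rank A f y \<longleftrightarrow> f x \<le> f y"
  and "dense_rank A f ` A = {1..card (f ` A)}"
proof -
 have fin: "finite (f ` A)" using assms by simp
 note r = rank_total_order[of "f ` A" "(\<le>)", OF fin]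
 show "dense_rank A f x \<le> dense_rank A f y \<longleftrightarrow> f x \<le> f y" if "x \<in> A" "y \<in> A"
  unfolding dense_rank_def by (rule r(2)) (use that in auto)
 have "bij_betw (\<lambda>b. card {a \<in> f ` A. a \<le> b}) (f ` A) {1..card (f ` A)}" by (rule r(1)) auto
 thus "dense_rank A f ` A = {1..card (f ` A)}"
  unfolding bij_betw_def dense_rank_def image_image by blast
qed

lemma lex_key_le:
 fixes B :: nat
 assumes "x < B" "y < B"
 shows "m * B + x \<le> k * B + y \<longleftrightarrow> m < k \<or> m = k \<and> x \<le> y"
proof -
 have "m * B + x < k * B + y" if "m < k" "x < B" for m k x y
 proof -
  have "Suc m * B \<le> k * B" using that by (intro mult_right_mono) auto
  thus ?thesis using that(2) by simp
 qed
 from this[of m k x y] this[of k m y x] show ?thesis using assms by (cases m k rule: linorder_cases) auto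
qed

context skew_shape
begin

text \<open>Rearrange the components: sort rows by the minimum of the component and then by the old row, columns
 by the reversed minimum and then by the old column, and close the gaps by taking ranks.\<close>

theorem ordered_schur_exists:
 assumes t: "labeling t" and s: "schur (entry t)"
 obtains sk' t' where "skew_shape sk'" "skew_shape.labeling sk' t'" "skew_shape.schur sk' (entry t')"
  "skew_shape.ordered sk' t'" "tab_poset t' = tab_poset t" "skew_size sk' = N"
proof -
 define m where "m a = pmin (tab_poset t) (entry t a)" for a
 define B where "B = Suc (nrows + lam 1)"
 define kr where "kr a = m a * B + fst a" for a
 define kc where "kc a = (N - m a) * B + snd a" for a
 define q where "q a = (dense_rank D kr a, dense_rank D kc a)" for a
 have B: "fst a < B" "snd a < B" if "a \<in> D" for a using D_bounds[OF that] by (auto simp: B_def)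
 have m_iff: "m a = m b \<longleftrightarrow> same_block links (fst a) (fst b)" if "a \<in> D" "b \<in> D" for a b
  unfolding m_def by (rule pmin_eq_iff[OF t that])
 have mN: "m a \<le> N" if a: "a \<in> D" for a
 proof -
  have "m a \<le> entry t a" unfolding m_def by (rule pmin_le[OF t a a]) simp
  thus ?thesis using entry_range[OF t a] by simp
 qed
 have R: "fst (q a) \<le> fst (q b) \<longleftrightarrow> m a < m b \<or> m a = m b \<and> fst a \<le> fst b" if "a \<in> D" "b \<in> D" for a b
  unfolding q_def fst_conv dense_rank(1)[OF finite_D that] kr_def
  by (rule lex_key_le[OF B(1)[OF that(1)] B(1)[OF that(2)]])
 have C: "snd (q a) \<le> snd (q b) \<longleftrightarrow> m b < m a \<or> m a = m b \<and> snd a \<le> snd b" if "a \<in> D" "b \<in> D" for a b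
 proof -
  have "snd (q a) \<le> snd (q b) \<longleftrightarrow> N - m a < N - m b \<or> N - m a = N - m b \<and> snd a \<le> snd b"
   unfolding q_def snd_conv dense_rank(1)[OF finite_D that] kc_def
   by (rule lex_key_le[OF B(2)[OF that(1)] B(2)[OF that(2)]])
  thus ?thesis using mN[OF that(1)] mN[OF that(2)] by auto
 qed
 have m_nw: "m a = m b" if "a \<in> D" "b \<in> D" "nw a b" for a b
  using m_iff[OF that(1,2)] nw_same_run[OF that] by blast
 have nwq: "nw (q a) (q b) \<longleftrightarrow> nw a b" if "a \<in> D" "b \<in> D" for a b
  using R[OF that] C[OF that] m_nw[OF that] by (auto simp: nw_def)
 have inj: "inj_on q D"
 proof (rule inj_onI)
  fix a b assume ab: "a \<in> D" "b \<in> D" "q a = q b"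
  hence "nw (q a) (q b)" "nw (q b) (q a)" by (auto simp: nw_def)
  hence "nw a b" "nw b a" using nwq ab by blast+
  thus "a = b" by (auto simp: nw_def prod_eq_iff)
 qed
 let ?D = "q ` D"
 have rows: "fst ` ?D = {1..card (kr ` D)}" and cols: "snd ` ?D = {1..card (kc ` D)}"
  unfolding image_image q_def fst_conv snd_conv by (rule dense_rank(2)[OF finite_D])+
 have rc: "rect_closed ?D"
  unfolding rect_closed_def
 proof (intro ballI allI impI)
  fix a' b' c assume "a' \<in> ?D" "b' \<in> ?D" and n: "nw a' c" "nw c b'"
  then obtain a b where ab: "a \<in> D" "b \<in> D" "a' = q a" "b' = q b" by blast
  have nab: "nw a b" using n nwq[OF ab(1,2)] ab(3,4) by (auto simp: nw_def)
  have mab: "m a = m b" by (rule m_nw[OF ab(1,2) nab])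
  have "fst c \<in> fst ` ?D"
  proof -
   have "fst a' \<in> fst ` ?D" "fst b' \<in> fst ` ?D" using ab by auto
   thus ?thesis using n unfolding rows nw_def by auto
  qed
  then obtain x where x: "x \<in> D" "fst (q x) = fst c" by force
  have "snd c \<in> snd ` ?D"
  proof -
   have "snd a' \<in> snd ` ?D" "snd b' \<in> snd ` ?D" using ab by auto
   thus ?thesis using n unfolding cols nw_def by auto
  qed
  then obtain y where y: "y \<in> D" "snd (q y) = snd c" by force
  have x1: "m x = m a" "fst a \<le> fst x" "fst x \<le> fst b"
   using n R[OF ab(1) x(1)] R[OF x(1) ab(2)] x(2) ab(3,4) mab unfolding nw_def by auto
  have y1: "m y = m a" "snd a \<le> snd y" "snd y \<le> snd b"
   using n C[OF ab(1) y(1)] C[OF y(1) ab(2)] y(2) ab(3,4) mab unfolding nw_def by auto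
  let ?d = "(fst x, snd y)"
  have nd: "nw a ?d" "nw ?d b" using x1 y1 by (auto simp: nw_def)
  have d: "?d \<in> D" by (rule rect[OF ab(1,2) nd])
  have md: "m ?d = m a" using m_nw[OF ab(1) d nd(1)] by simp
  have "fst (q ?d) = fst c" using R[OF d x(1)] R[OF x(1) d] md x1 x(2) by simp
  moreover have "snd (q ?d) = snd c" using C[OF d y(1)] C[OF y(1) d] md y1 y(2) by simp
  ultimately have "c = q ?d" by (simp add: prod_eq_iff)
  thus "c \<in> ?D" using d by blast
 qed
 obtain sk' where sk': "skew_partition sk'" "basic sk'" "diagram sk' = ?D"
  by (rule rect_closed_is_diagram[OF _ rc rows cols]) (simp, rule that)
 interpret K: skew_shape sk' by unfold_locales (rule sk')+
 have size: "K.N = N" using K.card_D(1) card_D(1) card_image[OF inj] sk'(3) by simp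
 define t' where "t' = (sk', restrict (entry t o inv_into D q) ?D)"
 have e': "entry t' (q a) = entry t a" if "a \<in> D" for a
  using that inv_into_f_f[OF inj that] by (simp add: t'_def entry_def)
 have lab: "K.labeling t'"
  unfolding K.labeling_def size sk'(3)
 proof (intro conjI)
  show "shape t' = sk'" by (simp add: t'_def shape_def)
  show "entry t' \<in> extensional ?D" by (simp add: t'_def entry_def)
  have "bij_betw (inv_into D q) ?D D" by (rule bij_betw_inv_into) (simp add: bij_betw_def inj)
  hence "bij_betw (entry t o inv_into D q) ?D {1..N}"
   using t by (rule_tac bij_betw_trans) (auto simp: labeling_def)
  thus "bij_betw (entry t') ?D {1..N}" by (simp add: t'_def entry_def bij_betw_restrict_eq)
 qed
 have pos: "tab_poset t' = tab_poset t"
 proof -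
  have sh: "shape t = sk" "shape t' = sk'" using t lab by (auto simp: labeling_def K.labeling_def)
  have "tab_poset t' = {(entry t' (q a), entry t' (q b)) | a b. a \<in> D \<and> b \<in> D \<and> nw (q a) (q b)}"
   unfolding K.tab_poset_eq[OF sh(2)] sk'(3) by blast
  also have "\<dots> = {(entry t a, entry t b) | a b. a \<in> D \<and> b \<in> D \<and> nw a b}"
   using e' nwq by (intro Collect_cong) metis
  also have "\<dots> = tab_poset t" unfolding tab_poset_eq[OF sh(1)] ..
  finally show ?thesis .
 qed
 have sch: "K.schur (entry t')"
  unfolding K.schur_def sk'(3)
 proof (intro conjI allI impI)
  fix i j j' assume "(i, j) \<in> ?D" "(i, j') \<in> ?D" "j < j'"
  then obtain a b where ab: "a \<in> D" "b \<in> D" "q a = (i, j)" "q b = (i, j')" "j < j'" by (metis imageE)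
  have ra: "m a = m b" "fst a = fst b" using R[OF ab(1,2)] R[OF ab(2,1)] ab(3,4) by auto
  hence "snd a < snd b" using C[OF ab(2,1)] ab(3-5) by auto
  hence "entry t b < entry t a" using s ab(1,2) ra(2) unfolding schur_def by (metis prod.collapse)
  thus "entry t' (i, j') < entry t' (i, j)" using e'[OF ab(1)] e'[OF ab(2)] ab(3,4) by simp
 next
  fix i i' j assume "(i, j) \<in> ?D" "(i', j) \<in> ?D" "i < i'"
  then obtain a b where ab: "a \<in> D" "b \<in> D" "q a = (i, j)" "q b = (i', j)" "i < i'" by (metis imageE)
  have ra: "m a = m b" "snd a = snd b" using C[OF ab(1,2)] C[OF ab(2,1)] ab(3,4) by auto
  hence "fst a < fst b" using R[OF ab(2,1)] ab(3-5) by auto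
  hence "entry t a < entry t b" using s ab(1,2) ra(2) unfolding schur_def by (metis prod.collapse)
  thus "entry t' (i, j) < entry t' (i', j)" using e'[OF ab(1)] e'[OF ab(2)] ab(3,4) by simp
 qed
 have ord: "K.ordered t'"
  unfolding K.ordered_def pos sk'(3)
 proof (intro ballI impI)
  fix a' b' assume "a' \<in> ?D" "b' \<in> ?D" and lt: "fst a' < fst b'" and nb: "\<not> same_block K.links (fst a') (fst b')"
  then obtain a b where ab: "a \<in> D" "b \<in> D" "a' = q a" "b' = q b" by blast
  have abK: "a' \<in> K.D" "b' \<in> K.D" using ab sk'(3) by auto
  have "m a \<noteq> m b"
  proof
   assume "m a = m b"
   hence "(entry t' a', entry t' b') \<in> conn (tab_poset t')"
    using same_run_conn[OF t ab(1,2)] m_iff[OF ab(1,2)] e' ab pos by simp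
   thus False using K.conn_iff[OF lab abK] nb by blast
  qed
  hence "m a < m b" using R[OF ab(1,2)] lt ab(3,4) by auto
  thus "pmin (tab_poset t) (entry t' a') < pmin (tab_poset t) (entry t' b')"
   using e' ab unfolding m_def by simp
 qed
 show thesis by (rule that[OF K.skew_shape_axioms lab sch ord pos size])
qed

lemma tau_labeling:
 assumes t: "labeling t" "schur (entry t)" "ordered t"
 shows "tau N (tab_poset t) = t"
 unfolding tau_def
proof (rule the_equality)
 show "schur_labeling N t \<and> tab_poset t = tab_poset t \<and> sorted_wrt (<) (component_mins t)"
  using schur_labeling_iff[of t] t sorted_component_mins[OF t(1)] by blast
 fix T assume T: "schur_labeling N T \<and> tab_poset T = tab_poset t \<and> sorted_wrt (<) (component_mins T)"
 hence bt: "skew_partition (shape T)" "basic (shape T)" "skew_size (shape T) = N"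
  by (auto simp: schur_labeling_def bijective_tableau_def)
 interpret K: skew_shape "shape T" by unfold_locales (rule bt)+
 have KT: "K.labeling T" "K.schur (entry T)" using K.schur_labeling_iff[of T] T bt(3) by auto
 hence "K.ordered T" using K.sorted_component_mins T by blast
 thus "T = t"
  using ordered_schur_unique[OF skew_shape_axioms K.skew_shape_axioms t KT] T bt(3) by blast
qed

lemma tau_distinguished: "labeling t ==> distinguished (entry t) ==> tau N (tab_poset t) = t"
 using tau_labeling distinguished_schur distinguished_ordered by blast

end

theorem regular_poset_labeling:
 assumes "P \<in> RSP n" and sk: "sk = shape (tau n P)"
 shows "skew_shape sk" "skew_size sk = n" "skew_shape.labeling sk (tau n P)"
  "skew_shape.distinguished sk (entry (tau n P))" "tab_poset (tau n P) = P"
proof -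
 obtain T where T: "schur_labeling n T" "P = tab_poset T" using assms(1) by (auto simp: RSP_def SP_def)
 have bt: "skew_partition (shape T)" "basic (shape T)" "skew_size (shape T) = n"
  using T by (auto simp: schur_labeling_def bijective_tableau_def)
 interpret A: skew_shape "shape T" by unfold_locales (rule bt)+
 have AT: "A.labeling T" "A.schur (entry T)" using A.schur_labeling_iff[of T] T bt(3) by auto
 obtain sk' t' where t': "skew_shape sk'" "skew_shape.labeling sk' t'" "skew_shape.schur sk' (entry t')"
  "skew_shape.ordered sk' t'" "tab_poset t' = tab_poset T" "skew_size sk' = A.N"
  by (rule A.ordered_schur_exists[OF AT]) (rule that)
 interpret K: skew_shape sk' by fact
 have e: "tau n P = t'" using K.tau_labeling[OF t'(2-4)] t'(5,6) T(2) bt(3) by simp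
 have s: "sk = sk'" using t'(2) sk e by (simp add: K.labeling_def)
 have "(x, y) \<in> P \<or> (y, z) \<in> P" if "(x, z) \<in> P" "x < y \<and> y < z \<or> z < y \<and> y < x" for x y z
  using assms(1) that unfolding RSP_def regular_poset_def by blast
 hence "K.distinguished (entry t')"
  using K.regular_distinguished[OF t'(2-4)] t'(5) T(2) by simp
 thus "skew_shape sk" "skew_size sk = n" "skew_shape.labeling sk (tau n P)"
  "skew_shape.distinguished sk (entry (tau n P))" "tab_poset (tau n P) = P"
  unfolding e s using t' T(2) bt(3) by auto
qed

section \<open>The projective cover\<close>

text \<open>Lowering a permutation of the smaller set within the larger one stays in the smaller set, so the
 remaining basis vectors span a submodule.\<close>

lemma restrict_vec_epi:
 assumes S: "weakly_convex n S" and S0: "weakly_convex n S0" "S0 \<subseteq> S"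
  and down: "\<And>w i. w \<in> S0 ==> i \<in> Des_L n w ==> tr i o w \<in> S ==> tr i o w \<in> S0"
 shows "restrict_vec S0 \<in> module_epi (HA n) (perm_module n S) (perm_module n S0)"
proof -
 have sub: "S \<subseteq> perms n" "S0 \<subseteq> perms n" using S S0 by (simp_all add: weakly_convex_def)
 have h: "restrict_vec S0 \<in> module_hom (HA n) (perm_module n S) (perm_module n S0)"
 proof (rule hecke_module_homI[OF perm_module_action(1)[OF S] perm_module_action(1)[OF S0(1)]])
  fix i v assume i: "i \<in> {1..<n}" and v: "v \<in> carrier (perm_module n S)"
  show "restrict_vec S0 (hecke_gen n i \<odot>\<^bsub>perm_module n S\<^esub> v) = hecke_gen n i \<odot>\<^bsub>perm_module n S0\<^esub> restrict_vec S0 v"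
   unfolding perm_module_action(2)[OF S i] perm_module_action(2)[OF S0(1) i]
  proof
   fix w
   show "restrict_vec S0 (gen_act n S i v) w = gen_act n S0 i (restrict_vec S0 v) w"
   proof (cases "w \<in> S0 \<and> i \<in> Des_L n w")
    case True
    hence "tr i o w \<in> S \<longleftrightarrow> tr i o w \<in> S0" using down S0(2) by blast
    thus ?thesis
     unfolding restrict_vec_def gen_act_apply[OF sub(1) i] gen_act_apply[OF sub(2) i] using True S0(2) by auto
   next
    case False
    thus ?thesis unfolding restrict_vec_def gen_act_apply[OF sub(1) i] gen_act_apply[OF sub(2) i] by argo
   qed
  qed
 qed (auto simp: pm_simps restrict_vec_def perm_module_action(3)[OF S] perm_module_action(3)[OF S0(1)])
 have "v \<in> restrict_vec S0 ` carrier (perm_module n S)" if v: "v \<in> carrier (perm_module n S0)" for v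
 proof (rule image_eqI)
  show "v = restrict_vec S0 v" using v by (auto simp: pm_simps restrict_vec_def)
  show "v \<in> carrier (perm_module n S)" using v S0(2) by (auto simp: pm_simps)
 qed
 hence "restrict_vec S0 ` carrier (perm_module n S) = carrier (perm_module n S0)"
  using module_homD(1)[OF h] by blast
 thus ?thesis unfolding module_epi_def using h by blast
qed

context skew_shape
begin

sublocale Pr: descent_module N Jset Kset
 by unfold_locales (rule JK)+

lemma S0_convex: "weakly_convex N S0"
 by (rule weakly_convex_Sigma_L[OF tab_poset_range[OF tau0(1)]])

lemma S0_down:
 assumes w: "w \<in> S0" and i: "i \<in> Des_L N w" and s: "tr i o w \<in> SA"
 shows "tr i o w \<in> S0"
proof -
 have p: "w permutes {1..N}" "inversions N w \<subseteq> inversions N rho" using w S0_iff_inversions by blast+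
 have "inversions N (tr i o w) \<subseteq> inversions N w" using inversions_down(1)[OF p(1) i] by blast
 thus ?thesis using s p(2) unfolding S0_iff_inversions descent_set_def by blast
qed

lemma Upsilon_eq: "Upsilon N (alpha_proj sk) rho = restrict_vec S0"
 unfolding Upsilon_def restrict_vec_def interval_eq_S0 ..

lemma Upsilon_epi: "restrict_vec S0 \<in> module_epi (HA N) (P_module N (alpha_proj sk)) (M_module N (tab_poset (tau0 sk)))"
 unfolding P_module_eq M_module_def
 by (rule restrict_vec_epi[OF Pr.S_convex S0_convex S0_subset_SA S0_down])

text \<open>The first factor of \<open>\<eta>\<close> restricts vectors to reading words, the second is bijective; so the kernel
 consists of the vectors supported on the other permutations.\<close>

theorem eta_epi:
 assumes t: "labeling t" "distinguished (entry t)"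
 shows "eta_map N (tab_poset t) \<in> module_epi (HA N) (P_module N (alpha_proj sk)) (M_module N (tab_poset t))"
  and "v \<in> carrier (P_module N (alpha_proj sk)) ==> eta_map N (tab_poset t) v = \<zero>\<^bsub>M_module N (tab_poset t)\<^esub> ==>
   u \<in> S0 ==> v u = 0"
  and "a_kernel (P_module N (alpha_proj sk)) (M_module N (tab_poset t)) (eta_map N (tab_poset t))
   \<subseteq> module_rad (HA N) (P_module N (alpha_proj sk))"
proof -
 let ?Q = "tab_poset t" and ?P = "P_module N (alpha_proj sk)" and ?M0 = "M_module N (tab_poset (tau0 sk))"
 have tau: "tau N ?Q = t" by (rule tau_distinguished[OF t])
 have sh: "shape t = sk" using t(1) by (simp add: labeling_def)
 have eta: "eta_map N ?Q = f_map N ?Q o restrict_vec S0"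
  unfolding eta_map_def tau sh Let_def Upsilon_eq ..
 note f = f_map_iso[OF t tau refl]
 have r: "restrict_vec S0 \<in> module_hom (HA N) ?P ?M0" "restrict_vec S0 ` carrier ?P = carrier ?M0"
  using Upsilon_epi by (auto simp: module_epi_def)
 have "eta_map N ?Q ` carrier ?P = carrier (M_module N ?Q)"
  unfolding eta image_comp[symmetric] r(2) using f(2) by (simp add: bij_betw_def)
 moreover have "eta_map N ?Q \<in> module_hom (HA N) ?P (M_module N ?Q)"
  unfolding eta by (rule module_hom_comp[OF r(1) f(1)])
 ultimately show "eta_map N ?Q \<in> module_epi (HA N) ?P (M_module N ?Q)" by (simp add: module_epi_def)
 show z: "v u = 0" if vk: "v \<in> carrier ?P" "eta_map N ?Q v = \<zero>\<^bsub>M_module N ?Q\<^esub>" and u: "u \<in> S0" for v u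
 proof -
  have v: "v \<in> carrier ?P" "f_map N ?Q (restrict_vec S0 v) = (\<lambda>w. 0)"
   using vk unfolding eta by (auto simp: M_module_def pm_simps)
  have 0: "(\<lambda>w. 0) \<in> carrier ?M0" by (simp add: M_module_def pm_simps)
  have "f_map N ?Q (\<lambda>w. 0 + 0) = (\<lambda>w. f_map N ?Q (\<lambda>w. 0) w + f_map N ?Q (\<lambda>w. 0) w)"
   using module_homD(2)[OF f(1) 0 0] by (simp add: M_module_def pm_simps)
  hence "f_map N ?Q (\<lambda>w. 0) = (\<lambda>w. 0)" by (auto simp: fun_eq_iff)
  hence "restrict_vec S0 v = (\<lambda>w. 0)"
   using f(2) v module_homD(1)[OF r(1) v(1)] 0 unfolding bij_betw_def by (metis inj_onD)
  thus "v u = 0" using u unfolding restrict_vec_def by metis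
 qed
 show "a_kernel ?P (M_module N ?Q) (eta_map N ?Q) \<subseteq> module_rad (HA N) ?P"
 proof
  fix v assume "v \<in> a_kernel ?P (M_module N ?Q) (eta_map N ?Q)"
  hence v: "v \<in> carrier ?P" "eta_map N ?Q v = \<zero>\<^bsub>M_module N ?Q\<^esub>" unfolding a_kernel_def' by auto
  show "v \<in> module_rad (HA N) ?P"
   unfolding P_module_eq
   by (rule Pr.in_radical) (use v z[OF v] S0_if_within_blocks in \<open>auto simp: P_module_eq\<close>)
 qed
qed

lemma left_module_P: "left_module (HA N) (P_module N (alpha_proj sk))"
 unfolding P_module_eq by (rule perm_module_action(1)[OF Pr.S_convex])

lemma M_convex: "labeling t ==> weakly_convex N (Sigma_L N (tab_poset t))"
 by (rule weakly_convex_Sigma_L[OF tab_poset_range])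

lemma left_module_M: "labeling t ==> left_module (HA N) (M_module N (tab_poset t))"
 unfolding M_module_def by (rule perm_module_action(1)[OF M_convex])

theorem projective_cover_M:
 fixes TX :: "'x itself" and TY :: "'y itself"
 assumes t: "labeling t" "distinguished (entry t)"
 shows "projective_cover TX TY (HA N) (P_module N (alpha_proj sk)) (eta_map N (tab_poset t)) (M_module N (tab_poset t))"
 unfolding projective_cover_def
proof (intro conjI eta_epi(1,3)[OF t])
 show "finitely_generated_module (HA N) (M_module N (tab_poset t))"
  unfolding M_module_def by (rule finitely_generated_perm_module[OF M_convex[OF t(1)]])
 show "projective_module TX TY (HA N) (P_module N (alpha_proj sk))"
  unfolding P_module_eq by (rule exE[OF Pr.regular_retract_M]) (rule regular_retract_projective)
qed

end

section \<open>Homomorphisms under the twisted duality\<close>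

lemma twist_hom_hom:
 assumes M: "left_module (HA n) M" and N: "left_module (HA n) N"
  and f: "f \<in> module_hom (HA n) M N"
 shows "twist_hom M f \<in> module_hom (HA n) (twist_module n N) (twist_module n M)"
proof -
 interpret M: left_module "HA n" M by fact
 interpret N: left_module "HA n" N by fact
 note fD = module_homD[OF f]
 have sc: "f (hecke_scalar n c \<odot>\<^bsub>M\<^esub> x) = hecke_scalar n c \<odot>\<^bsub>N\<^esub> f x" if "x \<in> carrier M" for c x
  using fD(3)[OF scalar_closed that] .
 have scc: "hecke_scalar n c \<odot>\<^bsub>M\<^esub> x \<in> carrier M" if "x \<in> carrier M" for c x
  using M.lsmult_closed[OF scalar_closed that] .
 show ?thesis
 proof (rule module_homI)
  fix d assume "d \<in> carrier (twist_module n N)"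
  thus "twist_hom M f d \<in> carrier (twist_module n M)"
   using fD sc scc by (simp add: twist_module_simps twist_hom_def)
 next
  fix d \<epsilon>
  show "twist_hom M f (d \<oplus>\<^bsub>twist_module n N\<^esub> \<epsilon>) = twist_hom M f d \<oplus>\<^bsub>twist_module n M\<^esub> twist_hom M f \<epsilon>"
   using fD(1) by (auto simp: twist_module_simps twist_hom_def)
 next
  fix h d assume h: "h \<in> carrier (HA n)"
  have "hecke_theta_hat n h \<odot>\<^bsub>M\<^esub> x \<in> carrier M"
   "f (hecke_theta_hat n h \<odot>\<^bsub>M\<^esub> x) = hecke_theta_hat n h \<odot>\<^bsub>N\<^esub> f x" if "x \<in> carrier M" for x
   using M.lsmult_closed[OF theta_hat_closed[OF h] that] fD(3)[OF theta_hat_closed[OF h] that] by auto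
  thus "twist_hom M f (h \<odot>\<^bsub>twist_module n N\<^esub> d) = h \<odot>\<^bsub>twist_module n M\<^esub> twist_hom M f d"
   using fD(1) by (auto simp: twist_module_simps twist_hom_def)
 qed
qed

lemma twist_hom_inj:
 assumes f: "f \<in> module_epi R M N"
 shows "inj_on (twist_hom M f) (carrier (twist_module n N))"
proof (rule inj_onI)
 fix v \<epsilon> assume d: "v \<in> carrier (twist_module n N)" "\<epsilon> \<in> carrier (twist_module n N)"
  and e: "twist_hom M f v = twist_hom M f \<epsilon>"
 show "v = \<epsilon>"
 proof (rule extensionalityI[of _ "carrier N"])
  fix y assume "y \<in> carrier N"
  then obtain x where x: "x \<in> carrier M" "y = f x" using f by (auto simp: module_epi_def)
  thus "v y = \<epsilon> y" using fun_cong[OF e, of x] by (simp add: twist_hom_def)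
 qed (use d in \<open>simp_all add: twist_module_simps\<close>)
qed

lemma functional_factors_through_epi:
 assumes M: "left_module (HA n) M" and N: "left_module (HA n) N"
  and f: "f \<in> module_epi (HA n) M N" and d: "\<delta> \<in> carrier (twist_module n M)"
  and ker: "\<And>u. u \<in> carrier M ==> f u = \<zero>\<^bsub>N\<^esub> ==> \<delta> u = 0"
 shows "\<delta> \<in> twist_hom M f ` carrier (twist_module n N)"
proof -
 interpret M: hecke_module n M by (rule hecke_module.intro[OF M])
 interpret N: hecke_module n N by (rule hecke_module.intro[OF N])
 have fh: "f \<in> module_hom (HA n) M N" and fs: "f ` carrier M = carrier N" using f by (auto simp: module_epi_def)
 note fD = module_homD[OF fh]
 have dl: "\<delta> (x \<oplus>\<^bsub>M\<^esub> y) = \<delta> x + \<delta> y" "\<delta> (hecke_scalar n c \<odot>\<^bsub>M\<^esub> x) = c * \<delta> x"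
  if "x \<in> carrier M" "y \<in> carrier M" for x y c using d that by (auto simp: twist_module_simps)
 have sc: "hecke_scalar n c \<odot>\<^bsub>M\<^esub> x \<in> carrier M" "f (hecke_scalar n c \<odot>\<^bsub>M\<^esub> x) = hecke_scalar n c \<odot>\<^bsub>N\<^esub> f x"
  if "x \<in> carrier M" for c x
  using M.cscale_closed[OF that] fD(3)[OF scalar_closed that] by auto
 have wd: "\<delta> u = \<delta> u'" if u: "u \<in> carrier M" "u' \<in> carrier M" "f u = f u'" for u u'
 proof -
  let ?w = "u \<oplus>\<^bsub>M\<^esub> (hecke_scalar n (-1) \<odot>\<^bsub>M\<^esub> u')"
  have "f ?w = f u' \<oplus>\<^bsub>N\<^esub> (hecke_scalar n (-1) \<odot>\<^bsub>N\<^esub> f u')" using fD(2)[OF u(1) sc(1)[OF u(2)]] sc(2) u by simp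
  hence "f ?w = \<zero>\<^bsub>N\<^esub>" using N.cscale_minus[OF fD(1)[OF u(2)]] by simp
  hence "\<delta> ?w = 0" using ker[of ?w] u sc by simp
  thus ?thesis using dl(1)[OF u(1) sc(1)[OF u(2)]] dl(2)[OF u(2) u(2), of "-1"] by simp
 qed
 define p where "p y = (SOME u. u \<in> carrier M \<and> f u = y)" for y
 have p: "p y \<in> carrier M \<and> f (p y) = y" if "y \<in> carrier N" for y
 proof -
  have "y \<in> f ` carrier M" using fs that by simp
  hence "\<exists>u. u \<in> carrier M \<and> f u = y" by blast
  thus ?thesis unfolding p_def by (rule someI_ex)
 qed
 define \<epsilon> where "\<epsilon> = (\<lambda>y\<in>carrier N. \<delta> (p y))"
 have ef: "\<epsilon> (f u) = \<delta> u" if u: "u \<in> carrier M" for u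
  using wd[of "p (f u)" u] p[OF fD(1)[OF u]] fD(1)[OF u] u by (simp add: \<epsilon>_def)
 have "\<epsilon> \<in> carrier (twist_module n N)"
  unfolding twist_module_simps
 proof (intro CollectI conjI ballI allI)
  show "\<epsilon> \<in> extensional (carrier N)" by (simp add: \<epsilon>_def)
  fix y z assume "y \<in> carrier N" "z \<in> carrier N"
  then obtain u v where uv: "u \<in> carrier M" "v \<in> carrier M" "y = f u" "z = f v" using fs by blast
  have "\<epsilon> (f (u \<oplus>\<^bsub>M\<^esub> v)) = \<epsilon> (f u) + \<epsilon> (f v)" using ef dl(1) uv by simp
  thus "\<epsilon> (y \<oplus>\<^bsub>N\<^esub> z) = \<epsilon> y + \<epsilon> z" using fD(2) uv by simp
 next
  fix c y assume "y \<in> carrier N"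
  then obtain u where u: "u \<in> carrier M" "y = f u" using fs by blast
  have "\<epsilon> (f (hecke_scalar n c \<odot>\<^bsub>M\<^esub> u)) = c * \<epsilon> (f u)" 
   unfolding ef[OF sc(1)[OF u(1)]] ef[OF u(1)] by (rule dl(2)[OF u(1) u(1)])
  thus "\<epsilon> (hecke_scalar n c \<odot>\<^bsub>N\<^esub> y) = c * \<epsilon> y" unfolding u(2) sc(2)[OF u(1)] .
 qed
 moreover have "\<delta> = twist_hom M f \<epsilon>"
  by (rule extensionalityI[of _ "carrier M"]) (use d ef in \<open>simp_all add: twist_module_simps twist_hom_def\<close>)
 ultimately show ?thesis by blast
qed

lemma finsum_in_submodule:
 assumes M: "left_module R M" and W: "submodule W R M" and F: "finite F" "\<forall>K\<in>F. x K \<in> W"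
 shows "finsum M x F \<in> W"
proof -
 interpret M: left_module R M by fact
 note WD = M.submoduleD[OF W]
 show ?thesis using F
 proof (induction F rule: finite_induct)
  case empty
  thus ?case using WD(2) by simp
 next
  case (insert K F)
  hence "x \<in> F \<rightarrow> carrier M" "x K \<in> carrier M" using WD(1) by auto
  hence "finsum M x (insert K F) = x K \<oplus>\<^bsub>M\<^esub> finsum M x F" using insert.hyps by (intro M.M.finsum_insert) auto
  thus ?case using WD(3) insert by simp
 qed
qed

lemma submodule_image:
 assumes M: "left_module (HA n) M" and N: "left_module (HA n) N" and f: "f \<in> module_hom (HA n) M N"
 shows "submodule (f ` carrier M) (HA n) N"
proof -
 interpret M: hecke_module n M by (rule hecke_module.intro[OF M])
 interpret N: hecke_module n N by (rule hecke_module.intro[OF N])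
 note fD = module_homD[OF f]
 show ?thesis
 proof (rule N.submoduleI)
  show "f ` carrier M \<subseteq> carrier N" using fD(1) by blast
  have "f (hecke_scalar n 0 \<odot>\<^bsub>M\<^esub> \<zero>\<^bsub>M\<^esub>) = hecke_scalar n 0 \<odot>\<^bsub>N\<^esub> f \<zero>\<^bsub>M\<^esub>"
   by (rule fD(3)[OF scalar_closed M.M.zero_closed])
  hence "f \<zero>\<^bsub>M\<^esub> = \<zero>\<^bsub>N\<^esub>"
   using M.cscale_zero[OF M.M.zero_closed] N.cscale_zero[OF fD(1)[OF M.M.zero_closed]] by simp
  thus "\<zero>\<^bsub>N\<^esub> \<in> f ` carrier M" using M.M.zero_closed by (metis imageI)
  fix x y assume "x \<in> f ` carrier M" "y \<in> f ` carrier M"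
  then obtain u v where uv: "u \<in> carrier M" "v \<in> carrier M" "x = f u" "y = f v" by blast
  thus "x \<oplus>\<^bsub>N\<^esub> y \<in> f ` carrier M" using fD(2)[OF uv(1,2)] M.M.a_closed[OF uv(1,2)] by (metis imageI)
 next
  fix a x assume a: "a \<in> carrier (HA n)" and "x \<in> f ` carrier M"
  then obtain u where u: "u \<in> carrier M" "x = f u" by blast
  thus "a \<odot>\<^bsub>N\<^esub> x \<in> f ` carrier M" using fD(3)[OF a u(1)] M.lsmult_closed[OF a u(1)] by (metis imageI)
 qed
qed

text \<open>A simple submodule is spanned by the image of an eigenfunctional, and this vanishes on the kernel of
 \<open>f\<close> by assumption.\<close>

theorem socle_in_twist_image:
 assumes S: "weakly_convex n S" and S': "weakly_convex n S'" and N: "left_module (HA n) N"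
  and g: "g \<in> module_hom (HA n) (twist_module n (perm_module n S)) (perm_module n S')"
   "bij_betw g (carrier (twist_module n (perm_module n S))) (carrier (perm_module n S'))"
  and f: "f \<in> module_epi (HA n) (perm_module n S) N"
  and ker: "\<And>\<phi> u. eigenfunctional n S \<phi> ==> u \<in> carrier (perm_module n S) ==> f u = \<zero>\<^bsub>N\<^esub> ==> \<phi> u = 0"
 shows "module_soc (HA n) (perm_module n S') \<subseteq>
  (g o twist_hom (perm_module n S) f) ` carrier (twist_module n N)"
proof -
 let ?Q = "perm_module n S" and ?I = "perm_module n S'"
 let ?T = "twist_module n ?Q"
 let ?h = "g o twist_hom ?Q f"
 have Q: "left_module (HA n) ?Q" and I: "left_module (HA n) ?I"
  using perm_module_action(1) S S' by blast+
 have fh: "f \<in> module_hom (HA n) ?Q N" using f by (simp add: module_epi_def)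
 have h: "?h \<in> module_hom (HA n) (twist_module n N) ?I"
  by (rule module_hom_comp[OF twist_hom_hom[OF Q N fh] g(1)])
 let ?W = "?h ` carrier (twist_module n N)"
 have W: "submodule ?W (HA n) ?I" by (rule submodule_image[OF left_module_twist[OF N] I h])
 interpret I: left_module "HA n" ?I by (rule I)
 note WD = I.submoduleD[OF W]
 have irr: "L \<subseteq> ?W" if L: "irreducible_submodule L (HA n) ?I" for L
 proof -
  obtain v where v: "v \<in> L" "v \<noteq> (\<lambda>w. 0)" "\<And>x. x \<in> L ==> \<exists>c. x = (\<lambda>w. c * v w)"
   "\<And>i. i \<in> {1..<n} ==> gen_act n S' i v = v \<or> gen_act n S' i v = (\<lambda>w. 0)"
   by (rule irreducible_submodule_eigenvector[OF S' L]) (rule that)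
  have "submodule L (HA n) ?I" using L unfolding irreducible_submodule_def by blast
  hence "v \<in> carrier ?I" using v(1) I.submoduleD(1) by blast
  hence "v \<in> g ` carrier ?T" using bij_betw_imp_surj_on[OF g(2)] by simp
  then obtain z where d: "z \<in> carrier ?T" "g z = v" by blast
  interpret T: left_module "HA n" ?T by (rule left_module_twist[OF Q])
  have eig: "(\<forall>u\<in>carrier ?Q. z (gen_act n S i u) = z u) \<or> (\<forall>u\<in>carrier ?Q. z (gen_act n S i u) = 0)"
   if i: "i \<in> {1..<n}" for i
  proof -
   obtain \<epsilon> where e: "gen_act n S' i v = (\<lambda>w. \<epsilon> * v w)" "\<epsilon> = 1 \<or> \<epsilon> = 0"
    using v(4)[OF i] by (metis mult_1 mult_zero_left)
   have c: "hecke_gen n i \<odot>\<^bsub>?T\<^esub> z \<in> carrier ?T" "hecke_scalar n \<epsilon> \<odot>\<^bsub>?T\<^esub> z \<in> carrier ?T"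
    using T.lsmult_closed[OF hecke_gen_closed[OF i] d(1)] T.lsmult_closed[OF scalar_closed d(1)] by blast+
   have "g (hecke_gen n i \<odot>\<^bsub>?T\<^esub> z) = g (hecke_scalar n \<epsilon> \<odot>\<^bsub>?T\<^esub> z)"
    unfolding module_homD(3)[OF g(1) hecke_gen_closed[OF i] d(1)] module_homD(3)[OF g(1) scalar_closed d(1)] d(2)
     perm_module_action(2)[OF S' i] perm_module_action(3)[OF S'] e(1) ..
   hence "hecke_gen n i \<odot>\<^bsub>?T\<^esub> z = hecke_scalar n \<epsilon> \<odot>\<^bsub>?T\<^esub> z"
    using g(2) c unfolding bij_betw_def by (metis inj_onD)
   hence "z u - z (gen_act n S i u) = \<epsilon> * z u" if "u \<in> carrier ?Q" for u
    using twist_perm_gen[OF S d(1) i that] twist_perm_scalar[OF S d(1) that, of \<epsilon>] by simp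
   thus ?thesis using e(2) by auto
  qed
  have "eigenfunctional n S z"
   unfolding eigenfunctional_def using twist_perm_linear[OF S d(1)] eig by blast
  hence "z u = 0" if "u \<in> carrier ?Q" "f u = \<zero>\<^bsub>N\<^esub>" for u using ker that by blast
  hence "z \<in> twist_hom ?Q f ` carrier (twist_module n N)"
   by (rule functional_factors_through_epi[OF Q N f d(1)])
  hence vW: "v \<in> ?W" using d(2) unfolding image_comp[symmetric] by blast
  show "L \<subseteq> ?W"
  proof
   fix x assume "x \<in> L"
   then obtain c where "x = (\<lambda>w. c * v w)" using v(3) by blast
   thus "x \<in> ?W" using WD(4)[OF scalar_closed[of n c] vW] unfolding perm_module_action(3)[OF S'] by simp
  qed
 qed
 show ?thesis
 proof
  fix y assume "y \<in> module_soc (HA n) ?I"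
  then obtain F x where F: "y = finsum ?I x F" "finite F"
   "\<forall>K\<in>F. irreducible_submodule K (HA n) ?I \<and> x K \<in> K" unfolding module_soc_def by blast
  hence "\<forall>K\<in>F. x K \<in> ?W" using irr by blast
  thus "y \<in> ?W" unfolding F(1) by (rule finsum_in_submodule[OF I W F(2)])
 qed
qed

section \<open>The injective hull\<close>

lemma reflect_compl:
 fixes N :: nat
 assumes "K \<subseteq> {1..<N}"
 shows "{1..<N} - (\<lambda>z. N - z) ` ({1..<N} - K) = (\<lambda>z. N - z) ` K"
proof
 show "{1..<N} - (\<lambda>z. N - z) ` ({1..<N} - K) \<subseteq> (\<lambda>z. N - z) ` K"
 proof
  fix z assume z: "z \<in> {1..<N} - (\<lambda>z. N - z) ` ({1..<N} - K)"
  hence "N - z \<in> {1..<N}" "z = N - (N - z)" by auto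
  hence "N - z \<in> K" using z by blast
  thus "z \<in> (\<lambda>z. N - z) ` K" using \<open>z = N - (N - z)\<close> by blast
 qed
 show "(\<lambda>z. N - z) ` K \<subseteq> {1..<N} - (\<lambda>z. N - z) ` ({1..<N} - K)"
 proof
  fix w assume "w \<in> (\<lambda>z. N - z) ` K"
  then obtain z where z: "z \<in> K" "w = N - z" by blast
  have zr: "1 \<le> z" "z < N" using z(1) assms by auto
  have "w \<notin> (\<lambda>z. N - z) ` ({1..<N} - K)"
  proof
   assume "w \<in> (\<lambda>z. N - z) ` ({1..<N} - K)"
   then obtain y where y: "y \<in> {1..<N}" "y \<notin> K" "w = N - y" by blast
   hence "y = z" using z zr by auto
   thus False using y z by simp
  qed
  thus "w \<in> {1..<N} - (\<lambda>z. N - z) ` ({1..<N} - K)" using zr z by auto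
 qed
qed

text \<open>Reversing the positions reflects descents and turns them into ascents.\<close>

lemma descent_set_comp_longest_perm:
 assumes J: "J \<subseteq> {1..<n}" and K: "K \<subseteq> {1..<n}"
 shows "u \<in> descent_set n ((\<lambda>z. n - z) ` K) ((\<lambda>z. n - z) ` J) \<longleftrightarrow> u o longest_perm n \<in> descent_set n J K"
proof -
 have sub: "(\<lambda>z. n - z) ` I \<subseteq> {1..<n}" if "I \<subseteq> {1..<n}" for I
 proof
  fix w assume "w \<in> (\<lambda>z. n - z) ` I"
  then obtain z where "z \<in> I" "w = n - z" by blast
  moreover have "1 \<le> z" "z < n" using \<open>z \<in> I\<close> that by auto
  ultimately show "w \<in> {1..<n}" by auto
 qed
 have p: "u permutes {1..n} \<longleftrightarrow> u o longest_perm n permutes {1..n}"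
  using comp_longest_perm_permutes[of u n] comp_longest_perm_permutes[of "u o longest_perm n" n]
  unfolding comp_longest_perm_twice by blast
 have w: "(u o longest_perm n) z = u (Suc (n - z))" "(u o longest_perm n) (Suc z) = u (n - z)"
  if "z \<in> {1..<n}" for z
  using that longest_perm(2)[of z n] longest_perm(2)[of "Suc z" n] by (auto simp: Suc_diff_le)
 have "(\<forall>j\<in>J. (u o longest_perm n) (Suc j) < (u o longest_perm n) j) \<longleftrightarrow> (\<forall>j\<in>J. u (n - j) < u (Suc (n - j)))"
 proof (rule ball_cong[OF refl])
  fix j assume "j \<in> J"
  hence "j \<in> {1..<n}" using J by blast
  from w[OF this] show "(u o longest_perm n) (Suc j) < (u o longest_perm n) j \<longleftrightarrow> u (n - j) < u (Suc (n - j))"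
   by (simp only:)
 qed
 hence "(\<forall>j\<in>J. (u o longest_perm n) (Suc j) < (u o longest_perm n) j) \<longleftrightarrow> (\<forall>k\<in>(\<lambda>z. n - z) ` J. u k < u (Suc k))"
  by (simp only: ball_simps)
 moreover have "(\<forall>k\<in>K. (u o longest_perm n) k < (u o longest_perm n) (Suc k)) \<longleftrightarrow> (\<forall>k\<in>K. u (Suc (n - k)) < u (n - k))"
 proof (rule ball_cong[OF refl])
  fix k assume "k \<in> K"
  hence "k \<in> {1..<n}" using K by blast
  from w[OF this] show "(u o longest_perm n) k < (u o longest_perm n) (Suc k) \<longleftrightarrow> u (Suc (n - k)) < u (n - k)"
   by (simp only:)
 qed
 hence "(\<forall>k\<in>K. (u o longest_perm n) k < (u o longest_perm n) (Suc k)) \<longleftrightarrow> (\<forall>j\<in>(\<lambda>z. n - z) ` K. u (Suc j) < u j)"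
  by (simp only: ball_simps)
 ultimately show ?thesis
  unfolding descent_set_iff[OF J K] descent_set_iff[OF sub[OF K] sub[OF J]] p by blast
qed

context skew_shape
begin

interpretation Tr: skew_shape "transpose_skew sk"
 rewrites "skew_size (transpose_skew sk) = skew_size sk"
 by (rule skew_shape_transpose) (rule skew_size_transpose)

text \<open>Transposing and reversing the column labeling gives the row labeling, as both visit the boxes in
 opposite orders.\<close>

lemma tau1_transpose:
 assumes "b \<in> D" shows "entry (tau1 (transpose_skew sk)) (prod.swap b) = Suc N - f0 b"
proof -
 let ?f1 = "\<lambda>b. entry (tau1 (transpose_skew sk)) (prod.swap b)"
 have sw: "prod.swap a \<in> Tr.D" if "a \<in> D" for a using that unfolding diagram_transpose by blast
 have r: "?f1 a \<in> {1..N}" if "a \<in> D" for a by (rule Tr.entry_range[OF Tr.tau1(1) sw[OF that]])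
 have "(\<lambda>b. Suc N - ?f1 b) b = f0 b"
 proof (rule rank_function_unique[of _ D N f0 N])
  have "entry (tau1 (transpose_skew sk)) ` Tr.D = {1..N}" using Tr.tau1(1) by (simp add: Tr.labeling_def bij_betw_def)
  hence im: "?f1 ` D = {1..N}" unfolding diagram_transpose image_image .
  have "(\<lambda>b. Suc N - ?f1 b) ` D = (\<lambda>k. Suc N - k) ` (?f1 ` D)" by (simp add: image_image)
  also have "\<dots> = {1..N}"
  proof
   show "{1..N} \<subseteq> (\<lambda>k. Suc N - k) ` (?f1 ` D)"
   proof
    fix k assume "k \<in> {1..N}"
    hence "Suc N - k \<in> {1..N}" "k = Suc N - (Suc N - k)" by auto
    thus "k \<in> (\<lambda>k. Suc N - k) ` (?f1 ` D)" unfolding im by blast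
   qed
  qed (unfold im, auto)
  finally show "(\<lambda>b. Suc N - ?f1 b) ` D = {1..N}" .
  show "f0 ` D = {1..N}" using tau0(1) by (simp add: labeling_def bij_betw_def)
  fix x y assume xy: "x \<in> D" "y \<in> D"
  have "?f1 x \<le> ?f1 y \<longleftrightarrow> f0 y \<le> f0 x"
   unfolding Tr.tau1(2)[OF sw[OF xy(1)] sw[OF xy(2)]] tau0(2)[OF xy(2,1)] by auto
  thus "Suc N - ?f1 x < Suc N - ?f1 y \<longleftrightarrow> f0 x < f0 y" using r[OF xy(1)] r[OF xy(2)] by auto
 qed (rule assms)
 thus ?thesis using r[OF assms] by auto
qed

lemma S0_iff_transpose: "w \<in> S0 \<longleftrightarrow> w o longest_perm N \<in> Sigma_L N (R_poset sk)"
proof -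
 have p: "w permutes {1..N} \<longleftrightarrow> w o longest_perm N permutes {1..N}"
  using comp_longest_perm_permutes[of w N] comp_longest_perm_permutes[of "w o longest_perm N" N]
  unfolding comp_longest_perm_twice by blast
 let ?h = "(w o longest_perm N) o entry (tau1 (transpose_skew sk))"
 have v: "?h (prod.swap b) = (w o f0) b" if b: "b \<in> D" for b
 proof -
  have r: "f0 b \<in> {1..N}" by (rule entry_range[OF tau0(1) b])
  hence "Suc N - f0 b \<in> {1..N}" "Suc N - (Suc N - f0 b) = f0 b" by auto
  thus ?thesis using tau1_transpose[OF b] longest_perm(2)[of "Suc N - f0 b" N] by simp
 qed
 have "Tr.standard ?h \<longleftrightarrow> (\<forall>a\<in>D. \<forall>b\<in>D. nw (prod.swap a) (prod.swap b) --> prod.swap a \<noteq> prod.swap b -->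
   ?h (prod.swap a) < ?h (prod.swap b))"
  unfolding Tr.standard_def diagram_transpose ball_simps ..
 also have "\<dots> \<longleftrightarrow> standard (w o f0)"
  unfolding standard_def using v by (simp add: nw_def conj_commute prod_eq_iff)
 finally show ?thesis unfolding R_poset_def Tr.Sigma_L_iff[OF Tr.tau1(1)] S0_iff p by blast
qed

lemma g1_iso:
 shows "g1_map N sk \<in> module_hom (HA N) (twist_module N (M_module N (R_poset sk))) (M_module N (tab_poset (tau0 sk)))"
  and "bij_betw (g1_map N sk) (carrier (twist_module N (M_module N (R_poset sk)))) (carrier (M_module N (tab_poset (tau0 sk))))"
proof -
 have c: "weakly_convex N (Sigma_L N (R_poset sk))" unfolding R_poset_def by (rule Tr.M_convex[OF Tr.tau1(1)])
 have r: "read_tab (tau1 (transpose_skew sk)) (T_col (transpose_skew sk)) permutes {1..N}"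
  by (rule Tr.read_tab_permutes[OF Tr.tau1(1) Tr.T_col(1)])
 show "g1_map N sk \<in> module_hom (HA N) (twist_module N (M_module N (R_poset sk))) (M_module N (tab_poset (tau0 sk)))"
  "bij_betw (g1_map N sk) (carrier (twist_module N (M_module N (R_poset sk)))) (carrier (M_module N (tab_poset (tau0 sk))))"
  unfolding g1_map_def M_module_def by (rule dual_to_perm_iso[OF c S0_convex S0_iff_transpose r])+
qed

abbreviation "Jinj \<equiv> (\<lambda>z. N - z) ` Tr.Kset"
abbreviation "Kinj \<equiv> (\<lambda>z. N - z) ` Tr.Jset"

lemma Kinj_subset: "Jinj \<subseteq> {1..<N}" "Kinj \<subseteq> {1..<N}"
 using Tr.JK by (fastforce, fastforce)

lemma alpha_inj_sets:
 "{1..<N} - comp_set (concat (alpha_inj sk)) = Jinj" "comp_set (near_concat (alpha_inj sk)) = Kinj"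
 "sum_list (concat (alpha_inj sk)) = N" "0 \<notin> set (concat (alpha_inj sk))"
proof -
 note g = gcomp_cr_sets[OF Tr.proper_alpha_proj, folded alpha_inj_def, unfolded Tr.sum_alpha_proj]
 show "{1..<N} - comp_set (concat (alpha_inj sk)) = Jinj"
  unfolding g(1) Tr.Kset_def[symmetric] by (rule reflect_compl[OF Tr.JK(2)])
 show "comp_set (near_concat (alpha_inj sk)) = Kinj" unfolding g(2) Tr.Jset_def ..
 show "sum_list (concat (alpha_inj sk)) = N" by (rule g(4))
 show "0 \<notin> set (concat (alpha_inj sk))" using g(3) by (auto simp: proper_gcomp_def)
qed

lemma P_module_inj_eq: "P_module N (alpha_inj sk) = perm_module N (descent_set N Jinj Kinj)"
proof -
 have "proj_lower N (alpha_inj sk) = longest_parabolic N Jinj"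
  using comp_compl(2)[OF alpha_inj_sets(4)] unfolding proj_lower_def w0_comp_def alpha_inj_sets(3) alpha_inj_sets(1) by simp
 moreover have "proj_upper N (alpha_inj sk) = longest_perm N o longest_parabolic N Kinj"
  unfolding proj_upper_def w0_comp_def alpha_inj_sets(2) ..
 ultimately show ?thesis
  unfolding P_module_def B_module_def using weak_interval_eq_descent_set[OF Kinj_subset] by simp
qed

lemma g2_iso:
 shows "g2_map N sk \<in> module_hom (HA N) (twist_module N (P_module N (alpha_proj (transpose_skew sk)))) (P_module N (alpha_inj sk))"
  and "bij_betw (g2_map N sk) (carrier (twist_module N (P_module N (alpha_proj (transpose_skew sk))))) (carrier (P_module N (alpha_inj sk)))"
proof -
 have r: "longest_perm N o w0_comp N (near_concat (alpha_inj sk)) permutes {1..N}"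
  unfolding w0_comp_def alpha_inj_sets(2)
  by (rule permutes_compose[OF longest_parabolic(1)[OF Kinj_subset(2)] longest_perm(1)])
 have int: "weak_interval N (proj_lower N (alpha_proj (transpose_skew sk))) (proj_upper N (alpha_proj (transpose_skew sk))) = descent_set N Tr.Jset Tr.Kset"
  unfolding Tr.proj_lower_eq Tr.proj_upper_eq by (rule weak_interval_eq_descent_set[OF Tr.JK(1,2)])
 show "g2_map N sk \<in> module_hom (HA N) (twist_module N (P_module N (alpha_proj (transpose_skew sk)))) (P_module N (alpha_inj sk))"
  "bij_betw (g2_map N sk) (carrier (twist_module N (P_module N (alpha_proj (transpose_skew sk))))) (carrier (P_module N (alpha_inj sk)))"
  unfolding g2_map_def Let_def int P_module_inj_eq Tr.P_module_eq
  by (rule dual_to_perm_iso[OF weakly_convex_descent_set weakly_convex_descent_set descent_set_comp_longest_perm[OF Tr.JK(1,2)] r])+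
qed

text \<open>The transpose of the epimorphism \<open>\<eta>\<^sub>R\<close> is injective, and the other factors of \<open>\<iota>\<close> are bijective.\<close>

theorem injective_hull_M:
 fixes TX :: "'x itself" and TY :: "'y itself"
 assumes t: "labeling t" "distinguished (entry t)"
 shows "injective_hull TX TY (HA N) (P_module N (alpha_inj sk)) (iota_map N (tab_poset t)) (M_module N (tab_poset t))"
proof -
 let ?H = "HA N" and ?MP = "M_module N (tab_poset t)" and ?M0 = "M_module N (tab_poset (tau0 sk))"
  and ?MR = "M_module N (R_poset sk)" and ?Q = "P_module N (alpha_proj (transpose_skew sk))" and ?I = "P_module N (alpha_inj sk)"
 let ?f = "f_map N (tab_poset t)" and ?eta = "eta_map N (R_poset sk)"
 have tau: "tau N (tab_poset t) = t" by (rule tau_distinguished[OF t])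
 have sh: "shape t = sk" using t(1) by (simp add: labeling_def)
 have iota: "iota_map N (tab_poset t) = (g2_map N sk o twist_hom ?Q ?eta) o
   (inv_into (carrier (twist_module N ?MR)) (g1_map N sk) o inv_into (carrier ?M0) ?f)"
  unfolding iota_map_def tau sh Let_def comp_assoc ..
 have mod: "left_module ?H ?M0" "left_module ?H ?MR" "left_module ?H ?Q" "left_module ?H ?I"
  using left_module_M[OF tau0(1)] Tr.left_module_M[OF Tr.tau1(1)] Tr.left_module_P
   perm_module_action(1)[OF weakly_convex_descent_set] unfolding R_poset_def P_module_inj_eq by blast+
 note f = module_hom_inv_into[OF f_map_iso[OF t tau refl] mod(1)]
 note g1 = module_hom_inv_into[OF g1_iso left_module_twist[OF mod(2)]]
 let ?u = "inv_into (carrier (twist_module N ?MR)) (g1_map N sk) o inv_into (carrier ?M0) ?f"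
 have u: "?u \<in> module_hom ?H ?MP (twist_module N ?MR)" "bij_betw ?u (carrier ?MP) (carrier (twist_module N ?MR))"
  by (rule module_hom_comp[OF f(1) g1(1)]) (rule bij_betw_trans[OF f(2) g1(2)])
 note eta = Tr.eta_epi(1,2)[OF Tr.tau1(1) Tr.distinguished_tau1, folded R_poset_def]
 have ker: "\<phi> u = 0" if "eigenfunctional N Tr.Pr.S \<phi>" "u \<in> carrier Tr.Pr.M" "?eta u = \<zero>\<^bsub>?MR\<^esub>" for \<phi> u
  by (rule Tr.Pr.eigenfunctional_zero[OF that(1,2)])
   (use eta(2)[unfolded Tr.P_module_eq, OF that(2,3)] Tr.S0_if_within_blocks in blast)
 have etah: "?eta \<in> module_hom ?H ?Q ?MR" using eta(1) by (simp add: module_epi_def)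
 let ?w = "g2_map N sk o twist_hom ?Q ?eta"
 have w: "?w \<in> module_hom ?H (twist_module N ?MR) ?I"
  by (rule module_hom_comp[OF twist_hom_hom[OF mod(3,2) etah] g2_iso(1)])
 have wi: "inj_on ?w (carrier (twist_module N ?MR))"
 proof (rule comp_inj_on[OF twist_hom_inj[OF eta(1)]])
  have "twist_hom ?Q ?eta ` carrier (twist_module N ?MR) \<subseteq> carrier (twist_module N ?Q)"
   using module_homD(1)[OF twist_hom_hom[OF mod(3,2) etah]] by blast
  thus "inj_on (g2_map N sk) (twist_hom ?Q ?eta ` carrier (twist_module N ?MR))"
   by (rule inj_on_subset[OF bij_betw_imp_inj_on[OF g2_iso(2)]])
 qed
 show ?thesis
  unfolding injective_hull_def
 proof (intro conjI)
  show "finitely_generated_module ?H ?MP"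
   unfolding M_module_def by (rule finitely_generated_perm_module[OF M_convex[OF t(1)]])
  obtain x s where "regular_retract ?H ?Q x s" using Tr.Pr.regular_retract_M unfolding Tr.P_module_eq by blast
  hence "injective_module TX TY ?H (twist_module N ?Q)" by (rule twist_regular_retract_injective)
  thus "injective_module TX TY ?H ?I" by (rule injective_module_iso[OF _ mod(4) g2_iso])
  have "inj_on (?w o ?u) (carrier ?MP)"
   by (rule comp_inj_on[of ?u _ ?w, OF bij_betw_imp_inj_on[OF u(2)]])
    (simp only: bij_betw_imp_surj_on[OF u(2)] wi)
  thus "iota_map N (tab_poset t) \<in> module_mono ?H ?MP ?I"
   unfolding module_mono_def iota using module_hom_comp[OF u(1) w] by blast
  have "(?w o ?u) ` carrier ?MP = ?w ` carrier (twist_module N ?MR)"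
   unfolding image_comp[symmetric, of ?w ?u] using u(2) by (simp add: bij_betw_def)
  moreover have "module_soc ?H ?I \<subseteq> ?w ` carrier (twist_module N ?MR)"
   unfolding Tr.P_module_eq P_module_inj_eq
   by (rule socle_in_twist_image[OF weakly_convex_descent_set weakly_convex_descent_set mod(2)
    g2_iso[unfolded Tr.P_module_eq P_module_inj_eq] eta(1)[unfolded Tr.P_module_eq]]) (rule ker)
  ultimately show "module_soc ?H ?I \<subseteq> iota_map N (tab_poset t) ` carrier ?MP" unfolding iota by simp
 qed
qed

end

section \<open>Projective cover and injective hull of the module of a regular poset\<close>

theorem lemma5p4:
  fixes n :: nat and P :: "(nat \<times> nat) set" and sk :: skew
  assumes "P \<in> RSP n"
    and "sk = shape (tau n P)"
  shows "projective_cover TYPE('x) TYPE('y) (hecke_alg n)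
           (P_module n (alpha_proj sk)) (eta_map n P) (M_module n P) \<and>
         injective_hull TYPE('x) TYPE('y) (hecke_alg n)
           (P_module n (alpha_inj sk)) (iota_map n P) (M_module n P)"
proof -
 note r = regular_poset_labeling[OF assms]
 interpret skew_shape sk by (rule r(1))
 show ?thesis
  using projective_cover_M[OF r(3,4)] injective_hull_M[OF r(3,4)] unfolding r(2,5) by blast
qed

end
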